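(* Let $k$ be a field of characteristic zero and let $(A,x)$ be a pair consisting either of a discrete valuation ring $A$ with uniformizing parameter $x$ and residue field $k$, or of the polynomial ring $A=k[x]$ and its variable $x$; let $X=\mathrm{Spec}(A)$ and $x_0=\mathrm{div}(x)$. Let $\pi:S\to X$ be a Danielewski-Fieseler surface with base $(X,x_0)$, let $C_1,\ldots,C_n$ be the connected components of $\pi^{-1}(x_0)$, and let $\rho_n:S\to X(n)$ be the unique $X$-morphism such that $\pi=\delta_n\circ\rho_n$ and $C_i=\rho_n^{-1}(x_i(n))$ for every $i=1,\ldots,n$. Then there exist a multi-index $\mu=(\mu_1,\ldots,\mu_n)\in\mathbb{Z}_{\geq0}^n$ such that $\mu_i=0$ for at least one index $i$, and a cocycle $g\in C^1(\mathcal{U}_{(n)},\mathcal{L}_{n,\mu})$ such that $S$ is $X(n)$-isomorphic to the $\mathbf{V}(\mathcal{L}_{n,-\mu})$-torsor $\rho_n:\mathbf{W}(\mathcal{U}_{(n)},\mathcal{L}_{n,-\mu},g)\to X(n)$.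
   Context: Let $X_*=X\setminus\{x_0\}$. A Danielewski-Fieseler surface with base $(X,x_0)$ is an integral affine $X$-scheme $\pi:S\to X$ of finite type such that $S|_{X_*}\simeq\mathbb{A}^1_{X_*}$ and the scheme-theoretic fiber $\pi^{-1}(x_0)$ is nonempty and reduced, consisting of a disjoint union of curves isomorphic to $\mathbb{A}^1_k$. The scheme $X(n)$. For $n\ge1$, $\delta_n:X(n)\to X$ is the scheme obtained by gluing $n$ copies $d_i:X_i(n)\simeq X$ of $X$ by the identity over the open subsets $X_i(n)\setminus\{x_i(n)\}$, where $x_i(n)=d_i^{-1}(x_0)$. $\mathcal{U}_{(n)}=(X_i(n))_{i=1,\ldots,n}$ is the canonical open covering, and $X_{ij}(n)=X_i(n)\cap X_j(n)\simeq X_*$ for $i\ne j$. The sheaves. For $\mu\in\mathbb{Z}^n$, $\mathcal{L}_{n,\mu}=\mathcal{O}_{X(n)}(\mu_1x_1(n)+\cdots+\mu_nx_n(n))$ is the subsheaf of $\mathcal{O}_{X(n)}$-modules of the constant sheaf of rational functions on $X(n)$ generated by $(x\circ\delta_n)^{-\mu_i}$ on $X_i(n)$. One has $\mathcal{L}_{n,\mu}^\vee\simeq\mathcal{L}_{n,-\mu}$. Torsors. For an invertible sheaf $\mathcal{L}$ on a scheme $Y$, $\mathbf{V}(\mathcal{L})=\mathbf{Spec}(\mathbf{S}(\mathcal{L}))$, with $\mathbf{S}(\mathcal{L})$ the symmetric algebra, is a commutative group scheme over $Y$ with group law induced by the diagonal $\mathcal{L}\to\mathcal{L}\oplus\mathcal{L}$.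 A $\mathbf{V}(\mathcal{L})$-torsor is a $Y$-scheme with a $\mathbf{V}(\mathcal{L})$-action which is locally over $Y$ equivariantly isomorphic to $\mathbf{V}(\mathcal{L})$ acting on itself by translations. Given an open covering $\mathcal{U}=(Y_i)$ of $Y$ and a Čech cocycle $g=\{g_{ij}\}\in C^1(\mathcal{U},\mathcal{L}^\vee)$, $\mathbf{W}(\mathcal{U},\mathcal{L},g)$ is the $\mathbf{V}(\mathcal{L})$-torsor defined as the spectrum of the $\mathcal{O}_Y$-algebra obtained by gluing the algebras $\mathbf{S}(\mathcal{L}|_{Y_i})$ over $Y_{ij}=Y_i\cap Y_j$ by the algebra isomorphisms induced by the module homomorphisms $(g_{ij},\mathrm{Id}):\mathcal{L}|_{Y_{ij}}\to\mathcal{O}_{Y_{ij}}\oplus\mathcal{L}|_{Y_{ij}}$. *)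

theory Defs
  imports
    "HOL-Algebra.UnivPoly"
    "HOL-Algebra.QuotRing"
    "HOL-Algebra.Ring_Divisibility"
    "HOL-Algebra.Generated_Rings"
    "HOL-Analysis.Abstract_Topology_2"
    "HOL-Library.Multiset"
begin

section \<open>Localization of commutative rings\<close>

definition fraction :: "('a, 'm) ring_scheme \<Rightarrow> 'a set \<Rightarrow> 'a \<Rightarrow> 'a \<Rightarrow> ('a \<times> 'a) set" where
  "fraction R T a s = {(b, t). b \<in> carrier R \<and> t \<in> T \<and>
     (\<exists>u\<in>T. u \<otimes>\<^bsub>R\<^esub> (t \<otimes>\<^bsub>R\<^esub> a) = u \<otimes>\<^bsub>R\<^esub> (s \<otimes>\<^bsub>R\<^esub> b))}"

text \<open>For multiplicative \<open>T\<close>. The sets united in the multiplication and addition all coincide, because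
  the fraction does not depend on the representatives.\<close>

definition localization :: "('a, 'm) ring_scheme \<Rightarrow> 'a set \<Rightarrow> ('a \<times> 'a) set ring" where
  "localization R T = \<lparr>
     carrier = {fraction R T a s | a s. a \<in> carrier R \<and> s \<in> T},
     monoid.mult = (\<lambda>F G. \<Union>{fraction R T (a \<otimes>\<^bsub>R\<^esub> b) (s \<otimes>\<^bsub>R\<^esub> t) | a s b t. (a, s) \<in> F \<and> (b, t) \<in> G}),
     one = fraction R T \<one>\<^bsub>R\<^esub> \<one>\<^bsub>R\<^esub>,
     ring.zero = fraction R T \<zero>\<^bsub>R\<^esub> \<one>\<^bsub>R\<^esub>,
     add = (\<lambda>F G. \<Union>{fraction R T ((t \<otimes>\<^bsub>R\<^esub> a) \<oplus>\<^bsub>R\<^esub> (s \<otimes>\<^bsub>R\<^esub> b)) (s \<otimes>\<^bsub>R\<^esub> t)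
                     | a s b t. (a, s) \<in> F \<and> (b, t) \<in> G})\<rparr>"

text \<open>The ring with underlying set \<open>C\<close>, a set of extensional functions on \<open>I\<close>, and
  pointwise operations.\<close>

definition fun_ring :: "'i set \<Rightarrow> ('i \<Rightarrow> ('b, 'm) ring_scheme) \<Rightarrow> ('i \<Rightarrow> 'b) set \<Rightarrow> ('i \<Rightarrow> 'b) ring" where
  "fun_ring I R C = \<lparr>
     carrier = C,
     monoid.mult = (\<lambda>f g. \<lambda>i\<in>I. f i \<otimes>\<^bsub>R i\<^esub> g i),
     one = (\<lambda>i\<in>I. \<one>\<^bsub>R i\<^esub>),
     ring.zero = (\<lambda>i\<in>I. \<zero>\<^bsub>R i\<^esub>),
     add = (\<lambda>f g. \<lambda>i\<in>I. f i \<oplus>\<^bsub>R i\<^esub> g i)\<rparr>"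


section \<open>Locally ringed spaces\<close>

text \<open>A topological space with a presheaf of rings. Only the values of \<open>sec\<close> and \<open>res\<close> on
  open sets are meaningful.\<close>

record ('p, 's) ringed =
  tsp :: "'p topology"
  sec :: "'p set \<Rightarrow> 's ring"
  res :: "'p set \<Rightarrow> 'p set \<Rightarrow> 's \<Rightarrow> 's"

abbreviation pts :: "('p, 's) ringed \<Rightarrow> 'p set" where
  "pts X \<equiv> topspace (tsp X)"

abbreviation opn :: "('p, 's) ringed \<Rightarrow> 'p set \<Rightarrow> bool" where
  "opn X U \<equiv> openin (tsp X) U"

definition ringed_space :: "('p, 's) ringed \<Rightarrow> bool" where
  "ringed_space X \<longleftrightarrow>
     (\<forall>U. opn X U \<longrightarrow> cring (sec X U)) \<and>
     (\<forall>U V. opn X U \<and> opn X V \<and> V \<subseteq> U \<longrightarrow> res X U V \<in> ring_hom (sec X U) (sec X V)) \<and>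
     (\<forall>U. opn X U \<longrightarrow> (\<forall>s\<in>carrier (sec X U). res X U U s = s)) \<and>
     (\<forall>U V W. opn X U \<and> opn X V \<and> opn X W \<and> W \<subseteq> V \<and> V \<subseteq> U \<longrightarrow>
        (\<forall>s\<in>carrier (sec X U). res X V W (res X U V s) = res X U W s)) \<and>
     (\<forall>\<U>. (\<forall>U\<in>\<U>. opn X U) \<longrightarrow>
        (\<forall>s\<in>carrier (sec X (\<Union>\<U>)). \<forall>t\<in>carrier (sec X (\<Union>\<U>)).
           (\<forall>U\<in>\<U>. res X (\<Union>\<U>) U s = res X (\<Union>\<U>) U t) \<longrightarrow> s = t)) \<and>
     (\<forall>\<U> f. (\<forall>U\<in>\<U>. opn X U \<and> f U \<in> carrier (sec X U)) \<and>
        (\<forall>U\<in>\<U>. \<forall>V\<in>\<U>. res X U (U \<inter> V) (f U) = res X V (U \<inter> V) (f V)) \<longrightarrow>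
        (\<exists>s\<in>carrier (sec X (\<Union>\<U>)). \<forall>U\<in>\<U>. res X (\<Union>\<U>) U s = f U))"

definition germ :: "('p, 's) ringed \<Rightarrow> 'p \<Rightarrow> 'p set \<Rightarrow> 's \<Rightarrow> ('p set \<times> 's) set" where
  "germ X p U s = {(V, t). opn X V \<and> p \<in> V \<and> t \<in> carrier (sec X V) \<and>
     (\<exists>W. opn X W \<and> p \<in> W \<and> W \<subseteq> U \<inter> V \<and> res X U W s = res X V W t)}"

definition stalk :: "('p, 's) ringed \<Rightarrow> 'p \<Rightarrow> ('p set \<times> 's) set ring" where
  "stalk X p = \<lparr>
     carrier = {germ X p U s | U s. opn X U \<and> p \<in> U \<and> s \<in> carrier (sec X U)},
     monoid.mult = (\<lambda>F G. \<Union>{germ X p (U \<inter> V) (res X U (U \<inter> V) s \<otimes>\<^bsub>sec X (U \<inter> V)\<^esub> res X V (U \<inter> V) t)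
                      | U s V t. (U, s) \<in> F \<and> (V, t) \<in> G}),
     one = germ X p (pts X) \<one>\<^bsub>sec X (pts X)\<^esub>,
     ring.zero = germ X p (pts X) \<zero>\<^bsub>sec X (pts X)\<^esub>,
     add = (\<lambda>F G. \<Union>{germ X p (U \<inter> V) (res X U (U \<inter> V) s \<oplus>\<^bsub>sec X (U \<inter> V)\<^esub> res X V (U \<inter> V) t)
                     | U s V t. (U, s) \<in> F \<and> (V, t) \<in> G})\<rparr>"

definition local_ring :: "('a, 'm) ring_scheme \<Rightarrow> bool" where
  "local_ring R \<longleftrightarrow> cring R \<and> (\<exists>!M. maximalideal M R)"

definition locally_ringed_space :: "('p, 's) ringed \<Rightarrow> bool" where
  "locally_ringed_space X \<longleftrightarrow> ringed_space X \<and> (\<forall>p\<in>pts X. local_ring (stalk X p))"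

text \<open>The open subspace on \<open>U\<close>.\<close>

definition restr :: "('p, 's) ringed \<Rightarrow> 'p set \<Rightarrow> ('p, 's) ringed" where
  "restr X U = X\<lparr>tsp := subtopology (tsp X) U\<rparr>"


section \<open>Morphisms\<close>

text \<open>For \<open>f\<close> from \<open>X\<close> to \<open>Y\<close>, the map \<open>pull f U\<close> goes from the sections of \<open>Y\<close> over \<open>U\<close>
  to the sections of \<open>X\<close> over the preimage of \<open>U\<close>. The same data represent the morphism
  induced between the preimage of an open set of \<open>Y\<close> and that open set.\<close>

record ('p, 's, 'q, 't) mor =
  pt :: "'p \<Rightarrow> 'q"
  pull :: "'q set \<Rightarrow> 't \<Rightarrow> 's"

definition pre :: "('p, 's) ringed \<Rightarrow> ('p, 's, 'q, 't) mor \<Rightarrow> 'q set \<Rightarrow> 'p set" where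
  "pre X f U = {p \<in> pts X. pt f p \<in> U}"

definition is_mor :: "('p, 's) ringed \<Rightarrow> ('q, 't) ringed \<Rightarrow> ('p, 's, 'q, 't) mor \<Rightarrow> bool" where
  "is_mor X Y f \<longleftrightarrow>
     continuous_map (tsp X) (tsp Y) (pt f) \<and>
     (\<forall>U. opn Y U \<longrightarrow> pull f U \<in> ring_hom (sec Y U) (sec X (pre X f U))) \<and>
     (\<forall>U V. opn Y U \<and> opn Y V \<and> V \<subseteq> U \<longrightarrow>
        (\<forall>s\<in>carrier (sec Y U).
           res X (pre X f U) (pre X f V) (pull f U s) = pull f V (res Y U V s))) \<and>
     (\<forall>p\<in>pts X. \<forall>U. opn Y U \<and> pt f p \<in> U \<longrightarrow>
        (\<forall>s\<in>carrier (sec Y U).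
           germ X p (pre X f U) (pull f U s) \<in> Units (stalk X p) \<longrightarrow>
           germ Y (pt f p) U s \<in> Units (stalk Y (pt f p))))"

definition mor_eq :: "('p, 's) ringed \<Rightarrow> ('q, 't) ringed \<Rightarrow>
    ('p, 's, 'q, 't) mor \<Rightarrow> ('p, 's, 'q, 't) mor \<Rightarrow> bool" where
  "mor_eq X Y f g \<longleftrightarrow>
     (\<forall>p\<in>pts X. pt f p = pt g p) \<and>
     (\<forall>U. opn Y U \<longrightarrow> (\<forall>s\<in>carrier (sec Y U). pull f U s = pull g U s))"

definition id_mor :: "('p, 's, 'p, 's) mor" where
  "id_mor = \<lparr>pt = (\<lambda>p. p), pull = (\<lambda>U s. s)\<rparr>"

text \<open>The composite of \<open>f\<close>, with target \<open>Y\<close>, followed by \<open>g\<close>, with source \<open>Y\<close>.\<close>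

definition mor_comp :: "('q, 't) ringed \<Rightarrow> ('q, 't, 'r, 'u) mor \<Rightarrow> ('p, 's, 'q, 't) mor \<Rightarrow>
    ('p, 's, 'r, 'u) mor" where
  "mor_comp Y g f = \<lparr>pt = (\<lambda>p. pt g (pt f p)), pull = (\<lambda>W s. pull f (pre Y g W) (pull g W s))\<rparr>"

definition is_iso :: "('p, 's) ringed \<Rightarrow> ('q, 't) ringed \<Rightarrow> ('p, 's, 'q, 't) mor \<Rightarrow> bool" where
  "is_iso X Y f \<longleftrightarrow> is_mor X Y f \<and>
     (\<exists>g. is_mor Y X g \<and> mor_eq X X (mor_comp Y g f) id_mor \<and> mor_eq Y Y (mor_comp X f g) id_mor)"

text \<open>\<open>p : X \<rightarrow> Z\<close> and \<open>q : Y \<rightarrow> Z\<close> are isomorphic as spaces over \<open>Z\<close>.\<close>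

definition iso_over :: "('r, 'u) ringed \<Rightarrow> ('p, 's) ringed \<Rightarrow> ('p, 's, 'r, 'u) mor \<Rightarrow>
    ('q, 't) ringed \<Rightarrow> ('q, 't, 'r, 'u) mor \<Rightarrow> bool" where
  "iso_over Z X p Y q \<longleftrightarrow> (\<exists>f. is_iso X Y f \<and> mor_eq X Z (mor_comp Y q f) p)"

text \<open>The inclusion of the open subspace \<open>restr X W\<close> into \<open>X\<close>.\<close>

definition incl :: "('p, 's) ringed \<Rightarrow> 'p set \<Rightarrow> ('p, 's, 'p, 's) mor" where
  "incl X W = \<lparr>pt = (\<lambda>p. p), pull = (\<lambda>V s. res X V (V \<inter> W) s)\<rparr>"


section \<open>Schemes\<close>

definition zariski :: "('a, 'm) ring_scheme \<Rightarrow> 'a set topology" where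
  "zariski R = topology_generated_by {{P. primeideal P R \<and> a \<notin> P} | a. a \<in> carrier R}"

definition Spec :: "('a, 'm) ring_scheme \<Rightarrow> ('a set, 'a set \<Rightarrow> ('a \<times> 'a) set) ringed" where
  "Spec R = \<lparr>
     tsp = zariski R,
     sec = (\<lambda>U. fun_ring U (\<lambda>P. localization R (carrier R - P))
       {s \<in> (\<Pi>\<^sub>E P\<in>U. carrier (localization R (carrier R - P))).
          \<forall>P\<in>U. \<exists>V a f. openin (zariski R) V \<and> P \<in> V \<and> V \<subseteq> U \<and> a \<in> carrier R \<and> f \<in> carrier R \<and>
            (\<forall>Q\<in>V. f \<notin> Q \<and> s Q = fraction R (carrier R - Q) a f)}),
     res = (\<lambda>U V s. restrict s V)\<rparr>"

definition spec_map :: "('a, 'm) ring_scheme \<Rightarrow> ('b, 'n) ring_scheme \<Rightarrow> ('a \<Rightarrow> 'b) \<Rightarrow>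
    ('b set, 'b set \<Rightarrow> ('b \<times> 'b) set, 'a set, 'a set \<Rightarrow> ('a \<times> 'a) set) mor" where
  "spec_map A B h = \<lparr>
     pt = (\<lambda>Q. {a \<in> carrier A. h a \<in> Q}),
     pull = (\<lambda>U s. \<lambda>Q\<in>{Q. primeideal Q B \<and> {a \<in> carrier A. h a \<in> Q} \<in> U}.
       \<Union>{fraction B (carrier B - Q) (h a) (h f) | a f. (a, f) \<in> s {a \<in> carrier A. h a \<in> Q}})\<rparr>"

text \<open>An element \<open>a\<close> of \<open>R\<close> as a global function on \<open>Spec R\<close>.\<close>

definition spec_section :: "('a, 'm) ring_scheme \<Rightarrow> 'a \<Rightarrow> 'a set \<Rightarrow> ('a \<times> 'a) set" where
  "spec_section R a = (\<lambda>P\<in>{P. primeideal P R}. fraction R (carrier R - P) a \<one>\<^bsub>R\<^esub>)"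

text \<open>If \<open>X\<close> is isomorphic to \<open>Spec R\<close> then \<open>R\<close> is isomorphic to the ring of global sections
  of \<open>X\<close>, so letting \<open>R\<close> range over rings of elements of type \<open>'s\<close> is no restriction.\<close>

definition affine_scheme :: "('p, 's) ringed \<Rightarrow> bool" where
  "affine_scheme X \<longleftrightarrow> locally_ringed_space X \<and>
     (\<exists>R :: 's ring. cring R \<and> (\<exists>f. is_iso X (Spec R) f))"

definition is_scheme :: "('p, 's) ringed \<Rightarrow> bool" where
  "is_scheme X \<longleftrightarrow> locally_ringed_space X \<and>
     (\<forall>p\<in>pts X. \<exists>U. opn X U \<and> p \<in> U \<and> affine_scheme (restr X U))"

definition integral_scheme :: "('p, 's) ringed \<Rightarrow> bool" where
  "integral_scheme X \<longleftrightarrow> is_scheme X \<and> pts X \<noteq> {} \<and>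
     (\<forall>U. opn X U \<and> U \<noteq> {} \<longrightarrow> domain (sec X U))"

definition reduced :: "('p, 's) ringed \<Rightarrow> bool" where
  "reduced X \<longleftrightarrow> (\<forall>U. opn X U \<longrightarrow>
     (\<forall>s\<in>carrier (sec X U). \<forall>m::nat. s [^]\<^bsub>sec X U\<^esub> m = \<zero>\<^bsub>sec X U\<^esub> \<longrightarrow> s = \<zero>\<^bsub>sec X U\<^esub>))"

definition affine_mor :: "('p, 's) ringed \<Rightarrow> ('q, 't) ringed \<Rightarrow> ('p, 's, 'q, 't) mor \<Rightarrow> bool" where
  "affine_mor X Y f \<longleftrightarrow>
     (\<forall>U. opn Y U \<and> affine_scheme (restr Y U) \<longrightarrow> affine_scheme (restr X (pre X f U)))"

definition finite_type :: "('p, 's) ringed \<Rightarrow> ('q, 't) ringed \<Rightarrow> ('p, 's, 'q, 't) mor \<Rightarrow> bool" where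
  "finite_type X Y f \<longleftrightarrow>
     (\<forall>y\<in>pts Y. \<exists>V \<U>. opn Y V \<and> y \<in> V \<and> affine_scheme (restr Y V) \<and>
        finite \<U> \<and> \<Union>\<U> = pre X f V \<and>
        (\<forall>U\<in>\<U>. opn X U \<and> affine_scheme (restr X U) \<and>
           (\<exists>E. finite E \<and> E \<subseteq> carrier (sec X U) \<and>
              generate_ring (sec X U)
                ((\<lambda>s. res X (pre X f V) U (pull f V s)) ` carrier (sec Y V) \<union> E) = carrier (sec X U))))"


section \<open>Scheme-theoretic fibers\<close>

text \<open>The fiber of \<open>f : X \<rightarrow> Y\<close> over \<open>y\<close> is the subspace \<open>f\<inverse>(y)\<close> of \<open>X\<close> with the structure sheaf
  whose stalk at \<open>p\<close> is the stalk of \<open>X\<close> modulo the ideal generated by the maximal ideal of \<open>y\<close>.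
  For schemes this is the base change of \<open>X\<close> to the residue field of \<open>y\<close>.\<close>

definition fiber_ideal :: "('p, 's) ringed \<Rightarrow> ('q, 't) ringed \<Rightarrow> ('p, 's, 'q, 't) mor \<Rightarrow> 'p \<Rightarrow>
    ('p set \<times> 's) set set" where
  "fiber_ideal X Y f p = Idl\<^bsub>stalk X p\<^esub>
     {germ X p (pre X f U) (pull f U s) | U s. opn Y U \<and> pt f p \<in> U \<and> s \<in> carrier (sec Y U) \<and>
        germ Y (pt f p) U s \<notin> Units (stalk Y (pt f p))}"

definition fiber :: "('p, 's) ringed \<Rightarrow> ('q, 't) ringed \<Rightarrow> ('p, 's, 'q, 't) mor \<Rightarrow> 'q \<Rightarrow>
    ('p, 'p \<Rightarrow> ('p set \<times> 's) set set) ringed" where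
  "fiber X Y f y = \<lparr>
     tsp = subtopology (tsp X) (pre X f {y}),
     sec = (\<lambda>V. fun_ring V (\<lambda>p. stalk X p Quot fiber_ideal X Y f p)
       {s \<in> (\<Pi>\<^sub>E p\<in>V. carrier (stalk X p Quot fiber_ideal X Y f p)).
          \<forall>p\<in>V. \<exists>U a. opn X U \<and> p \<in> U \<and> a \<in> carrier (sec X U) \<and>
            (\<forall>q\<in>V \<inter> U. s q = fiber_ideal X Y f q +>\<^bsub>stalk X q\<^esub> germ X q U a)}),
     res = (\<lambda>U V s. restrict s V)\<rparr>"

definition fiber_incl :: "('p, 's) ringed \<Rightarrow> ('q, 't) ringed \<Rightarrow> ('p, 's, 'q, 't) mor \<Rightarrow> 'q \<Rightarrow>
    ('p, 'p \<Rightarrow> ('p set \<times> 's) set set, 'p, 's) mor" where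
  "fiber_incl X Y f y = \<lparr>
     pt = (\<lambda>p. p),
     pull = (\<lambda>U a. \<lambda>p\<in>pre X f {y} \<inter> U. fiber_ideal X Y f p +>\<^bsub>stalk X p\<^esub> germ X p U a)\<rparr>"


section \<open>Danielewski-Fieseler surfaces\<close>

definition discrete_valuation_ring :: "('a, 'm) ring_scheme \<Rightarrow> bool" where
  "discrete_valuation_ring A \<longleftrightarrow> principal_domain A \<and> local_ring A \<and> \<not> field A"

text \<open>In the first case \<open>x\<close> is a uniformizing parameter, i.e. generates the maximal ideal, and
  the residue field is \<open>k\<close>. In the second case \<open>A\<close> is the ring of polynomials over \<open>k\<close> in the
  variable \<open>x\<close>.\<close>

definition base_pair :: "'k ring \<Rightarrow> 'a ring \<Rightarrow> 'a \<Rightarrow> bool" where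
  "base_pair k A x \<longleftrightarrow> cring A \<and> x \<in> carrier A \<and>
     (discrete_valuation_ring A \<and> maximalideal (PIdl\<^bsub>A\<^esub> x) A \<and> A Quot (PIdl\<^bsub>A\<^esub> x) \<simeq> k \<or>
      (\<exists>h. h \<in> ring_iso (UP k) A \<and> h (monom (UP k) \<one>\<^bsub>k\<^esub> 1) = x))"

text \<open>The structure map of the affine line over \<open>Spec B\<close>, considered over \<open>Spec A\<close> via a ring
  homomorphism \<open>h\<close> from \<open>A\<close> to \<open>B\<close>.\<close>

definition affine_line_map :: "'a ring \<Rightarrow> 'b ring \<Rightarrow> ('a \<Rightarrow> 'b) \<Rightarrow>
    ((nat \<Rightarrow> 'b) set, (nat \<Rightarrow> 'b) set \<Rightarrow> ((nat \<Rightarrow> 'b) \<times> (nat \<Rightarrow> 'b)) set,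
     'a set, 'a set \<Rightarrow> ('a \<times> 'a) set) mor" where
  "affine_line_map A B h = spec_map A (UP B) (\<lambda>a. monom (UP B) (h a) 0)"

text \<open>\<open>x\<^sub>0\<close> is the point \<open>PIdl x\<close> of \<open>X = Spec A\<close>, with residue field \<open>A/(x)\<close>, which is \<open>k\<close>.
  The affine line over the open subscheme \<open>X\<^sub>*\<close> of \<open>X\<close> is the inverse image of \<open>X\<^sub>*\<close> in
  the affine line over \<open>X\<close>. Isomorphisms are over \<open>X\<^sub>*\<close> for the first and over the residue
  field for the second kind of affine line; the latter is the same as over \<open>X\<close>.\<close>

definition danielewski_fieseler ::
    "'a ring \<Rightarrow> 'a \<Rightarrow> ('p, 's) ringed \<Rightarrow> ('p, 's, 'a set, 'a set \<Rightarrow> ('a \<times> 'a) set) mor \<Rightarrow> bool" where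
  "danielewski_fieseler A x S \<pi> \<longleftrightarrow>
     (let X = Spec A;
          x0 = PIdl\<^bsub>A\<^esub> x;
          Xs = pts X - {x0};
          L = Spec (UP A);
          l = affine_line_map A A (\<lambda>a. a);
          \<kappa> = A Quot x0;
          F = fiber S X \<pi> x0;
          \<phi> = mor_comp S \<pi> (fiber_incl S X \<pi> x0)
      in integral_scheme S \<and> is_mor S X \<pi> \<and> affine_mor S X \<pi> \<and> finite_type S X \<pi> \<and>
         iso_over (restr X Xs) (restr S (pre S \<pi> Xs)) \<pi> (restr L (pre L l Xs)) l \<and>
         pts F \<noteq> {} \<and> reduced F \<and>
         (\<exists>\<C>. (\<forall>C\<in>\<C>. opn F C) \<and> disjoint \<C> \<and> \<Union>\<C> = pts F \<and>
            (\<forall>C\<in>\<C>. iso_over X (restr F C) (mor_comp F \<phi> (incl F C))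
                       (Spec (UP \<kappa>)) (affine_line_map A \<kappa> (\<lambda>a. x0 +>\<^bsub>A\<^esub> a)))))"


section \<open>The line with multiple origins\<close>

text \<open>\<open>copies X x\<^sub>0 n\<close> is obtained by gluing \<open>n\<close> copies of \<open>X\<close> along the complement of the closed
  point \<open>x\<^sub>0\<close>: its points are \<open>(i, x\<^sub>0)\<close> for \<open>1 \<le> i \<le> n\<close>, and \<open>(0, p)\<close> for the other points \<open>p\<close>.
  A section consists of sections on the copies that agree on the overlaps.\<close>

definition copy_pt :: "'p \<Rightarrow> nat \<Rightarrow> 'p \<Rightarrow> nat \<times> 'p" where
  "copy_pt x0 i p = (if p = x0 then (i, p) else (0, p))"

definition copies :: "('p, 's) ringed \<Rightarrow> 'p \<Rightarrow> nat \<Rightarrow> (nat \<times> 'p, nat \<Rightarrow> 's) ringed" where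
  "copies X x0 n = (let D = (\<lambda>i U. {p \<in> pts X. copy_pt x0 i p \<in> U}) in \<lparr>
     tsp = topology (\<lambda>U. U \<subseteq> (\<Union>i\<in>{1..n}. copy_pt x0 i ` pts X) \<and> (\<forall>i\<in>{1..n}. opn X (D i U))),
     sec = (\<lambda>U. fun_ring {1..n} (\<lambda>i. sec X (D i U))
       {s \<in> (\<Pi>\<^sub>E i\<in>{1..n}. carrier (sec X (D i U))).
          \<forall>i\<in>{1..n}. \<forall>j\<in>{1..n}.
            res X (D i U) (D i U - {x0}) (s i) = res X (D j U) (D j U - {x0}) (s j)}),
     res = (\<lambda>U V s. \<lambda>i\<in>{1..n}. res X (D i U) (D i V) (s i))\<rparr>)"

definition copies_map :: "nat \<Rightarrow> (nat \<times> 'p, nat \<Rightarrow> 's, 'p, 's) mor" where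
  "copies_map n = \<lparr>pt = snd, pull = (\<lambda>U s. \<lambda>i\<in>{1..n}. s)\<rparr>"

definition copy :: "('p, 's) ringed \<Rightarrow> 'p \<Rightarrow> nat \<Rightarrow> (nat \<times> 'p) set" where
  "copy X x0 i = copy_pt x0 i ` pts X"


section \<open>Sheaves of modules\<close>

record ('p, 's, 'm) omod =
  msec :: "'p set \<Rightarrow> ('s, 'm) module"
  mres :: "'p set \<Rightarrow> 'p set \<Rightarrow> 'm \<Rightarrow> 'm"

definition generic_point :: "('p, 's) ringed \<Rightarrow> 'p" where
  "generic_point Y = (THE \<eta>. \<eta> \<in> pts Y \<and> tsp Y closure_of {\<eta>} = pts Y)"

definition function_field :: "('p, 's) ringed \<Rightarrow> ('p set \<times> 's) set ring" where
  "function_field Y = stalk Y (generic_point Y)"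

text \<open>A section over a nonempty open set as a rational function.\<close>

definition rat_fun :: "('p, 's) ringed \<Rightarrow> 'p set \<Rightarrow> 's \<Rightarrow> ('p set \<times> 's) set" where
  "rat_fun Y U s = germ Y (generic_point Y) U s"

text \<open>\<open>\<L>\<^bsub>n,\<mu>\<^esub>\<close> for the integral scheme \<open>X\<close>, its closed point \<open>x\<^sub>0\<close> and the nonzero function \<open>t\<close> on
  \<open>X\<close>. Over the empty set every sheaf vanishes. The multiplication and unit of a module record
  play no role.\<close>

definition div_sheaf :: "('p, 's) ringed \<Rightarrow> 'p \<Rightarrow> 's \<Rightarrow> nat \<Rightarrow> (nat \<Rightarrow> int) \<Rightarrow>
    (nat \<times> 'p, nat \<Rightarrow> 's, ((nat \<times> 'p) set \<times> (nat \<Rightarrow> 's)) set) omod" where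
  "div_sheaf X x0 t n \<mu> =
     (let Y = copies X x0 n;
          K = function_field Y;
          \<xi> = rat_fun Y (pts Y) (pull (copies_map n) (pts X) t)
      in \<lparr>
        msec = (\<lambda>U. \<lparr>
          carrier = (if U = {} then {\<zero>\<^bsub>K\<^esub>} else
            {f \<in> carrier K. \<forall>i\<in>{1..n}. \<forall>y\<in>U \<inter> copy X x0 i.
               \<exists>V s. opn Y V \<and> y \<in> V \<and> V \<subseteq> U \<inter> copy X x0 i \<and> s \<in> carrier (sec Y V) \<and>
                 f = rat_fun Y V s \<otimes>\<^bsub>K\<^esub> (\<xi> [^]\<^bsub>K\<^esub> (- \<mu> i))}),
          monoid.mult = monoid.mult K, one = \<one>\<^bsub>K\<^esub>, zero = \<zero>\<^bsub>K\<^esub>, add = ring.add K,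
          smult = (\<lambda>r f. if U = {} then \<zero>\<^bsub>K\<^esub> else rat_fun Y U r \<otimes>\<^bsub>K\<^esub> f)\<rparr>),
        mres = (\<lambda>U V f. if V = {} then \<zero>\<^bsub>K\<^esub> else f)\<rparr>)"

text \<open>A rational function \<open>f\<close> in \<open>\<L>\<^bsub>n,\<mu>\<^esub>(U)\<close> as a section of the dual of \<open>\<L>\<^bsub>n,-\<mu>\<^esub>\<close>: the
  homomorphism \<open>u \<mapsto> f u\<close> from \<open>\<L>\<^bsub>n,-\<mu>\<^esub>\<close> to the structure sheaf, over open subsets \<open>V\<close> of \<open>U\<close>.\<close>

definition dual_section :: "('p, 's) ringed \<Rightarrow> ('p set \<times> 's) set \<Rightarrow> 'p set \<Rightarrow> ('p set \<times> 's) set \<Rightarrow> 's" where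
  "dual_section Y f V u =
     (THE s. s \<in> carrier (sec Y V) \<and> rat_fun Y V s = f \<otimes>\<^bsub>function_field Y\<^esub> u)"

text \<open>Cech 1-cocycles with values in \<open>L\<close> for the family \<open>\<U>\<close> indexed by \<open>I\<close>.\<close>

definition cocycle :: "'i set \<Rightarrow> ('i \<Rightarrow> 'p set) \<Rightarrow> ('p, 's, 'm) omod \<Rightarrow> ('i \<Rightarrow> 'i \<Rightarrow> 'm) \<Rightarrow> bool" where
  "cocycle I \<U> L g \<longleftrightarrow>
     (\<forall>i\<in>I. \<forall>j\<in>I. g i j \<in> carrier (msec L (\<U> i \<inter> \<U> j))) \<and>
     (\<forall>i\<in>I. \<forall>j\<in>I. \<forall>l\<in>I.
        (mres L (\<U> i \<inter> \<U> j) (\<U> i \<inter> \<U> j \<inter> \<U> l) (g i j)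
              \<oplus>\<^bsub>msec L (\<U> i \<inter> \<U> j \<inter> \<U> l)\<^esub> mres L (\<U> j \<inter> \<U> l) (\<U> i \<inter> \<U> j \<inter> \<U> l) (g j l)
            = mres L (\<U> i \<inter> \<U> l) (\<U> i \<inter> \<U> j \<inter> \<U> l) (g i l)))"


section \<open>Symmetric algebras\<close>

text \<open>The polynomial algebra over \<open>R\<close> in the set of variables \<open>G\<close>; monomials are multisets.\<close>

definition free_calg :: "('a, 'm) ring_scheme \<Rightarrow> 'g set \<Rightarrow> ('g multiset \<Rightarrow> 'a) ring" where
  "free_calg R G = \<lparr>
     carrier = {p. (\<forall>m. p m \<in> carrier R) \<and> finite {m. p m \<noteq> \<zero>\<^bsub>R\<^esub>} \<and>
                   (\<forall>m. p m \<noteq> \<zero>\<^bsub>R\<^esub> \<longrightarrow> set_mset m \<subseteq> G)},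
     monoid.mult = (\<lambda>p q m. \<Oplus>\<^bsub>R\<^esub>ab\<in>{(a, b). a + b = m}. p (fst ab) \<otimes>\<^bsub>R\<^esub> q (snd ab)),
     one = (\<lambda>m. if m = {#} then \<one>\<^bsub>R\<^esub> else \<zero>\<^bsub>R\<^esub>),
     ring.zero = (\<lambda>m. \<zero>\<^bsub>R\<^esub>),
     add = (\<lambda>p q m. p m \<oplus>\<^bsub>R\<^esub> q m)\<rparr>"

definition free_const :: "('a, 'm) ring_scheme \<Rightarrow> 'a \<Rightarrow> 'g multiset \<Rightarrow> 'a" where
  "free_const R r = (\<lambda>m. if m = {#} then r else \<zero>\<^bsub>R\<^esub>)"

definition free_var :: "('a, 'm) ring_scheme \<Rightarrow> 'g \<Rightarrow> 'g multiset \<Rightarrow> 'a" where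
  "free_var R u = (\<lambda>m. if m = {#u#} then \<one>\<^bsub>R\<^esub> else \<zero>\<^bsub>R\<^esub>)"

definition sym_ideal :: "('a, 'm) ring_scheme \<Rightarrow> ('a, 'g) module \<Rightarrow> ('g multiset \<Rightarrow> 'a) set" where
  "sym_ideal R M = (let P = free_calg R (carrier M) in Idl\<^bsub>P\<^esub>
     ({free_var R (u \<oplus>\<^bsub>M\<^esub> v) \<ominus>\<^bsub>P\<^esub> (free_var R u \<oplus>\<^bsub>P\<^esub> free_var R v)
         | u v. u \<in> carrier M \<and> v \<in> carrier M} \<union>
      {free_var R (r \<odot>\<^bsub>M\<^esub> u) \<ominus>\<^bsub>P\<^esub> (free_const R r \<otimes>\<^bsub>P\<^esub> free_var R u)
         | r u. r \<in> carrier R \<and> u \<in> carrier M}))"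

definition sym_alg :: "('a, 'm) ring_scheme \<Rightarrow> ('a, 'g) module \<Rightarrow> ('g multiset \<Rightarrow> 'a) set ring" where
  "sym_alg R M = free_calg R (carrier M) Quot sym_ideal R M"

definition sym_const :: "('a, 'm) ring_scheme \<Rightarrow> ('a, 'g) module \<Rightarrow> 'a \<Rightarrow> ('g multiset \<Rightarrow> 'a) set" where
  "sym_const R M r = sym_ideal R M +>\<^bsub>free_calg R (carrier M)\<^esub> free_const R r"

definition sym_in :: "('a, 'm) ring_scheme \<Rightarrow> ('a, 'g) module \<Rightarrow> 'g \<Rightarrow> ('g multiset \<Rightarrow> 'a) set" where
  "sym_in R M u = sym_ideal R M +>\<^bsub>free_calg R (carrier M)\<^esub> free_var R u"

text \<open>The ring homomorphism from the symmetric algebra of an \<open>R\<close>-module to \<open>B\<close> induced by a ring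
  homomorphism \<open>h\<close> from \<open>R\<close> to \<open>B\<close> and an \<open>h\<close>-linear map \<open>f\<close> from the module to \<open>B\<close>.\<close>

definition sym_lift :: "('a, 'm) ring_scheme \<Rightarrow> ('b, 'n) ring_scheme \<Rightarrow> ('a \<Rightarrow> 'b) \<Rightarrow> ('g \<Rightarrow> 'b) \<Rightarrow>
    ('g multiset \<Rightarrow> 'a) set \<Rightarrow> 'b" where
  "sym_lift R B h f c = (THE b. \<forall>p\<in>c. b =
     (\<Oplus>\<^bsub>B\<^esub>m\<in>{m. p m \<noteq> \<zero>\<^bsub>R\<^esub>}. h (p m) \<otimes>\<^bsub>B\<^esub> (\<Otimes>\<^bsub>B\<^esub>u\<in>set_mset m. f u [^]\<^bsub>B\<^esub> count m u)))"

abbreviation SymO :: "('p, 's) ringed \<Rightarrow> ('p, 's, 'm) omod \<Rightarrow> 'p set \<Rightarrow> ('m multiset \<Rightarrow> 's) set ring" where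
  "SymO Y L V \<equiv> sym_alg (sec Y V) (msec L V)"

definition SymO_res :: "('p, 's) ringed \<Rightarrow> ('p, 's, 'm) omod \<Rightarrow> 'p set \<Rightarrow> 'p set \<Rightarrow>
    ('m multiset \<Rightarrow> 's) set \<Rightarrow> ('m multiset \<Rightarrow> 's) set" where
  "SymO_res Y L U V = sym_lift (sec Y U) (SymO Y L V)
     (\<lambda>r. sym_const (sec Y V) (msec L V) (res Y U V r))
     (\<lambda>u. sym_in (sec Y V) (msec L V) (mres L U V u))"

text \<open>For a section \<open>g\<close> of the dual of \<open>L\<close>, the automorphism of the symmetric algebra of \<open>L\<close>
  over \<open>V\<close> that is induced by \<open>(g, Id) : L \<rightarrow> \<O> \<oplus> L\<close>.\<close>

definition SymO_shift :: "('p, 's) ringed \<Rightarrow> ('p, 's, 'm) omod \<Rightarrow> ('p set \<Rightarrow> 'm \<Rightarrow> 's) \<Rightarrow> 'p set \<Rightarrow>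
    ('m multiset \<Rightarrow> 's) set \<Rightarrow> ('m multiset \<Rightarrow> 's) set" where
  "SymO_shift Y L g V = sym_lift (sec Y V) (SymO Y L V)
     (sym_const (sec Y V) (msec L V))
     (\<lambda>u. sym_const (sec Y V) (msec L V) (g V u) \<oplus>\<^bsub>SymO Y L V\<^esub> sym_in (sec Y V) (msec L V) u)"


section \<open>The torsor defined by a cocycle\<close>

text \<open>The algebra obtained by gluing the symmetric algebras of \<open>L\<close> over the members of the covering
  \<open>\<U>\<close>, the one with index \<open>i\<close> being identified over \<open>\<U> i \<inter> \<U> j\<close> with the one with index \<open>j\<close> by
  the automorphism induced by \<open>(g i j, Id)\<close>. It is a presheaf; it has the stalks of the
  associated sheaf, and the relative spectrum below depends only on the latter.\<close>

definition glued_alg :: "('p, 's) ringed \<Rightarrow> 'i set \<Rightarrow> ('i \<Rightarrow> 'p set) \<Rightarrow> ('p, 's, 'm) omod \<Rightarrow>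
    ('i \<Rightarrow> 'i \<Rightarrow> 'p set \<Rightarrow> 'm \<Rightarrow> 's) \<Rightarrow> ('p, 'i \<Rightarrow> ('m multiset \<Rightarrow> 's) set) ringed" where
  "glued_alg Y I \<U> L g = \<lparr>
     tsp = tsp Y,
     sec = (\<lambda>V. fun_ring I (\<lambda>i. SymO Y L (V \<inter> \<U> i))
       {a \<in> (\<Pi>\<^sub>E i\<in>I. carrier (SymO Y L (V \<inter> \<U> i))).
          \<forall>i\<in>I. \<forall>j\<in>I. let W = V \<inter> \<U> i \<inter> \<U> j in
            SymO_shift Y L (g i j) W (SymO_res Y L (V \<inter> \<U> i) W (a i))
              = SymO_res Y L (V \<inter> \<U> j) W (a j)}),
     res = (\<lambda>V W a. \<lambda>i\<in>I. SymO_res Y L (V \<inter> \<U> i) (W \<inter> \<U> i) (a i))\<rparr>"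

definition glued_alg_map :: "('p, 's) ringed \<Rightarrow> 'i set \<Rightarrow> ('i \<Rightarrow> 'p set) \<Rightarrow> ('p, 's, 'm) omod \<Rightarrow>
    'p set \<Rightarrow> 's \<Rightarrow> 'i \<Rightarrow> ('m multiset \<Rightarrow> 's) set" where
  "glued_alg_map Y I \<U> L V s =
     (\<lambda>i\<in>I. sym_const (sec Y (V \<inter> \<U> i)) (msec L (V \<inter> \<U> i)) (res Y V (V \<inter> \<U> i) s))"

text \<open>The spectrum of a quasi-coherent algebra \<open>\<A>\<close> over a scheme \<open>Y\<close>, with structure map \<open>\<sigma>\<close>.
  Its points over \<open>y\<close> are the prime ideals of the stalk \<open>\<A>\<^sub>y\<close> that lie over the maximal ideal of
  the stalk of \<open>Y\<close> at \<open>y\<close>; over an affine open \<open>Spec R\<close> of \<open>Y\<close> these are the prime ideals of the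
  \<open>R\<close>-algebra corresponding to \<open>\<A>\<close>.\<close>

definition rspec_basic :: "('p, 's) ringed \<Rightarrow> ('p, 'b) ringed \<Rightarrow> ('p set \<Rightarrow> 's \<Rightarrow> 'b) \<Rightarrow>
    'p set \<Rightarrow> 'b \<Rightarrow> ('p \<times> ('p set \<times> 'b) set set) set" where
  "rspec_basic Y \<A> \<sigma> U f = {(y, P). y \<in> U \<and> primeideal P (stalk \<A> y) \<and>
     (\<forall>V s. opn Y V \<and> y \<in> V \<and> s \<in> carrier (sec Y V) \<longrightarrow>
        (germ \<A> y V (\<sigma> V s) \<in> P \<longleftrightarrow> germ Y y V s \<notin> Units (stalk Y y))) \<and>
     germ \<A> y U f \<notin> P}"

definition rspec_top :: "('p, 's) ringed \<Rightarrow> ('p, 'b) ringed \<Rightarrow> ('p set \<Rightarrow> 's \<Rightarrow> 'b) \<Rightarrow>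
    ('p \<times> ('p set \<times> 'b) set set) topology" where
  "rspec_top Y \<A> \<sigma> = topology_generated_by
     {rspec_basic Y \<A> \<sigma> U f | U f. opn Y U \<and> f \<in> carrier (sec \<A> U)}"

definition rspec :: "('p, 's) ringed \<Rightarrow> ('p, 'b) ringed \<Rightarrow> ('p set \<Rightarrow> 's \<Rightarrow> 'b) \<Rightarrow>
    ('p \<times> ('p set \<times> 'b) set set,
     'p \<times> ('p set \<times> 'b) set set \<Rightarrow> (('p set \<times> 'b) set \<times> ('p set \<times> 'b) set) set) ringed" where
  "rspec Y \<A> \<sigma> = (let B = (\<lambda>w. localization (stalk \<A> (fst w)) (carrier (stalk \<A> (fst w)) - snd w)) in \<lparr>
     tsp = rspec_top Y \<A> \<sigma>,
     sec = (\<lambda>W. fun_ring W B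
       {s \<in> (\<Pi>\<^sub>E w\<in>W. carrier (B w)).
          \<forall>w\<in>W. \<exists>W' U a f. openin (rspec_top Y \<A> \<sigma>) W' \<and> w \<in> W' \<and> W' \<subseteq> W \<and> opn Y U \<and>
            a \<in> carrier (sec \<A> U) \<and> f \<in> carrier (sec \<A> U) \<and>
            (\<forall>(y, P)\<in>W'. y \<in> U \<and> germ \<A> y U f \<notin> P \<and>
               s (y, P) = fraction (stalk \<A> y) (carrier (stalk \<A> y) - P) (germ \<A> y U a) (germ \<A> y U f))}),
     res = (\<lambda>U V s. restrict s V)\<rparr>)"

definition rspec_map :: "('p, 's) ringed \<Rightarrow> ('p, 'b) ringed \<Rightarrow> ('p set \<Rightarrow> 's \<Rightarrow> 'b) \<Rightarrow>
    ('p \<times> ('p set \<times> 'b) set set,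
     'p \<times> ('p set \<times> 'b) set set \<Rightarrow> (('p set \<times> 'b) set \<times> ('p set \<times> 'b) set) set, 'p, 's) mor" where
  "rspec_map Y \<A> \<sigma> = \<lparr>
     pt = fst,
     pull = (\<lambda>U s. \<lambda>(y, P)\<in>{w \<in> topspace (rspec_top Y \<A> \<sigma>). fst w \<in> U}.
       fraction (stalk \<A> y) (carrier (stalk \<A> y) - P) (germ \<A> y U (\<sigma> U s)) \<one>\<^bsub>stalk \<A> y\<^esub>)\<rparr>"

text \<open>The torsor \<open>W(\<U>, L, g)\<close> under \<open>V(L)\<close> and its structure map. The cocycle \<open>g\<close> has values in the
  dual of \<open>L\<close>: \<open>g i j V\<close> is a homomorphism from the sections of \<open>L\<close> over \<open>V\<close> to functions.\<close>

abbreviation Wtorsor where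
  "Wtorsor Y I \<U> L g \<equiv> rspec Y (glued_alg Y I \<U> L g) (glued_alg_map Y I \<U> L)"

abbreviation Wtorsor_map where
  "Wtorsor_map Y I \<U> L g \<equiv> rspec_map Y (glued_alg Y I \<U> L g) (glued_alg_map Y I \<U> L)"

end

theory Submission
 imports Defs "HOL-Algebra.Weak_Morphisms"
begin

text \<open>Let \<open>S\<close> be the spectrum of \<open>B\<close>, a domain with fraction field \<open>Q\<close>. All rings in sight embed into \<open>Q\<close>, so
schemes are compared through their local rings inside \<open>Q\<close>. Inverting \<open>x\<close> turns \<open>B\<close> into the polynomial ring
\<open>A[1/x][t]\<close>, and each component of the special fiber gives a surjection of \<open>B\<close> onto \<open>k[u]\<close>. On the \<open>i\<close>-th
component \<open>t = a i + x^(m i) * z i\<close>, where \<open>z i\<close> restricts to a coordinate. With \<open>M\<close> the maximum of the \<open>m i\<close>,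
the multi-index is \<open>M - m i\<close> and the cocycle is \<open>(a j - a i) / x^M\<close>. The isomorphism of \<open>S\<close> onto the relative
spectrum sends \<open>p\<close> to the prime of the elements that are not units at \<open>p\<close>, over the image of \<open>p\<close>.\<close>

text \<open>Local rings, stalks, glued sections and symmetric algebras have different types, and
  their operations are unions over representatives. Inside \<open>Q\<close> they become subsets of
  one field, and an isomorphism of spaces needs only a homeomorphism with equal local rings. The
  exponents \<open>m i\<close> differ between components, while the cocycle needs one denominator.
  With \<open>w i = (t - a i) / x^M\<close> the differences \<open>w i - w j\<close> lie in
  \<open>A[1/x]\<close>, free of \<open>t\<close>, and \<open>z i = x^(M - m i) * w i\<close>. A
  section \<open>u\<close> of the invertible sheaf is evaluated over the i-th copy as
  \<open>u * w i\<close>: the local generator goes to \<open>z i\<close>, and the transition by the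
  cocycle becomes equality in \<open>Q\<close>. An index with \<open>m i = M\<close> gives
  multiplicity 0. The obstacle with several components: a function vanishing on one of them is
  divisible by \<open>x\<close> only after multiplication by a function \<open>e\<close> that is 1
  there and vanishes on the others. The same \<open>e\<close> decides over which origin a point of
  the special fiber lies.\<close>

text \<open>A ring stands for its carrier, and an operation followed by \<open>.R\<close> or \<open>.(R)\<close> is that of \<open>R\<close>.\<close>

declare [[coercion carrier]]

syntax
 "_index_sub" :: "id_position => index" ("._")
 "_index_sub_var" :: "var_position => index" ("._")
 "_index_term" :: "logic => index" (".'(_')")
translations
 "_index_term x" => "_index x"
 "_index_sub x" => "_index x"
 "_index_sub_var x" => "_index x"

section \<open>Commutative algebra\<close>

definition inj_hom :: "('a, 'm) ring_scheme => ('b, 'n) ring_scheme => ('a => 'b) => bool" where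
 "inj_hom R Q f \<longleftrightarrow> f : ring_hom R Q \<and> inj_on f (carrier R)"

lemma inj_homD:
 assumes "inj_hom R Q f"
 shows "f : ring_hom R Q" and "!!a. a : R ==> f a : Q"
  and "!!a b. a : R ==> b : R ==> f (a \<otimes>.R b) = f a \<otimes>.Q f b"
  and "!!a b. a : R ==> b : R ==> f (a \<oplus>.R b) = f a \<oplus>.Q f b"
  and "f \<one>.R = \<one>.Q"
  and "!!a b. a : R ==> b : R ==> f a = f b \<longleftrightarrow> a = b"
 using assms unfolding inj_hom_def by (auto simp: ring_hom_def inj_on_def)

lemma inj_hom_zero:
 assumes "inj_hom R Q f" "ring R" "ring Q"
 shows "f \<zero>.R = \<zero>.Q" and "!!a. a : R ==> f a = \<zero>.Q \<longleftrightarrow> a = \<zero>.R"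
proof -
 show 0: "f \<zero>.R = \<zero>.Q" using assms ring_hom_zero inj_homD(1) by blast
 show "!!a. a : R ==> f a = \<zero>.Q \<longleftrightarrow> a = \<zero>.R"
  using 0 inj_homD(6)[OF assms(1)] assms(2) by (metis ring.ring_simprules(2))
qed

lemma inj_hom_minus:
 assumes "inj_hom R Q f" "ring R" "ring Q" "a : R"
 shows "f (\<ominus>.R a) = \<ominus>.Q f a"
proof -
 interpret ring_hom_ring R Q f
  using assms inj_homD(1) by (intro ring_hom_ringI2)
 show ?thesis using assms(4) by simp
qed

lemma inj_hom_comp:
 assumes "inj_hom R S f" "inj_hom S T g" shows "inj_hom R T (\<lambda>a. g (f a))"
proof -
 have "(\<lambda>a. g (f a)) : ring_hom R T"
  using ring_hom_trans[OF inj_homD(1)[OF assms(1)] inj_homD(1)[OF assms(2)]] by (simp add: comp_def)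
 moreover have "inj_on (\<lambda>a. g (f a)) (carrier R)"
  using inj_homD(2,6)[OF assms(1)] inj_homD(6)[OF assms(2)] by (intro inj_onI) metis
 ultimately show ?thesis by (simp add: inj_hom_def)
qed

text \<open>Ring axioms are equations, so they pull back along an injective map into a ring. An
  injection cannot supply closure and the existence of negatives, hence these are the premises;
  \<open>neg\<close> is phrased through values because a negative is found as an element with the
  right value.\<close>

lemma cring_of_inj:
 fixes R :: "('a, 'm) ring_scheme"
 assumes Q: "cring Q" and h: "f : ring_hom R Q" "inj_on f (carrier R)"
  and cl: "!!a b. a : R ==> b : R ==> a \<otimes>.R b : R"
   "!!a b. a : R ==> b : R ==> a \<oplus>.R b : R"
   "\<one>.R : R" "\<zero>.R : R" "f \<zero>.R = \<zero>.Q"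
  and neg: "!!a. a : R ==> EX b:R. f b = \<ominus>.Q f a"
 shows "cring R"
proof -
 interpret Q: cring Q by fact
 have f[simp]: "!!a. a : R ==> f a : Q"
  "!!a b. a : R ==> b : R ==> f (a \<otimes>.R b) = f a \<otimes>.Q f b"
  "!!a b. a : R ==> b : R ==> f (a \<oplus>.R b) = f a \<oplus>.Q f b"
  "f \<one>.R = \<one>.Q" using h(1) by (auto simp: ring_hom_def)
 have eq: "a = b" if "a : R" "b : R" "f a = f b" for a b
  using h(2) that by (auto simp: inj_on_def)
 show ?thesis
 proof (rule cringI)
  show "abelian_group R"
  proof (rule abelian_groupI)
   fix a b c assume "a : R" "b : R" "c : R"
   thus "a \<oplus>.R b \<oplus>.R c = a \<oplus>.R (b \<oplus>.R c)"
    by (intro eq) (simp_all add: cl Q.a_assoc)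
  next
   fix a b assume "a : R" "b : R"
   thus "a \<oplus>.R b = b \<oplus>.R a" by (intro eq) (simp_all add: cl Q.a_comm)
  next
   fix a assume a: "a : R"
   thus "\<zero>.R \<oplus>.R a = a" by (intro eq) (simp_all add: cl)
   obtain b where "b : R" "f b = \<ominus>.Q f a" using neg a by blast
   thus "EX y:R. y \<oplus>.R a = \<zero>.R"
    using a by (intro bexI[of _ b] eq) (simp_all add: cl Q.l_neg)
  qed (use cl in auto)
  show "Group.comm_monoid R"
  proof (rule comm_monoidI)
   fix a b c assume "a : R" "b : R" "c : R"
   thus "a \<otimes>.R b \<otimes>.R c = a \<otimes>.R (b \<otimes>.R c)"
    by (intro eq) (simp_all add: cl Q.m_assoc)
  next
   fix a b assume "a : R" "b : R"
   thus "a \<otimes>.R b = b \<otimes>.R a" by (intro eq) (simp_all add: cl Q.m_comm)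
  next
   fix a assume a: "a : R"
   thus "\<one>.R \<otimes>.R a = a" by (intro eq) (simp_all add: cl)
  qed (use cl in auto)
  fix a b c assume "a : R" "b : R" "c : R"
  thus "(a \<oplus>.R b) \<otimes>.R c = a \<otimes>.R c \<oplus>.R b \<otimes>.R c"
   by (intro eq) (simp_all add: cl Q.l_distr)
 qed
qed

lemma domain_of_inj:
 assumes "inj_hom R Q f" "cring R" "domain Q" shows "domain R"
proof -
 interpret Q: domain Q by fact
 interpret R: cring R by fact
 note z = inj_hom_zero[OF assms(1) R.ring_axioms Q.ring_axioms]
 show ?thesis
 proof (rule domainI[OF assms(2)])
  show "\<one>.R ~= \<zero>.R" using inj_homD(5)[OF assms(1)] z(1) Q.one_not_zero by metis
  fix a b assume "a \<otimes>.R b = \<zero>.R" "a : R" "b : R"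
  thus "a = \<zero>.R \<or> b = \<zero>.R"
   using inj_homD(2,3)[OF assms(1)] z Q.integral by metis
 qed
qed

text \<open>An inverse in \<open>D\<close> must map to the inverse in the field, so units are
  recognized by the image alone. This is how stalks of different spaces with the same image get the
  same units.\<close>

lemma (in field) unit_iff_inj:
 assumes f: "inj_hom D R f" and D: "cring D" and c: "c : D"
 shows "c : Units D \<longleftrightarrow> f c ~= \<zero> \<and> inv (f c) : f ` carrier D"
proof -
 interpret D: cring D by fact
 note f' = inj_homD[OF f]
 show ?thesis
 proof
  assume "c : Units D"
  then obtain d where d: "d : D" "c \<otimes>.D d = \<one>.D" by (auto simp: Units_def)
  hence 1: "f c \<otimes> f d = \<one>" using f' c by metis
  hence "f c ~= \<zero>" using f'(2)[OF d(1)] by auto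
  moreover have "inv (f c) = f d" using 1 f'(2) c d(1) comm_inv_char by blast
  ultimately show "f c ~= \<zero> \<and> inv (f c) : f ` carrier D" using d by auto
 next
  assume as: "f c ~= \<zero> \<and> inv (f c) : f ` carrier D"
  then obtain d where d: "d : D" "inv (f c) = f d" by auto
  have "f (c \<otimes>.D d) = f \<one>.D"
   using as d f' c field_Units by (metis Diff_iff Units_r_inv singletonD)
  hence "c \<otimes>.D d = \<one>.D" using f'(6) c d by auto
  thus "c : Units D" using c d D.m_comm by (auto simp: Units_def intro!: bexI[of _ d])
 qed
qed

lemma (in cring) idealI':
 assumes I: "I \<subseteq> R" "\<zero> : I" and add: "!!a b. a : I ==> b : I ==> a \<oplus> b : I"
  and mult: "!!a y. a : I ==> y : R ==> y \<otimes> a : I"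
 shows "ideal I R"
proof (rule idealI[OF ring_axioms])
 have m: "\<ominus> a : I" if "a : I" for a
  using mult[OF that a_inv_closed[OF one_closed]] I that by (simp add: l_minus subset_iff)
 show "subgroup I (add_monoid R)" using I add m by unfold_locales (auto simp flip: a_inv_def)
 show "a : I ==> y : R ==> y \<otimes> a : I" "a : I ==> y : R ==> a \<otimes> y : I" for a y
  using mult I by (auto simp: m_comm subset_iff)
qed

lemma (in cring) ideal_pair:
 assumes "a : R" "b : R"
 shows "ideal {c \<otimes> a \<oplus> d \<otimes> b | c d. c : R \<and> d : R} R" (is "ideal ?J R")
proof -
 have "?J = PIdl a <+> PIdl b" unfolding set_add_def' cgenideal_def by blast
 thus ?thesis using add_ideals[OF cgenideal_ideal[OF assms(1)] cgenideal_ideal[OF assms(2)]] by simp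
qed

text \<open>Krull's argument: an ideal maximal among those that contain \<open>J\<close> and no
  power of \<open>f\<close> is prime.\<close>

lemma (in cring) prime_avoiding:
 assumes J: "ideal J R" and f: "f : R" and nf: "!!m::nat. f [^] m ~: J"
 shows "EX P. primeideal P R \<and> J \<subseteq> P \<and> f ~: P"
proof -
 define \<F> where "\<F> = {I. ideal I R \<and> J \<subseteq> I \<and> (ALL m::nat. f [^] m ~: I)}"
 have "EX M:\<F>. ALL X:\<F>. M \<subseteq> X --> X = M"
 proof (rule subset_Zorn_nonempty)
  show "\<F> ~= {}" using J nf by (auto simp: \<F>_def)
  fix C assume C: "C ~= {}" "subset.chain \<F> C"
  hence sub: "C \<subseteq> \<F>" and tot: "!!X Y. X : C ==> Y : C ==> X \<subseteq> Y \<or> Y \<subseteq> X"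
   by (auto simp: subset.chain_def)
  have id: "!!I. I : C ==> ideal I R" using sub by (auto simp: \<F>_def)
  have "ideal (\<Union>C) R"
  proof (rule idealI')
   show "\<zero> : \<Union>C" using C(1) additive_subgroup.zero_closed[OF ideal.axioms(1)[OF id]] by auto
   show "a \<oplus> b : \<Union>C" if "a : \<Union>C" "b : \<Union>C" for a b
    using that tot additive_subgroup.a_closed[OF ideal.axioms(1)[OF id]] by (meson UnionE UnionI subsetD)
  qed (use ideal.I_l_closed[OF id] ideal.Icarr[OF id] in auto)
  moreover have "J \<subseteq> \<Union>C" using C(1) sub by (auto simp: \<F>_def)
  ultimately show "\<Union>C \<in> \<F>" using sub by (auto simp: \<F>_def)
 qed
 then obtain M where M: "M : \<F>" and max: "!!X. X : \<F> ==> M \<subseteq> X ==> X = M" by blast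
 interpret M: ideal M R using M by (auto simp: \<F>_def)
 \<comment> \<open>By maximality, adding any \<open>a\<close> outside \<open>M\<close> must bring in
   a power of \<open>f\<close>.\<close>
 have pow: "EX m::nat. EX i:M. EX r:R. f [^] m = i \<oplus> r \<otimes> a" if a: "a : R" "a ~: M" for a
 proof -
  have I: "ideal (M <+> PIdl a) R" using add_ideals[OF M.ideal_axioms cgenideal_ideal[OF a(1)]] .
  have mem: "p \<oplus> q : M <+> PIdl a" if "p : M" "q : PIdl a" for p q
   using that unfolding set_add_def' by blast
  have z: "\<zero> : PIdl a"
   by (rule additive_subgroup.zero_closed[OF ideal.axioms(1)[OF cgenideal_ideal[OF a(1)]]])
  have s: "M \<subseteq> M <+> PIdl a"
  proof
   fix i assume "i : M"
   thus "i : M <+> PIdl a" using mem[OF \<open>i : M\<close> z] M.Icarr by simp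
  qed
  have "a : M <+> PIdl a" using mem[OF M.zero_closed cgenideal_self[OF a(1)]] a(1) by simp
  hence "M <+> PIdl a ~= M" using a by blast
  hence "M <+> PIdl a ~: \<F>" using max s by blast
  moreover have "J \<subseteq> M <+> PIdl a" using s M by (auto simp: \<F>_def)
  ultimately obtain m :: nat where "f [^] m : M <+> PIdl a" using I by (auto simp: \<F>_def)
  thus ?thesis unfolding set_add_def' cgenideal_def by blast
 qed
 have "primeideal M R"
 proof (rule primeidealI[OF M.ideal_axioms is_cring])
  have "f [^] (0::nat) ~: M" using M unfolding \<F>_def by blast
  thus "carrier R ~= M" by auto
  fix a b assume ab: "a : R" "b : R" "a \<otimes> b : M"
  show "a : M \<or> b : M"
  proof (rule ccontr)
   assume "~ (a : M \<or> b : M)"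
   then obtain m i r m' i' r' where *: "f [^] (m::nat) = i \<oplus> r \<otimes> a" "i : M" "r : R"
    "f [^] (m'::nat) = i' \<oplus> r' \<otimes> b" "i' : M" "r' : R" using pow ab by meson
   have ic: "i : R" "i' : R" using * M.Icarr by auto
   \<comment> \<open>In the product of the two expressions the only term without a factor from
     \<open>M\<close> is a multiple of \<open>a \<otimes> b\<close>, which lies in \<open>M\<close>
     too.\<close>
   have "f [^] (m + m') = (i \<oplus> r \<otimes> a) \<otimes> (i' \<oplus> r' \<otimes> b)"
    using * f by (metis nat_pow_mult)
   also have "\<dots> = i \<otimes> (i' \<oplus> r' \<otimes> b) \<oplus> (i' \<otimes> (r \<otimes> a) \<oplus> (r \<otimes> r') \<otimes> (a \<otimes> b))"
    using *(3,6) ic ab(1,2) by (simp add: l_distr r_distr m_ac a_ac)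
   also have "\<dots> : M" using * ic ab
    by (intro M.a_closed M.I_r_closed[of i] M.I_r_closed[of i'] M.I_l_closed[of "a \<otimes> b"]) auto
   finally show False using M by (auto simp: \<F>_def)
  qed
 qed
 moreover have "f [^] (1::nat) ~: M" using M unfolding \<F>_def by blast
 ultimately show ?thesis using M f by (auto simp: \<F>_def)
qed

lemma (in cring) radical_pow:
 assumes "ideal J R" "f : R" "!!P. primeideal P R ==> J \<subseteq> P ==> f : P"
 shows "EX m::nat. f [^] m : J"
 using prime_avoiding[OF assms(1,2)] assms(3) by blast

text \<open>Used as a local-to-global principle: to find 1 in an ideal of denominators it is enough
  to find, for each prime, a denominator outside it.\<close>

lemma (in cring) ideal_eq_carrier:
 assumes "ideal J R" "!!P. primeideal P R ==> ~ J \<subseteq> P"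
 shows "\<one> : J"
 using radical_pow[OF assms(1) one_closed] assms(2) by auto

lemma primeidealD:
 assumes "primeideal P R"
 shows "\<one>.R ~: P" "!!a. a : P ==> a : R" "\<zero>.R : P"
  "!!a b. a : R ==> b : R ==> a \<otimes>.R b : P \<longleftrightarrow> a : P \<or> b : P"
  "!!a b. a : P ==> b : P ==> a \<oplus>.R b : P"
  "!!a (m::nat). a : R ==> a [^].R m : P ==> a : P"
proof -
 interpret primeideal P R by fact
 show 1: "\<one>.R ~: P" using I_notcarr one_imp_carrier by blast
 show "!!a. a : P ==> a : R" "\<zero>.R : P" "!!a b. a : P ==> b : P ==> a \<oplus>.R b : P" by auto
 show m: "!!a b. a : R ==> b : R ==> a \<otimes>.R b : P \<longleftrightarrow> a : P \<or> b : P"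
  using I_prime I_l_closed I_r_closed by blast
 show "a : P" if "a : R" "a [^].R m : P" for a and m :: nat
  using that(2)
 proof (induction m)
  case 0 thus ?case using 1 unfolding nat_pow_0 by metis
 next
  case (Suc m)
  hence "a [^].R m \<otimes>.R a : P" unfolding nat_pow_Suc by metis
  thus ?case unfolding m[OF nat_pow_closed[OF that(1)] that(1)] using Suc.IH by metis
 qed
qed


text \<open>The operations of \<open>localization\<close> and \<open>stalk\<close> are unions over
  all pairs of representatives. Once the result does not depend on the choice, the union collapses
  to it, provided that one pair exists.\<close>

lemma Union_pairs_const:
 assumes "!!a s b t. (a, s) : F ==> (b, t) : G ==> fi a s b t = C"
  and "(a0, s0) : F" "(b0, t0) : G"
 shows "\<Union>{fi a s b t | a s b t. (a, s) : F \<and> (b, t) : G} = C"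
proof -
 have "{fi a s b t | a s b t. (a, s) : F \<and> (b, t) : G} = {C}"
 proof
  show "{fi a s b t | a s b t. (a, s) : F \<and> (b, t) : G} \<subseteq> {C}" using assms(1) by auto
  show "{C} \<subseteq> {fi a s b t | a s b t. (a, s) : F \<and> (b, t) : G}"
   using assms(1)[OF assms(2,3)] assms(2,3) by auto
 qed
 thus ?thesis by simp
qed

section \<open>Localization at a multiplicative set\<close>

locale mult_set = cring R for R :: "('a, 'm) ring_scheme" (structure) and T :: "'a set" +
 assumes T_sub: "T \<subseteq> R" and T_one: "\<one> : T"
  and T_mult: "!!s t. s : T ==> t : T ==> s \<otimes> t : T"
begin

lemma T_carr[simp]: "s : T ==> s : R" using T_sub by auto

lemma fraction_self: "a : R ==> s : T ==> (a, s) : fraction R T a s"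
 unfolding fraction_def using T_one by auto

text \<open>Transitivity of the equality of fractions. The multiplier
  \<open>u \<otimes> v \<otimes> s\<close> contains the middle denominator \<open>s\<close>, which
  cannot be cancelled in the presence of zero divisors.\<close>

lemma fraction_sub:
 assumes "a : R" "b : R" "s : T" "t : T" "u : T" "u \<otimes> (t \<otimes> a) = u \<otimes> (s \<otimes> b)"
 shows "fraction R T a s \<subseteq> fraction R T b t"
proof
 fix z assume "z : fraction R T a s"
 then obtain c w v where z: "z = (c, w)" "c : R" "w : T" "v : T"
  "v \<otimes> (w \<otimes> a) = v \<otimes> (s \<otimes> c)" by (auto simp: fraction_def)
 note [simp] = assms(1-5) z(2-4)
 have "(u \<otimes> v \<otimes> s) \<otimes> (w \<otimes> b) = v \<otimes> w \<otimes> (u \<otimes> (s \<otimes> b))" by (simp add: m_ac)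
 also have "\<dots> = v \<otimes> w \<otimes> (u \<otimes> (t \<otimes> a))" by (simp only: assms(6))
 also have "\<dots> = u \<otimes> t \<otimes> (v \<otimes> (w \<otimes> a))" by (simp add: m_ac)
 also have "\<dots> = u \<otimes> t \<otimes> (v \<otimes> (s \<otimes> c))" by (simp only: z(5))
 also have "\<dots> = (u \<otimes> v \<otimes> s) \<otimes> (t \<otimes> c)" by (simp add: m_ac)
 finally show "z : fraction R T b t"
  unfolding fraction_def using z by (auto intro!: bexI[of _ "u \<otimes> v \<otimes> s"] T_mult)
qed

lemma fraction_eqI:
 assumes "a : R" "b : R" "s : T" "t : T" "u : T" "u \<otimes> (t \<otimes> a) = u \<otimes> (s \<otimes> b)"
 shows "fraction R T a s = fraction R T b t"
 using fraction_sub[OF assms] fraction_sub[OF assms(2,1,4,3,5) assms(6)[symmetric]] by auto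

lemma fraction_eq_iff:
 assumes "a : R" "b : R" "s : T" "t : T"
 shows "fraction R T a s = fraction R T b t \<longleftrightarrow> (EX u:T. u \<otimes> (t \<otimes> a) = u \<otimes> (s \<otimes> b))"
proof
 assume "fraction R T a s = fraction R T b t"
 hence "(b, t) : fraction R T a s" using fraction_self[of b t] assms by simp
 thus "EX u:T. u \<otimes> (t \<otimes> a) = u \<otimes> (s \<otimes> b)" by (auto simp: fraction_def)
qed (use fraction_eqI assms in blast)

lemma loc_carrier: "carrier (localization R T) = {fraction R T a s | a s. a : R \<and> s : T}"
 by (simp add: localization_def)

lemma loc_mult:
 assumes [simp]: "a : R" "b : R" "s : T" "t : T"
 shows "fraction R T a s \<otimes>.(localization R T) fraction R T b t = fraction R T (a \<otimes> b) (s \<otimes> t)"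
proof -
 have "fraction R T (a' \<otimes> b') (s' \<otimes> t') = fraction R T (a \<otimes> b) (s \<otimes> t)"
  if as': "(a', s') : fraction R T a s" and bt': "(b', t') : fraction R T b t" for a' b' s' t'
 proof -
  from as' bt' obtain u v where uv: "a' : R" "s' : T" "u : T" "u \<otimes> (s' \<otimes> a) = u \<otimes> (s \<otimes> a')"
   "b' : R" "t' : T" "v : T" "v \<otimes> (t' \<otimes> b) = v \<otimes> (t \<otimes> b')" by (auto simp: fraction_def)
  note [simp] = uv(1-3) uv(5-7)
  have "(u \<otimes> v) \<otimes> ((s \<otimes> t) \<otimes> (a' \<otimes> b')) = (u \<otimes> (s \<otimes> a')) \<otimes> (v \<otimes> (t \<otimes> b'))" by (simp add: m_ac)
  also have "\<dots> = (u \<otimes> (s' \<otimes> a)) \<otimes> (v \<otimes> (t' \<otimes> b))" by (simp only: uv(4,8))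
  also have "\<dots> = (u \<otimes> v) \<otimes> ((s' \<otimes> t') \<otimes> (a \<otimes> b))" by (simp add: m_ac)
  finally have eq: "(u \<otimes> v) \<otimes> ((s \<otimes> t) \<otimes> (a' \<otimes> b')) = (u \<otimes> v) \<otimes> ((s' \<otimes> t') \<otimes> (a \<otimes> b))" .
  show ?thesis by (rule fraction_eqI[OF _ _ _ _ T_mult[OF uv(3,7)] eq]) (simp_all add: T_mult)
 qed
 note U = Union_pairs_const[OF this fraction_self[OF assms(1,3)] fraction_self[OF assms(2,4)]]
 show ?thesis unfolding localization_def by (simp, rule U)
qed

lemma loc_add:
 assumes [simp]: "a : R" "b : R" "s : T" "t : T"
 shows "fraction R T a s \<oplus>.(localization R T) fraction R T b t
  = fraction R T ((t \<otimes> a) \<oplus> (s \<otimes> b)) (s \<otimes> t)"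
proof -
 have "fraction R T ((t' \<otimes> a') \<oplus> (s' \<otimes> b')) (s' \<otimes> t') = fraction R T ((t \<otimes> a) \<oplus> (s \<otimes> b)) (s \<otimes> t)"
  if as': "(a', s') : fraction R T a s" and bt': "(b', t') : fraction R T b t" for a' b' s' t'
 proof -
  from as' bt' obtain u v where uv: "a' : R" "s' : T" "u : T" "u \<otimes> (s' \<otimes> a) = u \<otimes> (s \<otimes> a')"
   "b' : R" "t' : T" "v : T" "v \<otimes> (t' \<otimes> b) = v \<otimes> (t \<otimes> b')" by (auto simp: fraction_def)
  note [simp] = uv(1-3) uv(5-7)
  have 1: "(u \<otimes> v) \<otimes> ((s \<otimes> t) \<otimes> (t' \<otimes> a')) = (u \<otimes> v) \<otimes> ((s' \<otimes> t') \<otimes> (t \<otimes> a))"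
  proof -
   have "(u \<otimes> v) \<otimes> ((s \<otimes> t) \<otimes> (t' \<otimes> a')) = (u \<otimes> (s \<otimes> a')) \<otimes> (v \<otimes> t \<otimes> t')" by (simp add: m_ac)
   also have "\<dots> = (u \<otimes> (s' \<otimes> a)) \<otimes> (v \<otimes> t \<otimes> t')" by (simp only: uv(4))
   also have "\<dots> = (u \<otimes> v) \<otimes> ((s' \<otimes> t') \<otimes> (t \<otimes> a))" by (simp add: m_ac)
   finally show ?thesis .
  qed
  have 2: "(u \<otimes> v) \<otimes> ((s \<otimes> t) \<otimes> (s' \<otimes> b')) = (u \<otimes> v) \<otimes> ((s' \<otimes> t') \<otimes> (s \<otimes> b))"
  proof -
   have "(u \<otimes> v) \<otimes> ((s \<otimes> t) \<otimes> (s' \<otimes> b')) = (v \<otimes> (t \<otimes> b')) \<otimes> (u \<otimes> s \<otimes> s')" by (simp add: m_ac)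
   also have "\<dots> = (v \<otimes> (t' \<otimes> b)) \<otimes> (u \<otimes> s \<otimes> s')" by (simp only: uv(8))
   also have "\<dots> = (u \<otimes> v) \<otimes> ((s' \<otimes> t') \<otimes> (s \<otimes> b))" by (simp add: m_ac)
   finally show ?thesis .
  qed
  have eq: "(u \<otimes> v) \<otimes> ((s \<otimes> t) \<otimes> ((t' \<otimes> a') \<oplus> (s' \<otimes> b'))) = (u \<otimes> v) \<otimes> ((s' \<otimes> t') \<otimes> ((t \<otimes> a) \<oplus> (s \<otimes> b)))"
  proof -
   have "(u \<otimes> v) \<otimes> ((s \<otimes> t) \<otimes> ((t' \<otimes> a') \<oplus> (s' \<otimes> b')))
    = (u \<otimes> v) \<otimes> ((s \<otimes> t) \<otimes> (t' \<otimes> a')) \<oplus> (u \<otimes> v) \<otimes> ((s \<otimes> t) \<otimes> (s' \<otimes> b'))" by (simp add: r_distr)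
   also have "\<dots> = (u \<otimes> v) \<otimes> ((s' \<otimes> t') \<otimes> (t \<otimes> a)) \<oplus> (u \<otimes> v) \<otimes> ((s' \<otimes> t') \<otimes> (s \<otimes> b))"
    by (simp only: 1 2)
   also have "\<dots> = (u \<otimes> v) \<otimes> ((s' \<otimes> t') \<otimes> ((t \<otimes> a) \<oplus> (s \<otimes> b)))" by (simp add: r_distr)
   finally show ?thesis .
  qed
  show ?thesis by (rule fraction_eqI[OF _ _ _ _ T_mult[OF uv(3,7)] eq]) (simp_all add: T_mult)
 qed
 note U = Union_pairs_const[OF this fraction_self[OF assms(1,3)] fraction_self[OF assms(2,4)]]
 show ?thesis unfolding localization_def by (simp, rule U)
qed

lemma loc_one: "\<one>.(localization R T) = fraction R T \<one> \<one>"
 and loc_zero: "\<zero>.(localization R T) = fraction R T \<zero> \<one>"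
 by (simp_all add: localization_def)

end

lemma (in cring) mult_set_prime:
 assumes "primeideal P R" shows "mult_set R (carrier R - P)"
 using primeidealD(1,4)[OF assms] by unfold_locales auto

text \<open>A fraction is a set of pairs without a distinguished one, so its value is described as
  the quotient common to all of them.\<close>

definition lval :: "('q, 'n) ring_scheme => ('a => 'q) => ('a \<times> 'a) set => 'q" where
 "lval Q al F = (THE q. ALL (a, c):F. q = al a \<otimes>.Q inv .Q al c)"

context field
begin

lemma inv_nz: "a : R ==> a ~= \<zero> ==> inv a : R \<and> inv a ~= \<zero> \<and> a \<otimes> inv a = \<one> \<and> inv a \<otimes> a = \<one>"
 using field_Units by (metis DiffI Units_inv_closed Units_l_inv Units_r_inv l_null one_not_zero r_null singletonD)

lemma inv_cl[simp]: "a : R ==> a ~= \<zero> ==> inv a : R"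
 and inv_nz'[simp]: "a : R ==> a ~= \<zero> ==> inv a ~= \<zero>"
 and inv_r[simp]: "a : R ==> a ~= \<zero> ==> a \<otimes> inv a = \<one>"
 and inv_l[simp]: "a : R ==> a ~= \<zero> ==> inv a \<otimes> a = \<one>"
 using inv_nz by auto

lemma inv_l2[simp]: "a : R ==> a ~= \<zero> ==> b : R ==> inv a \<otimes> (a \<otimes> b) = b"
 and inv_r2[simp]: "a : R ==> a ~= \<zero> ==> b : R ==> a \<otimes> (inv a \<otimes> b) = b"
 by (simp_all add: m_assoc[symmetric])

lemma div_eq_iff:
 assumes "a : R" "b : R" "q : R" "b ~= \<zero>"
 shows "q = a \<otimes> inv b \<longleftrightarrow> q \<otimes> b = a" and "a \<otimes> inv b = q \<longleftrightarrow> q \<otimes> b = a"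
proof -
 have "(a \<otimes> inv b) \<otimes> b = a" "(q \<otimes> b) \<otimes> inv b = q" using assms by (simp_all add: m_assoc)
 thus "q = a \<otimes> inv b \<longleftrightarrow> q \<otimes> b = a" by metis
 thus "a \<otimes> inv b = q \<longleftrightarrow> q \<otimes> b = a" by metis
qed

lemma div_eq_div:
 assumes [simp]: "a : R" "b : R" "c : R" "d : R" "b ~= \<zero>" "d ~= \<zero>"
 shows "a \<otimes> inv b = c \<otimes> inv d \<longleftrightarrow> d \<otimes> a = b \<otimes> c"
proof -
 have "a \<otimes> inv b = c \<otimes> inv d \<longleftrightarrow> (c \<otimes> inv d) \<otimes> b = a" by (intro div_eq_iff) auto
 also have "(c \<otimes> inv d) \<otimes> b = (b \<otimes> c) \<otimes> inv d" by (simp add: m_ac)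
 also have "(b \<otimes> c) \<otimes> inv d = a \<longleftrightarrow> a \<otimes> d = b \<otimes> c" by (intro div_eq_iff) auto
 finally show ?thesis by (simp add: m_comm)
qed

lemma inv_mult: "a : R ==> b : R ==> a ~= \<zero> ==> b ~= \<zero> ==> inv (a \<otimes> b) = inv a \<otimes> inv b"
 by (intro comm_inv_char) (auto simp: m_ac)

lemma inv_inv': "a : R ==> a ~= \<zero> ==> inv (inv a) = a"
 by (intro comm_inv_char) auto

lemma nz_mult[simp]: "a : R ==> b : R ==> a ~= \<zero> ==> b ~= \<zero> ==> a \<otimes> b ~= \<zero>"
 using integral_iff by auto

lemma nz_pow[simp]: "a : R ==> a ~= \<zero> ==> a [^] (m::nat) ~= \<zero>"
 by (induction m) auto

lemma l_cancel: "a : R ==> a ~= \<zero> ==> b : R ==> c : R ==> a \<otimes> b = a \<otimes> c \<longleftrightarrow> b = c"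
 using inv_l2 by metis

end

locale loc_in_field = Q: field Q + mult_set R T
 for R :: "('a, 'm) ring_scheme" (structure) and T and Q :: "('q, 'n) ring_scheme" and al +
 assumes inj: "inj_hom R Q al" and T_nz: "\<zero> ~: T"
begin

lemmas alh = inj_homD[OF inj]
lemmas alz = inj_hom_zero[OF inj ring_axioms Q.ring_axioms]

lemma alT[simp]: "s : T ==> al s ~= \<zero>.Q" using alz(2)[OF T_carr] T_nz by auto

lemma eq_iff:
 assumes [simp]: "a : R" "b : R" "s : T" "t : T"
 shows "fraction R T a s = fraction R T b t \<longleftrightarrow> al a \<otimes>.Q inv .Q al s = al b \<otimes>.Q inv .Q al t"
proof -
 have "(EX u:T. u \<otimes> (t \<otimes> a) = u \<otimes> (s \<otimes> b)) \<longleftrightarrow> t \<otimes> a = s \<otimes> b"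
 proof
  assume "EX u:T. u \<otimes> (t \<otimes> a) = u \<otimes> (s \<otimes> b)"
  then obtain u where u: "u : T" "u \<otimes> (t \<otimes> a) = u \<otimes> (s \<otimes> b)" by blast
  hence "al u \<otimes>.Q al (t \<otimes> a) = al u \<otimes>.Q al (s \<otimes> b)"
   using alh(3)[of u "t \<otimes> a"] alh(3)[of u "s \<otimes> b"] by simp
  hence "al (t \<otimes> a) = al (s \<otimes> b)" using u(1) alh(2) by (simp add: Q.l_cancel)
  thus "t \<otimes> a = s \<otimes> b" using alh(6) by simp
 next
  assume "t \<otimes> a = s \<otimes> b"
  thus "EX u:T. u \<otimes> (t \<otimes> a) = u \<otimes> (s \<otimes> b)" using T_one by auto
 qed
 also have "t \<otimes> a = s \<otimes> b \<longleftrightarrow> al t \<otimes>.Q al a = al s \<otimes>.Q al b"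
  using alh(6)[of "t \<otimes> a" "s \<otimes> b"] by (simp add: alh(3))
 also have "\<dots> \<longleftrightarrow> al a \<otimes>.Q inv .Q al s = al b \<otimes>.Q inv .Q al t"
  using Q.div_eq_div[of "al a" "al s" "al b" "al t"] alh(2) by simp
 finally show ?thesis by (simp add: fraction_eq_iff)
qed

lemma lval_fraction:
 assumes [simp]: "a : R" "s : T"
 shows "lval Q al (fraction R T a s) = al a \<otimes>.Q inv .Q al s"
proof -
 have *: "al b \<otimes>.Q inv .Q al t = al a \<otimes>.Q inv .Q al s" if "(b, t) : fraction R T a s" for b t
 proof -
  from that obtain u where u: "b : R" "t : T" "u : T" "u \<otimes> (t \<otimes> a) = u \<otimes> (s \<otimes> b)"
   by (auto simp: fraction_def)
  thus ?thesis
   using fraction_eqI[OF assms(1) u(1) assms(2) u(2,3,4)] eq_iff[OF assms(1) u(1) assms(2) u(2)] by metis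
 qed
 show ?thesis unfolding lval_def
 proof (rule the_equality)
  show "ALL (b, t):fraction R T a s. al a \<otimes>.Q inv .Q al s = al b \<otimes>.Q inv .Q al t"
  proof (rule ballI, unfold split_paired_all prod.case)
   fix b t assume "(b, t) : fraction R T a s"
   from *[OF this] show "al a \<otimes>.Q inv .Q al s = al b \<otimes>.Q inv .Q al t" by (rule sym)
  qed
 qed (use fraction_self[OF assms] in auto)
qed

lemma loc_carrE:
 assumes "F : localization R T"
 obtains a s where "a : R" "s : T" "F = fraction R T a s"
 using assms by (auto simp: loc_carrier)

lemma frac_in_loc[simp]: "a : R ==> s : T ==> fraction R T a s : localization R T"
 by (auto simp: loc_carrier)

lemma lval_image: "lval Q al ` carrier (localization R T) = {al a \<otimes>.Q inv .Q al s | a s. a : R \<and> s : T}"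
 unfolding loc_carrier by (force simp: lval_fraction)

lemma lval_hom: "lval Q al : ring_hom (localization R T) Q"
proof (rule ring_hom_memI)
 fix F assume "F : localization R T"
 then obtain a s where F[simp]: "a : R" "s : T" "F = fraction R T a s" by (rule loc_carrE)
 show "lval Q al F : Q" by (simp add: lval_fraction alh(2))
 fix G assume "G : localization R T"
 then obtain b t where G[simp]: "b : R" "t : T" "G = fraction R T b t" by (rule loc_carrE)
 have st: "s \<otimes> t : T" using T_mult F(2) G(2) by simp
 note [simp] = alh(2,3,4) lval_fraction[OF _ st] Q.inv_mult
 show "lval Q al (F \<otimes>.(localization R T) G) = lval Q al F \<otimes>.Q lval Q al G"
  by (simp add: loc_mult lval_fraction Q.m_ac)
 have "al t \<otimes>.Q al a \<otimes>.Q (inv .Q al s \<otimes>.Q inv .Q al t) = (al t \<otimes>.Q inv .Q al t) \<otimes>.Q (al a \<otimes>.Q inv .Q al s)"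
  by (simp add: Q.m_ac del: Q.inv_r)
 moreover have "al s \<otimes>.Q al b \<otimes>.Q (inv .Q al s \<otimes>.Q inv .Q al t) = (al s \<otimes>.Q inv .Q al s) \<otimes>.Q (al b \<otimes>.Q inv .Q al t)"
  by (simp add: Q.m_ac del: Q.inv_r)
 ultimately show "lval Q al (F \<oplus>.(localization R T) G) = lval Q al F \<oplus>.Q lval Q al G"
  by (simp add: loc_add lval_fraction Q.l_distr)
next
 show "lval Q al \<one>.(localization R T) = \<one>.Q"
  by (simp add: loc_one lval_fraction T_one alh(5))
qed

lemma lval_inj: "inj_hom (localization R T) Q (lval Q al)"
 unfolding inj_hom_def
proof (intro conjI lval_hom inj_onI)
 fix F G assume "F : localization R T" "G : localization R T" "lval Q al F = lval Q al G"
 thus "F = G" by (elim loc_carrE) (simp add: lval_fraction eq_iff)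
qed

lemma loc_cring: "cring (localization R T)"
proof (rule cring_of_inj[OF Q.is_cring lval_hom])
 show "inj_on (lval Q al) (carrier (localization R T))" using lval_inj by (simp add: inj_hom_def)
 fix F assume "F : localization R T"
 then obtain a s where F[simp]: "a : R" "s : T" "F = fraction R T a s" by (rule loc_carrE)
 show "EX b:localization R T. lval Q al b = \<ominus>.Q lval Q al F"
  by (intro bexI[of _ "fraction R T (\<ominus> a) s"])
   (simp_all add: lval_fraction alh(2) inj_hom_minus[OF inj ring_axioms Q.ring_axioms] Q.l_minus)
 fix G assume "G : localization R T"
 then obtain b t where G[simp]: "b : R" "t : T" "G = fraction R T b t" by (rule loc_carrE)
 show "F \<otimes>.(localization R T) G : localization R T"
  "F \<oplus>.(localization R T) G : localization R T"
  by (simp_all add: loc_mult loc_add T_mult)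
next
 show "\<one>.(localization R T) : localization R T" "\<zero>.(localization R T) : localization R T"
  by (simp_all add: loc_one loc_zero T_one)
 show "lval Q al \<zero>.(localization R T) = \<zero>.Q"
  by (simp add: loc_zero lval_fraction T_one alz(1) alh(2))
qed

end

lemma (in cring) loc_in_field_prime:
 assumes "field Q" "inj_hom R Q al" "primeideal P R"
 shows "loc_in_field R (carrier R - P) Q al"
 using assms mult_set_prime[OF assms(3)] primeidealD(3)[OF assms(3)]
 by (simp add: loc_in_field_def loc_in_field_axioms_def)


section \<open>Ringed spaces inside a field\<close>

lemma fun_ring_simps[simp]:
 "carrier (fun_ring I R C) = C"
 "monoid.mult (fun_ring I R C) = (\<lambda>f g. \<lambda>i\<in>I. f i \<otimes>.(R i) g i)"
 "one (fun_ring I R C) = (\<lambda>i\<in>I. \<one>.(R i))"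
 "ring.zero (fun_ring I R C) = (\<lambda>i\<in>I. \<zero>.(R i))"
 "add (fun_ring I R C) = (\<lambda>f g. \<lambda>i\<in>I. f i \<oplus>.(R i) g i)"
 by (simp_all add: fun_ring_def)

text \<open>Over the empty set there is no point at which a value could be taken, so this ring is
  outside the reach of \<open>fiber_product\<close>.\<close>

lemma fun_ring_empty: "cring (fun_ring {} R {\<lambda>i. undefined})"
 by (intro cringI abelian_groupI Group.comm_monoidI) (auto simp: restrict_def)

text \<open>Components with a common value in \<open>Q\<close> determine each other, so any single
  index embeds the whole ring. Sections of an \<open>lc_space\<close>, of the line with several
  origins and of the glued algebra all have this form.\<close>

lemma fiber_product:
 fixes Q :: "('q, 'z) ring_scheme"
 assumes Q: "cring Q" and N: "i0 : N" and R: "!!i. i : N ==> cring (R i)" and v: "!!i. i : N ==> inj_hom (R i) Q (v i)"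
 defines "C \<equiv> {s : (\<Pi>\<^sub>E i\<in>N. carrier (R i)). ALL i:N. ALL j:N. v i (s i) = v j (s j)}"
 shows "cring (fun_ring N R C)" "inj_hom (fun_ring N R C) Q (\<lambda>s. v i0 (s i0))"
proof -
 interpret Q: cring Q by (rule Q)
 note c = cring.cring_simprules(1,2,3,5,6)[OF R] and vh = inj_homD(2-5)[OF v]
  and v0 = inj_hom_zero(1)[OF v cring.axioms(1)[OF R] Q.ring_axioms] and vm = inj_hom_minus[OF v cring.axioms(1)[OF R] Q.ring_axioms]
 have CI: "s : C" if "s : (\<Pi>\<^sub>E i\<in>N. carrier (R i))" "!!i. i : N ==> v i (s i) = q" for s q
  unfolding C_def using that by simp
 have CD: "s i : R i" "v i (s i) = v i0 (s i0)" if asm: "s : C" "i : N" for s i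
 proof -
  note P = asm(1)[unfolded C_def mem_Collect_eq, THEN conjunct1] and e = asm(1)[unfolded C_def mem_Collect_eq, THEN conjunct2]
  show "s i : R i" by (rule PiE_mem[OF P asm(2)])
  show "v i (s i) = v i0 (s i0)" by (rule e[THEN bspec, OF asm(2), THEN bspec, OF N])
 qed
 show h: "inj_hom (fun_ring N R C) Q (\<lambda>s. v i0 (s i0))" unfolding inj_hom_def
 proof (intro conjI ring_hom_memI inj_onI)
  fix s t assume st: "s : fun_ring N R C" "t : fun_ring N R C" "v i0 (s i0) = v i0 (t i0)"
  note C = st(1,2)[unfolded fun_ring_simps(1)] and P = st(1,2)[unfolded fun_ring_simps(1) C_def mem_Collect_eq, THEN conjunct1]
  show "s = t"
  proof (rule PiE_ext[OF P])
   fix i assume i: "i : N"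
   have "v i (s i) = v i (t i)" unfolding CD(2)[OF C(1) i] CD(2)[OF C(2) i] by (rule st(3))
   thus "s i = t i" using inj_homD(6)[OF v[OF i] CD(1)[OF C(1) i] CD(1)[OF C(2) i]] by simp
  qed
 qed (use N in \<open>simp_all add: CD(1) vh\<close>)
 show "cring (fun_ring N R C)"
 proof (rule cring_of_inj[OF Q inj_homD(1)[OF h]], unfold fun_ring_simps)
  show "inj_on (\<lambda>s. v i0 (s i0)) C" using h by (simp add: inj_hom_def)
  fix s t assume s: "s : C" and t: "t : C"
  note vs = CD(2)[OF s] and vt = CD(2)[OF t]
  show "(\<lambda>i\<in>N. s i \<otimes>.(R i) t i) : C" by (rule CI[where q = "v i0 (s i0) \<otimes>.Q v i0 (t i0)"]) (simp_all add: c vh CD(1) s t vs vt)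
  show "(\<lambda>i\<in>N. s i \<oplus>.(R i) t i) : C" by (rule CI[where q = "v i0 (s i0) \<oplus>.Q v i0 (t i0)"]) (simp_all add: c vh CD(1) s t vs vt)
 next
  fix s assume s: "s : C"
  note vs = CD(2)[OF s]
  have "(\<lambda>i\<in>N. \<ominus>.(R i) s i) : C" by (rule CI[where q = "\<ominus>.Q v i0 (s i0)"]) (simp_all add: c vm CD(1) s vs)
  thus "EX b:C. v i0 (b i0) = \<ominus>.Q v i0 (s i0)" by (rule bexI[rotated]) (simp add: N vm CD(1) s)
 next
  show "(\<lambda>i\<in>N. \<one>.(R i)) : C" by (rule CI[where q = "\<one>.Q"]) (simp_all add: c vh)
  show "(\<lambda>i\<in>N. \<zero>.(R i)) : C" by (rule CI[where q = "\<zero>.Q"]) (simp_all add: c v0)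
 qed (simp add: N v0)
qed


text \<open>No gluing of sections is asked for, because the glued algebra is only a presheaf;
  compatible values on nonempty open sets suffice to compute germs and stalks.\<close>

locale qspace = field Q for X :: "('p, 's) ringed" and Q :: "'q ring" and val :: "'p set => 's => 'q" +
 assumes sec_cring: "opn X U ==> U ~= {} ==> cring (sec X U)"
  and val_inj: "opn X U ==> U ~= {} ==> inj_hom (sec X U) Q (val U)"
  and res_val: "opn X U ==> opn X V ==> V \<subseteq> U ==> V ~= {} ==> s : sec X U ==>
    res X U V s : sec X V \<and> val V (res X U V s) = val U s"
begin

lemma resv:
 assumes "opn X U" "opn X V" "V \<subseteq> U" "p : V" "s : sec X U"
 shows "res X U V s : sec X V" "val V (res X U V s) = val U s"
 using res_val[OF assms(1-3) _ assms(5)] assms(4) by auto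

lemma val_carr: "opn X U ==> p : U ==> s : sec X U ==> val U s : Q"
 using inj_homD(2)[OF val_inj, of U s] by blast

definition sval :: "('p set \<times> 's) set => 'q" where
 "sval F = (THE q. ALL (U, s):F. q = val U s)"

text \<open>Values are injective on \<open>U \<inter> V\<close>, so two sections with the same value
  agree on the whole intersection. Hence a germ at \<open>p\<close> is the set of all sections
  around \<open>p\<close> with a given value.\<close>

lemma germ_mem:
 assumes "opn X U" "p : U" "s : sec X U"
 shows "(V, t) : germ X p U s \<longleftrightarrow> opn X V \<and> p : V \<and> t : sec X V \<and> val V t = val U s"
proof
 assume "(V, t) : germ X p U s"
 then obtain W where W: "opn X V" "p : V" "t : sec X V" "opn X W" "p : W" "W \<subseteq> U \<inter> V"
  "res X U W s = res X V W t" by (auto simp: germ_def)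
 moreover have "val W (res X U W s) = val U s" "val W (res X V W t) = val V t"
  using W assms resv(2)[of U W p s] resv(2)[of V W p t] by auto
 ultimately show "opn X V \<and> p : V \<and> t : sec X V \<and> val V t = val U s" by simp
next
 assume as: "opn X V \<and> p : V \<and> t : sec X V \<and> val V t = val U s"
 have W: "opn X (U \<inter> V)" "p : U \<inter> V" using as assms by auto
 have "res X U (U \<inter> V) s = res X V (U \<inter> V) t"
  using inj_homD(6)[OF val_inj[OF W(1)], of "res X U (U \<inter> V) s" "res X V (U \<inter> V) t"] W as assms
   resv[of U "U \<inter> V" p s] resv[of V "U \<inter> V" p t] by auto
 thus "(V, t) : germ X p U s" using W as unfolding germ_def by auto
qed

lemma germ_eq:
 assumes "opn X U" "p : U" "s : sec X U" "opn X V" "p : V" "t : sec X V"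
 shows "germ X p U s = germ X p V t \<longleftrightarrow> val U s = val V t"
proof
 assume "germ X p U s = germ X p V t"
 moreover have "(U, s) : germ X p U s" using germ_mem[OF assms(1-3)] assms by auto
 ultimately show "val U s = val V t" using germ_mem[OF assms(4-6)] by auto
next
 assume "val U s = val V t"
 thus "germ X p U s = germ X p V t"
  using germ_mem[OF assms(1-3)] germ_mem[OF assms(4-6)] by auto
qed

lemma sval_germ:
 assumes "opn X U" "p : U" "s : sec X U"
 shows "sval (germ X p U s) = val U s"
 unfolding sval_def
proof (rule the_equality)
 show "ALL (V, t):germ X p U s. val U s = val V t" using germ_mem[OF assms] by auto
 have "(U, s) : germ X p U s" using germ_mem[OF assms] assms by auto
 thus "q = val U s" if "ALL (V, t):germ X p U s. q = val V t" for q using that by auto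
qed

lemma stalk_carrier: "carrier (stalk X p) = {germ X p U s | U s. opn X U \<and> p : U \<and> s : sec X U}"
 by (simp add: stalk_def)

lemma germ_in_stalk: "opn X U ==> p : U ==> s : sec X U ==> germ X p U s : stalk X p"
 by (auto simp: stalk_carrier)

lemma stalkE:
 assumes "F : stalk X p"
 obtains U s where "opn X U" "p : U" "s : sec X U" "F = germ X p U s"
 using assms by (auto simp: stalk_carrier)

lemma res_pair:
 assumes "opn X U" "p : U" "s : sec X U" "opn X V" "p : V" "t : sec X V"
 shows "res X U (U \<inter> V) s \<otimes>.(sec X (U \<inter> V)) res X V (U \<inter> V) t : (sec X (U \<inter> V))"
  "res X U (U \<inter> V) s \<oplus>.(sec X (U \<inter> V)) res X V (U \<inter> V) t : (sec X (U \<inter> V))"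
  "val (U \<inter> V) (res X U (U \<inter> V) s \<otimes>.(sec X (U \<inter> V)) res X V (U \<inter> V) t) = val U s \<otimes>.Q val V t"
  "val (U \<inter> V) (res X U (U \<inter> V) s \<oplus>.(sec X (U \<inter> V)) res X V (U \<inter> V) t) = val U s \<oplus>.Q val V t"
  "opn X (U \<inter> V)" "p : U \<inter> V"
proof -
 show W: "opn X (U \<inter> V)" "p : U \<inter> V" using assms by auto
 interpret C: cring "sec X (U \<inter> V)" using sec_cring W by blast
 have 1: "res X U (U \<inter> V) s : (sec X (U \<inter> V)) \<and> val (U \<inter> V) (res X U (U \<inter> V) s) = val U s"
  "res X V (U \<inter> V) t : (sec X (U \<inter> V)) \<and> val (U \<inter> V) (res X V (U \<inter> V) t) = val V t"
  using resv[of U "U \<inter> V" p s] resv[of V "U \<inter> V" p t] assms W by auto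
 have ne: "U \<inter> V ~= {}" using W by auto
 show "res X U (U \<inter> V) s \<otimes>.(sec X (U \<inter> V)) res X V (U \<inter> V) t : (sec X (U \<inter> V))"
  "res X U (U \<inter> V) s \<oplus>.(sec X (U \<inter> V)) res X V (U \<inter> V) t : (sec X (U \<inter> V))"
  using 1 by auto
 show "val (U \<inter> V) (res X U (U \<inter> V) s \<otimes>.(sec X (U \<inter> V)) res X V (U \<inter> V) t) = val U s \<otimes>.Q val V t"
  "val (U \<inter> V) (res X U (U \<inter> V) s \<oplus>.(sec X (U \<inter> V)) res X V (U \<inter> V) t) = val U s \<oplus>.Q val V t"
  using 1 inj_homD(3,4)[OF val_inj[OF W(1) ne]] by simp_all
qed

lemma stalk_mult:
 assumes st: "opn X U" "p : U" "s : sec X U" "opn X V" "p : V" "t : sec X V"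
 shows "germ X p U s \<otimes>.(stalk X p) germ X p V t
  = germ X p (U \<inter> V) (res X U (U \<inter> V) s \<otimes>.(sec X (U \<inter> V)) res X V (U \<inter> V) t)" (is ?A)
  and "germ X p U s \<oplus>.(stalk X p) germ X p V t
  = germ X p (U \<inter> V) (res X U (U \<inter> V) s \<oplus>.(sec X (U \<inter> V)) res X V (U \<inter> V) t)" (is ?B)
proof -
 have self: "(U, s) : germ X p U s" "(V, t) : germ X p V t" using germ_mem st by auto
 have "germ X p (U' \<inter> V') (res X U' (U' \<inter> V') s' \<otimes>.(sec X (U' \<inter> V')) res X V' (U' \<inter> V') t')
  = germ X p (U \<inter> V) (res X U (U \<inter> V) s \<otimes>.(sec X (U \<inter> V)) res X V (U \<inter> V) t) \<and>
  germ X p (U' \<inter> V') (res X U' (U' \<inter> V') s' \<oplus>.(sec X (U' \<inter> V')) res X V' (U' \<inter> V') t')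
  = germ X p (U \<inter> V) (res X U (U \<inter> V) s \<oplus>.(sec X (U \<inter> V)) res X V (U \<inter> V) t)"
  if "(U', s') : germ X p U s" "(V', t') : germ X p V t" for U' s' V' t'
 proof -
  from that have a: "opn X U'" "p : U'" "s' : sec X U'" "val U' s' = val U s"
   "opn X V'" "p : V'" "t' : sec X V'" "val V' t' = val V t"
   using germ_mem st by auto
  note r = res_pair[OF st] and r' = res_pair[OF a(1-3) a(5-7)]
  show ?thesis
   using germ_eq[OF r'(5,6,1) r(5,6,1)] germ_eq[OF r'(5,6,2) r(5,6,2)] r(3,4) r'(3,4) a(4,8) by simp
 qed
 note * = this[THEN conjunct1] this[THEN conjunct2]
 show ?A unfolding stalk_def by (simp, rule Union_pairs_const[OF *(1) self])
 show ?B unfolding stalk_def by (simp, rule Union_pairs_const[OF *(2) self])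
qed

lemma stalk_one_zero:
 assumes "p : pts X"
 shows "\<one>.(stalk X p) : stalk X p" "\<zero>.(stalk X p) : stalk X p"
  "sval \<one>.(stalk X p) = \<one>.Q" "sval \<zero>.(stalk X p) = \<zero>.Q"
proof -
 have ne: "pts X ~= {}" using assms by auto
 interpret C: cring "sec X (pts X)" using sec_cring ne by blast
 have e: "\<one>.(stalk X p) = germ X p (pts X) \<one>.(sec X (pts X))"
  "\<zero>.(stalk X p) = germ X p (pts X) \<zero>.(sec X (pts X))" by (simp_all add: stalk_def)
 have i: "inj_hom (sec X (pts X)) Q (val (pts X))" using val_inj ne by simp
 show "\<one>.(stalk X p) : stalk X p" "\<zero>.(stalk X p) : stalk X p"
  using e assms by (auto intro: germ_in_stalk)
 show "sval \<one>.(stalk X p) = \<one>.Q" "sval \<zero>.(stalk X p) = \<zero>.Q"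
  unfolding e using assms inj_homD(5)[OF i] inj_hom_zero(1)[OF i C.ring_axioms ring_axioms]
  by (simp_all add: sval_germ)
qed

lemma stalk_hom:
 assumes "p : pts X"
 shows "inj_hom (stalk X p) Q sval"
 unfolding inj_hom_def
proof
 show "sval : ring_hom (stalk X p) Q"
 proof (rule ring_hom_memI)
  fix F assume "F : stalk X p"
  then obtain U s where F: "opn X U" "p : U" "s : sec X U" "F = germ X p U s" by (rule stalkE)
  show "sval F : Q" using F sval_germ val_carr by simp
  fix G assume "G : stalk X p"
  then obtain V t where G: "opn X V" "p : V" "t : sec X V" "G = germ X p V t" by (rule stalkE)
  note r = res_pair[OF F(1-3) G(1-3)]
  show "sval (F \<otimes>.(stalk X p) G) = sval F \<otimes>.Q sval G"
   unfolding F(4) G(4) stalk_mult[OF F(1-3) G(1-3)]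
   using sval_germ[OF r(5,6,1)] sval_germ F(1-3) G(1-3) r(3) by simp
  show "sval (F \<oplus>.(stalk X p) G) = sval F \<oplus>.Q sval G"
   unfolding F(4) G(4) stalk_mult[OF F(1-3) G(1-3)]
   using sval_germ[OF r(5,6,2)] sval_germ F(1-3) G(1-3) r(4) by simp
 qed (use stalk_one_zero assms in auto)
 show "inj_on sval (carrier (stalk X p))"
 proof (rule inj_onI)
  fix F G assume "F : stalk X p" "G : stalk X p" "sval F = sval G"
  thus "F = G" by (elim stalkE) (simp add: sval_germ germ_eq)
 qed
qed

lemma stalk_cring:
 assumes "p : pts X"
 shows "cring (stalk X p)"
proof (rule cring_of_inj[OF is_cring])
 show "sval : ring_hom (stalk X p) Q" "inj_on sval (carrier (stalk X p))"
  using stalk_hom[OF assms] by (auto simp: inj_hom_def)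
 fix F assume "F : stalk X p"
 then obtain U s where F: "opn X U" "p : U" "s : sec X U" "F = germ X p U s" by (rule stalkE)
 have ne: "U ~= {}" using F by auto
 interpret C: cring "sec X U" using sec_cring[OF F(1) ne] .
 have "\<ominus>.(sec X U) s : sec X U" using F(3) by simp
 thus "EX b:stalk X p. sval b = \<ominus>.Q sval F"
  using F inj_hom_minus[OF val_inj[OF F(1) ne] C.ring_axioms ring_axioms F(3)]
  by (intro bexI[of _ "germ X p U (\<ominus>.(sec X U) s)"]) (auto simp: sval_germ germ_in_stalk)
 fix G assume "G : stalk X p"
 then obtain V t where G: "opn X V" "p : V" "t : sec X V" "G = germ X p V t" by (rule stalkE)
 note r = res_pair[OF F(1-3) G(1-3)]
 show "F \<otimes>.(stalk X p) G : stalk X p" "F \<oplus>.(stalk X p) G : stalk X p"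
  unfolding F(4) G(4) stalk_mult[OF F(1-3) G(1-3)] using germ_in_stalk[OF r(5,6)] r(1,2) by auto
qed (use stalk_one_zero[OF assms] in auto)

lemma stalk_unit_iff:
 assumes "opn X U" "p : U" "s : sec X U"
 shows "germ X p U s : Units (stalk X p) \<longleftrightarrow>
  val U s ~= \<zero>.Q \<and> (EX V t. opn X V \<and> p : V \<and> t : sec X V \<and> val V t = inv .Q val U s)"
proof -
 have p: "p : pts X" using assms openin_subset by fastforce
 have "inv .Q val U s : sval ` carrier (stalk X p) \<longleftrightarrow>
  (EX V t. opn X V \<and> p : V \<and> t : sec X V \<and> val V t = inv .Q val U s)"
 proof
  assume "inv .Q val U s : sval ` carrier (stalk X p)"
  then obtain F where "F : stalk X p" "inv .Q val U s = sval F" by auto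
  thus "EX V t. opn X V \<and> p : V \<and> t : sec X V \<and> val V t = inv .Q val U s"
   by (metis stalkE sval_germ)
 next
  assume "EX V t. opn X V \<and> p : V \<and> t : sec X V \<and> val V t = inv .Q val U s"
  thus "inv .Q val U s : sval ` carrier (stalk X p)"
   by (metis sval_germ germ_in_stalk image_eqI)
 qed
 thus ?thesis
  using unit_iff_inj[OF stalk_hom[OF p] stalk_cring[OF p] germ_in_stalk[OF assms]] by (simp add: sval_germ[OF assms])
qed

end


text \<open>The structure sheaf of an integral scheme seen from its function field: local rings
  \<open>R p\<close> embedded by \<open>v p\<close>, sections that are one element of
  \<open>Q\<close> read at every point, and a generic point \<open>et\<close>. By
  \<open>nbhd\<close>, regularity at a point spreads to a neighbourhood.\<close>

locale lc_space = field Q for X :: "('p, 'p => 'r) ringed" and R :: "'p => 'r ring"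
  and v :: "'p => 'r => 'q" and Q :: "'q ring" and et +
 assumes eta: "et : pts X" and eta_in: "opn X U ==> U ~= {} ==> et : U"
  and R_cring: "p : pts X ==> cring (R p)"
  and v_inj: "p : pts X ==> inj_hom (R p) Q (v p)"
  and sec_eq: "opn X U ==> sec X U = fun_ring U R
    {s : (\<Pi>\<^sub>E p\<in>U. carrier (R p)). EX q. ALL p:U. v p (s p) = q}"
  and res_eq: "opn X U ==> opn X V ==> V \<subseteq> U ==> res X U V s = restrict s V"
  and nbhd: "p : pts X ==> q : v p ` carrier (R p) ==>
    EX U. opn X U \<and> p : U \<and> (ALL p':U. q : v p' ` carrier (R p'))"
begin

definition lc_val :: "'p set => ('p => 'r) => 'q" where "lc_val U s = v et (s et)"

definition reg :: "'p set => 'q set" where "reg U = {q. ALL p:U. q : v p ` carrier (R p)}"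

definition sect :: "'p set => 'q => 'p => 'r" where
 "sect U q = (\<lambda>p\<in>U. inv_into (carrier (R p)) (v p) q)"

lemma opn_pts: "opn X U ==> p : U ==> p : pts X"
 using openin_subset by blast

lemma sec_carr: "opn X U ==> carrier (sec X U) = {s : (\<Pi>\<^sub>E p\<in>U. carrier (R p)). EX q. ALL p:U. v p (s p) = q}"
 by (simp add: sec_eq)

lemma sec_in: "opn X U ==> s : sec X U ==> p : U ==> s p : R p"
 by (auto simp: sec_carr)

lemma sec_val:
 assumes "opn X U" "s : sec X U" "p : U"
 shows "v p (s p) = lc_val U s"
proof -
 have "et : U" using eta_in assms by blast
 thus ?thesis using assms unfolding sec_carr[OF assms(1)] lc_val_def by auto
qed

lemma lc_val_reg:
 assumes "opn X U" "s : sec X U" shows "lc_val U s : reg U"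
 unfolding reg_def
proof safe
 fix p assume "p : U"
 thus "lc_val U s : v p ` carrier (R p)"
  using sec_val[OF assms] sec_in[OF assms] by (metis image_eqI)
qed

lemma sec_eqI:
 assumes "opn X U" "s : sec X U" "t : sec X U" "U ~= {} ==> lc_val U s = lc_val U t"
 shows "s = t"
proof (rule PiE_ext)
 show "s : (\<Pi>\<^sub>E p\<in>U. carrier (R p))" "t : (\<Pi>\<^sub>E p\<in>U. carrier (R p))" using assms by (auto simp: sec_carr)
 fix p assume p: "p : U"
 hence "v p (s p) = v p (t p)" using sec_val[OF assms(1,2) p] sec_val[OF assms(1,3) p] assms(4) by auto
 thus "s p = t p"
  using inj_homD(6)[OF v_inj[OF opn_pts[OF assms(1) p]]] sec_in[OF assms(1,2) p] sec_in[OF assms(1,3) p] by blast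
qed

lemma v_inv_into:
 assumes "q : v p ` carrier (R p)"
 shows "inv_into (carrier (R p)) (v p) q : R p" "v p (inv_into (carrier (R p)) (v p) q) = q"
 using assms by (auto simp: inv_into_into f_inv_into_f)

lemma inv_into_v:
 assumes "p : pts X" "a : R p"
 shows "inv_into (carrier (R p)) (v p) (v p a) = a"
 using v_inj[OF assms(1)] assms(2) by (simp add: inj_hom_def)

lemma sect_in:
 assumes "opn X U" "q : reg U" shows "sect U q : sec X U" "U ~= {} ==> lc_val U (sect U q) = q"
proof -
 have 1: "!!p. p : U ==> q : v p ` carrier (R p)" using assms(2) by (auto simp: reg_def)
 show "sect U q : sec X U" unfolding sec_carr[OF assms(1)]
  using v_inv_into[OF 1] by (auto simp: sect_def intro!: exI[of _ q])
 show "lc_val U (sect U q) = q" if "U ~= {}"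
  using v_inv_into(2)[OF 1] eta_in[OF assms(1) that] by (simp add: lc_val_def sect_def)
qed

lemma sec_ring:
 assumes U: "opn X U" "U ~= {}"
 shows "cring (sec X U)" "inj_hom (sec X U) Q (lc_val U)"
proof -
 have e: "et : U" using eta_in U by blast
 have const: "(EX q. ALL p:U. w p = q) \<longleftrightarrow> (ALL p:U. ALL p':U. w p = w p')" for w :: "'p => 'q" by metis
 have eq: "{s : (\<Pi>\<^sub>E p\<in>U. carrier (R p)). EX q. ALL p:U. v p (s p) = q} =
   {s : (\<Pi>\<^sub>E p\<in>U. carrier (R p)). ALL p:U. ALL p':U. v p (s p) = v p' (s p')}" unfolding const ..
 note fp = fiber_product[OF is_cring e R_cring[OF opn_pts[OF U(1)]] v_inj[OF opn_pts[OF U(1)]]]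
 show "cring (sec X U)" unfolding sec_eq[OF U(1)] eq by (rule fp(1)) assumption+
 show "inj_hom (sec X U) Q (lc_val U)" unfolding sec_eq[OF U(1)] eq lc_val_def[abs_def] by (rule fp(2)) assumption+
qed

lemmas lc_val_hom = sec_ring(2)

lemma sec_cring: "opn X U ==> cring (sec X U)"
 by (cases "U = {}", simp add: sec_eq fun_ring_empty, rule sec_ring(1))

lemma restrict_in:
 assumes "opn X U" "opn X V" "V \<subseteq> U" "s : sec X U"
 shows "res X U V s : sec X V" "V ~= {} ==> lc_val V (res X U V s) = lc_val U s"
proof -
 show "res X U V s : sec X V"
  using assms unfolding res_eq[OF assms(1-3)] by (auto simp: sec_carr)
 show "V ~= {} ==> lc_val V (res X U V s) = lc_val U s"
  using eta_in[OF assms(2)] unfolding res_eq[OF assms(1-3)] by (simp add: lc_val_def)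
qed

sublocale qs: qspace X Q lc_val
proof (rule qspace.intro[OF field_axioms], rule qspace_axioms.intro)
 show "cring (sec X U)" if "opn X U" for U using sec_cring[OF that] .
 show "inj_hom (sec X U) Q (lc_val U)" if "opn X U" "U ~= {}" for U using lc_val_hom[OF that] .
 show "res X U V s : sec X V \<and> lc_val V (res X U V s) = lc_val U s"
  if "opn X U" "opn X V" "V \<subseteq> U" "V ~= {}" "s : sec X U" for U V s
  using restrict_in[OF that(1-3,5)] that(4) by blast
qed

lemma is_ringed: "ringed_space X"
proof -
 have eq: "s = t" if "opn X U" "s : sec X U" "t : sec X U" "!!p. p : U ==> s p = t p" for U s t
  using sec_eqI[OF that(1-3)] that(4) eta_in[OF that(1)] by (simp add: lc_val_def)
 have union: "opn X (\<Union>\<U>)" if "ALL U:\<U>. opn X U" for \<U> using that by (intro openin_Union) auto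
 show ?thesis unfolding ringed_space_def
 proof (intro conjI allI impI)
  fix U assume "opn X U" thus "cring (sec X U)" by (rule sec_cring)
 next
  fix U V assume UV: "opn X U \<and> opn X V \<and> V \<subseteq> U"
  hence UV': "opn X U" "opn X V" "V \<subseteq> U" by auto
  have "!!p. p : V ==> p : U" using UV by auto
  thus "res X U V : ring_hom (sec X U) (sec X V)"
   using restrict_in(1)[OF UV']
   by (intro ring_hom_memI) (simp_all add: sec_eq[OF UV'(1)] sec_eq[OF UV'(2)] res_eq[OF UV'],
     auto simp: restrict_def fun_eq_iff)
 next
  fix U assume U: "opn X U"
  thus "ALL s:sec X U. res X U U s = s"
   by (auto simp: res_eq sec_carr restrict_def PiE_def extensional_def fun_eq_iff)
 next
  fix U V W assume U: "opn X U \<and> opn X V \<and> opn X W \<and> W \<subseteq> V \<and> V \<subseteq> U"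
  hence "W \<subseteq> U" by auto
  thus "ALL s:sec X U. res X V W (res X U V s) = res X U W s"
   using U by (auto simp: res_eq restrict_def fun_eq_iff)
 next
  fix \<U> assume U: "ALL U:\<U>. opn X U"
  show "ALL s:(sec X (\<Union>\<U>)). ALL t:(sec X (\<Union>\<U>)).
      (ALL U:\<U>. res X (\<Union>\<U>) U s = res X (\<Union>\<U>) U t) --> s = t"
  proof (intro ballI impI)
   fix s t assume st: "s : (sec X (\<Union>\<U>))" "t : (sec X (\<Union>\<U>))"
    and e: "ALL U:\<U>. res X (\<Union>\<U>) U s = res X (\<Union>\<U>) U t"
   show "s = t"
   proof (rule eq[OF union[OF U] st])
    fix p assume "p : \<Union>\<U>"
    then obtain V where V: "V : \<U>" "p : V" by auto
    hence "restrict s V = restrict t V" using e U res_eq[OF union[OF U], of V] by (metis Union_upper)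
    thus "s p = t p" using V by (metis restrict_apply')
   qed
  qed
 next
  fix \<U> f assume "(ALL U:\<U>. opn X U \<and> f U : sec X U) \<and>
    (ALL U:\<U>. ALL V:\<U>. res X U (U \<inter> V) (f U) = res X V (U \<inter> V) (f V))"
  hence U: "!!U. U : \<U> ==> opn X U" "!!U. U : \<U> ==> f U : sec X U"
   and c: "!!U V. U : \<U> ==> V : \<U> ==> res X U (U \<inter> V) (f U) = res X V (U \<inter> V) (f V)" by auto
  have un: "opn X (\<Union>\<U>)" using union U by blast
  show "EX s:(sec X (\<Union>\<U>)). ALL U:\<U>. res X (\<Union>\<U>) U s = f U"
  proof (cases "EX U:\<U>. U ~= {}")
   \<comment> \<open>All members are empty, so any section over the union will do; the comparison
     takes place over the empty set.\<close>
   case False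
   let ?s = "\<zero>.(sec X (\<Union>\<U>))"
   interpret C: cring "sec X (\<Union>\<U>)" using sec_cring[OF un] .
   have "res X (\<Union>\<U>) U ?s = f U" if "U : \<U>" for U
    using that U False un by (intro sec_eqI[of U]) (auto intro!: restrict_in(1))
   thus ?thesis by blast
  next
   case True
   then obtain U0 where U0: "U0 : \<U>" "U0 ~= {}" by auto
   let ?q = "lc_val U0 (f U0)"
   \<comment> \<open>Any two nonempty members meet, since both contain \<open>et\<close>. Hence all
     of them carry the same value, and this value defines the glued section.\<close>
   have val: "lc_val U (f U) = ?q" if "U : \<U>" "U ~= {}" for U
   proof -
    have o: "opn X (U \<inter> U0)" using U that U0 by auto
    have e: "et : U \<inter> U0" using eta_in U that U0 by auto
    have "lc_val (U \<inter> U0) (res X U (U \<inter> U0) (f U)) = lc_val (U \<inter> U0) (res X U0 (U \<inter> U0) (f U0))"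
     using c that U0 by simp
    moreover have "U \<inter> U0 ~= {}" using e by blast
    ultimately show ?thesis using restrict_in(2)[OF U(1)[OF that(1)] o _ U(2)[OF that(1)]]
      restrict_in(2)[OF U(1)[OF U0(1)] o _ U(2)[OF U0(1)]] by auto
   qed
   have reg: "?q : reg (\<Union>\<U>)" unfolding reg_def
   proof safe
    fix p V assume "p : V" "V : \<U>"
    thus "?q : v p ` carrier (R p)" using lc_val_reg[OF U(1,2)] val by (fastforce simp: reg_def)
   qed
   have "res X (\<Union>\<U>) U (sect (\<Union>\<U>) ?q) = f U" if "U : \<U>" for U
   proof (rule sec_eqI[OF U(1)[OF that]])
    have s: "U \<subseteq> \<Union>\<U>" using that by auto
    note r = restrict_in[OF un U(1)[OF that] s sect_in(1)[OF un reg]]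
    show "res X (\<Union>\<U>) U (sect (\<Union>\<U>) ?q) \<in> sec X U" using r by simp
    assume "U ~= {}"
    thus "lc_val U (res X (\<Union>\<U>) U (sect (\<Union>\<U>) ?q)) = lc_val U (f U)"
     using r(2) sect_in(2)[OF un reg] that val s by auto
   qed (use U that in auto)
   thus ?thesis using sect_in(1)[OF un reg] by blast
  qed
 qed
qed

lemma stalk_image:
 assumes "p : pts X"
 shows "qs.sval ` carrier (stalk X p) = v p ` carrier (R p)"
proof safe
 fix F assume "F : stalk X p"
 then obtain U s where "opn X U" "p : U" "s : sec X U" "F = germ X p U s" by (rule qs.stalkE)
 thus "qs.sval F : v p ` carrier (R p)" using lc_val_reg by (auto simp: qs.sval_germ reg_def)
next
 fix a assume "a : R p"
 then obtain U where U: "opn X U" "p : U" "v p a : reg U" using nbhd[OF assms, of "v p a"] by (auto simp: reg_def)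
 hence "U ~= {}" by auto
 thus "v p a : qs.sval ` carrier (stalk X p)"
  using U sect_in[OF U(1,3)] by (intro image_eqI[of _ _ "germ X p U (sect U (v p a))"])
   (auto simp: qs.sval_germ intro: qs.germ_in_stalk)
qed

lemma unit_iff:
 assumes "opn X U" "p : U" "s : sec X U"
 shows "germ X p U s : Units (stalk X p) \<longleftrightarrow> lc_val U s ~= \<zero>.Q \<and> inv .Q (lc_val U s) : v p ` carrier (R p)"
 using unit_iff_inj[OF qs.stalk_hom qs.stalk_cring qs.germ_in_stalk[OF assms]] opn_pts[OF assms(1,2)]
  stalk_image[OF opn_pts[OF assms(1,2)]] by (simp add: qs.sval_germ[OF assms])

end

text \<open>The nonunits then form an ideal, and a proper ideal contains no unit, so this ideal
  contains all the others.\<close>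

lemma local_ringI:
 fixes R :: "('a, 'm) ring_scheme" (structure)
 assumes "cring R" "\<one>.R ~= \<zero>.R"
  and add: "!!a b. a : carrier R - Units R ==> b : carrier R - Units R ==> a \<oplus>.R b ~: Units R"
 shows "local_ring R"
proof -
 interpret cring R by fact
 let ?M = "carrier R - Units R"
 have mu: "a : Units R" if ab: "a : R" "b : R" "a \<otimes> b : Units R" for a b
 proof -
  obtain c where c: "c : R" "(a \<otimes> b) \<otimes> c = \<one>" using Units_r_inv_ex[OF ab(3)] by blast
  have "a \<otimes> (b \<otimes> c) = \<one>" "(b \<otimes> c) \<otimes> a = \<one>" using c ab(1,2) by (simp add: m_assoc, metis m_assoc m_comm m_closed)
  moreover have "b \<otimes> c : R" using c ab(2) by simp
  ultimately show ?thesis using ab(1) by (auto simp: Units_def)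
 qed
 have z: "\<zero> ~: Units R" using assms(2) by (metis Units_r_inv_ex l_null)
 have M: "ideal ?M R"
 proof (rule idealI')
  show "y \<otimes> a : ?M" if "a : ?M" "y : R" for a y using mu[of a y] m_comm[of a y] that by auto
 qed (use z add in auto)
 have sub: "I \<subseteq> ?M" if "ideal I R" "I ~= carrier R" for I
 proof
  fix a assume a: "a : I"
  interpret I: ideal I R by fact
  have "a ~: Units R"
  proof
   assume "a : Units R"
   hence "\<one> : I" using a I.I_r_closed[OF a] by (metis Units_inv_closed Units_r_inv)
   thus False using I.one_imp_carrier that by blast
  qed
  thus "a : ?M" using a I.Icarr by auto
 qed
 have max: "maximalideal ?M R"
 proof (rule maximalidealI[OF M])
  show "carrier R ~= ?M" by auto
  fix J assume J: "ideal J R" "?M \<subseteq> J" "J \<subseteq> R"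
  show "J = ?M \<or> J = carrier R" using sub[OF J(1)] J(2) by blast
 qed
 show ?thesis unfolding local_ring_def
 proof (intro conjI ex1I[of _ ?M])
  show "N = ?M" if N: "maximalideal N R" for N
  proof -
   have "N \<subseteq> ?M" using sub[OF maximalideal.axioms(1)[OF N]] maximalideal.I_notcarr[OF N] by blast
   thus ?thesis using maximalideal.I_maximal[OF N M] maximalideal.I_notcarr[OF max] by blast
  qed
 qed (use max is_cring in auto)
qed

text \<open>Pulling back means keeping the value in \<open>Q\<close>; the inverse of
  \<open>v p\<close> finds the element of the local ring at \<open>p\<close> that has the value at
  the image point.\<close>

definition lc_pull where
 "lc_pull X R v v' f = (\<lambda>U s. \<lambda>p\<in>{p : pts X. f p : U}. inv_into (carrier (R p)) (v p) (v' (f p) (s (f p))))"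

section \<open>Maps that preserve the local rings inside the field\<close>

locale lc_pair = X: lc_space X R v Q et + Y: lc_space Y R' v' Q et'
 for X :: "('p, 'p => 'r) ringed" and R v and Q :: "'q ring" and et
  and Y :: "('p2, 'p2 => 'r2) ringed" and R' v' et' +
 fixes f :: "'p => 'p2"
 assumes cont: "continuous_map (tsp X) (tsp Y) f"
  and img: "p : pts X ==> v' (f p) ` carrier (R' (f p)) = v p ` carrier (R p)"
begin

definition F where "F = \<lparr>pt = f, pull = lc_pull X R v v' f\<rparr>"

lemma F_pull: "pull F U s = (\<lambda>p\<in>{p : pts X. f p : U}. inv_into (carrier (R p)) (v p) (v' (f p) (s (f p))))"
 by (simp add: F_def lc_pull_def)

lemma preF: "pre X F U = {p : pts X. f p : U}" by (simp add: pre_def F_def)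

lemma pre_opn: "opn Y U ==> opn X (pre X F U)"
 using cont by (simp add: continuous_map_def preF)

lemma pull_eq_sect:
 assumes "opn Y U" "s : sec Y U"
 shows "pull F U s = X.sect (pre X F U) (Y.lc_val U s)"
 unfolding F_pull X.sect_def preF using Y.sec_val[OF assms] by (auto simp: fun_eq_iff)

lemma pull_in:
 assumes U: "opn Y U" and s: "s : sec Y U"
 shows "pull F U s : sec X (pre X F U)"
  "pre X F U ~= {} ==> X.lc_val (pre X F U) (pull F U s) = Y.lc_val U s"
proof -
 have "Y.lc_val U s : X.reg (pre X F U)"
  using Y.lc_val_reg[OF assms] unfolding X.reg_def Y.reg_def preF by (simp add: img[symmetric])
 thus "pull F U s : sec X (pre X F U)"
  "pre X F U ~= {} ==> X.lc_val (pre X F U) (pull F U s) = Y.lc_val U s"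
  using X.sect_in[OF pre_opn[OF U]] by (simp_all add: pull_eq_sect[OF assms])
qed

text \<open>Every clause is checked on values, which \<open>F\<close> preserves. Locality holds
  because a unit is a nonzero value whose inverse lies in the local ring, and the local rings at a
  point and at its image are equal.\<close>

lemma is_mor_F: "is_mor X Y F"
 unfolding is_mor_def
proof (intro conjI allI impI ballI)
 show "continuous_map (tsp X) (tsp Y) (pt F)" using cont by (simp add: F_def)
next
 fix U assume U: "opn Y U"
 interpret YU: cring "sec Y U" using Y.sec_cring[OF U] .
 interpret XU: cring "sec X (pre X F U)" using X.sec_cring[OF pre_opn[OF U]] .
 note xh = inj_homD[OF X.lc_val_hom[OF pre_opn[OF U]]] and yh = inj_homD[OF Y.lc_val_hom[OF U]]
 have nU: "U ~= {}" if "pre X F U ~= {}" using that by (auto simp: preF)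
 note p = pull_in[OF U] and eqI = X.sec_eqI[OF pre_opn[OF U]]
 show "pull F U : ring_hom (sec Y U) (sec X (pre X F U))"
  by (rule ring_hom_memI; (rule eqI)?) (use nU in \<open>simp_all add: p xh(3,4,5) yh(3,4,5)\<close>)
next
 fix U V s assume UV: "opn Y U \<and> opn Y V \<and> V \<subseteq> U" and s: "s : sec Y U"
 hence UV': "opn Y U" "opn Y V" "V \<subseteq> U" by auto
 have sub: "pre X F V \<subseteq> pre X F U" using UV by (auto simp: preF)
 note oU = pre_opn[OF UV'(1)] and oV = pre_opn[OF UV'(2)]
 note r = Y.restrict_in[OF UV' s] and r' = X.restrict_in[OF oU oV sub pull_in(1)[OF UV'(1) s]]
 show "res X (pre X F U) (pre X F V) (pull F U s) = pull F V (res Y U V s)"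
 proof (rule X.sec_eqI[OF oV])
  assume ne: "pre X F V ~= {}"
  hence "V ~= {}" "pre X F U ~= {}" using sub by (auto simp: preF)
  thus "X.lc_val (pre X F V) (res X (pre X F U) (pre X F V) (pull F U s)) = X.lc_val (pre X F V) (pull F V (res Y U V s))"
   using ne r r' pull_in[OF UV'(1) s] pull_in[OF UV'(2) r(1)] by simp
 qed (use r r' pull_in[OF UV'(2) r(1)] in auto)
next
 fix p U s assume p: "p : pts X" and U: "opn Y U \<and> pt F p : U" and s: "s : sec Y U"
  and u: "germ X p (pre X F U) (pull F U s) : Units (stalk X p)"
 have U': "opn Y U" "f p : U" using U by (auto simp: F_def)
 have pU: "p : pre X F U" using U' p by (simp add: preF)
 hence ne: "pre X F U ~= {}" by auto
 show "germ Y (pt F p) U s : Units (stalk Y (pt F p))"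
  using u X.unit_iff[OF pre_opn[OF U'(1)] pU pull_in(1)[OF U'(1) s]] Y.unit_iff[OF U' s] img[OF p]
   pull_in(2)[OF U'(1) s ne] by (simp add: F_def)
qed

end

lemma (in lc_pair) pair_inverse:
 assumes "lc_pair Y R' v' Q et' X R v et g" and gf: "!!p. p : pts X ==> g (f p) = p"
 shows "mor_eq X X (mor_comp Y (lc_pair.F Y R' v' v g) F) id_mor"
proof -
 interpret YX: lc_pair Y R' v' Q et' X R v et g by fact
 show ?thesis unfolding mor_eq_def
 proof (intro conjI ballI allI impI)
  show "pt (mor_comp Y YX.F F) p = pt id_mor p" if "p : pts X" for p
   using gf that by (simp add: mor_comp_def F_def YX.F_def id_mor_def)
  fix U s assume U: "opn X U" and s: "s : sec X U"
  note o = YX.pre_opn[OF U] and a = YX.pull_in[OF U s]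
  have e: "pre X F (pre Y YX.F U) = U"
   using openin_subset[OF U] gf continuous_map_image_subset_topspace[OF cont] by (auto simp: preF YX.preF)
  have ne: "U ~= {} ==> pre Y YX.F U ~= {}" using e by (auto simp: preF YX.preF)
  have "pull F (pre Y YX.F U) (pull YX.F U s) = s"
  proof (rule X.sec_eqI[OF U])
   show "pull F (pre Y YX.F U) (pull YX.F U s) : sec X U" using pull_in(1)[OF o a(1)] e by simp
   assume "U ~= {}"
   thus "X.lc_val U (pull F (pre Y YX.F U) (pull YX.F U s)) = X.lc_val U s"
    using pull_in(2)[OF o a(1)] e a(2) ne by simp
  qed fact
  thus "pull (mor_comp Y YX.F F) U s = pull id_mor U s" by (simp add: mor_comp_def id_mor_def)
 qed
qed

text \<open>Both composites keep points and values, and a section is determined by its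
  value.\<close>

lemma lc_iso:
 assumes X: "lc_space X R v Q et" and Y: "lc_space Y R' v' Q et'"
  and h: "homeomorphic_map (tsp X) (tsp Y) f"
  and img: "!!p. p : pts X ==> v' (f p) ` carrier (R' (f p)) = v p ` carrier (R p)"
 shows "is_iso X Y \<lparr>pt = f, pull = lc_pull X R v v' f\<rparr>" (is "is_iso X Y ?F")
proof -
 obtain g where hg: "homeomorphic_maps (tsp X) (tsp Y) f g" using h homeomorphic_map_maps by blast
 hence c: "continuous_map (tsp X) (tsp Y) f" "continuous_map (tsp Y) (tsp X) g"
  and gf: "!!p. p : pts X ==> g (f p) = p" and fg: "!!q. q : pts Y ==> f (g q) = q"
  by (auto simp: homeomorphic_maps_def)
 have gp: "!!q. q : pts Y ==> g q : pts X" using c by (auto simp: continuous_map_def)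
 interpret XY: lc_pair X R v Q et Y R' v' et' f
  using X Y c img by (simp add: lc_pair_def lc_pair_axioms_def)
 interpret YX: lc_pair Y R' v' Q et' X R v et g
  using X Y c img[OF gp] fg by (simp add: lc_pair_def lc_pair_axioms_def)
 have FF: "?F = XY.F" by (simp add: XY.F_def)
 show ?thesis unfolding is_iso_def FF
  by (intro conjI exI[of _ YX.F] XY.is_mor_F YX.is_mor_F XY.pair_inverse[OF YX.lc_pair_axioms] YX.pair_inverse[OF XY.lc_pair_axioms] gf fg)
qed


lemma (in field) frac_add:
 assumes [simp]: "a : R" "b : R" "f : R" "g : R" "f ~= \<zero>" "g ~= \<zero>"
 shows "a \<otimes> inv f \<oplus> b \<otimes> inv g = (g \<otimes> a \<oplus> f \<otimes> b) \<otimes> inv (f \<otimes> g)"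
proof -
 have "(a \<otimes> inv f) \<otimes> (f \<otimes> g) = g \<otimes> a" by (simp add: m_assoc) (simp add: m_comm)
 moreover have "(b \<otimes> inv g) \<otimes> (f \<otimes> g) = f \<otimes> b" by (simp add: m_assoc m_comm[of f g]) (simp add: m_comm)
 ultimately have "(a \<otimes> inv f \<oplus> b \<otimes> inv g) \<otimes> (f \<otimes> g) = g \<otimes> a \<oplus> f \<otimes> b" by (simp add: l_distr)
 thus ?thesis by (subst div_eq_iff) auto
qed

context mult_set
begin

text \<open>In contrast to \<open>loc_cring\<close> no field is given here; the result serves to
  construct the fraction field itself. So the axioms are verified on representatives, with 1 as
  multiplier.\<close>

lemma loc_is_cring: "cring (localization R T)"
proof -
 let ?L = "localization R T"
 have C: "EX a s. a : R \<and> s : T \<and> F = fraction R T a s" if "F : ?L" for F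
  using that by (auto simp: loc_carrier)
 have fc: "fraction R T a s : ?L" if "a : R" "s : T" for a s
  using that by (auto simp: loc_carrier)
 have eq: "fraction R T a s = fraction R T b t"
  if "a : R" "b : R" "s : T" "t : T" "t \<otimes> a = s \<otimes> b" for a b s t
  by (rule fraction_eqI[OF that(1-4) T_one]) (simp only: that(5))
 note [simp] = loc_mult loc_add T_mult T_one loc_one loc_zero
 show ?thesis
 proof (rule cringI)
  show "abelian_group ?L"
  proof (rule abelian_groupI)
   fix F G assume "F : ?L" "G : ?L"
   then obtain a s b t where [simp]: "a : R" "s : T" "F = fraction R T a s"
    "b : R" "t : T" "G = fraction R T b t" using C by meson
   show "F \<oplus>.?L G : ?L" by (simp add: fc)
   show "F \<oplus>.?L G = G \<oplus>.?L F"
    by simp (rule eq; simp add: m_comm a_comm)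
  next
   fix F G H assume "F : ?L" "G : ?L" "H : ?L"
   then obtain a s b t c u where [simp]: "a : R" "s : T" "F = fraction R T a s"
    "b : R" "t : T" "G = fraction R T b t" 
    "c : R" "u : T" "H = fraction R T c u" using C by meson
   show "F \<oplus>.?L G \<oplus>.?L H = F \<oplus>.?L (G \<oplus>.?L H)"
    by simp (rule eq; simp add: r_distr m_ac a_ac)
  next
   fix F assume "F : ?L"
   then obtain a s where [simp]: "a : R" "s : T" "F = fraction R T a s" using C by meson
   show "\<zero>.?L \<oplus>.?L F = F" by simp
   show "EX G:?L. G \<oplus>.?L F = \<zero>.?L"
    by (rule bexI[of _ "fraction R T (\<ominus> a) s"]) (simp, rule eq, simp_all add: fc r_minus l_neg)
  qed (simp add: fc)
  show "Group.comm_monoid ?L"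
  proof (rule comm_monoidI)
   fix F G assume "F : ?L" "G : ?L"
   then obtain a s b t where [simp]: "a : R" "s : T" "F = fraction R T a s"
    "b : R" "t : T" "G = fraction R T b t" using C by meson
   show "F \<otimes>.?L G : ?L" by (simp add: fc)
   show "F \<otimes>.?L G = G \<otimes>.?L F" by (simp add: m_comm)
  next
   fix F G H assume "F : ?L" "G : ?L" "H : ?L"
   then obtain a s b t c u where [simp]: "a : R" "s : T" "F = fraction R T a s"
    "b : R" "t : T" "G = fraction R T b t" 
    "c : R" "u : T" "H = fraction R T c u" using C by meson
   show "F \<otimes>.?L G \<otimes>.?L H = F \<otimes>.?L (G \<otimes>.?L H)"
    by (simp add: m_assoc)
  next
   fix F assume "F : ?L"
   then obtain a s where [simp]: "a : R" "s : T" "F = fraction R T a s" using C by meson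
   show "\<one>.?L \<otimes>.?L F = F" by simp
  qed (simp add: fc)
  fix F G H assume "F : ?L" "G : ?L" "H : ?L"
  then obtain a s b t c u where [simp]: "a : R" "s : T" "F = fraction R T a s"
   "b : R" "t : T" "G = fraction R T b t" 
   "c : R" "u : T" "H = fraction R T c u" using C by meson
  show "(F \<oplus>.?L G) \<otimes>.?L H = F \<otimes>.?L H \<oplus>.?L G \<otimes>.?L H"
   by simp (rule eq; simp add: r_distr l_distr m_ac)
 qed
qed

end

lemma (in domain) frac_field:
 defines "L \<equiv> localization R (carrier R - {\<zero>})"
 shows "field L" "inj_hom R L (\<lambda>a. fraction R (carrier R - {\<zero>}) a \<one>)"
proof -
 let ?T = "carrier R - {\<zero>}"
 interpret mult_set R ?T using integral by unfold_locales auto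
 interpret L: cring L unfolding L_def by (rule loc_is_cring)
 have eq: "fraction R ?T a s = fraction R ?T b t \<longleftrightarrow> t \<otimes> a = s \<otimes> b"
  if "a : R" "b : R" "s : ?T" "t : ?T" for a b s t
 proof -
  have "(u \<otimes> (t \<otimes> a) = u \<otimes> (s \<otimes> b)) = (t \<otimes> a = s \<otimes> b)" if "u : ?T" for u
   using that \<open>s : ?T\<close> \<open>t : ?T\<close> \<open>a : R\<close> \<open>b : R\<close>
   by (intro m_lcancel) auto
  thus ?thesis unfolding fraction_eq_iff[OF that] using T_one by blast
 qed
 have ne: "\<one>.L ~= \<zero>.L" unfolding L_def loc_one loc_zero using T_one by (subst eq) auto
 show "field L"
 proof (rule L.cring_fieldI2[OF ne[symmetric]])
  fix F assume F: "F : L" "F ~= \<zero>.L"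
  then obtain a s where as: "a : R" "s : ?T" "F = fraction R ?T a s" by (auto simp: L_def loc_carrier)
  have a: "a : ?T" using F(2) as T_one unfolding L_def loc_zero by (auto simp: eq)
  show "EX G:L. F \<otimes>.L G = \<one>.L"
  proof (rule bexI[of _ "fraction R ?T s a"])
   show "fraction R ?T s a : L" using a as by (auto simp: L_def loc_carrier)
   have "fraction R ?T (a \<otimes> s) (s \<otimes> a) = fraction R ?T \<one> \<one>"
    using a as T_one T_mult[of s a] by (subst eq) (auto simp: m_comm)
   thus "F \<otimes>.L fraction R ?T s a = \<one>.L"
    unfolding as(3) L_def loc_one using loc_mult[of a s s a] a as by auto
  qed
 qed
 show "inj_hom R L (\<lambda>a. fraction R ?T a \<one>)" unfolding inj_hom_def
 proof
  have [simp]: "\<one> : ?T" using T_one .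
  show "(\<lambda>a. fraction R ?T a \<one>) : ring_hom R L"
  proof (rule ring_hom_memI)
   fix a assume "a : R"
   thus "fraction R ?T a \<one> : L" unfolding L_def loc_carrier using T_one by blast
  qed (auto simp: L_def loc_mult loc_add loc_one)
  show "inj_on (\<lambda>a. fraction R ?T a \<one>) (carrier R)"
   by (rule inj_onI) (simp add: eq T_one)
 qed
qed

declare (in mult_set) T_carr [simp del]


section \<open>The spectrum of a domain\<close>

text \<open>By primality the intersection of two basic sets is the basic set of the product, so the
  generating family is a base.\<close>

lemma (in cring) zariski_open:
 "openin (zariski R) U \<longleftrightarrow> U \<subseteq> {P. primeideal P R} \<and>
   (ALL P:U. EX a:R. a ~: P \<and> {Q. primeideal Q R \<and> a ~: Q} \<subseteq> U)" (is "_ \<longleftrightarrow> ?B U")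
proof
 let ?G = "{{P. primeideal P R \<and> a ~: P} | a. a : R}"
 assume "openin (zariski R) U"
 hence "generate_topology_on ?G U" unfolding zariski_def openin_topology_generated_by_iff .
 thus "?B U"
 proof (induction rule: generate_topology_on.induct)
  case (Int V W)
  have "EX c:R. c ~: P \<and> {Q. primeideal Q R \<and> c ~: Q} \<subseteq> V \<inter> W" if P: "P : V \<inter> W" for P
  proof -
   have pP: "primeideal P R" using P Int.IH by auto
   obtain a b where ab: "a : R" "a ~: P" "{Q. primeideal Q R \<and> a ~: Q} \<subseteq> V"
    "b : R" "b ~: P" "{Q. primeideal Q R \<and> b ~: Q} \<subseteq> W" using P Int.IH by (meson IntD1 IntD2)
   thus ?thesis using primeidealD(4)[OF _ ab(1,4)] pP by (intro bexI[of _ "a \<otimes> b"]) auto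
  qed
  thus ?case using Int.IH by auto
 next
  case (UN K)
  have "EX c:R. c ~: P \<and> {Q. primeideal Q R \<and> c ~: Q} \<subseteq> \<Union>K" if "P : \<Union>K" for P
   using that UN.IH by (meson UnionE Union_upper order_trans)
  thus ?case using UN.IH by blast
 next
  case (Basis s)
  thus ?case by auto
 qed simp
next
 assume B: "?B U"
 hence "U = \<Union>{{Q. primeideal Q R \<and> a ~: Q} | a. a : R \<and> {Q. primeideal Q R \<and> a ~: Q} \<subseteq> U}"
  by blast
 moreover have "openin (zariski R) (\<Union>{{Q. primeideal Q R \<and> a ~: Q} | a. a : R \<and> {Q. primeideal Q R \<and> a ~: Q} \<subseteq> U})"
  unfolding zariski_def by (intro openin_Union) (auto intro: topology_generated_by_Basis)
 ultimately show "openin (zariski R) U" by simp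
qed

definition bopen :: "('a, 'm) ring_scheme => 'a => 'a set set" where
 "bopen R a = {P. primeideal P R \<and> a ~: P}"

lemma (in cring) bopen_open: "a : R ==> openin (zariski R) (bopen R a)"
 unfolding zariski_open bopen_def by auto

lemma (in cring) bopen_basis:
 assumes "openin (zariski R) U" "P : U" shows "EX a:R. P : bopen R a \<and> bopen R a \<subseteq> U"
 using assms unfolding zariski_open bopen_def by blast

lemma (in cring) topspace_zariski: "topspace (zariski R) = {P. primeideal P R}"
proof -
 have "bopen R \<one> = {P. primeideal P R}" using primeidealD(1) by (auto simp: bopen_def)
 thus ?thesis using bopen_open[OF one_closed] zariski_open[of "topspace (zariski R)"]
   openin_subset[of "zariski R" "bopen R \<one>"] by auto
qed

lemma Spec_simps[simp]: "tsp (Spec R) = zariski R" by (simp add: Spec_def)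

text \<open>The local ring at \<open>P\<close> as a subset of the field; equality of such subsets
  replaces isomorphism of local rings.\<close>

definition locq :: "('q, 'n) ring_scheme => ('a => 'q) => ('a, 'm) ring_scheme => 'a set => 'q set" where
 "locq Q al R P = {al a \<otimes>.Q inv .Q al f | a f. a : R \<and> f : carrier R - P}"

locale dom_in_field = domain R + Q: field Q for R :: "('a, 'm) ring_scheme" (structure) and Q :: "'q ring" and al +
 assumes al_inj: "inj_hom R Q al"
begin

lemmas al_hom = inj_homD[OF al_inj]
lemmas al_zero = inj_hom_zero[OF al_inj ring_axioms Q.ring_axioms]

lemma lf: "primeideal P R ==> loc_in_field R (carrier R - P) Q al"
 using loc_in_field_prime[OF Q.field_axioms al_inj] .

lemma al_nz: "primeideal P R ==> f : carrier R - P ==> al f ~= \<zero>.Q"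
 using al_zero(2)[of f] primeidealD(3)[of P R] by auto

lemma lval_frac: "primeideal P R ==> a : R ==> f : carrier R - P ==>
  lval Q al (fraction R (carrier R - P) a f) = al a \<otimes>.Q inv .Q al f"
 using loc_in_field.lval_fraction[OF lf] by blast

lemma locq_image: "primeideal P R ==> lval Q al ` carrier (localization R (carrier R - P)) = locq Q al R P"
 using loc_in_field.lval_image[OF lf] unfolding locq_def by blast

lemma zero_prime: "primeideal {\<zero>} R" by (rule zeroprimeideal)

lemma zero_in_open: "openin (zariski R) U ==> U ~= {} ==> {\<zero>} : U"
proof -
 assume U: "openin (zariski R) U" "U ~= {}"
 then obtain P where "P : U" by auto
 then obtain a where a: "a : R" "P : bopen R a" "bopen R a \<subseteq> U" using bopen_basis U by blast
 hence "a ~= \<zero>" using primeidealD(3) by (auto simp: bopen_def)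
 thus "{\<zero>} : U" using a zero_prime by (auto simp: bopen_def)
qed

end

text \<open>Common source of \<open>Spec\<close> and of the relative spectrum: sections are locally
  fractions drawn from an index set \<open>\<Delta>\<close>. Where a given fraction is defined its
  value is the constant \<open>vn / vd\<close>, and every nonempty open piece contains the generic
  point, so a section has one value. Conversely the value at a point is attained by some fraction,
  its domain is open, and injectivity of values forces the section to equal it there.\<close>

lemma loc_space:
 fixes X :: "('p, 'p => ('r \<times> 'r) set) ringed" and B :: "'p => ('r, 'm) ring_scheme" and P :: "'p => 'r set" and num den
 defines "L \<equiv> \<lambda>p. localization (B p) (carrier (B p) - P p)"
  and "fr \<equiv> \<lambda>de p. fraction (B p) (carrier (B p) - P p) (num de p) (den de p)"
 assumes Q: "field Q" and eta: "et : pts X" "!!U. opn X U ==> U ~= {} ==> et : U"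
  and B: "!!p. p : pts X ==> dom_in_field (B p) Q (al p)" and P: "!!p. p : pts X ==> primeideal (P p) (B p)"
  and num: "!!de p. de : \<Delta> ==> p : pts X ==> def de p ==> num de p : B p \<and> al p (num de p) = vn de"
  and den: "!!de p. de : \<Delta> ==> p : pts X ==> def de p ==> den de p : B p \<and> al p (den de p) = vd de"
  and opn: "!!de. de : \<Delta> ==> opn X {p : pts X. def de p \<and> den de p ~: P p}"
  and gen: "!!p a f. p : pts X ==> a : B p ==> f : B p ==> EX de:\<Delta>. def de p \<and> num de p = a \<and> den de p = f"
  and sec: "!!U. opn X U ==> sec X U = fun_ring U L {s : (\<Pi>\<^sub>E p\<in>U. carrier (L p)). ALL p:U. EX W. EX de:\<Delta>. opn X W \<and> p : W \<and> W \<subseteq> U \<and>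
    (ALL p:W. def de p \<and> den de p ~: P p \<and> s p = fr de p)}"
  and res: "!!U V s. res X U V s = restrict s V"
 shows "lc_space X L (\<lambda>p. lval Q (al p)) Q et"
proof -
 let ?D = "\<lambda>de. {p : pts X. def de p \<and> den de p ~: P p}"
 note lf = dom_in_field.lf[OF B P]
 have vf: "fr de p : L p"
  "lval Q (al p) (fr de p) = vn de \<otimes>.Q inv .Q vd de"
  if asm: "de : \<Delta>" "p : pts X" "def de p" "den de p ~: P p" for de p
 proof -
  have nd: "num de p : B p" "den de p : carrier (B p) - P p" "al p (num de p) = vn de" "al p (den de p) = vd de"
   using num[OF asm(1-3)] den[OF asm(1-3)] asm(4) by auto
  show "fr de p : L p"
   unfolding L_def fr_def by (rule loc_in_field.frac_in_loc[OF lf[OF asm(2,2)] nd(1,2)])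
  show "lval Q (al p) (fr de p) = vn de \<otimes>.Q inv .Q vd de"
   using dom_in_field.lval_frac[OF B[OF asm(2)] P[OF asm(2)] nd(1,2)] nd(3,4) by (simp add: fr_def)
 qed
 have ex: "EX de:\<Delta>. def de p \<and> den de p ~: P p \<and> c = fr de p"
  if p: "p : pts X" and c: "c : L p" for p c
 proof -
  obtain a f where af: "a : B p" "f : carrier (B p) - P p" "c = fraction (B p) (carrier (B p) - P p) a f"
   using c unfolding L_def by (rule loc_in_field.loc_carrE[OF lf[OF p p]])
  thus ?thesis using gen[OF p af(1), of f] unfolding fr_def by blast
 qed
 show ?thesis
 proof (rule lc_space.intro[OF Q], rule lc_space_axioms.intro[OF eta _ _ _ res])
 fix p assume p: "p : pts X"
 show "cring (L p)" unfolding L_def by (rule loc_in_field.loc_cring[OF lf[OF p p]])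
 show "inj_hom (L p) Q (lval Q (al p))" unfolding L_def by (rule loc_in_field.lval_inj[OF lf[OF p p]])
 fix q assume "q : lval Q (al p) ` carrier (L p)"
 then obtain c where c: "q = lval Q (al p) c" "c : L p" by (rule imageE)
 from ex[OF p c(2)] obtain de where d: "de : \<Delta>" "def de p" "den de p ~: P p"
  "c = fr de p" by blast
 have "q : lval Q (al p') ` carrier (L p')" if "p' : ?D de" for p'
  using vf[OF d(1), of p'] vf(2)[OF d(1) p d(2,3)] that unfolding c(1) d(4) by (metis (no_types, lifting) image_eqI mem_Collect_eq)
 thus "EX U. opn X U \<and> p : U \<and> (ALL p':U. q : lval Q (al p') ` carrier (L p'))"
  using opn[OF d(1)] p d(2,3) by blast
next
 fix U assume U: "opn X U"
 have Up: "p : pts X" if "p : U" for p using that openin_subset[OF U] by blast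
 have "(ALL p:U. EX W. EX de:\<Delta>. opn X W \<and> p : W \<and> W \<subseteq> U \<and>
    (ALL p:W. def de p \<and> den de p ~: P p \<and> s p = fr de p))
   \<longleftrightarrow> (EX q. ALL p:U. lval Q (al p) (s p) = q)" (is "?l \<longleftrightarrow> ?r") if s: "s : (\<Pi>\<^sub>E p\<in>U. carrier (L p))" for s
 proof
  assume l: ?l
  show ?r
  proof (intro exI ballI)
   fix p assume p: "p : U"
   from bspec[OF l p] obtain W de where W: "opn X W" "p : W" "W \<subseteq> U" "de : \<Delta>" and
    ws: "!!p. p : W ==> def de p \<and> den de p ~: P p \<and> s p = fr de p" by blast
   have v: "lval Q (al p') (s p') = vn de \<otimes>.Q inv .Q vd de" if p': "p' : W" for p'
   proof -
    have "p' : pts X" using p' W(3) Up by blast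
    thus ?thesis using vf(2)[OF W(4), of p'] ws[OF p'] by simp
   qed
   have "et : W" using eta(2)[OF W(1)] W(2) by blast
   thus "lval Q (al p) (s p) = lval Q (al et) (s et)" using v W(2) by simp
  qed
 next
  assume ?r
  then obtain q where q: "!!p. p : U ==> lval Q (al p) (s p) = q" by blast
  show ?l
  proof
   fix p assume p: "p : U"
   from ex[OF Up[OF p] PiE_mem[OF s p]] obtain de where d: "de : \<Delta>" "def de p" "den de p ~: P p"
    "s p = fr de p" by blast
   have qe: "q = vn de \<otimes>.Q inv .Q vd de" using q[OF p] vf(2)[OF d(1) Up[OF p] d(2,3)] d(4) by simp
   have "s p' = fr de p'" if p': "p' : U \<inter> ?D de" for p'
   proof -
    have pp: "p' : U" "p' : pts X" "def de p'" "den de p' ~: P p'" using p' by auto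
    have e: "lval Q (al p') (s p') = lval Q (al p') (fr de p')"
     unfolding vf(2)[OF d(1) pp(2-4)] qe[symmetric] by (rule q[OF pp(1)])
    show ?thesis
     using inj_homD(6)[OF loc_in_field.lval_inj[OF lf[OF pp(2,2)]] PiE_mem[OF s pp(1), unfolded L_def] vf(1)[OF d(1) pp(2-4), unfolded L_def]] e by blast
   qed
   moreover have "opn X (U \<inter> ?D de)" using U opn[OF d(1)] by blast
   moreover have "p : U \<inter> ?D de" using p Up d(2,3) by blast
   ultimately show "EX W. EX de:\<Delta>. opn X W \<and> p : W \<and> W \<subseteq> U \<and>
    (ALL p:W. def de p \<and> den de p ~: P p \<and> s p = fr de p)"
    using d(1) by blast
  qed
 qed
 hence "{s : (\<Pi>\<^sub>E p\<in>U. carrier (L p)). ALL p:U. EX W. EX de:\<Delta>. opn X W \<and> p : W \<and> W \<subseteq> U \<and>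
    (ALL p:W. def de p \<and> den de p ~: P p \<and> s p = fr de p)}
   = {s : (\<Pi>\<^sub>E p\<in>U. carrier (L p)). EX q. ALL p:U. lval Q (al p) (s p) = q}" by blast
 thus "sec X U = fun_ring U L {s : (\<Pi>\<^sub>E p\<in>U. carrier (L p)). EX q. ALL p:U. lval Q (al p) (s p) = q}"
  unfolding sec[OF U] by simp
 qed
qed

context dom_in_field
begin

lemma Spec_lc: "lc_space (Spec R) (\<lambda>P. localization R (carrier R - P)) (\<lambda>P. lval Q al) Q {\<zero>}"
proof (rule loc_space[where \<Delta> = "carrier R \<times> carrier R" and def = "\<lambda>_ _. True" and num = "\<lambda>(a, f) _. a"
   and den = "\<lambda>(a, f) _. f" and vn = "\<lambda>(a, f). al a" and vd = "\<lambda>(a, f). al f"])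
 show "opn (Spec R) {P : pts (Spec R). True \<and> (case de of (a, f) => \<lambda>_. f) P ~: P}" if "de : carrier R \<times> carrier R" for de
  using bopen_open that by (auto simp: topspace_zariski bopen_def)
 show "sec (Spec R) U = fun_ring U (\<lambda>P. localization R (carrier R - P)) {s : (\<Pi>\<^sub>E P\<in>U. carrier (localization R (carrier R - P))).
   ALL P:U. EX W. EX de:carrier R \<times> carrier R. opn (Spec R) W \<and> P : W \<and> W \<subseteq> U \<and> (ALL P:W. True \<and> (case de of (a, f) => \<lambda>_. f) P ~: P \<and>
    s P = fraction R (carrier R - P) ((case de of (a, f) => \<lambda>_. a) P) ((case de of (a, f) => \<lambda>_. f) P))}" for U
  unfolding Spec_def Bex_def split_paired_Ex by (simp add: conj_ac)
qed (use zero_prime zero_in_open dom_in_field_axioms in \<open>auto simp: topspace_zariski Spec_def Q.field_axioms\<close>)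

sublocale sp: lc_space "Spec R" "\<lambda>P. localization R (carrier R - P)" "\<lambda>P. lval Q al" Q "{\<zero>}"
 by (rule Spec_lc)

lemma reg_locq: "openin (zariski R) U ==> q : sp.reg U \<longleftrightarrow> (ALL P:U. q : locq Q al R P)"
 using locq_image zariski_open unfolding sp.reg_def by blast

text \<open>If \<open>b / g\<close> inverts \<open>a / f\<close>, cross-multiplication gives
  \<open>g \<otimes> f = a \<otimes> b\<close> with the left side outside \<open>P\<close>.\<close>

lemma locq_unit:
 assumes P: "primeideal P R" and a: "a : R" and f: "f : carrier R - P"
 shows "al a \<otimes>.Q inv .Q al f ~= \<zero>.Q \<and> inv .Q (al a \<otimes>.Q inv .Q al f) : locq Q al R P \<longleftrightarrow> a ~: P"
proof -
 have fz[simp]: "al f ~= \<zero>.Q" "al f : Q" "al a : Q" "f : R" using al_nz[OF P f] f a al_hom(2) by auto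
 show ?thesis
 proof
  assume as: "al a \<otimes>.Q inv .Q al f ~= \<zero>.Q \<and> inv .Q (al a \<otimes>.Q inv .Q al f) : locq Q al R P"
  then obtain b g where bg: "b : R" "g : carrier R - P"
   "inv .Q (al a \<otimes>.Q inv .Q al f) = al b \<otimes>.Q inv .Q al g" by (auto simp: locq_def)
  have az: "al a ~= \<zero>.Q" using as by auto
  have gz[simp]: "al g ~= \<zero>.Q" "al g : Q" "al b : Q" "g : R" using al_nz[OF P bg(2)] bg al_hom(2) by auto
  have "al f \<otimes>.Q inv .Q al a = al b \<otimes>.Q inv .Q al g"
   using bg(3) az by (simp add: Q.inv_mult Q.inv_inv' Q.m_comm)
  hence "al g \<otimes>.Q al f = al a \<otimes>.Q al b" by (simp add: Q.div_eq_div az)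
  hence "g \<otimes> f = a \<otimes> b" using al_hom(3,6) a bg by (metis fz(4) gz(4) m_closed)
  moreover have "g \<otimes> f ~: P" using primeidealD(4)[OF P, of g f] f bg by auto
  ultimately show "a ~: P" using primeidealD(4)[OF P a bg(1)] by auto
 next
  assume aP: "a ~: P"
  hence az: "al a ~= \<zero>.Q" using al_nz[OF P] a by auto
  moreover have "inv .Q (al a \<otimes>.Q inv .Q al f) = al f \<otimes>.Q inv .Q al a"
   using az by (simp add: Q.inv_mult Q.inv_inv' Q.m_comm)
  moreover have "al f \<otimes>.Q inv .Q al a : locq Q al R P"
   unfolding locq_def using aP a f by (intro CollectI exI[of _ f] exI[of _ a]) simp
  ultimately show "al a \<otimes>.Q inv .Q al f ~= \<zero>.Q \<and> inv .Q (al a \<otimes>.Q inv .Q al f) : locq Q al R P"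
   by simp
 qed
qed

lemma unit_germ:
 assumes "opn (Spec R) U" "P : U" "s : sec (Spec R) U" "a : R" "f : carrier R - P"
  "sp.lc_val U s = al a \<otimes>.Q inv .Q al f"
 shows "germ (Spec R) P U s : Units (stalk (Spec R) P) \<longleftrightarrow> a ~: P"
proof -
 have P: "primeideal P R" using assms(1,2) zariski_open by auto
 show ?thesis using sp.unit_iff[OF assms(1-3)] locq_unit[OF P assms(4,5)] locq_image[OF P] assms(6) by simp
qed

lemma local_stalk:
 assumes "P : pts (Spec R)"
 shows "local_ring (stalk (Spec R) P)"
proof (rule local_ringI)
 have P: "primeideal P R" using assms by (simp add: topspace_zariski)
 interpret S: cring "stalk (Spec R) P" using sp.qs.stalk_cring[OF assms] .
 note h = sp.qs.stalk_hom[OF assms]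
 note h' = inj_homD[OF h]
 show "cring (stalk (Spec R) P)" by (rule S.is_cring)
 show "\<one>.(stalk (Spec R) P) ~= \<zero>.(stalk (Spec R) P)"
  using h'(5) inj_hom_zero(1)[OF h S.ring_axioms Q.ring_axioms] Q.one_not_zero by metis
 have un: "c : Units (stalk (Spec R) P) \<longleftrightarrow> a ~: P"
  if "c : stalk (Spec R) P" "a : R" "f : carrier R - P"
   "sp.qs.sval c = al a \<otimes>.Q inv .Q al f" for c a f
  using Q.unit_iff_inj[OF h S.is_cring that(1)] sp.stalk_image[OF assms] locq_image[OF P]
   locq_unit[OF P that(2,3)] that(4) by simp
 have ex: "EX a:R. EX f:carrier R - P. sp.qs.sval c = al a \<otimes>.Q inv .Q al f"
  if "c : stalk (Spec R) P" for c
  using sp.stalk_image[OF assms] locq_image[OF P] that unfolding locq_def by blast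
 fix c d assume c: "c : carrier (stalk (Spec R) P) - Units (stalk (Spec R) P)"
  and d: "d : carrier (stalk (Spec R) P) - Units (stalk (Spec R) P)"
 obtain a f where af: "a : R" "f : carrier R - P" "sp.qs.sval c = al a \<otimes>.Q inv .Q al f"
  using ex c by blast
 obtain b g where bg: "b : R" "g : carrier R - P" "sp.qs.sval d = al b \<otimes>.Q inv .Q al g"
  using ex d by blast
 have ab: "a : P" "b : P" using un af bg c d by auto
 note [simp] = af(1) bg(1) al_hom(2,3,4) al_nz[OF P af(2)] al_nz[OF P bg(2)]
 have [simp]: "f : R" "g : R" using af bg by auto
 have "sp.qs.sval (c \<oplus>.(stalk (Spec R) P) d) = al (g \<otimes> a \<oplus> f \<otimes> b) \<otimes>.Q inv .Q al (f \<otimes> g)"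
  using h'(4)[of c d] c d by (simp add: af(3) bg(3) Q.frac_add)
 moreover have "f \<otimes> g : carrier R - P" using primeidealD(4)[OF P, of f g] af bg by auto
 moreover have "g \<otimes> a \<oplus> f \<otimes> b : P" using primeidealD(4,5)[OF P] ab by auto
 ultimately show "c \<oplus>.(stalk (Spec R) P) d ~: Units (stalk (Spec R) P)"
  using un[of "c \<oplus>.(stalk (Spec R) P) d" "g \<otimes> a \<oplus> f \<otimes> b" "f \<otimes> g"] c d by auto
qed

lemma Spec_locally_ringed: "locally_ringed_space (Spec R)"
 unfolding locally_ringed_space_def using sp.is_ringed local_stalk by blast

text \<open>The denominators of \<open>q\<close> form an ideal. A prime not containing
  \<open>f\<close> cannot contain this ideal, since \<open>q\<close> is regular there. So
  \<open>f\<close> lies in all primes above the ideal, and some power of \<open>f\<close> is a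
  denominator.\<close>

lemma locq_all:
 assumes q: "q : Q" and f: "f : R" and all: "!!P. P : bopen R f ==> q : locq Q al R P"
 shows "EX a:R. EX m::nat. q \<otimes>.Q al (f [^] m) = al a"
proof -
 let ?J = "{g : R. EX a:R. q \<otimes>.Q al g = al a}"
 note [simp] = al_hom(2,3,4) q
 have JI: "g : ?J" if "g : R" "a : R" "q \<otimes>.Q al g = al a" for g a using that by blast
 have J: "ideal ?J R"
 proof (rule idealI')
  show "\<zero> : ?J" using al_zero(1) JI[of \<zero> \<zero>] by simp
  fix g assume "g : ?J"
  then obtain a where g: "g : R" "a : R" "q \<otimes>.Q al g = al a" by blast
  show "g \<oplus> h : ?J" if hJ: "h : ?J" for h
  proof -
   obtain b where "h : R" "b : R" "q \<otimes>.Q al h = al b" using hJ by blast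
   thus ?thesis using g JI[of "g \<oplus> h" "a \<oplus> b"] by (simp add: Q.r_distr)
  qed
  show "y \<otimes> g : ?J" if y: "y : R" for y
   by (rule JI[of _ "y \<otimes> a"]) (use y g Q.m_lcomm[of q "al y" "al g"] in simp_all)
 qed blast
 have "EX m::nat. f [^] m : ?J"
 proof (rule radical_pow[OF J f], rule ccontr)
  fix P assume P: "primeideal P R" "?J \<subseteq> P" and "f ~: P"
  hence "q : locq Q al R P" using all by (simp add: bopen_def)
  then obtain a g where ag: "a : R" "g : carrier R - P" "q = al a \<otimes>.Q inv .Q al g" by (auto simp: locq_def)
  hence "q \<otimes>.Q al g = al a" using al_nz[OF P(1) ag(2)] by (simp add: Q.m_assoc)
  thus False using ag P(2) by blast
 qed
 thus ?thesis by blast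
qed

lemma reg_all:
 assumes "q : sp.reg (pts (Spec R))" shows "EX a:R. q = al a"
proof -
 have l: "ALL P:pts (Spec R). q : locq Q al R P" using assms reg_locq[of "pts (Spec R)"] by (auto simp: openin_topspace)
 have b: "bopen R \<one> = pts (Spec R)" using primeidealD(1) by (auto simp: bopen_def topspace_zariski)
 have "q : locq Q al R {\<zero>}" using l zero_prime by (simp add: topspace_zariski)
 hence "q : Q" using al_hom(2) al_nz[OF zero_prime] by (auto simp: locq_def)
 from locq_all[OF this one_closed] show ?thesis using l b \<open>q : Q\<close> al_hom(5) by auto
qed

lemma al_in_locq: "primeideal P R ==> a : R ==> al a : locq Q al R P"
 unfolding locq_def using primeidealD(1)[of P R] al_hom(2,5)
 by (intro CollectI exI[of _ a] exI[of _ \<one>]) simp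

lemma al_in_reg: "openin (zariski R) U ==> a : R ==> al a : sp.reg U"
 using reg_locq al_in_locq zariski_open by blast

lemma spec_section_eq: "a : R ==> spec_section R a = sp.sect (pts (Spec R)) (al a)"
proof -
 assume a: "a : R"
 have "fraction R (carrier R - P) a \<one> = inv_into (carrier (localization R (carrier R - P))) (lval Q al) (al a)"
  if P: "primeideal P R" for P
 proof -
  interpret L: loc_in_field R "carrier R - P" Q al using lf[OF P] .
  have o: "\<one> : carrier R - P" using primeidealD(1)[OF P] by simp
  have "lval Q al (fraction R (carrier R - P) a \<one>) = al a"
   using L.lval_fraction[OF a o] al_hom(2,5) a by simp
  thus ?thesis using sp.inv_into_v[of P "fraction R (carrier R - P) a \<one>"] P L.frac_in_loc[OF a o]
   by (simp add: topspace_zariski)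
 qed
 thus ?thesis unfolding spec_section_def sp.sect_def by (auto simp: topspace_zariski fun_eq_iff)
qed

lemma spec_section_in:
 assumes "a : R"
 shows "spec_section R a : sec (Spec R) (pts (Spec R))"
  "sp.lc_val (pts (Spec R)) (spec_section R a) = al a"
proof -
 have n: "pts (Spec R) ~= {}" using zero_prime by (auto simp: topspace_zariski)
 show "spec_section R a : sec (Spec R) (pts (Spec R))"
  "sp.lc_val (pts (Spec R)) (spec_section R a) = al a"
  using sp.sect_in[OF openin_topspace, of "al a"] al_in_reg[OF _ assms] n spec_section_eq[OF assms]
  by (auto simp: openin_topspace)
qed

end


section \<open>Morphisms\<close>

lemma mor_comp_simps[simp]:
 "pt (mor_comp Y g f) p = pt g (pt f p)" "pull (mor_comp Y g f) W s = pull f (pre Y g W) (pull g W s)"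
 by (simp_all add: mor_comp_def)

lemma is_morD:
 assumes "is_mor X Y f"
 shows "continuous_map (tsp X) (tsp Y) (pt f)"
  and "!!U. opn Y U ==> pull f U : ring_hom (sec Y U) (sec X (pre X f U))"
  and "!!U s. opn Y U ==> s : sec Y U ==> pull f U s : sec X (pre X f U)"
  and "!!U V s. opn Y U ==> opn Y V ==> V \<subseteq> U ==> s : sec Y U ==>
      res X (pre X f U) (pre X f V) (pull f U s) = pull f V (res Y U V s)"
  and "!!p U s. p : pts X ==> opn Y U ==> pt f p : U ==> s : sec Y U ==>
      germ X p (pre X f U) (pull f U s) : Units (stalk X p) ==>
      germ Y (pt f p) U s : Units (stalk Y (pt f p))"
  and "!!p. p : pts X ==> pt f p : pts Y"
  and "!!U. opn Y U ==> opn X (pre X f U)"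
 using assms by (auto simp: is_mor_def ring_hom_def continuous_map_def pre_def)

lemma pre_comp:
 assumes "is_mor X Y f" shows "pre X (mor_comp Y g f) U = pre X f (pre Y g U)"
 using is_morD(6)[OF assms] by (auto simp: pre_def)

lemma is_mor_comp:
 assumes f: "is_mor X Y f" and g: "is_mor Y Z g"
 shows "is_mor X Z (mor_comp Y g f)"
 unfolding is_mor_def
proof (intro conjI allI impI ballI)
 show "continuous_map (tsp X) (tsp Z) (pt (mor_comp Y g f))"
  using continuous_map_compose[OF is_morD(1)[OF f] is_morD(1)[OF g]] by (simp add: comp_def mor_comp_def)
 fix U assume U: "opn Z U"
 show "pull (mor_comp Y g f) U : ring_hom (sec Z U) (sec X (pre X (mor_comp Y g f) U))"
 proof -
  have "pull (mor_comp Y g f) U = pull f (pre Y g U) \<circ> pull g U" by (simp add: fun_eq_iff)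
  thus ?thesis
   using ring_hom_trans[OF is_morD(2)[OF g U] is_morD(2)[OF f is_morD(7)[OF g U]]] by (simp add: pre_comp[OF f])
 qed
next
 fix U V s assume "opn Z U \<and> opn Z V \<and> V \<subseteq> U" and s: "s : sec Z U"
 hence UV: "opn Z U" "opn Z V" "V \<subseteq> U" by auto
 have sub: "pre Y g V \<subseteq> pre Y g U" using UV by (auto simp: pre_def)
 show "res X (pre X (mor_comp Y g f) U) (pre X (mor_comp Y g f) V) (pull (mor_comp Y g f) U s)
   = pull (mor_comp Y g f) V (res Z U V s)"
  using is_morD(4)[OF f is_morD(7)[OF g UV(1)] is_morD(7)[OF g UV(2)] sub is_morD(3)[OF g UV(1) s]]
   is_morD(4)[OF g UV s] by (simp add: pre_comp[OF f])
next
 fix p U s assume p: "p : pts X" and "opn Z U \<and> pt (mor_comp Y g f) p : U" and s: "s : sec Z U"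
  and u: "germ X p (pre X (mor_comp Y g f) U) (pull (mor_comp Y g f) U s) : Units (stalk X p)"
 hence U: "opn Z U" "pt g (pt f p) : U" by auto
 note fp = is_morD(6)[OF f p]
 have m: "pt f p : pre Y g U" using fp U by (simp add: pre_def)
 have "germ Y (pt f p) (pre Y g U) (pull g U s) : Units (stalk Y (pt f p))"
  using is_morD(5)[OF f p is_morD(7)[OF g U(1)] m is_morD(3)[OF g U(1) s]] u by (simp add: pre_comp[OF f])
 thus "germ Z (pt (mor_comp Y g f) p) U s : Units (stalk Z (pt (mor_comp Y g f) p))"
  using is_morD(5)[OF g fp U s] by simp
qed

text \<open>\<open>is_iso\<close> hides the inverse behind a quantifier, but its pullback is what
  carries sections of a scheme to sections of a spectrum.\<close>

definition inv_pair where
 "inv_pair X Y f g \<longleftrightarrow> is_mor X Y f \<and> is_mor Y X g \<and> mor_eq X X (mor_comp Y g f) id_mor \<and> mor_eq Y Y (mor_comp X f g) id_mor"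

lemma inv_pair_iso: "is_iso X Y f \<longleftrightarrow> (EX g. inv_pair X Y f g)"
 by (auto simp: is_iso_def inv_pair_def)

lemma inv_pair_sym: "inv_pair X Y f g ==> inv_pair Y X g f"
 by (auto simp: inv_pair_def)

lemma inv_pairD:
 assumes "inv_pair X Y f g"
 shows "is_mor X Y f" "is_mor Y X g"
  "!!p. p : pts X ==> pt g (pt f p) = p"
  "!!U s. opn X U ==> s : sec X U ==> pull f (pre Y g U) (pull g U s) = s"
  "!!U. opn X U ==> pre X f (pre Y g U) = U"
proof -
 show m: "is_mor X Y f" "is_mor Y X g" using assms by (auto simp: inv_pair_def)
 show p: "!!p. p : pts X ==> pt g (pt f p) = p"
  and "!!U s. opn X U ==> s : sec X U ==> pull f (pre Y g U) (pull g U s) = s"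
  using assms by (auto simp: inv_pair_def mor_eq_def id_mor_def)
 show "pre X f (pre Y g U) = U" if "opn X U" for U
  using p is_morD(6)[OF m(1)] openin_subset[OF that] by (auto simp: pre_def)
qed

lemma inv_pair_comp:
 assumes f: "inv_pair X Y f f'" and g: "inv_pair Y Z g g'"
 shows "inv_pair X Z (mor_comp Y g f) (mor_comp Y f' g')"
proof -
 have half: "mor_eq X X (mor_comp Z (mor_comp Y f' g') (mor_comp Y g f)) id_mor"
  if f: "inv_pair X Y f f'" and g: "inv_pair Y Z g g'" for X Y Z f f' g g'
  unfolding mor_eq_def
 proof (intro conjI ballI allI impI)
  note fD = inv_pairD[OF f] and gD = inv_pairD[OF g]
  fix p assume "p : pts X"
  thus "pt (mor_comp Z (mor_comp Y f' g') (mor_comp Y g f)) p = pt id_mor p"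
   using fD(3) gD(3)[OF is_morD(6)[OF fD(1)]] by (simp add: id_mor_def)
 next
  note fD = inv_pairD[OF f] and gD = inv_pairD[OF g]
  fix U s assume U: "opn X U" and s: "s : sec X U"
  note oU = is_morD(7)[OF fD(2) U]
  show "pull (mor_comp Z (mor_comp Y f' g') (mor_comp Y g f)) U s = pull id_mor U s"
   using gD(4)[OF oU is_morD(3)[OF fD(2) U s]] gD(5)[OF oU] fD(4)[OF U s]
   by (simp add: pre_comp[OF gD(2)] id_mor_def)
 qed
 note fD = inv_pairD[OF f] and gD = inv_pairD[OF g]
 show ?thesis unfolding inv_pair_def
  using is_mor_comp[OF fD(1) gD(1)] is_mor_comp[OF gD(2) fD(2)] half[OF f g]
   half[OF inv_pair_sym[OF g] inv_pair_sym[OF f]] by blast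
qed

lemma inv_pair_pull:
 assumes "inv_pair X Y f g" "opn Y U"
 shows "pull f U : ring_hom (sec Y U) (sec X (pre X f U))" "bij_betw (pull f U) (carrier (sec Y U)) (carrier (sec X (pre X f U)))"
proof -
 note D = inv_pairD[OF assms(1)] and D' = inv_pairD[OF inv_pair_sym[OF assms(1)]]
 show "pull f U : ring_hom (sec Y U) (sec X (pre X f U))" using is_morD(2)[OF D(1) assms(2)] .
 have o: "opn X (pre X f U)" using is_morD(7)[OF D(1) assms(2)] .
 show "bij_betw (pull f U) (carrier (sec Y U)) (carrier (sec X (pre X f U)))"
 proof (rule bij_betwI[where g = "pull g (pre X f U)"])
  show "pull f U : (sec Y U) \<rightarrow> carrier (sec X (pre X f U))" using is_morD(3)[OF D(1) assms(2)] by auto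
  show "pull g (pre X f U) : (sec X (pre X f U)) \<rightarrow> carrier (sec Y U)"
   using is_morD(3)[OF D(2) o] D'(5)[OF assms(2)] by auto
  show "pull g (pre X f U) (pull f U s) = s" if "s : sec Y U" for s using D'(4)[OF assms(2) that] .
  show "pull f U (pull g (pre X f U) s) = s" if "s : sec X (pre X f U)" for s
   using D(4)[OF o that] D'(5)[OF assms(2)] by simp
 qed
qed

lemma inv_pair_homeo:
 assumes "inv_pair X Y f g" shows "homeomorphic_maps (tsp X) (tsp Y) (pt f) (pt g)"
 unfolding homeomorphic_maps_def
 using inv_pairD(3)[OF assms] inv_pairD(3)[OF inv_pair_sym[OF assms]]
  is_morD(1)[OF inv_pairD(1)[OF assms]] is_morD(1)[OF inv_pairD(2)[OF assms]] by auto

lemma prime_preimage: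
 assumes "cring R" "cring R'" "h : ring_hom R R'" "primeideal P R'"
 shows "primeideal {a : R. h a : P} R"
proof -
 interpret h: ring_hom_ring R R' h
  by (rule ring_hom_ringI2[OF cring.axioms(1)[OF assms(1)] cring.axioms(1)[OF assms(2)] assms(3)])
 show ?thesis using h.primeideal_vimage[OF assms(1,4)] .
qed

lemma spec_pt_cont:
 assumes "cring R" "cring R'" "h : ring_hom R R'"
 shows "continuous_map (zariski R') (zariski R) (\<lambda>P. {a : R. h a : P})"
 unfolding continuous_map_def
proof (intro conjI allI impI)
 interpret R: cring R by fact
 interpret R': cring R' by fact
 have hc: "!!a. a : R ==> h a : R'" using assms(3) by (auto simp: ring_hom_def)
 show "(\<lambda>P. {a : R. h a : P}) : topspace (zariski R') \<rightarrow> topspace (zariski R)"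
  using prime_preimage[OF assms] by (auto simp: R.topspace_zariski R'.topspace_zariski)
 fix U assume U: "openin (zariski R) U"
 show "openin (zariski R') {P : topspace (zariski R'). {a : R. h a : P} : U}"
  unfolding R'.zariski_open R'.topspace_zariski
 proof (intro conjI ballI)
  fix P assume "P : {P : {P. primeideal P R'}. {a : R. h a : P} : U}"
  hence P: "primeideal P R'" "{a : R. h a : P} : U" by auto
  from R.bopen_basis[OF U P(2)] obtain a where a: "a : R" "h a ~: P" "bopen R a \<subseteq> U"
   by (auto simp: bopen_def)
  show "EX b:R'. b ~: P \<and> {Q. primeideal Q R' \<and> b ~: Q} \<subseteq> {P : {P. primeideal P R'}. {a : R. h a : P} : U}"
   using a hc prime_preimage[OF assms] by (intro bexI[of _ "h a"]) (auto simp: bopen_def)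
 qed auto
qed

text \<open>Since \<open>al'\<close> factors through \<open>i\<close>, corresponding local rings are
  the same subset of \<open>Q\<close>, and \<open>lc_iso\<close> applies.\<close>

lemma spec_ring_iso_in_field:
 assumes "dom_in_field D Q al" "dom_in_field D' Q al'" and i: "i : ring_hom D' D" and j: "j : ring_hom D D'"
  and ij: "!!a. a : D ==> i (j a) = a" and ji: "!!b. b : D' ==> j (i b) = b"
  and al': "!!b. b : D' ==> al' b = al (i b)"
 shows "EX F. is_iso (Spec D) (Spec D') F"
proof -
 interpret d: dom_in_field D Q al by fact
 interpret d': dom_in_field D' Q al' by fact
 have ic: "!!b. b : D' ==> i b : D" and jc: "!!a. a : D ==> j a : D'"
  using i j by (auto simp: ring_hom_def)
 let ?f = "\<lambda>P. {b : D'. i b : P}" and ?g = "\<lambda>P. {a : D. j a : P}"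
 have gf: "?g (?f P) = P" if "primeideal P D" for P using primeidealD(2)[OF that] ij jc by auto
 have fg: "?f (?g P) = P" if "primeideal P D'" for P using primeidealD(2)[OF that] ji ic by auto
 have h: "homeomorphic_map (tsp (Spec D)) (tsp (Spec D')) ?f"
 proof (rule homeomorphic_maps_imp_map[where g = ?g])
  show "homeomorphic_maps (tsp (Spec D)) (tsp (Spec D')) ?f ?g"
   unfolding homeomorphic_maps_def Spec_simps d.topspace_zariski d'.topspace_zariski
   using spec_pt_cont[OF d'.is_cring d.is_cring i] spec_pt_cont[OF d.is_cring d'.is_cring j] gf fg by blast
 qed
 have im: "lval Q al' ` carrier (localization D' (carrier D' - ?f P)) = lval Q al ` carrier (localization D (carrier D - P))"
  if "P : pts (Spec D)" for P
 proof -
  have P: "primeideal P D" using that by (simp add: d.topspace_zariski)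
  note P' = prime_preimage[OF d'.is_cring d.is_cring i P]
  have "locq Q al' D' (?f P) \<subseteq> locq Q al D P"
  proof
   fix q assume "q : locq Q al' D' (?f P)"
   then obtain a f where "a : D'" "f : D'" "i f ~: P" "q = al' a \<otimes>.Q inv .Q al' f" by (auto simp: locq_def)
   thus "q : locq Q al D P" unfolding locq_def using ic al'
    by (intro CollectI exI[of _ "i a"] exI[of _ "i f"]) auto
  qed
  moreover have "locq Q al D P \<subseteq> locq Q al' D' (?f P)"
  proof
   fix q assume "q : locq Q al D P"
   then obtain a f where "a : D" "f : D" "f ~: P" "q = al a \<otimes>.Q inv .Q al f" by (auto simp: locq_def)
   thus "q : locq Q al' D' (?f P)" unfolding locq_def using jc al' ij
    by (intro CollectI exI[of _ "j a"] exI[of _ "j f"]) auto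
  qed
  ultimately show ?thesis unfolding d.locq_image[OF P] d'.locq_image[OF P'] by blast
 qed
 show ?thesis using lc_iso[OF d.Spec_lc d'.Spec_lc h im] by blast
qed

lemma (in domain) frac_dom_in_field:
 "dom_in_field R (localization R (carrier R - {\<zero>})) (\<lambda>a. fraction R (carrier R - {\<zero>}) a \<one>)"
 using frac_field domain_axioms by (simp add: dom_in_field_def dom_in_field_axioms_def)

lemma spec_ring_iso:
 assumes "domain D" "domain D'" and i: "i : ring_iso D D'"
 shows "EX F. is_iso (Spec D) (Spec D') F"
proof -
 interpret D: domain D by fact
 interpret D': domain D' by fact
 let ?j = "inv_into (carrier D) i"
 have b: "bij_betw i (carrier D) (carrier D')" and ih: "i : ring_hom D D'" using i by (auto simp: ring_iso_def)
 have j: "?j : ring_iso D' D" by (rule ring_iso_set_sym[OF D.ring_axioms i])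
 hence jj: "inj_hom D' D ?j" by (auto simp: ring_iso_def inj_hom_def bij_betw_def)
 interpret d: dom_in_field D "localization D (carrier D - {\<zero>.D})" "\<lambda>a. fraction D (carrier D - {\<zero>.D}) a \<one>.D"
  by (rule D.frac_dom_in_field)
 have d': "dom_in_field D' (localization D (carrier D - {\<zero>.D})) (\<lambda>b. fraction D (carrier D - {\<zero>.D}) (?j b) \<one>.D)"
  using inj_hom_comp[OF jj d.al_inj] d.Q.field_axioms D'.domain_axioms by (simp add: dom_in_field_def dom_in_field_axioms_def)
 show ?thesis
  by (rule spec_ring_iso_in_field[OF D.frac_dom_in_field d' inj_homD(1)[OF jj] ih])
   (use b in \<open>auto simp: bij_betw_inv_into_left bij_betw_inv_into_right\<close>)
qed

text \<open>\<open>affine_scheme\<close> asks for a ring whose elements have the type of sections,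
  so \<open>A\<close> is copied into that type: \<open>a\<close> becomes the constant function with
  value \<open>{(a, a)}\<close>.\<close>

lemma affine_Spec:
 assumes "domain (A :: 'a ring)" shows "affine_scheme (Spec A)"
proof -
 interpret A: domain A by fact
 interpret d: dom_in_field A "localization A (carrier A - {\<zero>.A})" "\<lambda>a. fraction A (carrier A - {\<zero>.A}) a \<one>.A"
  by (rule A.frac_dom_in_field)
 let ?io = "\<lambda>a (P :: 'a set). {(a, a)}"
 let ?R = "image_ring ?io A"
 have inj: "inj_on ?io (carrier A)" by (rule inj_onI) (auto simp: fun_eq_iff)
 interpret R: domain ?R using A.inj_imp_image_ring_is_domain[OF inj] .
 show ?thesis unfolding affine_scheme_def
  using spec_ring_iso[OF assms R.domain_axioms inj_imp_image_ring_iso[OF inj]]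
   d.Spec_locally_ringed R.is_cring by blast
qed

lemma (in cring) annihilator_ideal: "a : R ==> ideal {u : R. u \<otimes> a = \<zero>} R"
 by (rule idealI') (auto simp: l_distr m_assoc)

text \<open>A ring embeds into the global sections of its spectrum, and here these form a domain.
  Injectivity: if \<open>a / 1\<close> vanishes at every prime, the annihilator of \<open>a\<close>
  lies in no prime and so contains 1. There is no ambient field yet, hence the computation with
  fractions.\<close>

lemma domain_of_iso_Spec:
 assumes B: "cring B" and F: "is_iso S (Spec B) F" and dom: "domain (sec S (pts S))"
 shows "domain B"
proof -
 interpret B: cring B by fact
 interpret D: domain "sec S (pts S)" by fact
 let ?X = "{P. primeideal P B}" and ?s = "spec_section B"
 obtain G where FG: "inv_pair S (Spec B) F G" using F inv_pair_iso by blast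
 have oX: "opn (Spec B) ?X" using openin_topspace[of "zariski B"] by (simp add: B.topspace_zariski)
 have pX: "pre S F ?X = pts S" using is_morD(6)[OF inv_pairD(1)[OF FG]] by (auto simp: pre_def B.topspace_zariski)
 note ph = inv_pair_pull(1)[OF FG oX, unfolded pX] and pb = inv_pair_pull(2)[OF FG oX, unfolded pX]
 have secX: "carrier (sec (Spec B) ?X) = {s : (\<Pi>\<^sub>E P\<in>?X. carrier (localization B (carrier B - P))).
     ALL P:?X. EX V a f. openin (zariski B) V \<and> P : V \<and> V \<subseteq> ?X \<and> a : B \<and> f : B \<and>
      (ALL Q:V. f ~: Q \<and> s Q = fraction B (carrier B - Q) a f)}" by (simp add: Spec_def)
 have ss: "?s a : sec (Spec B) ?X" if a: "a : B" for a
 proof -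
  have "?s a : (\<Pi>\<^sub>E P\<in>?X. carrier (localization B (carrier B - P)))"
  proof (rule PiE_I)
   fix P assume "P : ?X"
   then interpret mult_set B "carrier B - P" using B.mult_set_prime by simp
   show "?s a P : (localization B (carrier B - P))"
    using a \<open>P : ?X\<close> T_one by (auto simp: spec_section_def loc_carrier)
  qed (simp add: spec_section_def)
  moreover have "EX V a' f. openin (zariski B) V \<and> P : V \<and> V \<subseteq> ?X \<and> a' : B \<and> f : B \<and>
      (ALL Q:V. f ~: Q \<and> ?s a Q = fraction B (carrier B - Q) a' f)" if "P : ?X" for P
   by (intro exI[of _ ?X] exI[of _ a] exI[of _ "\<one>.B"])
    (use that a oX in \<open>auto simp: spec_section_def dest: primeidealD(1)\<close>)
  ultimately show ?thesis unfolding secX by blast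
 qed
 have ops: "?s a \<otimes>.(sec (Spec B) ?X) ?s b = ?s (a \<otimes>.B b)" "?s a \<oplus>.(sec (Spec B) ?X) ?s b = ?s (a \<oplus>.B b)"
  if a: "a : B" and b: "b : B" for a b
 proof -
  have "fraction B (carrier B - P) a \<one>.B \<otimes>.(localization B (carrier B - P)) fraction B (carrier B - P) b \<one>.B = fraction B (carrier B - P) (a \<otimes>.B b) \<one>.B"
   "fraction B (carrier B - P) a \<one>.B \<oplus>.(localization B (carrier B - P)) fraction B (carrier B - P) b \<one>.B = fraction B (carrier B - P) (a \<oplus>.B b) \<one>.B"
   if "primeideal P B" for P
  proof -
   interpret mult_set B "carrier B - P" using B.mult_set_prime that by simp
   show "fraction B (carrier B - P) a \<one>.B \<otimes>.(localization B (carrier B - P)) fraction B (carrier B - P) b \<one>.B = fraction B (carrier B - P) (a \<otimes>.B b) \<one>.B"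
   "fraction B (carrier B - P) a \<one>.B \<oplus>.(localization B (carrier B - P)) fraction B (carrier B - P) b \<one>.B = fraction B (carrier B - P) (a \<oplus>.B b) \<one>.B"
    using loc_mult[OF a b T_one T_one] loc_add[OF a b T_one T_one] a b by simp_all
  qed
  thus "?s a \<otimes>.(sec (Spec B) ?X) ?s b = ?s (a \<otimes>.B b)" "?s a \<oplus>.(sec (Spec B) ?X) ?s b = ?s (a \<oplus>.B b)"
   by (simp_all add: Spec_def spec_section_def fun_eq_iff)
 qed
 define ps where "ps a = pull F ?X (?s a)" for a
 have psc: "ps a : sec S (pts S)" if "a : B" for a
  using ring_hom_closed[OF ph ss[OF that]] by (simp add: ps_def)
 have psm: "ps (a \<otimes>.B b) = ps a \<otimes>.(sec S (pts S)) ps b" "ps (a \<oplus>.B b) = ps a \<oplus>.(sec S (pts S)) ps b"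
  if "a : B" "b : B" for a b
  using ring_hom_mult[OF ph ss ss] ring_hom_add[OF ph ss ss] that by (simp_all add: ps_def flip: ops)
 have ps0: "ps \<zero>.B = \<zero>.(sec S (pts S))"
 proof -
  \<comment> \<open>Additivity alone suffices: \<open>z + z = z\<close> forces \<open>z = 0\<close>
    in the ring of sections of \<open>S\<close>.\<close>
  have "ps \<zero>.B \<oplus>.(sec S (pts S)) ps \<zero>.B = ps \<zero>.B" using psm(2)[OF B.zero_closed B.zero_closed] by simp
  thus ?thesis using psc[OF B.zero_closed] by (metis D.add.r_cancel_one')
 qed
 have ps1: "ps \<one>.B = \<one>.(sec S (pts S))"
 proof -
  have "?s \<one>.B = \<one>.(sec (Spec B) ?X)" by (simp add: Spec_def spec_section_def localization_def fun_eq_iff)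
  thus ?thesis using ring_hom_one[OF ph] by (simp add: ps_def)
 qed
 have inj0: "a = \<zero>.B" if a: "a : B" and z: "ps a = \<zero>.(sec S (pts S))" for a
 proof -
  have "?s a = ?s \<zero>.B" using z ps0 ss[OF a] ss[OF B.zero_closed] pb
   unfolding ps_def bij_betw_def inj_on_def by simp
  hence e: "fraction B (carrier B - P) a \<one>.B = fraction B (carrier B - P) \<zero>.B \<one>.B" if "primeideal P B" for P
   using that by (metis (no_types, lifting) mem_Collect_eq restrict_apply' spec_section_def)
  let ?N = "{u : B. u \<otimes>.B a = \<zero>.B}"
  have "\<one>.B : ?N"
  proof (rule B.ideal_eq_carrier[OF B.annihilator_ideal[OF a]])
   fix P assume P: "primeideal P B"
   interpret mult_set B "carrier B - P" using B.mult_set_prime[OF P] .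
   obtain u where "u : carrier B - P" "u \<otimes>.B (\<one>.B \<otimes>.B a) = u \<otimes>.B (\<one>.B \<otimes>.B \<zero>.B)"
    using e[OF P] fraction_eq_iff[OF a B.zero_closed T_one T_one] by blast
   thus "~ ?N \<subseteq> P" using a by auto
  qed
  thus ?thesis using a by simp
 qed
 show ?thesis
 proof (rule domainI[OF B])
  show "\<one>.B ~= \<zero>.B" using ps0 ps1 D.one_not_zero by metis
  fix a b assume ab: "a \<otimes>.B b = \<zero>.B" "a : B" "b : B"
  hence "ps a \<otimes>.(sec S (pts S)) ps b = \<zero>.(sec S (pts S))" using psm(1)[OF ab(2,3)] ps0 by simp
  hence "ps a = \<zero>.(sec S (pts S)) \<or> ps b = \<zero>.(sec S (pts S))" using D.integral psc ab by blast
  thus "a = \<zero>.B \<or> b = \<zero>.B" using inj0 ab by blast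
 qed
qed


section \<open>Integral affine schemes as models in a field\<close>

lemma ringed_spaceD:
 assumes "ringed_space X"
 shows "opn X U ==> cring (sec X U)"
  "opn X U ==> opn X V ==> V \<subseteq> U ==> res X U V : ring_hom (sec X U) (sec X V)"
 using assms[unfolded ringed_space_def, THEN conjunct1]
  assms[unfolded ringed_space_def, THEN conjunct2, THEN conjunct1] by blast+

lemma (in dom_in_field) locq_ring:
 assumes P: "primeideal P R"
 shows "!!a b. a : locq Q al R P ==> b : locq Q al R P ==> a \<otimes>.Q b : locq Q al R P"
  "!!a b. a : locq Q al R P ==> b : locq Q al R P ==> a \<oplus>.Q b : locq Q al R P"
  "!!a. a : locq Q al R P ==> \<ominus>.Q a : locq Q al R P"
  "!!a. a : locq Q al R P ==> a : Q"
proof -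
 interpret L: loc_in_field R "carrier R - P" Q al by (rule lf[OF P])
 interpret M: cring "localization R (carrier R - P)" by (rule L.loc_cring)
 note i = L.lval_inj
 note e = locq_image[OF P]
 have I: "lval Q al F : locq Q al R P" if "F : (localization R (carrier R - P))" for F
  using that unfolding e[symmetric] by (rule imageI)
 have E: "EX F:(localization R (carrier R - P)). a = lval Q al F" if "a : locq Q al R P" for a
  using that unfolding e[symmetric] by blast
 {
  fix a assume "a : locq Q al R P"
  then obtain F where F: "F : (localization R (carrier R - P))" "a = lval Q al F" using E by blast
  show "a : Q" using F inj_homD(2)[OF i] by simp
  show "\<ominus>.Q a : locq Q al R P"
   using I[OF M.a_inv_closed[OF F(1)]] inj_hom_minus[OF i M.ring_axioms Q.ring_axioms F(1)] F(2) by simp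
  fix b assume "b : locq Q al R P"
  then obtain G where G: "G : (localization R (carrier R - P))" "b = lval Q al G" using E by blast
  show "a \<otimes>.Q b : locq Q al R P" using I[OF M.m_closed[OF F(1) G(1)]] inj_homD(3)[OF i F(1) G(1)] F G by simp
  show "a \<oplus>.Q b : locq Q al R P" using I[OF M.a_closed[OF F(1) G(1)]] inj_homD(4)[OF i F(1) G(1)] F G by simp
 }
qed

lemma (in dom_in_field) spec_section_bij:
 "spec_section R : ring_hom R (sec (Spec R) (pts (Spec R)))"
 "bij_betw (spec_section R) (carrier R) (carrier (sec (Spec R) (pts (Spec R))))"
proof -
 have o: "opn (Spec R) (pts (Spec R))" by simp
 have ne: "pts (Spec R) ~= {}" using zero_prime by (auto simp: topspace_zariski)
 interpret C: cring "sec (Spec R) (pts (Spec R))" using sp.sec_cring[OF o] .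
 note v = sp.lc_val_hom[OF o ne]
 note s = spec_section_in
 have eqI: "s = t" if "s : sec (Spec R) (pts (Spec R))" "t : sec (Spec R) (pts (Spec R))"
  "sp.lc_val (pts (Spec R)) s = sp.lc_val (pts (Spec R)) t" for s t using inj_homD(6)[OF v] that by blast
 show "spec_section R : ring_hom R (sec (Spec R) (pts (Spec R)))"
 proof (rule ring_hom_memI)
  fix a b assume a: "a : R" and b: "b : R"
  show "spec_section R (a \<otimes> b) = spec_section R a \<otimes>.(sec (Spec R) (pts (Spec R))) spec_section R b"
   by (rule eqI) (simp_all add: s a b inj_homD(3)[OF v] al_hom(3) del: Spec_simps)
  show "spec_section R (a \<oplus> b) = spec_section R a \<oplus>.(sec (Spec R) (pts (Spec R))) spec_section R b"
   by (rule eqI) (simp_all add: s a b inj_homD(4)[OF v] al_hom(4) del: Spec_simps)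
 next
  show "spec_section R \<one> = \<one>.(sec (Spec R) (pts (Spec R)))"
   by (rule eqI) (simp_all add: s inj_homD(5)[OF v] al_hom(5) del: Spec_simps)
 qed (rule s(1))
 show "bij_betw (spec_section R) (carrier R) (carrier (sec (Spec R) (pts (Spec R))))"
  unfolding bij_betw_def
 proof
  show "inj_on (spec_section R) (carrier R)"
  proof (rule inj_onI)
   fix a b assume "a : R" "b : R" "spec_section R a = spec_section R b"
   thus "a = b" using s(2) al_hom(6) by metis
  qed
  show "spec_section R ` carrier R = carrier (sec (Spec R) (pts (Spec R)))"
  proof
   show "spec_section R ` carrier R \<subseteq> sec (Spec R) (pts (Spec R))" using s(1) by blast
   show "carrier (sec (Spec R) (pts (Spec R))) \<subseteq> spec_section R ` carrier R"
   proof
    fix t assume t: "t : sec (Spec R) (pts (Spec R))"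
    obtain a where a: "a : R" "sp.lc_val (pts (Spec R)) t = al a"
     using reg_all[OF sp.lc_val_reg[OF o t]] by blast
    hence "t = spec_section R a" using eqI[OF t s(1)[OF a(1)]] s(2)[OF a(1)] by simp
    thus "t : spec_section R ` carrier R" using a by blast
   qed
  qed
 qed
qed

locale smodel = dom_in_field B Q al for B :: "('b, 'm) ring_scheme" and Q :: "'q ring" and al +
 fixes S :: "('p, 's) ringed" and F G
 assumes FG: "inv_pair S (Spec B) F G" and S_ringed: "ringed_space S"
begin

definition pr :: "'p => 'b set" where "pr p = pt F p"

text \<open>Sections of \<open>S\<close> have an arbitrary type; they get values in \<open>Q\<close>
  by transport along the inverse \<open>G\<close> to the spectrum.\<close>

definition vS :: "'p set => 's => 'q" where "vS U s = sp.lc_val (pre (Spec B) G U) (pull G U s)"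

lemmas FD = inv_pairD[OF FG] and GD = inv_pairD[OF inv_pair_sym[OF FG]]

lemma pr_prime: "p : pts S ==> primeideal (pr p) B"
 using is_morD(6)[OF FD(1)] by (simp add: pr_def topspace_zariski)

lemma pr_surj: "primeideal P B ==> EX p:pts S. pr p = P"
 using GD(3)[of P] is_morD(6)[OF FD(2), of P] by (auto simp: pr_def topspace_zariski)

lemma pr_inj: "p : pts S ==> p' : pts S ==> pr p = pr p' ==> p = p'"
 using FD(3) unfolding pr_def by metis

lemma pre_G: "opn S U ==> pre (Spec B) G U = pr ` U"
proof -
 assume U: "opn S U"
 show ?thesis
 proof
  show "pre (Spec B) G U \<subseteq> pr ` U" unfolding pre_def pr_def using GD(3) by force
  show "pr ` U \<subseteq> pre (Spec B) G U" unfolding pre_def pr_def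
   using openin_subset[OF U] FD(3) is_morD(6)[OF FD(1)] by auto
 qed
qed

lemma opn_pr: "opn S U ==> openin (zariski B) (pr ` U)"
 using is_morD(7)[OF FD(2), of U] pre_G[of U] by simp

lemma S_opnD: "opn S U ==> p : U ==> p : pts S"
 using openin_subset by blast

lemma opn_bopen: "b : B ==> opn S {p : pts S. b ~: pr p}"
proof -
 assume b: "b : B"
 have "pre S F (bopen B b) = {p : pts S. b ~: pr p}"
  using pr_prime by (auto simp: pre_def pr_def bopen_def)
 thus ?thesis using is_morD(7)[OF FD(1), of "bopen B b"] bopen_open[OF b] by simp
qed

lemma S_basis:
 assumes "opn S U" "p : U" shows "EX b:B. b ~: pr p \<and> {p' : pts S. b ~: pr p'} \<subseteq> U"
proof -
 obtain b where b: "b : B" "pr p : bopen B b" "bopen B b \<subseteq> pr ` U"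
  using bopen_basis[OF opn_pr[OF assms(1)], of "pr p"] assms by blast
 have "{p' : pts S. b ~: pr p'} \<subseteq> U"
 proof safe
  fix p' assume p': "p' : pts S" "b ~: pr p'"
  hence "pr p' : pr ` U" using b pr_prime by (auto simp: bopen_def)
  thus "p' : U" using pr_inj p' S_opnD[OF assms(1)] by blast
 qed
 thus ?thesis using b by (auto simp: bopen_def)
qed

lemma G_bij:
 assumes "opn S U"
 shows "pull G U : ring_hom (sec S U) (sec (Spec B) (pr ` U))"
  "bij_betw (pull G U) (carrier (sec S U)) (carrier (sec (Spec B) (pr ` U)))"
 using inv_pair_pull[OF inv_pair_sym[OF FG] assms] by (simp_all add: pre_G[OF assms])

lemma G_inj: "opn S U ==> inj_hom (sec S U) (sec (Spec B) (pr ` U)) (pull G U)"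
 using G_bij by (simp add: inj_hom_def bij_betw_def)

lemma vS_inj: "opn S U ==> U ~= {} ==> inj_hom (sec S U) Q (vS U)"
 using inj_hom_comp[OF G_inj sp.lc_val_hom, of U] opn_pr[of U] unfolding vS_def by (simp add: pre_G)

lemma sec_cringS: "opn S U ==> cring (sec S U)"
 using ringed_spaceD(1)[OF S_ringed] .

lemma res_vS:
 assumes "opn S U" "opn S V" "V \<subseteq> U" "V ~= {}" "s : sec S U"
 shows "res S U V s : sec S V" "vS V (res S U V s) = vS U s"
proof -
 show "res S U V s : sec S V"
  using ring_hom_closed[OF ringed_spaceD(2)[OF S_ringed assms(1,2,3)] assms(5)] .
 have "pull G V (res S U V s) = res (Spec B) (pr ` U) (pr ` V) (pull G U s)"
  using is_morD(4)[OF FD(2) assms(1,2,3,5)] assms by (simp add: pre_G)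
 thus "vS V (res S U V s) = vS U s"
  using sp.restrict_in(2)[of "pr ` U" "pr ` V" "pull G U s"] opn_pr[OF assms(1)] opn_pr[OF assms(2)] assms
   bij_betwE[OF G_bij(2)[OF assms(1)]] by (auto simp: vS_def pre_G)
qed

sublocale qS: qspace S Q vS
proof (rule qspace.intro[OF Q.field_axioms], rule qspace_axioms.intro)
 show "cring (sec S U)" if "opn S U" for U using sec_cringS[OF that] .
 show "inj_hom (sec S U) Q (vS U)" if "opn S U" "U ~= {}" for U using vS_inj[OF that] .
 show "res S U V s : sec S V \<and> vS V (res S U V s) = vS U s"
  if "opn S U" "opn S V" "V \<subseteq> U" "V ~= {}" "s : sec S U" for U V s
  using res_vS[OF that] by blast
qed

lemma vS_locq:
 assumes "opn S U" "s : sec S U" "p : U" shows "vS U s : locq Q al B (pr p)"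
proof -
 have "vS U s : sp.reg (pr ` U)" using sp.lc_val_reg[of "pr ` U" "pull G U s"] opn_pr[OF assms(1)]
   bij_betwE[OF G_bij(2)[OF assms(1)]] assms(2) by (simp add: vS_def pre_G[OF assms(1)])
 thus ?thesis using reg_locq[OF opn_pr[OF assms(1)]] assms(3) by blast
qed

text \<open>With \<open>vS_locq\<close> this identifies the sections over a nonempty
  \<open>U\<close> with the elements of \<open>Q\<close> that are regular at all its points.
  Sections of \<open>S\<close> with a prescribed value are produced in this way.\<close>

lemma vS_surj:
 assumes "opn S U" "U ~= {}" "!!p. p : U ==> q : locq Q al B (pr p)"
 shows "EX s:sec S U. vS U s = q"
proof -
 have "q : sp.reg (pr ` U)" using reg_locq[OF opn_pr[OF assms(1)]] assms(3) by blast
 note si = sp.sect_in[OF _ this]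
 have "sp.sect (pr ` U) q : pull G U ` carrier (sec S U)"
  unfolding bij_betw_imp_surj_on[OF G_bij(2)[OF assms(1)]] by (rule si(1)) (simp add: opn_pr[OF assms(1)])
 then obtain s where s: "sp.sect (pr ` U) q = pull G U s" "s : sec S U" by (rule imageE)
 moreover have "sp.lc_val (pr ` U) (sp.sect (pr ` U) q) = q"
  by (rule si(2)) (simp_all add: opn_pr[OF assms(1)] assms(2))
 ultimately have "vS U s = q" unfolding vS_def pre_G[OF assms(1)] s(1)[symmetric] by metis
 thus ?thesis using s(2) by blast
qed

lemma stalk_image:
 assumes "p : pts S" shows "qS.sval ` carrier (stalk S p) = locq Q al B (pr p)"
proof safe
 fix c assume "c : stalk S p"
 then obtain U s where "opn S U" "p : U" "s : sec S U" "c = germ S p U s" by (rule qS.stalkE)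
 thus "qS.sval c : locq Q al B (pr p)" using vS_locq by (simp add: qS.sval_germ)
next
 fix q assume q: "q : locq Q al B (pr p)"
 then obtain a f where af: "a : B" "f : carrier B - pr p" "q = al a \<otimes>.Q inv .Q al f" by (auto simp: locq_def)
 let ?U = "{p : pts S. f ~: pr p}"
 have "?U ~= {}" using assms af by auto
 moreover have "q : locq Q al B (pr p')" if "p' : ?U" for p' using that af by (auto simp: locq_def)
 ultimately obtain s where "s : sec S ?U" "vS ?U s = q" using vS_surj[OF opn_bopen] af by blast
 thus "q : qS.sval ` carrier (stalk S p)" using af assms opn_bopen
  by (intro image_eqI[of _ _ "germ S p ?U s"] qS.germ_in_stalk) (auto simp: qS.sval_germ)
qed

lemma unit_iff:
 assumes "opn S U" "p : U" "s : sec S U" "a : B" "f : carrier B - pr p" "vS U s = al a \<otimes>.Q inv .Q al f"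
 shows "germ S p U s : Units (stalk S p) \<longleftrightarrow> a ~: pr p"
proof -
 have p: "p : pts S" using S_opnD assms by blast
 show ?thesis using Q.unit_iff_inj[OF qS.stalk_hom[OF p] qS.stalk_cring[OF p] qS.germ_in_stalk[OF assms(1-3)]]
   stalk_image[OF p] locq_unit[OF pr_prime[OF p] assms(4,5)] assms(6) by (simp add: qS.sval_germ[OF assms(1-3)])
qed

lemma unit_iff':
 assumes "opn S U" "p : U" "s : sec S U" "a : B" "vS U s = al a"
 shows "germ S p U s : Units (stalk S p) \<longleftrightarrow> a ~: pr p"
 using unit_iff[OF assms(1-4), of "\<one>.B"] assms primeidealD(1)[OF pr_prime[OF S_opnD]] al_hom(2,5) by simp

lemma S_ne: "pts S ~= {}"
 using pr_surj[OF zero_prime] by auto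

lemma vS_pts:
 assumes "s : sec S (pts S)" shows "EX b:B. vS (pts S) s = al b"
proof -
 have "pr ` pts S = pts (Spec B)" using pr_surj pr_prime by (auto simp: topspace_zariski)
 hence "vS (pts S) s : sp.reg (pts (Spec B))"
  using sp.lc_val_reg[of "pr ` pts S" "pull G (pts S) s"] opn_pr[OF openin_topspace]
   bij_betwE[OF G_bij(2)[OF openin_topspace]] assms by (simp add: vS_def pre_G)
 thus ?thesis using reg_all by blast
qed

definition gsec :: "'b => 's" where
 "gsec b = (SOME s. s : sec S (pts S) \<and> vS (pts S) s = al b)"

lemma gsec: "b : B ==> gsec b : sec S (pts S)" "b : B ==> vS (pts S) (gsec b) = al b"
proof -
 assume b: "b : B"
 have "EX s. s : sec S (pts S) \<and> vS (pts S) s = al b"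
  using vS_surj[OF openin_topspace S_ne] al_in_locq[OF pr_prime b] by blast
 from someI_ex[OF this] show "gsec b : sec S (pts S)" "vS (pts S) (gsec b) = al b" by (auto simp: gsec_def)
qed

end


lemma fraction_mem: "(b, t) : fraction R T a s \<longleftrightarrow>
  b : R \<and> t : T \<and> (EX u:T. u \<otimes>.R (t \<otimes>.R a) = u \<otimes>.R (s \<otimes>.R b))"
 by (simp only: fraction_def mem_Collect_eq prod.case)

text \<open>The pullback of \<open>spec_map\<close> is a union over all representatives of a germ.
  Every representative \<open>(b, f)\<close> of \<open>a / 1\<close> leads to the same fraction,
  because the equation that witnesses it is preserved by \<open>h\<close>.\<close>

lemma spec_map_section:
 assumes "cring A" "cring B" and h: "h : ring_hom A B" and a: "a : A" and U: "U \<subseteq> {P. primeideal P A}"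
 shows "pull (spec_map A B h) U (restrict (spec_section A a) U)
  = restrict (spec_section B (h a)) {Q. primeideal Q B \<and> {a : A. h a : Q} : U}"
proof -
 interpret A: cring A by fact
 interpret B: cring B by fact
 have "\<Union>{fraction B (carrier B - Q) (h b) (h f) | b f. (b, f) : fraction A (carrier A - {a : A. h a : Q}) a \<one>.A}
   = fraction B (carrier B - Q) (h a) \<one>.B" (is "\<Union>?S = ?f")
  if Q: "primeideal Q B" for Q
 proof -
  let ?P = "{a : A. h a : Q}"
  interpret MA: mult_set A "carrier A - ?P"
   by (rule A.mult_set_prime[OF prime_preimage[OF A.is_cring B.is_cring h Q]])
  interpret MB: mult_set B "carrier B - Q" by (rule B.mult_set_prime[OF Q])
  have "fraction B (carrier B - Q) (h b) (h f) = ?f" if bf: "(b, f) : fraction A (carrier A - ?P) a \<one>.A" for b f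
  proof -
   note m = bf[unfolded fraction_mem]
   from m[THEN conjunct2, THEN conjunct2] obtain u where u': "u : carrier A - ?P"
    "u \<otimes>.A (f \<otimes>.A a) = u \<otimes>.A (\<one>.A \<otimes>.A b)" by (rule bexE)
   note u = m[THEN conjunct1] m[THEN conjunct2, THEN conjunct1] u'
   have c: "u : A" "f : A" using u(2,3) by simp_all
   have hu: "h b : B" "h f : carrier B - Q" "h u : carrier B - Q" "h a : B"
    using u(2,3) ring_hom_closed[OF h u(1)] ring_hom_closed[OF h a] ring_hom_closed[OF h c(1)] ring_hom_closed[OF h c(2)]
    by simp_all
   have "h (u \<otimes>.A (f \<otimes>.A a)) = h (u \<otimes>.A (\<one>.A \<otimes>.A b))" by (simp only: u(4))
   note that = this
   have "h u \<otimes>.B (h f \<otimes>.B h a) = h u \<otimes>.B (\<one>.B \<otimes>.B h b)"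
   proof -
    show ?thesis using that c a u(1)
     by (simp only: ring_hom_mult[OF h] ring_hom_one[OF h] A.m_closed A.one_closed)
   qed
   from MB.fraction_eqI[OF hu(4,1) MB.T_one hu(2,3) this] show ?thesis by (rule sym)
  qed
  moreover have "(a, \<one>.A) : fraction A (carrier A - ?P) a \<one>.A" using MA.fraction_self[OF a MA.T_one] .
  ultimately have "?S = {?f}" by blast
  thus ?thesis by simp
 qed
 thus ?thesis using U unfolding spec_map_def spec_section_def by (auto simp: fun_eq_iff subset_iff)
qed

section \<open>The ring homomorphism behind a morphism to an affine scheme\<close>

locale dfmodel = smodel B Q al S F G for B :: "('b, 'm) ring_scheme" and Q :: "'q ring" and al
  and S :: "('p, 's) ringed" and F G +
 fixes A :: "'a ring" and pj :: "('p, 's, 'a set, 'a set => ('a \<times> 'a) set) mor"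
 assumes A_dom: "domain A" and pj_mor: "is_mor S (Spec A) pj"
begin

sublocale A: domain A by (rule A_dom)

text \<open>\<open>A\<close> sits in its own fraction field here, because injectivity of
  \<open>h\<close> becomes known only through the trivialization over the punctured base.\<close>

sublocale fa: dom_in_field A "localization A (carrier A - {\<zero>.A})" "\<lambda>a. fraction A (carrier A - {\<zero>.A}) a \<one>.A"
 by (rule A.frac_dom_in_field)

lemmas pjD = is_morD[OF pj_mor]

text \<open>The comorphism on global functions, read off through values; by \<open>pt_pj\<close> it
  determines the morphism on points.\<close>

definition h :: "'a => 'b" where
 "h a = (SOME b. b : B \<and> vS (pts S) (pull pj (pts (Spec A)) (spec_section A a)) = al b)"

lemma preX: "pre S pj (pts (Spec A)) = pts S" using pjD(6) by (auto simp: pre_def)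

lemma pull_spec_section: "a : A ==> pull pj (pts (Spec A)) (spec_section A a) : sec S (pts S)"
 using pjD(3)[of "pts (Spec A)" "spec_section A a"] fa.spec_section_in(1)[of a] by (simp add: preX[simplified])

lemma h_val:
 assumes "a : A"
 shows "h a : B" "vS (pts S) (pull pj (pts (Spec A)) (spec_section A a)) = al (h a)"
proof -
 have "EX b. b : B \<and> vS (pts S) (pull pj (pts (Spec A)) (spec_section A a)) = al b"
  using vS_pts[OF pull_spec_section[OF assms]] by blast
 from someI_ex[OF this] show "h a : B" "vS (pts S) (pull pj (pts (Spec A)) (spec_section A a)) = al (h a)"
  by (auto simp: h_def)
qed

lemma h_hom: "h : ring_hom A B"
proof -
 have o: "opn (Spec A) (pts (Spec A))" by simp
 note p = pjD(2)[OF o, unfolded preX] and v = vS_inj[OF openin_topspace S_ne]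
 note s = fa.spec_section_in(1) and sh = fa.spec_section_bij(1)
 show ?thesis
 proof (rule ring_hom_memI)
  fix a b assume a: "a : A" and b: "b : A"
  note c = pull_spec_section[OF a] pull_spec_section[OF b]
  have "al (h (a \<otimes>.A b)) = al (h a \<otimes>.B h b)"
   using h_val(2)[OF A.m_closed[OF a b]] h_val[OF a] h_val[OF b] inj_homD(3)[OF v c] al_hom(3)
   by (simp add: ring_hom_mult[OF sh a b] ring_hom_mult[OF p s[OF a] s[OF b]] del: Spec_simps)
  thus "h (a \<otimes>.A b) = h a \<otimes>.B h b"
   using al_hom(6) h_val(1)[OF A.m_closed[OF a b]] h_val(1)[OF a] h_val(1)[OF b] by blast
  have "al (h (a \<oplus>.A b)) = al (h a \<oplus>.B h b)"
   using h_val(2)[OF A.a_closed[OF a b]] h_val[OF a] h_val[OF b] inj_homD(4)[OF v c] al_hom(4)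
   by (simp add: ring_hom_add[OF sh a b] ring_hom_add[OF p s[OF a] s[OF b]] del: Spec_simps)
  thus "h (a \<oplus>.A b) = h a \<oplus>.B h b"
   using al_hom(6) h_val(1)[OF A.a_closed[OF a b]] h_val(1)[OF a] h_val(1)[OF b] by blast
 next
  have "al (h \<one>.A) = al \<one>.B"
   using h_val(2)[OF A.one_closed] inj_homD(5)[OF v] al_hom(5)
   by (simp add: ring_hom_one[OF sh] ring_hom_one[OF p] del: Spec_simps)
  thus "h \<one>.A = \<one>.B" using al_hom(6) h_val(1)[OF A.one_closed] by blast
 qed (rule h_val(1))
qed

lemma pj_res:
 assumes "opn (Spec A) U" "pre S pj U ~= {}" "a : A"
 shows "vS (pre S pj U) (pull pj U (res (Spec A) (pts (Spec A)) U (spec_section A a))) = al (h a)"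
proof -
 have sub: "U \<subseteq> pts (Spec A)" "pre S pj U \<subseteq> pts S" using openin_subset[OF assms(1)] by (auto simp: pre_def)
 have "pull pj U (res (Spec A) (pts (Spec A)) U (spec_section A a))
   = res S (pts S) (pre S pj U) (pull pj (pts (Spec A)) (spec_section A a))"
  using pjD(4)[OF openin_topspace assms(1) sub(1) fa.spec_section_in(1)[OF assms(3)]] by (simp only: preX)
 thus ?thesis
  using res_vS(2)[OF openin_topspace pjD(7)[OF assms(1)] sub(2) assms(2) pull_spec_section[OF assms(3)]]
   h_val(2)[OF assms(3)] by simp
qed

text \<open>One inclusion is locality: if \<open>h a\<close> were invertible at \<open>p\<close>,
  then \<open>a\<close> would be invertible at the image. The other uses the section
  \<open>1 / a\<close> over the basic open set of \<open>a\<close>: its pullback inverts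
  \<open>h a\<close> at \<open>p\<close>.\<close>

lemma pt_pj:
 assumes p: "p : pts S" shows "pt pj p = {a : A. h a : pr p}"
proof -
 have P: "primeideal (pt pj p) A" using pjD(6)[OF p] by (simp add: A.topspace_zariski)
 have o: "opn (Spec A) (pts (Spec A))" by simp
 have "a : pt pj p \<longleftrightarrow> h a : pr p" if a: "a : A" for a
 proof
  assume ap: "a : pt pj p"
  show "h a : pr p"
  proof (rule ccontr)
   assume "h a ~: pr p"
   hence "germ S p (pts S) (pull pj (pts (Spec A)) (spec_section A a)) : Units (stalk S p)"
    using unit_iff'[OF openin_topspace p pull_spec_section[OF a] h_val[OF a]] by simp
   hence "germ (Spec A) (pt pj p) (pts (Spec A)) (spec_section A a) : Units (stalk (Spec A) (pt pj p))"
    using pjD(5)[OF p o pjD(6)[OF p] fa.spec_section_in(1)[OF a]] by (simp only: preX)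
   thus False
    using fa.unit_germ[OF o pjD(6)[OF p] fa.spec_section_in(1)[OF a] a, of "\<one>.A"] ap
     primeidealD(1)[OF P] fa.spec_section_in(2)[OF a] fa.al_hom(2,5) a by auto
  qed
 next
  assume hp: "h a : pr p"
  show "a : pt pj p"
  proof (rule ccontr)
   assume na: "a ~: pt pj p"
   let ?U = "bopen A a" and ?fr = "\<lambda>a. fraction A (carrier A - {\<zero>.A}) a \<one>.A"
   let ?K = "localization A (carrier A - {\<zero>.A})"
   have oU: "opn (Spec A) ?U" using A.bopen_open[OF a] by simp
   have pU: "pt pj p : ?U" using na P by (simp add: bopen_def)
   hence neU: "?U ~= {}" and ppU: "p : pre S pj ?U" using p by (auto simp: pre_def)
   hence nepU: "pre S pj ?U ~= {}" by blast
   have az: "?fr a ~= \<zero>.?K" using fa.al_nz[OF P] na a by blast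
   have "inv .?K ?fr a : fa.sp.reg ?U"
    unfolding fa.reg_locq[OF oU[simplified]]
   proof
    fix P' assume "P' : ?U"
    hence "a : carrier A - P'" using a by (simp add: bopen_def)
    thus "inv .?K ?fr a : locq ?K ?fr A P'" unfolding locq_def
     using fa.al_hom(2,5) a az
     by (intro CollectI exI[of _ "\<one>.A"] exI[of _ a]) simp
   qed
   then obtain t where t: "t : sec (Spec A) ?U" "fa.sp.lc_val ?U t = inv .?K ?fr a"
    using fa.sp.sect_in[OF oU] neU by blast
   let ?s = "res (Spec A) (pts (Spec A)) ?U (spec_section A a)"
   have s: "?s : sec (Spec A) ?U" "fa.sp.lc_val ?U ?s = ?fr a"
    using fa.sp.restrict_in[OF o oU openin_subset[OF oU] fa.spec_section_in(1)[OF a]] neU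
     fa.spec_section_in(2)[OF a] by simp_all
   interpret SU: cring "sec (Spec A) ?U" by (rule fa.sp.sec_cring[OF oU])
   note lh = fa.sp.lc_val_hom[OF oU neU]
   have "fa.sp.lc_val ?U (?s \<otimes>.(sec (Spec A) ?U) t) = fa.sp.lc_val ?U \<one>.(sec (Spec A) ?U)"
    using inj_homD(3)[OF lh s(1) t(1)] inj_homD(5)[OF lh] s(2) t(2) az fa.al_hom(2)[OF a] by simp
   hence st: "?s \<otimes>.(sec (Spec A) ?U) t = \<one>.(sec (Spec A) ?U)"
    using inj_homD(6)[OF lh SU.m_closed[OF s(1) t(1)] SU.one_closed] by blast
   note ph = pjD(2)[OF oU] and vh = vS_inj[OF pjD(7)[OF oU] nepU]
   have "vS (pre S pj ?U) (pull pj ?U ?s) \<otimes>.Q vS (pre S pj ?U) (pull pj ?U t) = \<one>.Q"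
    using inj_homD(3)[OF vh pjD(3)[OF oU s(1)] pjD(3)[OF oU t(1)]] inj_homD(5)[OF vh]
     ring_hom_mult[OF ph s(1) t(1)] ring_hom_one[OF ph] st by simp
   moreover obtain b g where bg: "b : B" "g : carrier B - pr p"
    "vS (pre S pj ?U) (pull pj ?U t) = al b \<otimes>.Q inv .Q al g"
    using vS_locq[OF pjD(7)[OF oU] pjD(3)[OF oU t(1)] ppU] by (auto simp: locq_def)
   ultimately have e: "al (h a) \<otimes>.Q (al b \<otimes>.Q inv .Q al g) = \<one>.Q"
    using pj_res[OF oU nepU a] by simp
   have gz: "al g ~= \<zero>.Q" "al g : Q" "al b : Q" "al (h a) : Q"
    using al_nz[OF pr_prime[OF p] bg(2)] bg al_hom(2) h_val(1)[OF a] by auto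
   have "(al (h a) \<otimes>.Q al b) \<otimes>.Q inv .Q al g = \<one>.Q" using e gz by (simp add: Q.m_assoc)
   hence "al (h a \<otimes>.B b) = al g" using gz bg h_val(1)[OF a] al_hom(3) by (simp add: Q.div_eq_iff)
   hence "h a \<otimes>.B b = g" using al_hom(6)[of "h a \<otimes>.B b" g] bg h_val(1)[OF a] by auto
   thus False using hp primeidealD(4)[OF pr_prime[OF p] h_val(1)[OF a] bg(1)] bg(2) by auto
  qed
 qed
 thus ?thesis using primeidealD(2)[OF P] by auto
qed

end

lemma maximal_PIdl:
 assumes "cring A" "x : A" "maximalideal (PIdl .A x) A" "primeideal P A"
 shows "x : P \<longleftrightarrow> P = PIdl .A x"
proof
 interpret cring A by fact
 interpret P: primeideal P A by fact
 assume "x : P"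
 hence "PIdl .A x \<subseteq> P" by (rule cgenideal_minimal[OF P.ideal_axioms])
 hence "P = PIdl .A x \<or> P = carrier A"
  using maximalideal.I_maximal[OF assms(3) P.ideal_axioms] subsetI[of P "carrier A", OF P.Icarr] by metis
 thus "P = PIdl .A x" using P.I_notcarr by metis
next
 assume "P = PIdl .A x" thus "x : P" using cring.axioms(1)[OF assms(1)] ring.cgenideal_self[OF _ assms(2)] by simp
qed


lemma subtop_opn: "opn X U ==> V \<subseteq> U ==> opn (restr X U) V \<longleftrightarrow> opn X V"
 unfolding restr_def by (auto simp: openin_open_subtopology)

lemma restr_simps[simp]: "sec (restr X U) = sec X" "res (restr X U) = res X"
 "tsp (restr X U) = subtopology (tsp X) U"
 by (simp_all add: restr_def)

lemma mor_eqD: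
 assumes "mor_eq X Y f g"
 shows "p : pts X ==> pt f p = pt g p"
  "opn Y U ==> s : sec Y U ==> pull f U s = pull g U s"
 using assms unfolding mor_eq_def by blast+

section \<open>The trivial line over the punctured base\<close>

context dfmodel
begin

text \<open>\<open>\<Psi>\<close> reads a polynomial as a function on the line, restricts it to the
  part over the punctured base, pulls it back to \<open>S\<close> and takes its value. The punctured
  base is the locus where \<open>x\<close> is invertible, so \<open>B\<close> and the polynomials
  have the same image up to powers of \<open>h x\<close>; the last two clauses are the two
  inclusions.\<close>

lemma generic_trivial:
 fixes x defines "x0 \<equiv> PIdl .A x" and "X \<equiv> Spec A"
 defines "Xs \<equiv> pts X - {x0}" and "L \<equiv> Spec (UP A)" and "l \<equiv> affine_line_map A A (\<lambda>a. a)"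
 assumes x: "x : A" "maximalideal x0 A" "x ~= \<zero>.A"
  and iso: "iso_over (restr X Xs) (restr S (pre S pj Xs)) pj (restr L (pre L l Xs)) l"
 shows "EX \<Psi>. inj_hom (UP A) Q \<Psi> \<and> (ALL a:A. \<Psi> (monom (UP A) a 0) = al (h a)) \<and>
  (ALL b:B. EX p:UP A. EX m::nat. al b \<otimes>.Q al (h x [^].B m) = \<Psi> p) \<and>
  (ALL p:UP A. EX b:B. EX m::nat. \<Psi> p \<otimes>.Q al (h x [^].B m) = al b)"
proof -
 let ?U = "UP A"
 interpret UA: UP_domain A ?U by unfold_locales simp
 let ?c = "\<lambda>a. monom ?U a 0"
 let ?ux = "?c x"
 interpret fu: dom_in_field ?U "localization ?U (carrier ?U - {\<zero>.?U})" "\<lambda>a. fraction ?U (carrier ?U - {\<zero>.?U}) a \<one>.?U"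
  by (rule domain.frac_dom_in_field[OF UA.UP_domain])
 have ch: "?c : ring_hom A ?U" using UA.const_ring_hom .
 have uxc: "?ux : ?U" using x by simp
 have uxz: "?ux ~= \<zero>.?U" using x UA.monom_inj[of 0] by (auto simp: inj_on_def)
 have Xs: "Xs = bopen A x" unfolding Xs_def X_def bopen_def Spec_simps A.topspace_zariski
  using maximal_PIdl[OF A.is_cring x(1)] x(2) unfolding x0_def by blast
 have oXs: "opn X Xs" unfolding Xs X_def using A.bopen_open[OF x(1)] by simp
 have lpt: "pt l P = {a : A. ?c a : P}" for P by (simp add: l_def affine_line_map_def spec_map_def)
 have Ls: "pre L l Xs = bopen ?U ?ux"
  using prime_preimage[OF A.is_cring UA.UP_cring ch] x(1)
  unfolding pre_def L_def Spec_simps cring.topspace_zariski[OF UA.UP_cring] lpt Xs by (auto simp: bopen_def)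
 let ?Ls = "bopen ?U ?ux"
 have oLs: "opn L ?Ls" unfolding L_def using cring.bopen_open[OF UA.UP_cring uxc] by simp
 have subLs: "?Ls \<subseteq> pts L" using openin_subset[OF oLs] .
 define Ss where "Ss = pre S pj Xs"
 have oSs: "opn S Ss" unfolding Ss_def using pjD(7)[of Xs] oXs by (simp add: X_def)
 have Ss: "p : Ss \<longleftrightarrow> p : pts S \<and> h x ~: pr p" for p
  unfolding Ss_def Xs using pjD(6) pt_pj x(1) by (auto simp: pre_def bopen_def A.topspace_zariski)
 obtain fi where fi: "is_iso (restr S Ss) (restr L ?Ls) fi"
  and fieq: "mor_eq (restr S Ss) (restr X Xs) (mor_comp (restr L ?Ls) l fi) pj"
  using iso unfolding iso_over_def Ls Ss_def by blast
 obtain ga where figa: "inv_pair (restr S Ss) (restr L ?Ls) fi ga" using fi inv_pair_iso by blast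
 note fiD = inv_pairD[OF figa] and gaD = inv_pairD[OF inv_pair_sym[OF figa]]
 have tS: "pts (restr S Ss) = Ss" using openin_subset[OF oSs] by (simp add: Int_absorb1)
 have tL: "pts (restr L ?Ls) = ?Ls" using subLs by (simp add: Int_absorb1)
 have oL': "opn (restr L ?Ls) ?Ls" using subtop_opn[OF oLs] oLs by simp
 have prefi: "pre (restr S Ss) fi ?Ls = Ss" using is_morD(6)[OF fiD(1)] unfolding pre_def tS tL by blast
 have neLs: "?Ls ~= {}" using fu.zero_prime uxz by (auto simp: bopen_def)
 hence neSs: "Ss ~= {}" using is_morD(6)[OF gaD(1)] unfolding tS tL by blast
 note b = inv_pair_pull[OF figa oL', unfolded prefi restr_simps]
 have phiinj: "inj_hom (sec L ?Ls) (sec S Ss) (pull fi ?Ls)" using b by (simp add: inj_hom_def bij_betw_def)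
 define e where "e p = res L (pts L) ?Ls (spec_section ?U p)" for p
 have ss: "spec_section ?U p : sec L (pts L)" if "p : ?U" for p
  using fu.spec_section_in(1)[OF that] by (simp add: L_def)
 have oL: "opn L (pts L)" by simp
 note rI = fu.sp.restrict_in[folded L_def, OF oL oLs subLs]
 have ec: "e p : sec L ?Ls" "fu.sp.lc_val ?Ls (e p) = fraction ?U (carrier ?U - {\<zero>.?U}) p \<one>.?U"
  if "p : ?U" for p
  using rI[OF ss[OF that]] neLs fu.spec_section_in(2)[OF that] by (simp_all add: e_def L_def)
 note lh = fu.sp.lc_val_hom[folded L_def, OF oLs neLs]
 interpret SL: cring "sec L ?Ls" using fu.sp.sec_cring[folded L_def, OF oLs] .
 have eqI: "s = t" if "s : sec L ?Ls" "t : sec L ?Ls" "fu.sp.lc_val ?Ls s = fu.sp.lc_val ?Ls t" for s t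
  using inj_homD(6)[OF lh] that by blast
 have einj: "inj_hom ?U (sec L ?Ls) e" unfolding inj_hom_def
 proof
  show "e : ring_hom ?U (sec L ?Ls)"
  proof (rule ring_hom_memI)
   fix p q assume pq: "p : ?U" "q : ?U"
   show "e (p \<otimes>.?U q) = e p \<otimes>.(sec L ?Ls) e q"
    using pq by (intro eqI) (simp_all add: ec inj_homD(3)[OF lh] fu.al_hom(3))
   show "e (p \<oplus>.?U q) = e p \<oplus>.(sec L ?Ls) e q"
    using pq by (intro eqI) (simp_all add: ec inj_homD(4)[OF lh] fu.al_hom(4))
  next
   show "e \<one>.?U = \<one>.(sec L ?Ls)" by (intro eqI) (simp_all add: ec inj_homD(5)[OF lh] fu.al_hom(5))
  qed (rule ec(1))
  show "inj_on e (carrier ?U)"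
  proof (rule inj_onI)
   fix p q assume "p : ?U" "q : ?U" "e p = e q"
   thus "p = q" using ec(2) fu.al_hom(6) by metis
  qed
 qed
 define \<Psi> where "\<Psi> p = vS Ss (pull fi ?Ls (e p))" for p
 note vh = vS_inj[OF oSs neSs]
 have \<Psi>i: "inj_hom ?U Q \<Psi>"
  unfolding \<Psi>_def by (rule inj_hom_comp[OF inj_hom_comp[OF einj phiinj] vh])
 have \<Psi>c: "\<Psi> (?c a) = al (h a)" if a: "a : A" for a
 proof -
  let ?s = "res X (pts X) Xs (spec_section A a)"
  have oX: "opn X (pts X)" by simp
  have sX: "?s : sec X Xs"
   using fa.sp.restrict_in(1)[folded X_def, OF oX oXs openin_subset[OF oXs]] fa.spec_section_in(1)[OF a] by (simp add: X_def)
  have sr: "?s = restrict (spec_section A a) Xs"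
   using fa.sp.res_eq[folded X_def, OF oX oXs openin_subset[OF oXs]] .
  have "pull l Xs ?s = e (?c a)"
  proof -
   have "pull l Xs ?s = restrict (spec_section ?U (?c a)) {Q. primeideal Q ?U \<and> {a : A. ?c a : Q} : Xs}"
    unfolding sr l_def affine_line_map_def
    by (rule spec_map_section[OF A.is_cring UA.UP_cring ch a]) (auto simp: Xs bopen_def)
   also have "{Q. primeideal Q ?U \<and> {a : A. ?c a : Q} : Xs} = ?Ls"
    using Ls unfolding pre_def lpt L_def Spec_simps cring.topspace_zariski[OF UA.UP_cring] by simp
   also have "restrict (spec_section ?U (?c a)) ?Ls = e (?c a)"
    unfolding e_def using fu.sp.res_eq[folded L_def, OF oL oLs subLs] by simp
   finally show ?thesis .
  qed
  note pl = this
  have pLs: "pre (restr L ?Ls) l Xs = ?Ls" using Ls subLs unfolding pre_def tL by auto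
  have oX': "opn (restr X Xs) Xs" using subtop_opn[OF oXs] oXs by simp
  have "pull fi ?Ls (e (?c a)) = pull pj Xs ?s"
   using mor_eqD(2)[OF fieq oX', of ?s] sX by (simp only: mor_comp_simps pLs pl restr_simps)
  thus ?thesis
   using pj_res[of Xs a] oXs neSs a by (simp add: \<Psi>_def Ss_def X_def)
 qed
 have hxc: "h x : B" using h_val(1) x(1) .
 have pw: "\<Psi> (?ux [^].?U m) = al (h x [^].B m)" for m :: nat
 proof (induction m)
  case 0 show ?case using inj_homD(5)[OF \<Psi>i] al_hom(5) by simp
 next
  case (Suc m)
  thus ?case using inj_homD(3)[OF \<Psi>i UA.P.nat_pow_closed[OF uxc] uxc] \<Psi>c[OF x(1)] hxc al_hom(3) by simp
 qed
 \<comment> \<open>A function on \<open>S\<close> restricts to the part over the punctured base and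
   so comes from a section \<open>t'\<close> of the line there; \<open>locq_all\<close> turns
   \<open>t'\<close> into a polynomial over a power of \<open>x\<close>.\<close>
 have 1: "EX p:?U. EX m::nat. al b \<otimes>.Q al (h x [^].B m) = \<Psi> p" if bB: "b : B" for b
 proof -
  have "al b : locq Q al B (pr p)" if "p : Ss" for p using al_in_locq[OF pr_prime bB] that Ss by blast
  from vS_surj[OF oSs neSs this] obtain t where t: "t : sec S Ss" "vS Ss t = al b" by blast
  have "t : pull fi ?Ls ` carrier (sec L ?Ls)" unfolding bij_betw_imp_surj_on[OF b(2)] by (rule t(1))
  then obtain t' where t': "t' : sec L ?Ls" "pull fi ?Ls t' = t" by auto
  note r = fu.sp.lc_val_reg[folded L_def, OF oLs t'(1), unfolded fu.reg_locq[OF oLs[unfolded L_def Spec_simps]]]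
  obtain p m where p: "p : ?U"
   "fu.sp.lc_val ?Ls t' \<otimes>.(localization ?U (carrier ?U - {\<zero>.?U})) fraction ?U (carrier ?U - {\<zero>.?U}) (?ux [^].?U (m::nat)) \<one>.?U
    = fraction ?U (carrier ?U - {\<zero>.?U}) p \<one>.?U"
   using fu.locq_all[OF inj_homD(2)[OF lh t'(1)] uxc] r by blast
  have um: "?ux [^].?U m : ?U" using UA.P.nat_pow_closed[OF uxc] .
  have "t' \<otimes>.(sec L ?Ls) e (?ux [^].?U m) = e p"
   using t'(1) p um by (intro eqI) (simp_all add: ec inj_homD(3)[OF lh])
  hence "\<Psi> p = vS Ss (pull fi ?Ls t') \<otimes>.Q \<Psi> (?ux [^].?U m)"
   unfolding \<Psi>_def using inj_homD(3)[OF inj_hom_comp[OF phiinj vh] t'(1) ec(1)[OF um]] by simp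
  thus ?thesis using t' t pw p(1) by metis
 qed
 \<comment> \<open>The same argument in the other direction: \<open>\<Psi> p\<close> is regular
   wherever \<open>h x\<close> does not vanish.\<close>
 have 2: "EX b:B. EX m::nat. \<Psi> p \<otimes>.Q al (h x [^].B m) = al b" if p: "p : ?U" for p
 proof -
  have "\<Psi> p : locq Q al B P" if P: "P : bopen B (h x)" for P
  proof -
   obtain p' where "p' : pts S" "pr p' = P" using pr_surj[of P] P by (auto simp: bopen_def)
   hence "p' : Ss" using Ss P by (auto simp: bopen_def)
   thus ?thesis using vS_locq[OF oSs inj_homD(2)[OF phiinj ec(1)[OF p]]] \<open>pr p' = P\<close> unfolding \<Psi>_def by blast
  qed
  thus ?thesis using locq_all[OF inj_homD(2)[OF \<Psi>i p] hxc] by blast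
 qed
 show ?thesis using \<Psi>i \<Psi>c 1 2 by blast
qed

end


section \<open>The special fiber\<close>

locale dfmodel_inj = dfmodel B Q al S F G A pj
  for B :: "('b, 'm) ring_scheme" and Q :: "'q ring" and al
  and S :: "('p, 's) ringed" and F G and A :: "'a ring" and pj +
 fixes x
 assumes h_inj: "inj_on h (carrier A)"
  and x: "x : A" "maximalideal (PIdl .A x) A" "x ~= \<zero>.A"
begin

lemma hinj: "inj_hom A B h" using h_hom h_inj by (simp add: inj_hom_def)

lemma ahinj: "inj_hom A Q (\<lambda>a. al (h a))" using inj_hom_comp[OF hinj al_inj] .

sublocale ax: dom_in_field A Q "\<lambda>a. al (h a)"
 using ahinj by unfold_locales

abbreviation "x0 \<equiv> PIdl .A x"

lemma x0_prime: "primeideal x0 A" using A.maximalideal_prime[OF x(2)] .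

lemma x0_iff: "primeideal P A ==> P = x0 \<longleftrightarrow> x : P" using maximal_PIdl[OF A.is_cring x(1,2)] by blast

lemma hxc: "h x : B" using h_val(1) x(1) .

lemma alhx: "al (h x) ~= \<zero>.Q" "al (h x) : Q"
 using ax.al_zero(2)[OF x(1)] x(3) al_hom(2)[OF hxc] by auto

lemma pt_x0: "p : pts S ==> pt pj p = x0 \<longleftrightarrow> h x : pr p"
 using x0_iff[of "pt pj p"] pjD(6)[of p] pt_pj[of p] x(1) by (auto simp: A.topspace_zariski)

definition Z where "Z = pre S pj {x0}"

lemma Z_iff: "p : Z \<longleftrightarrow> p : pts S \<and> h x : pr p"
 unfolding Z_def pre_def using pt_x0 by auto

text \<open>Known for the functions from \<open>A\<close> by \<open>pj_res\<close>. A section over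
  \<open>U\<close> has a value \<open>a / d\<close>, where \<open>d\<close> may vanish somewhere on
  \<open>U\<close>. Therefore it is pinned down by the equation of sections \<open>s d = a\<close>,
  which the pullback preserves.\<close>

lemma pull_val:
 assumes U: "opn (Spec A) U" and ne: "pre S pj U ~= {}" and s: "s : sec (Spec A) U"
 shows "vS (pre S pj U) (pull pj U s) = ax.sp.lc_val U s"
proof -
 have neU: "U ~= {}" using ne by (auto simp: pre_def)
 hence "{\<zero>.A} : U" using ax.zero_in_open U by simp
 hence "ax.sp.lc_val U s : locq Q (\<lambda>a. al (h a)) A {\<zero>.A}"
  using ax.sp.lc_val_reg[OF U s] ax.reg_locq U by simp
 then obtain a d where ad: "a : A" "d : carrier A - {\<zero>.A}"
  "ax.sp.lc_val U s = al (h a) \<otimes>.Q inv .Q al (h d)" by (auto simp: locq_def)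
 have d: "d : A" using ad by simp
 have dz: "al (h d) ~= \<zero>.Q" "al (h d) : Q" "al (h a) : Q"
  using ax.al_nz[OF ax.zero_prime ad(2)] ax.al_hom(2) ad by auto
 let ?r = "\<lambda>a. res (Spec A) (pts (Spec A)) U (spec_section A a)"
 have o: "opn (Spec A) (pts (Spec A))" by simp
 have r: "?r b : sec (Spec A) U" "ax.sp.lc_val U (?r b) = al (h b)" if "b : A" for b
  using ax.sp.restrict_in[OF o U openin_subset[OF U] ax.spec_section_in(1)[OF that]] neU
   ax.spec_section_in(2)[OF that] by simp_all
 interpret SU: cring "sec (Spec A) U" by (rule ax.sp.sec_cring[OF U])
 note lh = ax.sp.lc_val_hom[OF U neU] and vh = vS_inj[OF pjD(7)[OF U] ne]
 have "ax.sp.lc_val U (s \<otimes>.(sec (Spec A) U) ?r d) = ax.sp.lc_val U (?r a)"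
  using inj_homD(3)[OF lh s r(1)[OF d]] r(2)[OF d] r(2)[OF ad(1)] ad(3) dz
  by (simp add: Q.m_assoc)
 hence e: "s \<otimes>.(sec (Spec A) U) ?r d = ?r a"
  using inj_homD(6)[OF lh SU.m_closed[OF s r(1)[OF d]] r(1)[OF ad(1)]] by blast
 have "vS (pre S pj U) (pull pj U s) \<otimes>.Q al (h d) = al (h a)"
  using ring_hom_mult[OF pjD(2)[OF U] s r(1)[OF d]] e
   inj_homD(3)[OF vh pjD(3)[OF U s] pjD(3)[OF U r(1)[OF d]]] pj_res[OF U ne d] pj_res[OF U ne ad(1)] by simp
 thus ?thesis using dz inj_homD(2)[OF vh pjD(3)[OF U s]] unfolding ad(3) by (simp add: Q.div_eq_iff)
qed

definition FI where "FI p = fiber_ideal S (Spec A) pj p"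

lemma stalk_ring: "p : pts S ==> cring (stalk S p)" by (rule qS.stalk_cring)

text \<open>Divisibility of \<open>v\<close> by \<open>x\<close> in the local ring at
  \<open>p\<close>; by \<open>FI_eq\<close> this is vanishing on the scheme-theoretic fiber at
  \<open>p\<close>.\<close>

definition xd :: "'p => 'q => bool" where "xd p v \<longleftrightarrow> v : Q \<and> v \<otimes>.Q inv .Q al (h x) : locq Q al B (pr p)"

lemma xdI: "v : Q ==> q : locq Q al B (pr p) ==> p : pts S ==> v = q \<otimes>.Q al (h x) ==> xd p v"
 using alhx locq_ring(4)[OF pr_prime] by (simp add: xd_def Q.m_assoc)

text \<open>A nonunit at \<open>x0\<close> has a value \<open>a / f\<close> with \<open>a\<close> in
  \<open>x0\<close>, thus a multiple of \<open>x\<close>, and \<open>f\<close> outside. So all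
  generators of the fiber ideal are multiples of the germ of \<open>x\<close>, which is one of
  them.\<close>

lemma FI_eq:
 assumes pZ: "p : Z"
 shows "ideal (FI p) (stalk S p)" "c : stalk S p ==> c : FI p \<longleftrightarrow> xd p (qS.sval c)"
proof -
 have p: "p : pts S" and pt: "pt pj p = x0" using pZ by (auto simp: Z_def pre_def)
 interpret T: cring "stalk S p" by (rule stalk_ring[OF p])
 note sh = inj_homD[OF qS.stalk_hom[OF p]]
 let ?gx = "germ S p (pts S) (pull pj (pts (Spec A)) (spec_section A x))"
 let ?G = "{germ S p (pre S pj U) (pull pj U s) | U s. opn (Spec A) U \<and> pt pj p : U \<and> s : sec (Spec A) U \<and>
    germ (Spec A) (pt pj p) U s ~: Units (stalk (Spec A) (pt pj p))}"
 have gx: "?gx : stalk S p" "qS.sval ?gx = al (h x)"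
  using qS.germ_in_stalk[OF openin_topspace p pull_spec_section[OF x(1)]]
   qS.sval_germ[OF openin_topspace p pull_spec_section[OF x(1)]] h_val(2)[OF x(1)] by simp_all
 have x0X: "x0 : pts (Spec A)" using x0_prime by (simp add: A.topspace_zariski)
 have PI: "c : PIdl .(stalk S p) ?gx \<longleftrightarrow> xd p (qS.sval c)" if c: "c : stalk S p" for c
 proof
  assume "c : PIdl .(stalk S p) ?gx"
  then obtain d where d: "d : stalk S p" "c = d \<otimes>.(stalk S p) ?gx" by (auto simp: cgenideal_def)
  have "qS.sval d : locq Q al B (pr p)" unfolding stalk_image[OF p, symmetric] by (rule imageI[OF d(1)])
  from xdI[OF sh(2)[OF c] this p] show "xd p (qS.sval c)" unfolding d(2) sh(3)[OF d(1) gx(1)] gx(2) by simp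
 next
  assume "xd p (qS.sval c)"
  hence "qS.sval c \<otimes>.Q inv .Q al (h x) : qS.sval ` carrier (stalk S p)" unfolding stalk_image[OF p] xd_def by blast
  then obtain d where d: "qS.sval c \<otimes>.Q inv .Q al (h x) = qS.sval d" "d : stalk S p" by (rule imageE)
  have "qS.sval c = qS.sval (d \<otimes>.(stalk S p) ?gx)"
   unfolding sh(3)[OF d(2) gx(1)] gx(2) d(1)[symmetric] using sh(2)[OF c] alhx by (subst Q.m_assoc) simp_all
  hence "c = d \<otimes>.(stalk S p) ?gx" by (rule sh(6)[OF c T.m_closed[OF d(2) gx(1)], THEN iffD1])
  thus "c : PIdl .(stalk S p) ?gx" using d(2) by (auto simp: cgenideal_def)
 qed
 have GP: "?G \<subseteq> PIdl .(stalk S p) ?gx"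
 proof
  fix c assume "c : ?G"
  then obtain U s where U: "opn (Spec A) U" "pt pj p : U" "s : sec (Spec A) U"
   "germ (Spec A) (pt pj p) U s ~: Units (stalk (Spec A) (pt pj p))" "c = germ S p (pre S pj U) (pull pj U s)" by blast
  have pU: "p : pre S pj U" using p U(2) by (simp add: pre_def)
  hence ne: "pre S pj U ~= {}" by auto
  note oU = pjD(7)[OF U(1)] and cU = pjD(3)[OF U(1,3)]
  have cc: "c : stalk S p" using qS.germ_in_stalk[OF oU pU cU] U(5) by simp
  have "ax.sp.lc_val U s : locq Q (\<lambda>a. al (h a)) A x0" using ax.sp.lc_val_reg[OF U(1,3)] ax.reg_locq U(1,2) pt by simp
  then obtain a f where af: "a : A" "f : carrier A - x0" "ax.sp.lc_val U s = al (h a) \<otimes>.Q inv .Q al (h f)" by (auto simp: locq_def)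
  have "a : x0" using ax.unit_germ[OF U(1,2,3) af(1), of f] af(2,3) U(4) pt by simp
  then obtain a' where a': "a' : A" "a = a' \<otimes>.A x" by (auto simp: cgenideal_def)
  have fp: "h f : carrier B - pr p" using af(2) pt pt_pj[OF p] h_val(1) by auto
  have [simp]: "al (h f) ~= \<zero>.Q" "al (h f) : Q" "al (h a') : Q" "h a' : B"
   using al_nz[OF pr_prime[OF p] fp] ax.al_hom(2) a' af(2) h_val(1) by auto
  have l: "al (h a') \<otimes>.Q inv .Q al (h f) : locq Q al B (pr p)"
   unfolding locq_def using fp by (intro CollectI exI[of _ "h a'"] exI[of _ "h f"]) simp
  have "qS.sval c = (al (h a') \<otimes>.Q inv .Q al (h f)) \<otimes>.Q al (h x)"
   using qS.sval_germ[OF oU pU cU] pull_val[OF U(1) ne U(3)] af(3) U(5) ax.al_hom(3)[OF a'(1) x(1)] a'(2) alhx by (simp add: Q.m_ac)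
  thus "c : PIdl .(stalk S p) ?gx" using PI[OF cc] xdI[OF sh(2)[OF cc] l p] by blast
 qed
 have "al (h x) = al (h x) \<otimes>.Q inv .Q al (h \<one>.A)" using ax.al_hom(5) alhx by simp
 hence "germ (Spec A) (pt pj p) (pts (Spec A)) (spec_section A x) ~: Units (stalk (Spec A) (pt pj p))"
  using ax.unit_germ[OF openin_topspace x0X ax.spec_section_in(1)[OF x(1)] x(1), of "\<one>.A"]
   primeidealD(1)[OF x0_prime] ax.spec_section_in(2)[OF x(1)] x0_iff[OF x0_prime] pt by simp
 hence gxG: "?gx : ?G" using x0X ax.spec_section_in(1)[OF x(1)] pt preX by (intro CollectI exI[of _ "pts (Spec A)"] exI[of _ "spec_section A x"]) simp
 have PIi: "ideal (PIdl .(stalk S p) ?gx) (stalk S p)" by (rule T.cgenideal_ideal[OF gx(1)])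
 have Gc: "?G \<subseteq> stalk S p" using GP ideal.Icarr[OF PIi] by blast
 have FIe: "FI p = PIdl .(stalk S p) ?gx" unfolding FI_def fiber_ideal_def
  by (intro equalityI T.genideal_minimal[OF PIi GP] T.cgenideal_minimal[OF T.genideal_ideal[OF Gc]] subsetD[OF T.genideal_self[OF Gc] gxG])
 show "ideal (FI p) (stalk S p)" "c : stalk S p ==> c : FI p \<longleftrightarrow> xd p (qS.sval c)" using FIe PIi PI by simp_all
qed

lemma coset_eq:
 assumes pZ: "p : Z" and U: "opn S U" "p : U" "s : sec S U" and V: "opn S V" "p : V" "t : sec S V"
 shows "FI p +>\<^bsub>stalk S p\<^esub> germ S p U s = FI p +>\<^bsub>stalk S p\<^esub> germ S p V t \<longleftrightarrow> xd p (vS U s \<ominus>.Q vS V t)"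
proof -
 have p: "p : pts S" using pZ by (simp add: Z_iff)
 interpret T: cring "stalk S p" by (rule stalk_ring[OF p])
 note sh = qS.stalk_hom[OF p] and gU = qS.germ_in_stalk[OF U] and gV = qS.germ_in_stalk[OF V]
 have "qS.sval (germ S p U s \<ominus>.(stalk S p) germ S p V t) = vS U s \<ominus>.Q vS V t"
  unfolding a_minus_def using inj_homD(4)[OF sh gU T.a_inv_closed[OF gV]]
   inj_hom_minus[OF sh T.ring_axioms Q.ring_axioms gV] by (simp add: qS.sval_germ U V)
 thus ?thesis
  using T.quotient_eq_iff_same_a_r_cos[OF FI_eq(1)[OF pZ] gU gV] FI_eq(2)[OF pZ T.minus_closed[OF gU gV]] by simp
qed

text \<open>The global function \<open>b\<close> restricted to the fiber, as an element of the stalk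
  of the fiber at \<open>p\<close>.\<close>

definition cls :: "'p => 'b => ('p set \<times> 's) set set" where
 "cls p b = FI p +>\<^bsub>stalk S p\<^esub> germ S p (pts S) (gsec b)"

lemma cls_eq:
 assumes "p : Z" "opn S U" "p : U" "s : sec S U" "b : B"
 shows "FI p +>\<^bsub>stalk S p\<^esub> germ S p U s = cls p b \<longleftrightarrow> xd p (vS U s \<ominus>.Q al b)"
 using coset_eq[OF assms(1-4) openin_topspace _ gsec(1)[OF assms(5)]] gsec(2)[OF assms(5)] assms(1) by (simp add: cls_def Z_iff)

lemma cls_cls: "p : Z ==> a : B ==> b : B ==> cls p a = cls p b \<longleftrightarrow> xd p (al a \<ominus>.Q al b)"
 using cls_eq[of p "pts S" "gsec a" b] gsec[of a] unfolding cls_def by (simp add: Z_iff)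

lemma cls0: "p : Z ==> b : B ==> cls p b = cls p \<zero>.B \<longleftrightarrow> xd p (al b)"
 using cls_cls[of p b "\<zero>.B"] al_zero(1) al_hom(2) by (simp add: Q.minus_eq)

lemma xd_mult: "p : pts S ==> xd p v ==> q : locq Q al B (pr p) ==> xd p (v \<otimes>.Q q)"
 using locq_ring(1,4)[OF pr_prime[of p]] alhx by (auto simp: xd_def Q.m_ac)

lemma xd_pr: assumes p: "p : Z" and b: "b : B" "xd p (al b)" shows "b : pr p"
proof -
 have P: "primeideal (pr p) B" "h x : pr p" using p Z_iff pr_prime by auto
 have "al b \<otimes>.Q inv .Q al (h x) : locq Q al B (pr p)" using b(2) by (simp add: xd_def)
 then obtain a f where a: "a : B" "f : carrier B - pr p" "al b \<otimes>.Q inv .Q al (h x) = al a \<otimes>.Q inv .Q al f" unfolding locq_def by blast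
 have "al (f \<otimes>.B b) = al (h x \<otimes>.B a)"
  using a b alhx al_hom(2,3) al_nz[OF P(1) a(2)] hxc Q.div_eq_div[of "al b" "al (h x)" "al a" "al f"] by simp
 hence "f \<otimes>.B b = h x \<otimes>.B a" using al_hom(6) a b hxc by simp
 thus ?thesis using primeidealD(4)[OF P(1), of f b] primeidealD(4)[OF P(1), of "h x" a] P(2) a b hxc by auto
qed

text \<open>The quotient \<open>b / x\<close> is regular at every prime: on the fiber by assumption,
  elsewhere because \<open>x\<close> is invertible. Hence it is a global function.\<close>

lemma in_xB:
 assumes b: "b : B" and all: "!!p. p : Z ==> xd p (al b)"
 shows "EX c:B. b = h x \<otimes>.B c"
proof -
 let ?v = "al b \<otimes>.Q inv .Q al (h x)"
 have v: "?v : Q" using b alhx al_hom(2) by simp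
 have "?v : locq Q al B P" if P: "primeideal P B" for P
 proof (cases "h x : P")
  case False thus ?thesis using b hxc unfolding locq_def by blast
 next
  case True
  obtain p where "p : pts S" "pr p = P" using pr_surj[OF P] by blast
  thus ?thesis using all[of p] True by (simp add: Z_iff xd_def)
 qed
 then obtain a m where "a : B" "?v \<otimes>.Q al (\<one>.B [^].B (m::nat)) = al a" using locq_all[OF v one_closed] by (auto simp: bopen_def)
 hence "a : B" "al b = al (h x \<otimes>.B a)" using v b alhx al_hom(2,3,5) hxc Q.div_eq_iff[of "al b" "al (h x)" "al a"] by (auto simp: Q.m_comm)
 thus ?thesis using al_hom(6)[of b "h x \<otimes>.B a"] b hxc by auto
qed

end


section \<open>The components of the special fiber\<close>

context dfmodel_inj
begin

abbreviation "Fib \<equiv> fiber S (Spec A) pj x0"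
abbreviation "ka \<equiv> A Quot x0"

lemma Fib_tsp: "tsp Fib = subtopology (tsp S) Z" by (simp add: fiber_def Z_def)

lemma Z_sub: "Z \<subseteq> pts S" by (auto simp: Z_iff)

lemma Fib_pts: "pts Fib = Z" using Z_sub by (auto simp: Fib_tsp)

lemma Fib_opn: "opn Fib V \<longleftrightarrow> (EX U. opn S U \<and> V = U \<inter> Z)" by (simp add: Fib_tsp openin_subtopology)

lemma Fib_sec: "sec Fib V = fun_ring V (\<lambda>p. stalk S p Quot FI p)
  {s : (\<Pi>\<^sub>E p\<in>V. carrier (stalk S p Quot FI p)). ALL p:V. EX U a. opn S U \<and> p : U \<and> a : sec S U \<and>
      (ALL q:V \<inter> U. s q = FI q +>\<^bsub>stalk S q\<^esub> germ S q U a)}"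
 by (simp add: fiber_def FI_def)

lemma cls_hom:
 assumes p: "p : Z" shows "cls p : ring_hom B (stalk S p Quot FI p)"
proof -
 have p': "p : pts S" using p Z_sub by blast
 interpret T: cring "stalk S p" by (rule stalk_ring[OF p'])
 interpret I: ideal "FI p" "stalk S p" by (rule FI_eq(1)[OF p])
 note sh = qS.stalk_hom[OF p']
 define g where "g b = germ S p (pts S) (gsec b)" for b
 have gc: "g b : stalk S p" "qS.sval (g b) = al b" if "b : B" for b
  using qS.germ_in_stalk[OF openin_topspace p' gsec(1)[OF that]] qS.sval_germ[OF openin_topspace p' gsec(1)[OF that]]
   gsec(2)[OF that] by (simp_all add: g_def)
 have eqI: "c = d" if "c : stalk S p" "d : stalk S p" "qS.sval c = qS.sval d" for c d
  using inj_homD(6)[OF sh] that by blast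
 have gh: "g : ring_hom B (stalk S p)"
 proof (rule ring_hom_memI)
  fix a b assume ab: "a : B" "b : B"
  show "g (a \<otimes>.B b) = g a \<otimes>.(stalk S p) g b"
   by (rule eqI) (simp_all add: gc ab inj_homD(3)[OF sh] al_hom(3))
  show "g (a \<oplus>.B b) = g a \<oplus>.(stalk S p) g b"
   by (rule eqI) (simp_all add: gc ab inj_homD(4)[OF sh] al_hom(4))
 next
  show "g \<one>.B = \<one>.(stalk S p)" by (rule eqI) (simp_all add: gc inj_homD(5)[OF sh] al_hom(5))
 qed (rule gc(1))
 have "cls p = (\<lambda>b. FI p +>\<^bsub>stalk S p\<^esub> b) \<circ> g" by (auto simp: cls_def g_def)
 thus ?thesis using ring_hom_trans[OF gh I.rcos_ring_hom] by simp
qed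

definition vanish :: "'p set => 'b set" where "vanish D = {b : B. ALL p:D. b : pr p}"

lemma vanish:
 assumes "D \<subseteq> pts S" shows "ideal (vanish D) B"
proof -
 have P: "primeideal (pr p) B" if "p : D" for p using pr_prime assms that by blast
 show ?thesis
 proof (rule idealI')
  show "\<zero>.B : vanish D" using primeidealD(3)[OF P] by (simp add: vanish_def)
  show "a : vanish D ==> b : vanish D ==> a \<oplus>.B b : vanish D" for a b
   using primeidealD(5)[OF P] by (simp add: vanish_def)
  show "a : vanish D ==> y : B ==> y \<otimes>.B a : vanish D" for a y
   using primeidealD(4)[OF P, of _ y a] by (simp add: vanish_def)
 qed (auto simp: vanish_def)
qed

lemma vanish_notin: "D \<subseteq> pts S ==> opn S (pts S - D) ==> p : pts S ==> p ~: D ==> EX b:vanish D. b ~: pr p"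
 using S_basis[of "pts S - D" p] unfolding vanish_def by blast

text \<open>Functions vanishing on the two parts are comaximal and their product is nilpotent on the fiber.\<close>

lemma fiber_idempotent:
 assumes C: "C \<subseteq> Z" and oC: "opn S (pts S - C)" and oC': "opn S (pts S - (Z - C))"
 shows "EX e:B. EX e':B. EX c:B. e \<oplus>.B e' = \<one>.B \<and> e \<otimes>.B e' = h x \<otimes>.B c \<and> (ALL p:Z - C. e : pr p) \<and> (ALL p:C. e' : pr p)"
proof -
 have sub: "C \<subseteq> pts S" "Z - C \<subseteq> pts S" using C Z_sub by auto
 let ?J = "vanish (Z - C) <+>.B vanish C"
 note I1 = vanish[OF sub(2)] and I2 = vanish[OF sub(1)]
 have mem: "u : vanish (Z - C) ==> v : vanish C ==> u \<oplus>.B v : ?J" for u v unfolding set_add_def' by blast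
 have "\<one>.B : ?J"
 proof (rule ideal_eq_carrier[OF add_ideals[OF I1 I2]])
  fix P assume P: "primeideal P B"
  obtain p where p: "p : pts S" "pr p = P" using pr_surj[OF P] by blast
  have z: "\<zero>.B : vanish D" if "D \<subseteq> pts S" for D by (rule additive_subgroup.zero_closed[OF ideal.axioms(1)[OF vanish[OF that]]])
  show "~ ?J \<subseteq> P"
  proof (cases "p : C")
   case True
   then obtain b where b: "b : vanish (Z - C)" "b ~: P" using vanish_notin[OF sub(2) oC' p(1)] p(2) by blast
   thus ?thesis using mem[OF b(1) z[OF sub(1)]] by (auto simp: vanish_def)
  next
   case False
   then obtain b where b: "b : vanish C" "b ~: P" using vanish_notin[OF sub(1) oC p(1)] p(2) by blast
   thus ?thesis using mem[OF z[OF sub(2)] b(1)] by (auto simp: vanish_def)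
  qed
 qed
 then obtain r s where rs: "\<one>.B = r \<oplus>.B s" "r : vanish (Z - C)" "s : vanish C" unfolding set_add_def' by blast
 hence rc: "r : B" "s : B" by (auto simp: vanish_def)
 \<comment> \<open>\<open>r\<close> vanishes on \<open>Z - C\<close> and \<open>s\<close> on
   \<open>C\<close>, so the product lies in every prime that contains \<open>h x\<close>.\<close>
 have "EX m::nat. (r \<otimes>.B s) [^].B m : PIdl .B (h x)"
 proof (rule radical_pow[OF cgenideal_ideal[OF hxc]])
  fix P assume P: "primeideal P B" "PIdl .B (h x) \<subseteq> P"
  obtain p where p: "p : pts S" "pr p = P" using pr_surj[OF P(1)] by blast
  hence "p : Z" using P(2) cgenideal_self[OF hxc] by (auto simp: Z_iff)
  thus "r \<otimes>.B s : P" using rs(2,3) primeidealD(4)[OF P(1) rc] p(2) unfolding vanish_def by blast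
 qed (use rc in simp)
 then obtain m c where m: "c : B" "(r \<otimes>.B s) [^].B (m::nat) = c \<otimes>.B h x" by (auto simp: cgenideal_def)
 \<comment> \<open>The exponent is \<open>Suc m\<close> and not \<open>m\<close>: for
   \<open>m = 0\<close> the powers would be 1 and vanish nowhere. The product of the two powers
   still contains \<open>(r s)^m\<close>, which is divisible by \<open>x\<close>.\<close>
 let ?r = "r [^].B Suc m" and ?s = "s [^].B Suc m"
 have "\<one>.B : {c \<otimes>.B ?r \<oplus>.B d \<otimes>.B ?s | c d. c : B \<and> d : B}" (is "_ : ?I")
 proof (rule ideal_eq_carrier[OF ideal_pair])
  fix P assume P: "primeideal P B"
  have r: "?r : ?I" by (intro CollectI exI[of _ "\<one>.B"] exI[of _ "\<zero>.B"]) (use rc in simp)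
  have s: "?s : ?I" by (intro CollectI exI[of _ "\<zero>.B"] exI[of _ "\<one>.B"]) (use rc in simp)
  show "~ ?I \<subseteq> P"
  proof
   assume "?I \<subseteq> P"
   hence "\<one>.B : P" unfolding rs(1)
    by (intro primeidealD(5)[OF P] primeidealD(6)[OF P rc(1) subsetD[OF _ r]] primeidealD(6)[OF P rc(2) subsetD[OF _ s]])
   thus False using primeidealD(1)[OF P] by simp
  qed
 qed (use rc in simp_all)
 then obtain a d where ad: "\<one>.B = a \<otimes>.B ?r \<oplus>.B d \<otimes>.B ?s" "a : B" "d : B" unfolding mem_Collect_eq by (elim exE conjE)
 have "(a \<otimes>.B ?r) \<otimes>.B (d \<otimes>.B ?s) = (a \<otimes>.B d \<otimes>.B r \<otimes>.B s) \<otimes>.B (r \<otimes>.B s) [^].B m"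
  using rc ad(2,3) by (simp add: nat_pow_distrib m_ac)
 also have "\<dots> = h x \<otimes>.B (a \<otimes>.B d \<otimes>.B r \<otimes>.B s \<otimes>.B c)" unfolding m(2) using rc ad(2,3) m(1) hxc by (simp add: m_ac)
 finally have e: "(a \<otimes>.B ?r) \<otimes>.B (d \<otimes>.B ?s) = h x \<otimes>.B (a \<otimes>.B d \<otimes>.B r \<otimes>.B s \<otimes>.B c)" .
 have pw: "a \<otimes>.B u [^].B Suc m : pr p" if "u : B" "u : pr p" "p : pts S" "a : B" for u p a
  using that primeidealD(4)[OF pr_prime[OF that(3)]] by simp
 show ?thesis
  by (rule bexI[where x = "a \<otimes>.B ?r"], rule bexI[where x = "d \<otimes>.B ?s"], rule bexI[where x = "a \<otimes>.B d \<otimes>.B r \<otimes>.B s \<otimes>.B c"],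
   intro conjI ballI, rule ad(1)[symmetric], rule e) (use rc ad(2,3) m(1) rs(2,3) sub pw in \<open>auto simp: vanish_def simp del: nat_pow_Suc\<close>)
qed

text \<open>\<open>q\<close> restricts a function to \<open>C\<close> and reads it as a polynomial
  through the given isomorphism with the line. \<open>C\<close> is open and closed in the fiber,
  which gives \<open>e\<close>; multiplying by \<open>e\<close> removes the other components, so
  that \<open>in_xB\<close> describes the kernel. Surjectivity of \<open>q\<close> says that
  functions on \<open>C\<close> extend to \<open>S\<close>; it is proved by collecting
  denominators.\<close>

lemma component_data:
 assumes oC: "opn Fib C" and oC': "opn Fib (Z - C)"
  and iso: "iso_over (Spec A) (restr Fib C) (mor_comp Fib (mor_comp S pj (fiber_incl S (Spec A) pj x0)) (incl Fib C))
    (Spec (UP ka)) (affine_line_map A ka (\<lambda>a. x0 +>.A a))"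
 shows "EX q e. q : ring_hom B (UP ka) \<and> q ` carrier B = carrier (UP ka) \<and>
  (ALL a:A. q (h a) = monom (UP ka) (x0 +>.A a) 0) \<and> e : B \<and> q e = \<one>.(UP ka) \<and>
  (ALL b:B. q b = \<zero>.(UP ka) --> (EX c:B. e \<otimes>.B b = h x \<otimes>.B c)) \<and>
  (ALL s:B. q s = \<one>.(UP ka) --> (ALL p:C. s ~: pr p)) \<and> (ALL p:Z - C. e : pr p)"
proof -
 let ?U = "UP ka"
 interpret x0: maximalideal x0 A by (rule x(2))
 interpret ka: field ka by (rule x0.quotient_is_field[OF A.is_cring])
 interpret UK: UP_domain ka ?U by unfold_locales simp
 interpret fu: dom_in_field ?U "localization ?U (carrier ?U - {\<zero>.?U})" "\<lambda>a. fraction ?U (carrier ?U - {\<zero>.?U}) a \<one>.?U"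
  by (rule domain.frac_dom_in_field[OF UK.UP_domain])
 let ?L = "Spec ?U"
 have CZ: "C \<subseteq> Z" using oC Fib_opn by auto
 have Cpts: "pts (restr Fib C) = C" using CZ by (simp add: Fib_pts Int_absorb1)
 have oCC: "opn (restr Fib C) C" using subtop_opn[OF oC] oC by simp
 obtain ps where ps: "is_iso (restr Fib C) ?L ps"
  and pseq: "mor_eq (restr Fib C) (Spec A) (mor_comp ?L (affine_line_map A ka (\<lambda>a. x0 +>.A a)) ps)
    (mor_comp Fib (mor_comp S pj (fiber_incl S (Spec A) pj x0)) (incl Fib C))"
  using iso unfolding iso_over_def by blast
 obtain om where psom: "inv_pair (restr Fib C) ?L ps om" using ps inv_pair_iso by blast
 note omps = inv_pair_sym[OF psom]
 note psD = inv_pairD[OF psom] and omD = inv_pairD[OF omps]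
 have preom: "pre ?L om C = pts ?L" using is_morD(6)[OF omD(1)] unfolding pre_def Cpts by blast
 have preps: "pre (restr Fib C) ps (pts ?L) = C" using is_morD(6)[OF psD(1)] unfolding pre_def Cpts by blast
 note omb = inv_pair_pull[OF omps oCC, unfolded preom restr_simps]
 have oL: "opn ?L (pts ?L)" by simp
 define fs where "fs b = (\<lambda>p\<in>C. cls p b)" for b
 have fsc: "fs b : sec Fib C" if b: "b : B" for b
 proof -
  have "fs b : (\<Pi>\<^sub>E p\<in>C. carrier (stalk S p Quot FI p))"
   using ring_hom_closed[OF cls_hom b] CZ by (auto simp: fs_def)
  moreover have "EX U a. opn S U \<and> p : U \<and> a : sec S U \<and>
      (ALL q:C \<inter> U. fs b q = FI q +>\<^bsub>stalk S q\<^esub> germ S q U a)" if "p : C" for p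
   using that CZ Z_sub gsec(1)[OF b] by (intro exI[of _ "pts S"] exI[of _ "gsec b"]) (auto simp: fs_def cls_def)
  ultimately show ?thesis unfolding Fib_sec by simp
 qed
 have fsh: "fs : ring_hom B (sec Fib C)"
 proof (rule ring_hom_memI)
  fix a b assume ab: "a : B" "b : B"
  show "fs (a \<otimes>.B b) = fs a \<otimes>.(sec Fib C) fs b" "fs (a \<oplus>.B b) = fs a \<oplus>.(sec Fib C) fs b"
   unfolding Fib_sec fs_def fun_ring_simps
   using ring_hom_mult[OF cls_hom ab] ring_hom_add[OF cls_hom ab] CZ by (auto simp: fun_eq_iff)
 next
  show "fs \<one>.B = \<one>.(sec Fib C)"
   unfolding Fib_sec fs_def fun_ring_simps using ring_hom_one[OF cls_hom] CZ by (auto simp: fun_eq_iff)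
 qed (rule fsc)
 note sb = fu.spec_section_bij
 let ?inv = "inv_into (carrier ?U) (spec_section ?U)"
 have "spec_section ?U : ring_iso ?U (sec ?L (pts ?L))" using sb by (simp add: ring_iso_def)
 hence "?inv : ring_iso (sec ?L (pts ?L)) ?U" by (rule ring_iso_set_sym[OF UK.UP_ring])
 hence invh: "?inv : ring_hom (sec ?L (pts ?L)) ?U" and invb: "bij_betw ?inv (carrier (sec ?L (pts ?L))) (carrier ?U)"
  by (auto simp: ring_iso_def)
 define q where "q b = ?inv (pull om C (fs b))" for b
 have qh: "q : ring_hom B ?U"
 proof -
  have "q = ?inv \<circ> (pull om C \<circ> fs)" by (auto simp: q_def)
  thus ?thesis using ring_hom_trans[OF ring_hom_trans[OF fsh omb(1)] invh] by simp
 qed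
 have qinj: "q b = q b' \<longleftrightarrow> (ALL p:C. cls p b = cls p b')" if b: "b : B" "b' : B" for b b'
 proof -
  have m: "pull om C (fs b) : sec ?L (pts ?L)" "pull om C (fs b') : sec ?L (pts ?L)"
   using ring_hom_closed[OF omb(1)] fsc b by auto
  have "q b = q b' \<longleftrightarrow> pull om C (fs b) = pull om C (fs b')"
   unfolding q_def using inj_on_eq_iff[OF bij_betw_imp_inj_on[OF invb] m] .
  also have "\<dots> \<longleftrightarrow> fs b = fs b'"
   using inj_on_eq_iff[OF bij_betw_imp_inj_on[OF omb(2)] fsc[OF b(1)] fsc[OF b(2)]] .
  also have "\<dots> \<longleftrightarrow> (ALL p:C. cls p b = cls p b')" by (auto simp: fs_def fun_eq_iff)
  finally show ?thesis .
 qed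
 have qsec: "q b = P" if "P : ?U" "fs b = pull ps (pts ?L) (spec_section ?U P)" for b P
 proof -
  have "pull om C (fs b) = spec_section ?U P"
   unfolding that(2) using omD(4)[OF oL fu.spec_section_in(1)[OF that(1)]] unfolding preps .
  thus ?thesis unfolding q_def using inv_into_f_f[OF bij_betw_imp_inj_on[OF sb(2)] that(1)] by simp
 qed
 have q0: "q \<zero>.B = \<zero>.?U" and q1: "q \<one>.B = \<one>.?U" using ring_hom_zero[OF qh ring_axioms UK.UP_ring] ring_hom_one[OF qh] .
 note qm = ring_hom_mult[OF qh] and qa = ring_hom_add[OF qh] and qc = ring_hom_closed[OF qh]
 have q0_iff: "q b = \<zero>.?U \<longleftrightarrow> (ALL p:C. xd p (al b))" if b: "b : B" for b
  unfolding q0[symmetric] qinj[OF b zero_closed] using cls0[OF _ b] CZ by blast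
 have P: "primeideal (pr p) B" "h x : pr p" "p : pts S" if "p : Z" for p using that Z_iff pr_prime by auto
 obtain U0 U1 where U0: "opn S U0" "C = U0 \<inter> Z" and U1: "opn S U1" "Z - C = U1 \<inter> Z"
  using oC oC' unfolding Fib_opn by blast
 have oZ: "opn S {p : pts S. h x ~: pr p}" by (rule opn_bopen[OF hxc])
 have "pts S - C = {p : pts S. h x ~: pr p} \<union> U1" "pts S - (Z - C) = {p : pts S. h x ~: pr p} \<union> U0"
  using U0(2) U1(2) CZ openin_subset[OF U0(1)] openin_subset[OF U1(1)] by (auto simp: Z_iff)
 hence "opn S (pts S - C)" "opn S (pts S - (Z - C))" using oZ U0(1) U1(1) by auto
 from fiber_idempotent[OF CZ this] obtain e e' c0 where e: "e : B" "e' : B" "c0 : B" "e \<oplus>.B e' = \<one>.B" "e \<otimes>.B e' = h x \<otimes>.B c0"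
  "ALL p:Z - C. e : pr p" "ALL p:C. e' : pr p" by (elim bexE conjE)
 have xh: "xd p (al (h x \<otimes>.B c))" if "p : Z" "c : B" for p c
  by (rule xdI[OF _ al_in_locq[OF P(1)[OF that(1)] that(2)] P(3)[OF that(1)]]) (use that(2) hxc al_hom(2,3) in \<open>simp_all add: Q.m_comm\<close>)
 have not_both: "~ (e : pr p \<and> e' : pr p)" if "p : Z" for p
  using primeidealD(1,5)[OF P(1)[OF that]] unfolding e(4)[symmetric] by blast
 obtain p0 where p0: "p0 : C" using preps omD(1) fu.zero_prime is_morD(6)[OF omD(1), of "{\<zero>.?U}"] Cpts by (auto simp: UK.topspace_zariski)
 have "q e \<otimes>.?U q e' = \<zero>.?U" unfolding qm[OF e(1,2), symmetric] e(5) using q0_iff[of "h x \<otimes>.B c0"] xh e(3) hxc CZ by blast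
 moreover have "q e ~= \<zero>.?U" using q0_iff[OF e(1)] xd_pr[OF _ e(1), of p0] not_both[of p0] e(7) p0 CZ by blast
 \<comment> \<open>Polynomials over the residue field form a domain, and \<open>e\<close> does not
   vanish on \<open>C\<close> because \<open>e'\<close> does. So it is the factor
   \<open>q e'\<close> that is zero.\<close>
 ultimately have qe': "q e' = \<zero>.?U" using UK.integral_iff qc e(1,2) by blast
 hence qe: "q e = \<one>.?U" using qa[OF e(1,2)] q1 qc[OF e(1)] unfolding e(4) by simp
 \<comment> \<open>On the rest of the fiber \<open>e'\<close> is invertible, and
   \<open>e = x c0 / e'\<close>.\<close>
 have xe: "xd p (al e)" if p: "p : Z - C" for p
 proof -
  have pZ: "p : Z" and n: "e' : carrier B - pr p" using p not_both[of p] e(2,6) by auto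
  note nz = al_nz[OF P(1)[OF pZ] n]
  have "al e = al (h x \<otimes>.B c0) \<otimes>.Q inv .Q al e'" unfolding e(5)[symmetric] using al_hom(2,3) e(1,2) nz by (simp add: Q.m_assoc)
  moreover have "inv .Q al e' : locq Q al B (pr p)" unfolding locq_def using n nz al_hom(2,5) by (intro CollectI exI[of _ "\<one>.B"] exI[of _ e']) simp
  ultimately show ?thesis using xd_mult[OF P(3)[OF pZ] xh[OF pZ e(3)]] by simp
 qed
 have ker: "EX c:B. e \<otimes>.B b = h x \<otimes>.B c" if b: "b : B" "q b = \<zero>.?U" for b
 proof (rule in_xB)
  fix p assume p: "p : Z"
  note l = al_in_locq[OF P(1)[OF p]] and xm = xd_mult[OF P(3)[OF p]]
  show "xd p (al (e \<otimes>.B b))"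
  proof (cases "p : C")
   case True thus ?thesis using xm[OF _ l[OF e(1)], of "al b"] q0_iff[OF b(1)] b al_hom(2,3) e(1) by (simp add: Q.m_comm)
  next
   case False thus ?thesis using xm[OF xe l[OF b(1)]] p al_hom(3)[OF e(1) b(1)] by simp
  qed
 qed (use e(1) b in simp)
 have npr: "s ~: pr p" if s: "s : B" "q s = \<one>.?U" and p: "p : C" for s p
 proof
  assume sp: "s : pr p"
  have pZ: "p : Z" using p CZ by blast
  interpret P: primeideal "pr p" B by (rule P(1)[OF pZ])
  have "q (s \<ominus>.B \<one>.B) = \<zero>.?U" unfolding a_minus_def
   using qa[of s "\<ominus>.B \<one>.B"] qa[of "\<one>.B" "\<ominus>.B \<one>.B"] s q0 q1 by (simp add: r_neg)
  hence "s \<ominus>.B \<one>.B : pr p" using q0_iff[of "s \<ominus>.B \<one>.B"] xd_pr[OF pZ] s(1) p by simp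
  hence "s \<ominus>.B (s \<ominus>.B \<one>.B) : pr p" using sp P.a_closed P.a_inv_closed unfolding a_minus_def by blast
  moreover have "s \<ominus>.B (s \<ominus>.B \<one>.B) = \<one>.B" using s(1) by (simp add: a_minus_def minus_add r_neg1 r_neg2)
  ultimately show False using primeidealD(1)[OF P(1)[OF pZ]] by simp
 qed
 \<comment> \<open>The \<open>s\<close> for which \<open>q s \<otimes> u\<close> is in the image
   form an ideal. For each prime it contains an element outside: a local denominator for a point of
   \<open>C\<close>, the function \<open>e'\<close> for another point of the fiber, and
   \<open>h x\<close> for a point off the fiber.\<close>
 have surj: "u : q ` carrier B" if u: "u : ?U" for u
 proof -
  let ?t = "pull ps (pts ?L) (spec_section ?U u)" and ?I = "{s : B. EX b:B. q s \<otimes>.?U u = q b}"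
  have t: "?t : sec Fib C" using is_morD(3)[OF psD(1) oL fu.spec_section_in(1)[OF u]] unfolding preps restr_simps .
  have zI: "s : ?I" if "s : B" "q s = \<zero>.?U" for s using that u by (auto intro!: bexI[of _ "\<zero>.B"] simp: q0)
  have "ideal ?I B"
  proof (rule idealI')
   fix a assume a: "a : ?I"
   then obtain a' where a': "a : B" "a' : B" "q a \<otimes>.?U u = q a'" by blast
   show "a \<oplus>.B b : ?I" if bI: "b : ?I" for b
   proof -
    obtain b' where "b : B" "b' : B" "q b \<otimes>.?U u = q b'" using bI by blast
    thus ?thesis using u a' by (auto simp: qa qc UK.P.l_distr intro!: bexI[of _ "a' \<oplus>.B b'"])
   qed
   show "y \<otimes>.B a : ?I" if "y : B" for y
    using u a' that by (auto simp: qm qc UK.P.m_assoc intro!: bexI[of _ "y \<otimes>.B a'"])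
  qed (use zI q0 in auto)
  hence "\<one>.B : ?I"
  proof (rule ideal_eq_carrier)
   fix P' assume P': "primeideal P' B"
   obtain p where p: "p : pts S" "pr p = P'" using pr_surj[OF P'] by blast
   show "~ ?I \<subseteq> P'"
   proof (cases "p : C")
    case True
    then obtain V a where V: "opn S V" "p : V" "a : sec S V" "!!p. p : C \<inter> V ==> ?t p = FI p +>\<^bsub>stalk S p\<^esub> germ S p V a"
     using t unfolding Fib_sec by auto
    obtain b g where bg: "b : B" "g : carrier B - pr p" "vS V a = al b \<otimes>.Q inv .Q al g" using vS_locq[OF V(1,3,2)] by (auto simp: locq_def)
    have g: "g : B" using bg(2) by simp
    \<comment> \<open>Near \<open>p\<close> the section given by \<open>u\<close> is the class of
      \<open>b / g\<close>, so multiplication by \<open>g\<close> makes it the class of a global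
      function.\<close>
    have "cls p' g \<otimes>.(stalk S p' Quot FI p') ?t p' = cls p' b" if p': "p' : C \<inter> V" for p'
    proof -
     have pZ: "p' : Z" and pV: "p' : V" and pS: "p' : pts S" using p' CZ Z_sub by auto
     interpret T: cring "stalk S p'" by (rule stalk_ring[OF pS])
     interpret I: ideal "FI p'" "stalk S p'" by (rule FI_eq(1)[OF pZ])
     note sh = inj_homD[OF qS.stalk_hom[OF pS]] and gg = gsec[OF g] and gb = gsec[OF bg(1)]
     note cg = qS.germ_in_stalk[OF openin_topspace pS gg(1)] and cb = qS.germ_in_stalk[OF openin_topspace pS gb(1)] and ca = qS.germ_in_stalk[OF V(1) pV V(3)]
     have "germ S p' (pts S) (gsec g) \<otimes>.(stalk S p') germ S p' V a = germ S p' (pts S) (gsec b)"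
      by (rule sh(6)[THEN iffD1, OF T.m_closed[OF cg ca] cb])
       (use al_nz[OF pr_prime[OF p(1)] bg(2)] al_hom(2) g bg(1) in \<open>simp add: sh(3)[OF cg ca] qS.sval_germ[OF openin_topspace pS gg(1)]
        qS.sval_germ[OF openin_topspace pS gb(1)] qS.sval_germ[OF V(1) pV V(3)] gg(2) gb(2) bg(3) Q.m_lcomm\<close>)
     thus ?thesis unfolding V(4)[OF p'] cls_def ring_hom_mult[OF I.rcos_ring_hom cg ca, symmetric] by simp
    qed
    hence eq: "res Fib C (C \<inter> V) (fs g \<otimes>.(sec Fib C) ?t) = res Fib C (C \<inter> V) (fs b)"
     unfolding Fib_sec fun_ring_simps by (auto simp: fiber_def fs_def fun_eq_iff restrict_def)
    note mo = is_morD[OF omD(1)] and wc = ring_hom_closed[OF omb(1)]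
    interpret SL: cring "sec ?L (pts ?L)" by (rule fu.sp.sec_cring[OF oL])
    have "pull ps (pts ?L) (pull om C (fs g) \<otimes>.(sec ?L (pts ?L)) spec_section ?U u) = fs g \<otimes>.(sec Fib C) ?t"
     using ring_hom_mult[OF is_morD(2)[OF psD(1) oL] wc[OF fsc[OF g]] fu.spec_section_in(1)[OF u]] psD(4)[OF oCC, unfolded restr_simps preom, OF fsc[OF g]]
     unfolding preps restr_simps by simp
    hence m1: "fs g \<otimes>.(sec Fib C) ?t : sec Fib C"
     using is_morD(3)[OF psD(1) oL SL.m_closed[OF wc[OF fsc[OF g]] fu.spec_section_in(1)[OF u]]] unfolding preps restr_simps by simp
    have W: "opn (restr Fib C) (C \<inter> V)" unfolding subtop_opn[OF oC Int_lower1] Fib_opn using U0 V(1) by (intro exI[of _ "U0 \<inter> V"]) auto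
    have ne: "pre ?L om (C \<inter> V) ~= {}" using psD(3)[of p] is_morD(6)[OF psD(1), of p] True V(2) unfolding Cpts pre_def by (auto intro!: exI[of _ "pt ps p"])
    \<comment> \<open>So far the two sections agree on \<open>C \<inter> V\<close> only. The line
      over the residue field is integral, so the value on a nonempty open set is the value
      everywhere, and they agree on all of \<open>C\<close>.\<close>
    have vl: "fu.sp.lc_val (pre ?L om (C \<inter> V)) (pull om (C \<inter> V) (res Fib C (C \<inter> V) s)) = fu.sp.lc_val (pts ?L) (pull om C s)" if s: "s : sec Fib C" for s
     using mo(4)[OF oCC W Int_lower1, unfolded restr_simps preom, OF s]
      fu.sp.restrict_in(2)[OF oL mo(7)[OF W] openin_subset[OF mo(7)[OF W]] wc[OF s] ne] by simp
    have "pull om C (fs g \<otimes>.(sec Fib C) ?t) = pull om C (fs b)"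
     by (rule fu.sp.sec_eqI[OF oL wc[OF m1] wc[OF fsc[OF bg(1)]]]) (use vl[OF m1] vl[OF fsc[OF bg(1)]] eq in simp)
    moreover have "?inv (pull om C ?t) = u"
     using omD(4)[OF oL fu.spec_section_in(1)[OF u]] inv_into_f_f[OF bij_betw_imp_inj_on[OF sb(2)] u] unfolding preps by simp
    ultimately have "q g \<otimes>.?U u = q b"
     unfolding q_def using ring_hom_mult[OF invh wc[OF fsc[OF g]] wc[OF t]] ring_hom_mult[OF omb(1) fsc[OF g] t] by simp
    hence "g : ?I" using g bg(1) by (intro CollectI conjI bexI[of _ b])
    thus ?thesis using bg(2) p(2) by blast
   next
    case False
    show ?thesis
    proof (cases "p : Z")
     case True
     have "e' : ?I" by (rule zI[OF e(2) qe'])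
     thus ?thesis using not_both[OF True] e(6) True False p(2) by blast
    next
     case F: False
     have "q (h x) = \<zero>.?U" using q0_iff[OF hxc] xh[of _ "\<one>.B"] hxc CZ by auto
     hence "h x : ?I" by (rule zI[OF hxc])
     thus ?thesis using F p by (auto simp: Z_iff)
    qed
   qed
  qed
  thus ?thesis using u q1 by auto
 qed
 \<comment> \<open>\<open>ps\<close> commutes with the maps to \<open>Spec A\<close>, so the
   restriction of \<open>a\<close> to \<open>C\<close> corresponds to the class of \<open>a\<close>
   as a constant polynomial.\<close>
 have compat: "q (h a) = monom ?U (x0 +>.A a) 0" if a: "a : A" for a
 proof (rule qsec)
  let ?k = "\<lambda>a. monom ?U (x0 +>.A a) 0"
  have kh: "?k : ring_hom A ?U"
   using ring_hom_trans[OF x0.rcos_ring_hom UK.const_ring_hom] by (simp add: comp_def)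
  show m: "?k a : ?U" using ring_hom_closed[OF kh a] .
  have o: "opn (Spec A) (pts (Spec A))" by simp
  note sa = ax.spec_section_in(1)[OF a]
  have "pull (affine_line_map A ka (\<lambda>a. x0 +>.A a)) (pts (Spec A)) (spec_section A a) = spec_section ?U (?k a)"
  proof -
   have r: "restrict (spec_section A a) (pts (Spec A)) = spec_section A a"
    unfolding spec_section_def by (auto simp: A.topspace_zariski)
   have "pull (affine_line_map A ka (\<lambda>a. x0 +>.A a)) (pts (Spec A)) (restrict (spec_section A a) (pts (Spec A)))
     = restrict (spec_section ?U (?k a)) {Q. primeideal Q ?U \<and> {a : A. ?k a : Q} : pts (Spec A)}"
    unfolding affine_line_map_def
    by (rule spec_map_section[OF A.is_cring UK.UP_cring kh a]) (simp add: A.topspace_zariski)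
   also have "{Q. primeideal Q ?U \<and> {a : A. ?k a : Q} : pts (Spec A)} = {Q. primeideal Q ?U}"
    using prime_preimage[OF A.is_cring UK.UP_cring kh] by (auto simp: A.topspace_zariski)
   also have "restrict (spec_section ?U (?k a)) {Q. primeideal Q ?U} = spec_section ?U (?k a)"
    unfolding spec_section_def by auto
   finally show ?thesis unfolding r .
  qed
  moreover have "pre ?L (affine_line_map A ka (\<lambda>a. x0 +>.A a)) (pts (Spec A)) = pts ?L"
   using prime_preimage[OF A.is_cring UK.UP_cring kh]
   by (auto simp: pre_def affine_line_map_def spec_map_def A.topspace_zariski cring.topspace_zariski[OF UK.UP_cring])
  ultimately have e: "pull ps (pts ?L) (spec_section ?U (?k a)) =
    pull (mor_comp Fib (mor_comp S pj (fiber_incl S (Spec A) pj x0)) (incl Fib C)) (pts (Spec A)) (spec_section A a)"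
   using mor_eqD(2)[OF pseq o sa] by (simp only: mor_comp_simps)
  have pf: "pre Fib (mor_comp S pj (fiber_incl S (Spec A) pj x0)) (pts (Spec A)) = Z"
   unfolding pre_def Fib_pts using pjD(6) Z_sub by (auto simp: mor_comp_def fiber_incl_def)
  have "pull (mor_comp Fib (mor_comp S pj (fiber_incl S (Spec A) pj x0)) (incl Fib C)) (pts (Spec A)) (spec_section A a)
   = res Fib Z (Z \<inter> C) (\<lambda>p\<in>Z \<inter> pts S. FI p +>\<^bsub>stalk S p\<^esub> germ S p (pts S) (pull pj (pts (Spec A)) (spec_section A a)))"
   unfolding mor_comp_simps pf preX by (simp add: incl_def fiber_incl_def Z_def FI_def preX del: Spec_simps)
  also have "\<dots> = fs (h a)"
  proof -
   have "germ S p (pts S) (pull pj (pts (Spec A)) (spec_section A a)) = germ S p (pts S) (gsec (h a))" if "p : pts S" for p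
    using qS.germ_eq[OF openin_topspace that pull_spec_section[OF a] openin_topspace that gsec(1)[OF h_val(1)[OF a]]]
     h_val(2)[OF a] gsec(2)[OF h_val(1)[OF a]] by simp
   thus ?thesis using CZ Z_sub by (auto simp: fiber_def fs_def cls_def fun_eq_iff)
  qed
  finally show "fs (h a) = pull ps (pts ?L) (spec_section ?U (?k a))" using e by simp
 qed
 have "q ` carrier B = carrier ?U" using surj qc by blast
 thus ?thesis using qh compat e(1,6) qe ker npr by blast
qed

end


section \<open>Generators of the components\<close>

text \<open>Polynomials are handled as lists of coefficients, constant term first. Zeros at the end
  are harmless, so no degree has to be tracked.\<close>

definition horner :: "('q, 'n) ring_scheme => 'q => 'q list => 'q" where
 "horner R z rs = foldr (\<lambda>r w. r \<oplus>.R z \<otimes>.R w) rs \<zero>.R"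

lemma horner_simps[simp]: "horner R z [] = \<zero>.R" "horner R z (r # rs) = r \<oplus>.R z \<otimes>.R horner R z rs"
 by (simp_all add: horner_def)

lemma (in ring) horner_closed[simp]: "z : R ==> set rs \<subseteq> R ==> horner R z rs : R"
 by (induction rs) auto

lemma horner_hom:
 assumes "ring R" "ring S" "f : ring_hom R S" "z : R" "set rs \<subseteq> R"
 shows "f (horner R z rs) = horner S (f z) (map f rs)"
 using assms(5)
proof (induction rs)
 case Nil thus ?case using ring_hom_zero[OF assms(3,1,2)] by simp
next
 case (Cons r rs)
 thus ?case using ring.horner_closed[OF assms(1,4)] ring.ring_simprules(5)[OF assms(1)] assms(4)
  by (simp add: ring_hom_add[OF assms(3)] ring_hom_mult[OF assms(3)])
qed

text \<open>If \<open>w\<close> were nonzero, \<open>th \<otimes> w\<close> would have positive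
  degree, yet it is minus a constant.\<close>

lemma (in UP_domain) const_add_mult_zero:
 assumes th: "th : P" "deg R th \<ge> 1" and a: "a : R" and w: "w : P"
  and e: "monom P a 0 \<oplus>.P th \<otimes>.P w = \<zero>.P"
 shows "w = \<zero>.P" "a = \<zero>"
proof -
 show w0: "w = \<zero>.P"
 proof (rule ccontr)
  assume nz: "w ~= \<zero>.P"
  have t0: "th ~= \<zero>.P" using th(2) by auto
  have "th \<otimes>.P w = \<ominus>.P monom P a 0"
   using P.sum_zero_eq_neg[of "th \<otimes>.P w" "monom P a 0"] e a w th(1) P.a_comm[of "monom P a 0" "th \<otimes>.P w"] by simp
  hence "deg R (th \<otimes>.P w) = 0" using a by simp
  thus False using deg_mult[OF t0 nz th(1) w] th(2) by simp
 qed
 hence "monom P a 0 = \<zero>.P" using e a th(1) by simp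
 thus "a = \<zero>" using monom_inj[of 0] a by (auto simp: inj_on_def)
qed

lemma (in UP_domain) horner_transcendental:
 assumes th: "th : P" "deg R th \<ge> 1" and "set as \<subseteq> R"
  and "horner P th (map (\<lambda>a. monom P a 0) as) = \<zero>.P"
 shows "set as \<subseteq> {\<zero>}"
 using assms(3,4)
proof (induction as)
 case (Cons a as)
 have "horner P th (map (\<lambda>a. monom P a 0) as) : P" using Cons.prems(1) th(1) by (auto intro!: P.horner_closed monom_closed)
 from const_add_mult_zero[OF th _ this, of a] show ?case using Cons by simp
qed simp

text \<open>The ring \<open>A[z]\<close> inside \<open>Q\<close>, generated by the Horner scheme:
  induction peels off the constant term, which suits divisibility arguments modulo
  \<open>x\<close>.\<close>

inductive_set poly_ring :: "('q, 'n) ring_scheme => ('a => 'q) => 'a set => 'q => 'q set" for Q et A z where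
 base: "a : A ==> et a : poly_ring Q et A z"
| step: "a : A ==> w : poly_ring Q et A z ==> et a \<oplus>.Q z \<otimes>.Q w : poly_ring Q et A z"

lemma poly_ring_minimal:
 assumes "w : poly_ring Q et A z" "!!a. a : A ==> et a : M" "z : M"
  "!!u v. u : M ==> v : M ==> u \<oplus>.Q v : M" "!!u v. u : M ==> v : M ==> u \<otimes>.Q v : M"
 shows "w : M"
 using assms(1) by induction (auto intro: assms(2-5))

locale poly_gen = A: cring A + Q: cring Q for A :: "('a, 'm) ring_scheme" and Q :: "('q, 'n) ring_scheme" and et and z +
 assumes et: "et : ring_hom A Q" and z: "z : Q"
begin

abbreviation "Az \<equiv> poly_ring Q et (carrier A) z"

lemma etc[simp]: "a : A ==> et a : Q" using et by (simp add: ring_hom_closed)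

lemma Az_carr: "w : Az ==> w : Q"
 by (induction rule: poly_ring.induct) (use z in auto)

lemma et0: "et \<zero>.A = \<zero>.Q" using ring_hom_zero[OF et A.ring_axioms Q.ring_axioms] .

lemma Az_z_mult: "w : Az ==> z \<otimes>.Q w : Az"
 using poly_ring.step[OF A.zero_closed, of w Q et z] z Az_carr[of w] by (simp add: et0)

lemma Az_gen: "z : Az"
 using Az_z_mult[OF poly_ring.base[OF A.one_closed]] z ring_hom_one[OF et] by simp

lemma Az_const_add: "a : A ==> w : Az ==> et a \<oplus>.Q w : Az"
proof (erule poly_ring.cases)
 fix b assume "a : A" "w = et b" "b : A"
 thus ?thesis using poly_ring.base[of "a \<oplus>.A b" "carrier A" et Q z] by (simp add: ring_hom_add[OF et])
next
 fix b v assume *: "a : A" "w = et b \<oplus>.Q z \<otimes>.Q v" "b : A" "v : Az"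
 thus ?thesis using poly_ring.step[of "a \<oplus>.A b" "carrier A" v Q et z] z Az_carr[of v]
  by (simp add: ring_hom_add[OF et] Q.a_assoc)
qed

lemma Az_add: "u : Az ==> w : Az ==> u \<oplus>.Q w : Az"
proof (induction arbitrary: w rule: poly_ring.induct)
 case (base a) thus ?case by (rule Az_const_add)
next
 case (step a u)
 from step.prems show ?case
 proof cases
  case (base b)
  hence "w \<oplus>.Q (et a \<oplus>.Q z \<otimes>.Q u) : Az" using Az_const_add poly_ring.step[OF step.hyps] by blast
  thus ?thesis using base step.hyps z Az_carr by (simp add: Q.a_comm)
 next
  case st: (step b v)
  have c: "u : Q" "v : Q" using step.hyps st Az_carr by auto
  have "(et a \<oplus>.Q z \<otimes>.Q u) \<oplus>.Q w = et (a \<oplus>.A b) \<oplus>.Q z \<otimes>.Q (u \<oplus>.Q v)"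
   unfolding st(1) using c z step.hyps(1) st(2) by (simp add: ring_hom_add[OF et] Q.r_distr Q.a_ac)
  thus ?thesis using poly_ring.step[OF A.a_closed[OF step.hyps(1) st(2)] step.IH[OF st(3)]] by simp
 qed
qed

lemma Az_const_mult: "w : Az ==> a : A ==> et a \<otimes>.Q w : Az"
proof (induction rule: poly_ring.induct)
 case (base b)
 thus ?case using poly_ring.base[of "a \<otimes>.A b" "carrier A" et Q z] by (simp add: ring_hom_mult[OF et])
next
 case (step b w)
 have "et a \<otimes>.Q (et b \<oplus>.Q z \<otimes>.Q w) = et (a \<otimes>.A b) \<oplus>.Q z \<otimes>.Q (et a \<otimes>.Q w)"
  using step z Az_carr[of w] by (simp add: ring_hom_mult[OF et] Q.r_distr Q.m_lcomm)
 thus ?case using poly_ring.step[OF A.m_closed[OF step.prems step.hyps(1)] step.IH[OF step.prems]] by simp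
qed

lemma Az_mult: "u : Az ==> w : Az ==> u \<otimes>.Q w : Az"
proof (induction rule: poly_ring.induct)
 case (base a) thus ?case by (rule Az_const_mult[rotated])
next
 case (step a u)
 have "(et a \<oplus>.Q z \<otimes>.Q u) \<otimes>.Q w = et a \<otimes>.Q w \<oplus>.Q z \<otimes>.Q (u \<otimes>.Q w)"
  using step Az_carr z by (simp add: Q.l_distr Q.m_assoc)
 thus ?case using Az_add Az_const_mult[OF step.prems step.hyps(1)] Az_z_mult[OF step.IH[OF step.prems]] by simp
qed

end

text \<open>Clearing denominators in a relation: the power of \<open>u\<close> is spread over the
  coefficients, and a polynomial in \<open>z\<close> becomes one in \<open>u \<otimes> z\<close>.
  For nonzero \<open>u\<close> in a domain the new coefficients vanish only with the old
  ones.\<close>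

lemma (in cring) horner_scale:
 assumes "u : R" "z : R" "set rs \<subseteq> R"
 shows "EX rs'. u [^] length rs \<otimes> horner R z rs = horner R (u \<otimes> z) rs' \<and>
  list_all2 (\<lambda>r r'. EX m::nat. r' = u [^] m \<otimes> r) rs rs'"
 using assms(3)
proof (induction rs)
 case Nil thus ?case using assms by (intro exI[of _ "[]"]) simp
next
 case (Cons r rs)
 then obtain rs' where rs': "u [^] length rs \<otimes> horner R z rs = horner R (u \<otimes> z) rs'"
  "list_all2 (\<lambda>r r'. EX m::nat. r' = u [^] m \<otimes> r) rs rs'" by auto
 have c: "r : R" "horner R z rs : R" using Cons.prems assms by auto
 have "u [^] length (r # rs) \<otimes> horner R z (r # rs) = u [^] Suc (length rs) \<otimes> r \<oplus> (u \<otimes> z) \<otimes> (u [^] length rs \<otimes> horner R z rs)"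
  using c assms by (simp add: r_distr m_ac)
 also have "\<dots> = horner R (u \<otimes> z) ((u [^] Suc (length rs) \<otimes> r) # rs')" by (simp add: rs'(1))
 finally have 1: "u [^] length (r # rs) \<otimes> horner R z (r # rs) = horner R (u \<otimes> z) ((u [^] Suc (length rs) \<otimes> r) # rs')" .
 have "EX m::nat. u [^] Suc (length rs) \<otimes> r = u [^] m \<otimes> r" by blast
 hence "list_all2 (\<lambda>r r'. EX m::nat. r' = u [^] m \<otimes> r) (r # rs) ((u [^] Suc (length rs) \<otimes> r) # rs')"
  using rs'(2) by (simp del: nat_pow_Suc)
 with 1 show ?case by blast
qed


text \<open>\<open>t_gen\<close> places \<open>B\<close> in \<open>A[t]\<close> after inverting
  \<open>x\<close>. \<open>q_ker\<close> is the form in which divisibility by \<open>x\<close> is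
  available when the fiber has further components: only after multiplication by
  \<open>e\<close>.\<close>

locale component = dom_in_field B Q al + A: domain A for B :: "('b, 'm) ring_scheme" and Q :: "'q ring" and al
  and A :: "'a ring" +
 fixes h x q e t
 assumes h_hom: "h : ring_hom A B" and h_inj: "inj_on h (carrier A)"
  and x: "x : A" "maximalideal (PIdl .A x) A" "x ~= \<zero>.A"
  and q_hom: "q : ring_hom B (UP (A Quot (PIdl .A x)))"
  and q_surj: "q ` carrier B = carrier (UP (A Quot (PIdl .A x)))"
  and q_h: "!!a. a : A ==> q (h a) = monom (UP (A Quot (PIdl .A x))) (PIdl .A x +>.A a) 0"
  and e: "e : B" "q e = \<one>\<^bsub>UP (A Quot (PIdl .A x))\<^esub>"
  and q_ker: "!!b. b : B ==> q b = \<zero>\<^bsub>UP (A Quot (PIdl .A x))\<^esub> ==> EX c:B. e \<otimes>.B b = h x \<otimes>.B c"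
  and t: "t : B"
  and t_gen: "!!b. b : B ==> EX m::nat. al (h x) [^].Q m \<otimes>.Q al b : poly_ring Q (\<lambda>a. al (h a)) (carrier A) (al t)"
begin

abbreviation "et \<equiv> \<lambda>a. al (h a)"
abbreviation "x0 \<equiv> PIdl .A x"
abbreviation "ka \<equiv> A Quot x0"
abbreviation "U \<equiv> UP ka"

sublocale x0: maximalideal x0 A by (rule x(2))
sublocale ka: field ka by (rule x0.quotient_is_field[OF A.is_cring])
sublocale UK: UP_domain ka U by unfold_locales simp

lemma et_inj: "inj_hom A Q et"
 using inj_hom_comp[of A B h Q al] h_hom h_inj al_inj by (simp add: inj_hom_def)

lemmas eth = inj_homD[OF et_inj] and et0 = inj_hom_zero[OF et_inj A.ring_axioms Q.ring_axioms]

lemma hc[simp]: "a : A ==> h a : B" using h_hom by (simp add: ring_hom_closed)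

lemma X[simp]: "et x : Q" "et x ~= \<zero>.Q" using eth(2)[OF x(1)] et0(2)[OF x(1)] x(3) by auto

lemma qc[simp]: "b : B ==> q b : U" using q_hom by (simp add: ring_hom_closed)

lemmas q_add = ring_hom_add[OF q_hom] and q_mult = ring_hom_mult[OF q_hom] and q_one = ring_hom_one[OF q_hom]

lemma q_zero: "q \<zero>.B = \<zero>.U" using ring_hom_zero[OF q_hom ring_axioms UK.UP_ring] .

text \<open>The localization of \<open>B\<close> at the functions that restrict to 1 on the
  component, inside \<open>Q\<close>; \<open>q\<close> extends to it as \<open>qt\<close>. On this
  ring the kernel is generated by \<open>x\<close>, by \<open>qt_zero\<close>.\<close>

definition Bq :: "'q set" where
 "Bq = {z : Q. EX s:B. EX b:B. q s = \<one>.U \<and> al s \<otimes>.Q z = al b}"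

definition qt where
 "qt z = (THE p. EX s:B. EX b:B. q s = \<one>.U \<and> al s \<otimes>.Q z = al b \<and> p = q b)"

lemma BqI: "z : Q ==> s : B ==> b : B ==> q s = \<one>.U ==> al s \<otimes>.Q z = al b ==> z : Bq"
 unfolding Bq_def by blast

lemma BqE:
 assumes "z : Bq"
 obtains s b where "z : Q" "s : B" "b : B" "q s = \<one>.U" "al s \<otimes>.Q z = al b"
 using assms unfolding Bq_def by blast

text \<open>Two presentations of \<open>z\<close> satisfy
  \<open>s \<otimes> b' = s' \<otimes> b\<close>, and \<open>q\<close> sends both \<open>s\<close>
  and \<open>s'\<close> to 1.\<close>

lemma qt_eq:
 assumes "z : Q" "s : B" "b : B" "q s = \<one>.U" "al s \<otimes>.Q z = al b"
 shows "qt z = q b"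
 unfolding qt_def
proof (rule the_equality)
 show "EX s:B. EX b':B. q s = \<one>.U \<and> al s \<otimes>.Q z = al b' \<and> q b = q b'" using assms by blast
 fix p assume "EX s:B. EX b:B. q s = \<one>.U \<and> al s \<otimes>.Q z = al b \<and> p = q b"
 then obtain s' b' where *: "s' : B" "b' : B" "q s' = \<one>.U" "al s' \<otimes>.Q z = al b'" "p = q b'" by blast
 have c: "al s : Q" "al s' : Q" using al_hom(2) assms(2) *(1) by auto
 have "al (s \<otimes>.B b') = al s \<otimes>.Q (al s' \<otimes>.Q z)" unfolding *(4) by (rule al_hom(3)[OF assms(2) *(2)])
 also have "\<dots> = al s' \<otimes>.Q (al s \<otimes>.Q z)" by (rule Q.m_lcomm[OF c assms(1)])
 also have "\<dots> = al (s' \<otimes>.B b)" unfolding assms(5) by (rule al_hom(3)[OF *(1) assms(3), symmetric])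
 finally have "s \<otimes>.B b' = s' \<otimes>.B b" using al_hom(6)[OF m_closed[OF assms(2) *(2)] m_closed[OF *(1) assms(3)]] by blast
 hence "q s \<otimes>.U q b' = q s' \<otimes>.U q b" using q_mult[OF assms(2) *(2)] q_mult[OF *(1) assms(3)] by simp
 thus "p = q b" using *(2,3,5) assms(3,4) by simp
qed

lemma Bq_B: "b : B ==> al b : Bq" "b : B ==> qt (al b) = q b"
 using BqI[of "al b" "\<one>.B" b] qt_eq[of "al b" "\<one>.B" b] al_hom(2,5) q_one by simp_all

lemma Bq_carr: "z : Bq ==> z : Q" unfolding Bq_def by blast

lemma Bq_ops:
 assumes z: "z : Bq" and w: "w : Bq"
 shows "z \<otimes>.Q w : Bq" "qt (z \<otimes>.Q w) = qt z \<otimes>.U qt w" "z \<oplus>.Q w : Bq" "qt (z \<oplus>.Q w) = qt z \<oplus>.U qt w"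
proof -
 obtain s b where zs: "z : Q" "s : B" "b : B" "q s = \<one>.U" "al s \<otimes>.Q z = al b" using z by (rule BqE)
 obtain s' b' where ws: "w : Q" "s' : B" "b' : B" "q s' = \<one>.U" "al s' \<otimes>.Q w = al b'" using w by (rule BqE)
 note [simp] = zs(1-4) ws(1-4) al_hom(2,3,4)
 have s: "s \<otimes>.B s' : B" "q (s \<otimes>.B s') = \<one>.U" by (simp_all add: q_mult)
 have "al (s \<otimes>.B s') \<otimes>.Q (z \<otimes>.Q w) = (al s \<otimes>.Q z) \<otimes>.Q (al s' \<otimes>.Q w)" by (simp add: Q.m_ac)
 hence m: "al (s \<otimes>.B s') \<otimes>.Q (z \<otimes>.Q w) = al (b \<otimes>.B b')" unfolding zs(5) ws(5) by simp
 have "al (s \<otimes>.B s') \<otimes>.Q (z \<oplus>.Q w) = al s' \<otimes>.Q (al s \<otimes>.Q z) \<oplus>.Q al s \<otimes>.Q (al s' \<otimes>.Q w)"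
  by (simp add: Q.r_distr Q.m_ac)
 hence a: "al (s \<otimes>.B s') \<otimes>.Q (z \<oplus>.Q w) = al (s' \<otimes>.B b \<oplus>.B s \<otimes>.B b')" unfolding zs(5) ws(5) by simp
 have qz: "qt z = q b" "qt w = q b'" using qt_eq[OF zs] qt_eq[OF ws] by blast+
 show "z \<otimes>.Q w : Bq" by (rule BqI[OF _ s(1) _ s(2) m]) simp_all
 show "z \<oplus>.Q w : Bq" by (rule BqI[OF _ s(1) _ s(2) a]) simp_all
 show "qt (z \<otimes>.Q w) = qt z \<otimes>.U qt w"
  using qt_eq[OF _ s(1) _ s(2) m] by (simp add: qz q_mult)
 show "qt (z \<oplus>.Q w) = qt z \<oplus>.U qt w"
  using qt_eq[OF _ s(1) _ s(2) a] by (simp add: qz q_mult q_add)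
qed

lemma qt_carr: "z : Bq ==> qt z : U"
 using qt_eq by (elim BqE) simp

lemma et_Bq: "a : A ==> et a : Bq" "a : A ==> qt (et a) = monom U (x0 +>.A a) 0"
 using Bq_B[of "h a"] q_h by auto

lemma coset_zero: "a : A ==> x0 +>.A a = \<zero>.ka \<longleftrightarrow> (EX a':A. a = x \<otimes>.A a')"
proof -
 assume a: "a : A"
 have "x0 +>.A a = \<zero>.ka \<longleftrightarrow> a : x0"
  using A.quotient_eq_iff_same_a_r_cos[OF x0.ideal_axioms a A.zero_closed] A.a_rcos_zero[OF x0.ideal_axioms x0.zero_closed] a
  by (simp add: FactRing_def a_minus_def)
 thus ?thesis unfolding cgenideal_def using A.m_comm[OF x(1)] by auto
qed

lemma coset_carr: "a : A ==> x0 +>.A a : ka"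
 using ring_hom_closed[OF x0.rcos_ring_hom] .

lemma qt_et_zero: "a : A ==> qt (et a) = \<zero>.U ==> EX a':A. a = x \<otimes>.A a'"
 using et_Bq(2)[of a] coset_zero[of a] coset_carr[of a] UK.monom_inj[of 0] by (auto simp: inj_on_def)

text \<open>\<open>e \<otimes> b\<close> is divisible by \<open>x\<close> in \<open>B\<close>, and
  the factor \<open>e\<close> costs nothing here, since \<open>e \<otimes> s\<close> is again sent
  to 1.\<close>

lemma qt_zero:
 assumes z: "z : Bq" and q0: "qt z = \<zero>.U"
 shows "EX z':Bq. z = et x \<otimes>.Q z'"
proof -
 obtain s b where zs: "z : Q" "s : B" "b : B" "q s = \<one>.U" "al s \<otimes>.Q z = al b" using z by (rule BqE)
 have "q b = \<zero>.U" using qt_eq[OF zs] q0 by simp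
 then obtain c where c: "c : B" "e \<otimes>.B b = h x \<otimes>.B c" using q_ker zs by blast
 note [simp] = zs(1-4) c(1) e al_hom(2) x(1)
 let ?z = "inv .Q et x \<otimes>.Q z"
 have es: "q (e \<otimes>.B s) = \<one>.U" by (simp add: q_mult)
 have 1: "al e \<otimes>.Q (al s \<otimes>.Q z) = et x \<otimes>.Q al c"
  using arg_cong[OF c(2), of al] zs(5) by (simp add: al_hom(3))
 have "al (e \<otimes>.B s) \<otimes>.Q ?z = inv .Q et x \<otimes>.Q (al e \<otimes>.Q (al s \<otimes>.Q z))"
  by (simp add: al_hom(3) Q.m_ac)
 also have "\<dots> = al c" unfolding 1 by simp
 finally have "?z : Bq" by (intro BqI[OF _ _ _ es]) simp_all
 moreover have "z = et x \<otimes>.Q ?z" by simp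
 ultimately show ?thesis by blast
qed

lemma qt_mult_x: "z : Bq ==> qt (et x \<otimes>.Q z) = \<zero>.U"
proof -
 assume z: "z : Bq"
 have "x = x \<otimes>.A \<one>.A" using x(1) by simp
 hence "x0 +>.A x = \<zero>.ka" using coset_zero[OF x(1)] A.one_closed by blast
 thus ?thesis using Bq_ops(2)[OF et_Bq(1)[OF x(1)] z] et_Bq(2)[OF x(1)] qt_carr[OF z] by simp
qed

lemma xpow_Bq: "et x [^].Q (m::nat) : Bq"
proof (induction m)
 case 0 thus ?case using et_Bq(1)[OF A.one_closed] eth(5) by simp
next
 case (Suc m) thus ?case using Bq_ops(1)[OF Suc et_Bq(1)[OF x(1)]] by simp
qed

text \<open>Induction on \<open>m\<close>: an element of \<open>A\<close> killed by
  \<open>qt\<close> has zero class in the residue field, hence is a multiple of \<open>x\<close> in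
  \<open>A\<close> itself, and this factor can be cancelled.\<close>

lemma et_in_xpow: "a : A ==> w : Bq ==> et a = et x [^].Q (m::nat) \<otimes>.Q w ==>
  EX a':A. et a = et x [^].Q m \<otimes>.Q et a'"
proof (induction m arbitrary: a)
 case 0
 show ?case using eth(2)[OF 0(1)] 0(1) by (intro bexI[of _ a]) simp_all
next
 case (Suc m)
 note wc = Bq_carr[OF Suc.prems(2)]
 have 1: "et a = et x \<otimes>.Q (et x [^].Q m \<otimes>.Q w)" using Suc.prems(3) wc by (simp add: Q.m_ac)
 have mB: "et x [^].Q m \<otimes>.Q w : Bq" by (rule Bq_ops(1)[OF xpow_Bq Suc.prems(2)])
 have "qt (et a) = \<zero>.U" unfolding 1 by (rule qt_mult_x[OF mB])
 from qt_et_zero[OF Suc.prems(1) this] obtain a1 where a1: "a1 : A" "a = x \<otimes>.A a1" by (rule bexE)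
 have e: "et a = et x \<otimes>.Q et a1" unfolding a1(2) by (rule eth(3)[OF x(1) a1(1)])
 have "et x \<otimes>.Q et a1 = et x \<otimes>.Q (et x [^].Q m \<otimes>.Q w)" unfolding e[symmetric] by (rule 1)
 hence "et a1 = et x [^].Q m \<otimes>.Q w" by (rule Q.l_cancel[OF X eth(2)[OF a1(1)] Bq_carr[OF mB], THEN iffD1])
 from Suc.IH[OF a1(1) Suc.prems(2) this] obtain a' where a': "a' : A" "et a1 = et x [^].Q m \<otimes>.Q et a'" by blast
 have "et a = et x [^].Q Suc m \<otimes>.Q et a'" unfolding e a'(2) using eth(2)[OF a'(1)] by (simp add: Q.m_ac)
 thus ?case using a'(1) by blast
qed

lemma pg: "z : Q ==> poly_gen A Q et z"
 using A.is_cring Q.is_cring eth(1) by (simp add: poly_gen_def poly_gen_axioms_def)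

text \<open>Subtracting from \<open>t\<close> the constant it takes on the component and dividing by \<open>x\<close> must stop, because
 otherwise every element of \<open>B\<close> would be constant on the component.\<close>

lemma ex_generator:
 "EX m a t1. a : A \<and> t1 : Bq \<and> al t = et a \<oplus>.Q et x [^].Q (m::nat) \<otimes>.Q t1 \<and> deg ka (qt t1) \<ge> 1"
proof (rule ccontr)
 assume no: "~ ?thesis"
 \<comment> \<open>As long as the quotient \<open>t1\<close> is constant on the component, a lift
   \<open>c\<close> of that constant is subtracted and another factor \<open>x\<close> comes
   out.\<close>
 have all: "EX a:A. EX t1:Bq. al t = et a \<oplus>.Q et x [^].Q m \<otimes>.Q t1" for m :: nat
 proof (induction m)
  case 0
  show ?case using Bq_B(1)[OF t] al_hom(2)[OF t] et0(1)
   by (intro bexI[of _ "\<zero>.A"] bexI[of _ "al t"]) simp_all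
 next
  case (Suc m)
  then obtain a t1 where at: "a : A" "t1 : Bq" "al t = et a \<oplus>.Q et x [^].Q m \<otimes>.Q t1" by blast
  hence "deg ka (qt t1) = 0" using no by (meson less_one not_le)
  hence "qt t1 = monom U (coeff U (qt t1) 0) 0" using UK.deg_zero_impl_monom qt_carr[OF at(2)] by blast
  moreover have "coeff U (qt t1) 0 : ka" using qt_carr[OF at(2)] by simp
  then obtain c where c: "c : A" "coeff U (qt t1) 0 = x0 +>.A c" by (auto simp: FactRing_def A_RCOSETS_def')
  ultimately have qc: "qt t1 = qt (et c)" using et_Bq(2) by simp
  let ?z = "t1 \<oplus>.Q et (\<ominus>.A c)"
  have "qt ?z = qt (et c) \<oplus>.U qt (et (\<ominus>.A c))" using Bq_ops(4)[OF at(2) et_Bq(1)] c qc by simp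
  also have "\<dots> = qt (et c \<oplus>.Q et (\<ominus>.A c))" using Bq_ops(4)[OF et_Bq(1) et_Bq(1)] c by simp
  also have "et c \<oplus>.Q et (\<ominus>.A c) = et \<zero>.A" using eth(4)[of c "\<ominus>.A c"] c(1) by (simp add: A.r_neg)
  also have "qt (et \<zero>.A) = \<zero>.U" using Bq_B(2)[OF zero_closed] al_zero(1) et0(1) q_zero by simp
  finally obtain z' where z': "z' : Bq" "?z = et x \<otimes>.Q z'" using qt_zero[OF Bq_ops(3)[OF at(2) et_Bq(1)]] c by blast
  note [simp] = Bq_carr[OF at(2)] Bq_carr[OF z'(1)] eth(2)
  have "et c \<oplus>.Q ?z = t1"
   using c(1) eth(4)[of c "\<ominus>.A c"] et0(1) by (simp add: A.r_neg Q.a_lcomm)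
  hence t1: "t1 = et c \<oplus>.Q et x \<otimes>.Q z'" unfolding z'(2) by simp
  have xm: "et x [^].Q m = et (x [^].A m)"
  proof (induction m)
   case 0 thus ?case using eth(5) by simp
  next
   case (Suc m) thus ?case using eth(3)[of "x [^].A m" x] x(1) by simp
  qed
  have "al t = et (a \<oplus>.A x [^].A m \<otimes>.A c) \<oplus>.Q et x [^].Q Suc m \<otimes>.Q z'"
  proof -
   have "al t = et a \<oplus>.Q (et x [^].Q m \<otimes>.Q et c \<oplus>.Q (et x [^].Q m \<otimes>.Q et x) \<otimes>.Q z')"
    unfolding at(3) t1 using c(1) at(1) by (simp add: Q.r_distr Q.m_assoc)
   also have "\<dots> = (et a \<oplus>.Q et x [^].Q m \<otimes>.Q et c) \<oplus>.Q et x [^].Q Suc m \<otimes>.Q z'"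
    using c(1) at(1) by (simp add: Q.a_assoc)
   also have "et a \<oplus>.Q et x [^].Q m \<otimes>.Q et c = et (a \<oplus>.A x [^].A m \<otimes>.A c)"
    unfolding xm using eth(3,4) c(1) at(1) x(1) by simp
   finally show ?thesis .
  qed
  thus ?case using c(1) at(1) x(1) z'(1) by (intro bexI[of _ "a \<oplus>.A x [^].A m \<otimes>.A c"] bexI[of _ z']) auto
 qed
 \<comment> \<open>The contradiction will come from a function restricting to the coordinate of the
   component: it is shown to be constant there.\<close>
 have "monom U \<one>.ka 1 : q ` carrier B" unfolding q_surj by simp
 then obtain b where b: "b : B" "q b = monom U \<one>.ka 1" by auto
 obtain N :: nat where N: "et x [^].Q N \<otimes>.Q al b : poly_ring Q et (carrier A) (al t)" using t_gen[OF b(1)] by blast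
 \<comment> \<open>One more than the exponent that brings \<open>b\<close> into \<open>A[t]\<close>:
   after cancelling \<open>x^N\<close> a factor \<open>x\<close> remains, which \<open>qt\<close>
   kills.\<close>
 let ?X = "et x [^].Q Suc N"
 obtain a t1 where at: "a : A" "t1 : Bq" "al t = et a \<oplus>.Q ?X \<otimes>.Q t1" using all by blast
 \<comment> \<open>\<open>A + x^(N+1) Bq\<close> is closed under the ring operations and contains
   \<open>A\<close> and \<open>t\<close>, hence also \<open>x^N b\<close>.\<close>
 let ?M = "{et a \<oplus>.Q ?X \<otimes>.Q w | a w. a : A \<and> w : Bq}"
 have Xc: "?X : Q" by (rule Q.nat_pow_closed) simp
 have Bz: "\<zero>.Q : Bq" using et_Bq(1)[OF A.zero_closed] et0(1) by simp
 have "et x [^].Q N \<otimes>.Q al b : ?M"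
 proof (rule poly_ring_minimal[OF N])
  show "et a : ?M" if "a : A" for a
   using that Bz Xc eth(2)[OF that] by (intro CollectI exI[of _ a] exI[of _ "\<zero>.Q"]) (simp del: Q.nat_pow_Suc)
  show "al t : ?M" using at by blast
  fix u v assume "u : ?M" "v : ?M"
  then obtain a w a' w' where uv: "u = et a \<oplus>.Q ?X \<otimes>.Q w" "v = et a' \<oplus>.Q ?X \<otimes>.Q w'"
   "a : A" "a' : A" "w : Bq" "w' : Bq" by blast
  note c = Bq_carr[OF uv(5)] Bq_carr[OF uv(6)] eth(2)[OF uv(3)] eth(2)[OF uv(4)] Xc
  have "u \<oplus>.Q v = et (a \<oplus>.A a') \<oplus>.Q ?X \<otimes>.Q (w \<oplus>.Q w')"
   unfolding uv(1,2) eth(4)[OF uv(3,4)] using c by (simp add: Q.r_distr Q.a_ac del: Q.nat_pow_Suc)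
  thus "u \<oplus>.Q v : ?M" using A.add.m_closed[OF uv(3,4)] Bq_ops(3)[OF uv(5,6)] by blast
  let ?y = "et a \<otimes>.Q w' \<oplus>.Q w \<otimes>.Q v"
  have vB: "v : Bq" unfolding uv(2)
   by (rule Bq_ops(3)[OF et_Bq(1)[OF uv(4)] Bq_ops(1)[OF xpow_Bq uv(6)]])
  have yB: "?y : Bq" by (rule Bq_ops(3)[OF Bq_ops(1)[OF et_Bq(1)[OF uv(3)] uv(6)] Bq_ops(1)[OF uv(5) vB]])
  have vc: "v : Q" using vB by (rule Bq_carr)
  have "u \<otimes>.Q v = et a \<otimes>.Q v \<oplus>.Q (?X \<otimes>.Q w) \<otimes>.Q v" unfolding uv(1) using c vc by (simp add: Q.l_distr del: Q.nat_pow_Suc)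
  also have "et a \<otimes>.Q v = et a \<otimes>.Q et a' \<oplus>.Q ?X \<otimes>.Q (et a \<otimes>.Q w')"
   unfolding uv(2) using c by (simp add: Q.r_distr Q.m_lcomm del: Q.nat_pow_Suc)
  also have "et a \<otimes>.Q et a' \<oplus>.Q ?X \<otimes>.Q (et a \<otimes>.Q w') \<oplus>.Q (?X \<otimes>.Q w) \<otimes>.Q v = et (a \<otimes>.A a') \<oplus>.Q ?X \<otimes>.Q ?y"
   unfolding eth(3)[OF uv(3,4)] using c vc by (simp add: Q.r_distr Q.a_assoc Q.m_assoc del: Q.nat_pow_Suc)
  finally show "u \<otimes>.Q v : ?M" using A.m_closed[OF uv(3,4)] yB by blast
 qed
 then obtain a' w where aw: "a' : A" "w : Bq" "et x [^].Q N \<otimes>.Q al b = et a' \<oplus>.Q ?X \<otimes>.Q w" by blast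
 note [simp] = Bq_carr[OF aw(2)] al_hom(2)[OF b(1)] eth(2)
 have XN: "et x [^].Q N : Q" "et x [^].Q N ~= \<zero>.Q" by simp_all
 have mw: "(\<ominus>.Q (et x \<otimes>.Q w)) = et x \<otimes>.Q (al (\<ominus>.B \<one>.B) \<otimes>.Q w)"
  using inj_hom_minus[OF al_inj ring_axioms Q.ring_axioms one_closed] al_hom(5) by (simp add: Q.l_minus Q.r_minus)
 let ?w = "al b \<oplus>.Q (et x \<otimes>.Q (al (\<ominus>.B \<one>.B) \<otimes>.Q w))"
 have m1w: "al (\<ominus>.B \<one>.B) \<otimes>.Q w : Bq" using Bq_ops(1)[OF Bq_B(1) aw(2)] by simp
 have wB: "?w : Bq" using Bq_ops(3)[OF Bq_B(1)[OF b(1)] Bq_ops(1)[OF et_Bq(1)[OF x(1)] m1w]] .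
 have bw: "al b = ?w \<oplus>.Q et x \<otimes>.Q w" unfolding mw[symmetric] by (simp add: Q.a_assoc Q.l_neg)
 have "et x [^].Q N \<otimes>.Q ?w \<oplus>.Q ?X \<otimes>.Q w = et x [^].Q N \<otimes>.Q (?w \<oplus>.Q et x \<otimes>.Q w)"
  using Bq_carr[OF wB] by (simp add: Q.r_distr Q.m_assoc)
 also have "\<dots> = et a' \<oplus>.Q ?X \<otimes>.Q w" unfolding bw[symmetric] aw(3) ..
 finally have "et a' = et x [^].Q N \<otimes>.Q ?w"
  using Bq_carr[OF wB] Xc aw(1) by (simp del: Q.nat_pow_Suc)
 \<comment> \<open>So \<open>x^N\<close> divides \<open>a'\<close> already in \<open>A\<close>, and
   \<open>b\<close> is congruent to an element of \<open>A\<close> modulo \<open>x\<close>.\<close>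
 from et_in_xpow[OF aw(1) wB this] obtain a2 where a2: "a2 : A" "et a' = et x [^].Q N \<otimes>.Q et a2" by blast
 have "et x [^].Q N \<otimes>.Q ?w = et x [^].Q N \<otimes>.Q et a2" using \<open>et a' = et x [^].Q N \<otimes>.Q ?w\<close> a2(2) by metis
 hence "?w = et a2" using Q.l_cancel[OF XN Bq_carr[OF wB]] a2(1) by simp
 hence "al b = et a2 \<oplus>.Q et x \<otimes>.Q w" using bw by metis
 hence "q b = qt (et a2) \<oplus>.U \<zero>.U"
  using Bq_ops(4)[OF et_Bq(1)[OF a2(1)] Bq_ops(1)[OF et_Bq(1)[OF x(1)] aw(2)]] qt_mult_x[OF aw(2)] Bq_B(2)[OF b(1)] by simp
 hence "q b = monom U (x0 +>.A a2) 0" using et_Bq(2)[OF a2(1)] coset_carr[OF a2(1)] by simp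
 hence "deg ka (q b) = 0" using coset_carr[OF a2(1)] by simp
 moreover have "deg ka (monom U \<one>.ka 1) = 1" using ka.one_not_zero by simp
 ultimately show False using b(2) by simp
qed

end


section \<open>Functions near a component as polynomials in the new coordinate\<close>

locale generator = component B Q al A h x q e t for B :: "('b, 'm) ring_scheme" and Q :: "'q ring" and al
  and A :: "'a ring" and h x q e t +
 fixes a and m :: nat and t1
 assumes a: "a : A" and t1: "t1 : Bq" and t_t1: "al t = et a \<oplus>.Q et x [^].Q m \<otimes>.Q t1"
  and deg_t1: "deg ka (qt t1) \<ge> 1"
begin

lemma t1c[simp]: "t1 : Q" using Bq_carr[OF t1] .

sublocale g: poly_gen A Q et t1 by (rule pg[OF t1c])

abbreviation "T \<equiv> poly_ring Q et (carrier A) t1"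

lemma T_Bq: "w : T ==> w : Bq"
 by (rule poly_ring_minimal[of w Q et "carrier A" t1]) (auto intro: et_Bq t1 Bq_ops)

lemma x_pow_T: "et x [^].Q (k::nat) : T"
proof (induction k)
 case 0 show ?case using poly_ring.base[OF A.one_closed, of et Q t1] eth(5) by simp
next
 case (Suc k) thus ?case using g.Az_mult[OF Suc poly_ring.base[OF x(1)]] by simp
qed

text \<open>\<open>qt t1\<close> has positive degree, so a polynomial in it over the residue field
  vanishes only with all its coefficients. The coefficients in \<open>A\<close> are then multiples
  of \<open>x\<close>.\<close>

lemma T_qt_zero: "w : T ==> qt w = \<zero>.U ==> EX w':T. w = et x \<otimes>.Q w'"
proof (induction rule: poly_ring.induct)
 case (base b)
 obtain b' where b': "b' : A" "b = x \<otimes>.A b'" using qt_et_zero[OF base] by (rule bexE)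
 show ?case unfolding b'(2) 
  by (rule bexI[where x = "et b'"], rule eth(3)[OF x(1) b'(1)], rule poly_ring.base[OF b'(1)])
next
 case (step b w)
 have wB: "w : Bq" by (rule T_Bq[OF step.hyps(2)])
 have e: "monom U (x0 +>.A b) 0 \<oplus>.U qt t1 \<otimes>.U qt w = \<zero>.U"
  using step.prems Bq_ops(4)[OF et_Bq(1)[OF step.hyps(1)] Bq_ops(1)[OF t1 wB]] Bq_ops(2)[OF t1 wB] et_Bq(2)[OF step.hyps(1)]
  by simp
 note z = UK.const_add_mult_zero[OF qt_carr[OF t1] deg_t1 coset_carr[OF step.hyps(1)] qt_carr[OF wB] e]
 from step.IH[OF z(1)] obtain w' where w': "w' : T" "w = et x \<otimes>.Q w'" by (rule bexE)
 from z(2)[unfolded coset_zero[OF step.hyps(1)]] obtain b' where b': "b' : A" "b = x \<otimes>.A b'" by (rule bexE)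
 have c: "w' : Q" "et b' : Q" using g.Az_carr[OF w'(1)] b'(1) by auto
 have "et b \<oplus>.Q t1 \<otimes>.Q w = et x \<otimes>.Q (et b' \<oplus>.Q t1 \<otimes>.Q w')"
  unfolding b'(2) w'(2) eth(3)[OF x(1) b'(1)] using c by (simp add: Q.r_distr Q.m_lcomm)
 thus ?case by (rule bexI[OF _ poly_ring.step[OF b'(1) w'(1)]])
qed

text \<open>The factors \<open>x\<close> are divided out one at a time: a multiple of
  \<open>x\<close> is killed by \<open>qt\<close>, and \<open>T_qt_zero\<close> finds the quotient
  inside \<open>T\<close>. So \<open>A[t1]\<close> is saturated with respect to \<open>x\<close> in
  \<open>Bq\<close>.\<close>

lemma T_div: "z : Bq ==> et x [^].Q (k::nat) \<otimes>.Q z : T ==> z : T"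
proof (induction k)
 case 0 thus ?case using Bq_carr[OF 0(1)] by simp
next
 case (Suc k)
 note zc = Bq_carr[OF Suc.prems(1)]
 have kB: "et x [^].Q k \<otimes>.Q z : Bq" by (rule Bq_ops(1)[OF xpow_Bq Suc.prems(1)])
 have e: "et x [^].Q Suc k \<otimes>.Q z = et x \<otimes>.Q (et x [^].Q k \<otimes>.Q z)" using zc by (simp add: Q.m_ac)
 from T_qt_zero[OF Suc.prems(2)[unfolded e] qt_mult_x[OF kB]] obtain w'
  where w': "w' : T" "et x \<otimes>.Q (et x [^].Q k \<otimes>.Q z) = et x \<otimes>.Q w'" by (rule bexE)
 have "et x [^].Q k \<otimes>.Q z = w'" by (rule Q.l_cancel[OF X Bq_carr[OF kB] g.Az_carr[OF w'(1)], THEN iffD1, OF w'(2)])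
 thus ?case using Suc.IH[OF Suc.prems(1)] w'(1) by simp
qed

text \<open>A power of \<open>x\<close> moves \<open>b\<close> into \<open>A[t]\<close>, which is
  part of \<open>A[t1]\<close>, and saturation removes the power again.\<close>

lemma B_T: assumes b: "b : B" shows "al b : T"
proof -
 obtain N :: nat where N: "et x [^].Q N \<otimes>.Q al b : poly_ring Q et (carrier A) (al t)" using t_gen[OF b] by (rule exE)
 have "al t : T" unfolding t_t1 by (rule g.Az_const_add[OF a g.Az_mult[OF x_pow_T g.Az_gen]])
 hence "et x [^].Q N \<otimes>.Q al b : T"
  by (intro poly_ring_minimal[OF N]) (auto intro: poly_ring.base g.Az_add g.Az_mult)
 thus ?thesis by (rule T_div[OF Bq_B(1)[OF b]])
qed

lemma T_B: assumes "w : T" shows "EX s:B. EX b:B. q s = \<one>.U \<and> al s \<otimes>.Q w = al b"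
 using T_Bq[OF assms] unfolding Bq_def by blast

text \<open>\<open>s - 1\<close> lies in \<open>A[t1]\<close> and is killed by
  \<open>qt\<close>.\<close>

lemma unit_T:
 assumes s: "s : B" "q s = \<one>.U" shows "EX w:T. al s = \<one>.Q \<oplus>.Q et x \<otimes>.Q w"
proof -
 let ?s = "s \<oplus>.B \<ominus>.B \<one>.B"
 have sc: "?s : B" using s by simp
 interpret qh: ring_hom_ring B U q by (rule ring_hom_ringI2[OF ring_axioms UK.UP_ring q_hom])
 have "qt (al ?s) = \<zero>.U" unfolding Bq_B(2)[OF sc] using s by (simp add: UK.P.r_neg)
 from T_qt_zero[OF B_T[OF sc] this] obtain w where w: "w : T" "al ?s = et x \<otimes>.Q w" by (rule bexE)
 have "s = \<one>.B \<oplus>.B ?s" using s a_lcomm[of "\<one>.B" s "\<ominus>.B \<one>.B"] by (simp add: r_neg)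
 hence "al s = al (\<one>.B \<oplus>.B ?s)" by (rule arg_cong)
 also have "\<dots> = \<one>.Q \<oplus>.Q et x \<otimes>.Q w" unfolding w(2)[symmetric] using al_hom(4)[OF one_closed sc] al_hom(5) by simp
 finally show ?thesis by (rule bexI[OF _ w(1)])
qed

text \<open>The generator is \<open>(t - a) / x^m\<close>, and the elements carried into
  \<open>B\<close> by a power of \<open>x\<close> form a ring.\<close>

lemma T_pow_B: assumes "w : T" shows "EX k::nat. EX b:B. et x [^].Q k \<otimes>.Q w = al b"
proof -
 let ?M = "{w : Q. EX k::nat. EX b:B. et x [^].Q k \<otimes>.Q w = al b}"
 have Xk: "et x [^].Q (k::nat) = al (h x [^].B k)" for k
 proof (induction k)
  case 0 show ?case using al_hom(5) by simp
 next
  case (Suc k) thus ?case using al_hom(3)[of "h x [^].B k" "h x"] x(1) by simp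
 qed
 have hk: "h x [^].B k : B" for k :: nat using x(1) by simp
 have MI: "w : ?M" if "w : Q" "et x [^].Q (k::nat) \<otimes>.Q w = al b" "b : B" for w k b using that by blast
 have "w : ?M"
 proof (rule poly_ring_minimal[OF assms])
  show "et a : ?M" if "a : A" for a using that by (intro MI[of _ 0 "h a"]) auto
  have "al t = et a \<oplus>.Q (al (t \<oplus>.B \<ominus>.B h a))"
   using a t al_hom(2,4) inj_hom_minus[OF al_inj ring_axioms Q.ring_axioms, of "h a"]
    Q.a_lcomm[of "et a" "al t" "\<ominus>.Q (et a)"] by (simp add: Q.r_neg)
  hence "et a \<oplus>.Q et x [^].Q m \<otimes>.Q t1 = et a \<oplus>.Q (al (t \<oplus>.B \<ominus>.B h a))" unfolding t_t1[symmetric] .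
  hence "et x [^].Q m \<otimes>.Q t1 = al (t \<oplus>.B \<ominus>.B h a)"
   by (rule Q.add.l_cancel) (use a t al_hom(2) in simp_all)
  thus "t1 : ?M" by (rule MI[OF t1c]) (use a t in simp)
  fix u v assume u0: "u : ?M" and v0: "v : ?M"
  from u0[unfolded mem_Collect_eq] obtain k b where u: "u : Q" "et x [^].Q (k::nat) \<otimes>.Q u = al b" "b : B" by (elim conjE exE bexE) (rule that)
  from v0[unfolded mem_Collect_eq] obtain k' b' where v: "v : Q" "et x [^].Q (k'::nat) \<otimes>.Q v = al b'" "b' : B" by (elim conjE exE bexE) (rule that)
  have p: "et x [^].Q (k + k') = et x [^].Q k \<otimes>.Q et x [^].Q k'" by (simp add: Q.nat_pow_mult)
  have Xc: "et x [^].Q k : Q" "et x [^].Q k' : Q" by simp_all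
  have "et x [^].Q (k + k') \<otimes>.Q (u \<otimes>.Q v) = (et x [^].Q k \<otimes>.Q u) \<otimes>.Q (et x [^].Q k' \<otimes>.Q v)"
   unfolding p using Xc u(1) v(1) by (simp add: Q.m_ac del: Q.nat_pow_closed)
  also have "\<dots> = al (b \<otimes>.B b')" unfolding u(2) v(2) al_hom(3)[OF u(3) v(3)] ..
  finally show "u \<otimes>.Q v : ?M" by (rule MI[rotated]) (use u(1,3) v(1,3) in auto)
  have "et x [^].Q (k + k') \<otimes>.Q (u \<oplus>.Q v)
   = et x [^].Q k' \<otimes>.Q (et x [^].Q k \<otimes>.Q u) \<oplus>.Q et x [^].Q k \<otimes>.Q (et x [^].Q k' \<otimes>.Q v)"
   unfolding p using Xc u(1) v(1) by (simp add: Q.m_ac Q.r_distr Q.l_distr del: Q.nat_pow_closed)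
  also have "\<dots> = al (h x [^].B k' \<otimes>.B b \<oplus>.B h x [^].B k \<otimes>.B b')"
   unfolding u(2) v(2) al_hom(4)[OF m_closed[OF hk u(3)] m_closed[OF hk v(3)]] al_hom(3)[OF hk u(3)] al_hom(3)[OF hk v(3)] Xk[symmetric] ..
  finally show "u \<oplus>.Q v : ?M" by (rule MI[rotated]) (use u(1,3) v(1,3) x(1) in auto)
 qed
 thus ?thesis by blast
qed

text \<open>Scaling turns a relation for \<open>t1\<close> into one for
  \<open>x^m t1 = t - a\<close>. This is the image under the injective \<open>\<Psi>\<close> of a
  polynomial of degree 1 over \<open>A\<close>, and such a polynomial satisfies no relation.\<close>

lemma transcendental:
 assumes \<Psi>: "inj_hom (UP A) Q \<Psi>" "!!a. a : A ==> \<Psi> (monom (UP A) a 0) = et a"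
  and t: "al t = \<Psi> (monom (UP A) \<one>.A 1) \<otimes>.Q et x [^].Q (M::nat)"
  and as: "set as \<subseteq> A" "horner Q t1 (map et as) = \<zero>.Q"
 shows "set as \<subseteq> {\<zero>.A}"
proof -
 interpret UA: UP_domain A "UP A" by unfold_locales simp
 note \<Psi>h = inj_homD[OF \<Psi>(1)] and \<Psi>0 = inj_hom_zero[OF \<Psi>(1) UA.UP_ring Q.ring_axioms]
 have Xk: "et x [^].Q (k::nat) = et (x [^].A k)" for k
 proof (induction k)
  case 0 show ?case using eth(5) by simp
 next
  case (Suc k) thus ?case using eth(3)[of "x [^].A k" x] x(1) by simp
 qed
 let ?th = "monom (UP A) (x [^].A M) 1 \<oplus>.(UP A) monom (UP A) (\<ominus>.A a) 0"
 have xnz: "x [^].A k ~= \<zero>.A" for k :: nat by (induction k) (use x in \<open>auto simp: A.integral_iff\<close>)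
 have thc: "?th : UP A" using x(1) a by simp
 have "deg A ?th = 1"
  using UA.deg_add[of "monom (UP A) (x [^].A M) 1" "monom (UP A) (\<ominus>.A a) 0"] UA.deg_belowI[of 1 ?th] x(1) a xnz
  by (simp add: le_antisym)
 have "monom (UP A) (x [^].A M) 1 = monom (UP A) \<one>.A 1 \<otimes>.(UP A) monom (UP A) (x [^].A M) 0"
  using UA.monom_mult[of "\<one>.A" "x [^].A M" 1 0] x(1) by simp
 hence "\<Psi> ?th = al t \<oplus>.Q et (\<ominus>.A a)"
  using x(1) a by (simp add: \<Psi>h(3,4) \<Psi>(2) t Xk del: UA.monom_a_inv)
 also have "\<dots> = et x [^].Q m \<otimes>.Q t1"
  using a inj_hom_minus[OF et_inj A.ring_axioms Q.ring_axioms a] eth(2)[OF a] unfolding t_t1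
  by (simp add: Q.a_assoc Q.l_neg Q.r_neg Q.a_comm[of "et a"])
 finally have th: "\<Psi> ?th = et x [^].Q m \<otimes>.Q t1" .
 have "set (map et as) \<subseteq> Q" using as(1) by auto
 from Q.horner_scale[OF _ t1c this, of "et x [^].Q m"] obtain rs where rs: "horner Q (et x [^].Q m \<otimes>.Q t1) rs = \<zero>.Q"
  "list_all2 (\<lambda>r r'. EX k::nat. r' = (et x [^].Q m) [^].Q k \<otimes>.Q r) (map et as) rs" unfolding as(2) by auto
 \<comment> \<open>The scaled coefficients still come from \<open>A\<close>, and each of them
   vanishes only with the original one, as \<open>A\<close> is a domain and \<open>x\<close> is
   nonzero.\<close>
 from rs(2) as(1) have "EX bs. rs = map et bs \<and> list_all2 (\<lambda>b c. b : A \<and> (b = \<zero>.A --> c = \<zero>.A)) bs as"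
 proof (induction as arbitrary: rs)
  case (Cons c as)
  then obtain r rs' k where r: "rs = r # rs'" "r = (et x [^].Q m) [^].Q (k::nat) \<otimes>.Q et c"
   "list_all2 (\<lambda>r r'. EX k::nat. r' = (et x [^].Q m) [^].Q k \<otimes>.Q r) (map et as) rs'" by (auto simp: list_all2_Cons1)
  from Cons.IH[OF r(3)] Cons.prems(2) obtain bs where bs: "rs' = map et bs" "list_all2 (\<lambda>b c. b : A \<and> (b = \<zero>.A --> c = \<zero>.A)) bs as" by auto
  let ?b = "x [^].A (m * k) \<otimes>.A c"
  have c: "c : A" using Cons.prems(2) by simp
  have "r = et ?b" using c x(1) by (simp add: r(2) Q.nat_pow_pow Xk[symmetric] eth(3))
  moreover have "?b : A \<and> (?b = \<zero>.A --> c = \<zero>.A)" using c x(1) xnz[of "m * k"] A.integral_iff by simp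
  ultimately show ?case using r(1) bs by (intro exI[of _ "?b # bs"]) simp
 qed simp
 then obtain bs where bs: "rs = map et bs" "list_all2 (\<lambda>b c. b : A \<and> (b = \<zero>.A --> c = \<zero>.A)) bs as"
  by (elim exE conjE) (rule that)
 have bsc: "set bs \<subseteq> A" using bs(2) by (auto simp: list_all2_conv_all_nth in_set_conv_nth)
 have "\<Psi> (horner (UP A) ?th (map (\<lambda>a. monom (UP A) a 0) bs)) = horner Q (\<Psi> ?th) (map \<Psi> (map (\<lambda>a. monom (UP A) a 0) bs))"
  by (rule horner_hom[OF UA.UP_ring Q.ring_axioms \<Psi>h(1) thc]) (use bsc in auto)
 also have "map \<Psi> (map (\<lambda>a. monom (UP A) a 0) bs) = rs" unfolding bs(1) using bsc \<Psi>(2) by auto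
 finally have e: "\<Psi> (horner (UP A) ?th (map (\<lambda>a. monom (UP A) a 0) bs)) = \<zero>.Q" unfolding th rs(1) .
 have "set (map (\<lambda>a. monom (UP A) a 0) bs) \<subseteq> UP A" using bsc by auto
 from \<Psi>0(2)[OF UA.P.horner_closed[OF thc this], THEN iffD1, OF e]
 have "horner (UP A) ?th (map (\<lambda>a. monom (UP A) a 0) bs) = \<zero>.(UP A)" .
 hence "set bs \<subseteq> {\<zero>.A}" using UA.horner_transcendental[OF thc _ bsc] \<open>deg A ?th = 1\<close> by simp
 with bs(2) show ?thesis by (induction rule: list_all2_induct) auto
qed

end


section \<open>Symmetric algebras\<close>

lemma finite_splittings: "finite {(a, b). a + b = (m :: 'g multiset)}"
proof (induction m)
 case empty
 have "{(a, b). a + b = ({#} :: 'g multiset)} = {({#}, {#})}" by auto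
 thus ?case by simp
next
 case (add u m)
 have "{(a, b). a + b = add_mset u m} \<subseteq> (\<lambda>(a, b). (add_mset u a, b)) ` {(a, b). a + b = m}
   \<union> (\<lambda>(a, b). (a, add_mset u b)) ` {(a, b). a + b = m}"
 proof clarify
  fix a b assume e: "a + b = add_mset u m" and n: "(a, b) ~: (\<lambda>(a, b). (a, add_mset u b)) ` {(a, b). a + b = m}"
  have "u \<in># a + b" unfolding e by simp
  moreover have "u ~:# b"
  proof
   assume "u \<in># b"
   then obtain b' where "b = add_mset u b'" by (meson mset_add)
   thus False using e n by (auto simp: image_iff)
  qed
  ultimately obtain a' where "a = add_mset u a'" by (meson mset_add union_iff)
  thus "(a, b) : (\<lambda>(a, b). (add_mset u a, b)) ` {(a, b). a + b = m}" using e by (auto simp: image_iff)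
 qed
 thus ?case using add finite_subset by blast
qed

lemma free_calg_simps[simp]:
 "monoid.mult (free_calg R G) = (\<lambda>p q m. \<Oplus>\<^bsub>R\<^esub>ab\<in>{(a, b). a + b = m}. p (fst ab) \<otimes>.R q (snd ab))"
 "one (free_calg R G) = (\<lambda>m. if m = {#} then \<one>.R else \<zero>.R)"
 "ring.zero (free_calg R G) = (\<lambda>m. \<zero>.R)"
 "add (free_calg R G) = (\<lambda>p q m. p m \<oplus>.R q m)"
 by (simp_all add: free_calg_def)

definition fsupp :: "('a, 'm) ring_scheme => ('g multiset => 'a) => 'g multiset set" where
 "fsupp R p = {m. p m ~= \<zero>.R}"

lemma free_calg_carrier: "p : free_calg R G \<longleftrightarrow>
  (ALL m. p m : R) \<and> finite (fsupp R p) \<and> (ALL m:fsupp R p. set_mset m \<subseteq> G)"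
 by (auto simp: free_calg_def fsupp_def)

text \<open>Evaluations are of this form, and so are coefficients; this gives both multiplicativity of
 evaluations and associativity.\<close>

definition lfun :: "('a, 'm) ring_scheme => ('b, 'n) ring_scheme => ('a => 'b) => ('g multiset => 'b) =>
  ('g multiset => 'a) => 'b" where
 "lfun R S h fi p = (\<Oplus>\<^bsub>S\<^esub>m\<in>fsupp R p. h (p m) \<otimes>.S fi m)"

lemma (in cring) free_add:
 assumes "p : free_calg R G" "q : free_calg R G"
 shows "fsupp R (\<lambda>m. p m \<oplus> q m) \<subseteq> fsupp R p \<union> fsupp R q" "(\<lambda>m. p m \<oplus> q m) : free_calg R G"
proof -
 show s: "fsupp R (\<lambda>m. p m \<oplus> q m) \<subseteq> fsupp R p \<union> fsupp R q" by (auto simp: fsupp_def)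
 have "finite (fsupp R (\<lambda>m. p m \<oplus> q m))" using finite_subset[OF s] assms unfolding free_calg_carrier by blast
 thus "(\<lambda>m. p m \<oplus> q m) : free_calg R G" using assms s unfolding free_calg_carrier by blast
qed

context ring_hom_cring
begin

lemma lfun_sup:
 assumes p: "p : free_calg R G" and F: "finite F" "fsupp R p \<subseteq> F" and fi: "!!m. fi m : S"
 shows "lfun R S h fi p = (\<Oplus>\<^bsub>S\<^esub>m\<in>F. h (p m) \<otimes>.S fi m)"
 unfolding lfun_def
 by (rule S.add.finprod_mono_neutral_cong_left) (use assms in \<open>auto simp: free_calg_carrier fsupp_def\<close>)

lemma lfun_closed: "p : free_calg R G ==> (!!m. fi m : S) ==> lfun R S h fi p : S"
 unfolding lfun_def by (rule S.finsum_closed) (auto simp: free_calg_carrier)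

lemma lfun_add:
 assumes p: "p : free_calg R G" and q: "q : free_calg R G" and fi: "!!m. fi m : S"
 shows "lfun R S h fi (\<lambda>m. p m \<oplus> q m) = lfun R S h fi p \<oplus>.S lfun R S h fi q"
proof -
 let ?F = "fsupp R p \<union> fsupp R q"
 note pq = R.free_add(2)[OF p q]
 have F: "finite ?F" "fsupp R p \<subseteq> ?F" "fsupp R q \<subseteq> ?F" "fsupp R (\<lambda>m. p m \<oplus> q m) \<subseteq> ?F"
  using p q R.free_add(1)[OF p q] by (auto simp: free_calg_carrier)
 have c: "p m : R" "q m : R" for m using p q by (auto simp: free_calg_carrier)
 have "lfun R S h fi (\<lambda>m. p m \<oplus> q m) = (\<Oplus>\<^bsub>S\<^esub>m\<in>?F. h (p m) \<otimes>.S fi m \<oplus>.S h (q m) \<otimes>.S fi m)"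
  unfolding lfun_sup[OF pq F(1,4) fi] by (rule S.finsum_cong') (use c fi in \<open>auto simp: S.l_distr\<close>)
 also have "\<dots> = lfun R S h fi p \<oplus>.S lfun R S h fi q"
  unfolding lfun_sup[OF p F(1,2) fi] lfun_sup[OF q F(1,3) fi] using c fi by (intro S.finsum_addf) auto
 finally show ?thesis .
qed

lemma finsum_times:
 assumes "finite M" "finite N" "!!a b. a : M ==> b : N ==> g a b : S"
 shows "(\<Oplus>\<^bsub>S\<^esub>ab\<in>M \<times> N. g (fst ab) (snd ab)) = (\<Oplus>\<^bsub>S\<^esub>a\<in>M. \<Oplus>\<^bsub>S\<^esub>b\<in>N. g a b)"
proof -
 have "(\<Oplus>\<^bsub>S\<^esub>ab\<in>(\<Union>a\<in>M. {a} \<times> N). g (fst ab) (snd ab)) = (\<Oplus>\<^bsub>S\<^esub>a\<in>M. \<Oplus>\<^bsub>S\<^esub>ab\<in>{a} \<times> N. g (fst ab) (snd ab))"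
  by (rule S.add.finprod_UN_disjoint) (use assms in \<open>auto simp: pairwise_def disjnt_def\<close>)
 also have "\<dots> = (\<Oplus>\<^bsub>S\<^esub>a\<in>M. \<Oplus>\<^bsub>S\<^esub>b\<in>N. g a b)"
 proof (rule S.finsum_cong')
  fix a assume a: "a : M"
  have i: "{a} \<times> N = Pair a ` N" by auto
  have "(\<lambda>ab. g (fst ab) (snd ab)) : Pair a ` N \<rightarrow> carrier S" using assms(3)[OF a] by auto
  from S.finsum_reindex[OF this] show "(\<Oplus>\<^bsub>S\<^esub>ab\<in>{a} \<times> N. g (fst ab) (snd ab)) = (\<Oplus>\<^bsub>S\<^esub>b\<in>N. g a b)"
   unfolding i by (simp add: inj_on_def)
 qed (use assms in auto)
 also have "(\<Union>a\<in>M. {a} \<times> N) = M \<times> N" by auto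
 finally show ?thesis .
qed

lemma conv_support:
 assumes p: "p : free_calg R G" and q: "q : free_calg R G"
 shows "fsupp R (p \<otimes>.(free_calg R G) q) \<subseteq> (\<lambda>(a, b). a + b) ` (fsupp R p \<times> fsupp R q)"
proof
 fix m assume m: "m : fsupp R (p \<otimes>.(free_calg R G) q)"
 have c: "p m : R" "q m : R" for m using p q by (auto simp: free_calg_carrier)
 show "m : (\<lambda>(a, b). a + b) ` (fsupp R p \<times> fsupp R q)"
 proof (rule ccontr)
  assume "m ~: (\<lambda>(a, b). a + b) ` (fsupp R p \<times> fsupp R q)"
  hence *: "p (fst ab) = \<zero> \<or> q (snd ab) = \<zero>" if "ab : {(a, b). a + b = m}" for ab
   using that by (force simp: image_iff fsupp_def)
  have "p (fst ab) \<otimes> q (snd ab) = \<zero>" if "ab : {(a, b). a + b = m}" for ab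
   using *[OF that] c by auto
  hence "(p \<otimes>.(free_calg R G) q) m = \<zero>" unfolding free_calg_simps by (rule R.add.finprod_one_eqI)
  thus False using m by (simp add: fsupp_def)
 qed
qed

lemma conv_closed:
 assumes p: "p : free_calg R G" and q: "q : free_calg R G"
 shows "p \<otimes>.(free_calg R G) q : free_calg R G"
proof -
 have "finite ((\<lambda>(a, b). a + b) ` (fsupp R p \<times> fsupp R q))" using p q by (auto simp: free_calg_carrier)
 hence "finite (fsupp R (p \<otimes>.(free_calg R G) q))" using conv_support[OF p q] finite_subset by blast
 moreover have "set_mset m \<subseteq> G" if "m : fsupp R (p \<otimes>.(free_calg R G) q)" for m
  using conv_support[OF p q] that p q by (fastforce simp: free_calg_carrier)
 moreover have "(p \<otimes>.(free_calg R G) q) m : R" for m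
  unfolding free_calg_simps by (rule R.finsum_closed) (use p q in \<open>auto simp: free_calg_carrier\<close>)
 ultimately show ?thesis unfolding free_calg_carrier by blast
qed

text \<open>The sum over the support of the product is regrouped along pairs with
  \<open>a + b = m\<close>; pairs outside the two supports contribute zero. The nested form on the
  right no longer mentions the convolution.\<close>

lemma lfun_conv:
 assumes p: "p : free_calg R G" and q: "q : free_calg R G" and fi: "!!m. fi m : S"
 shows "lfun R S h fi (p \<otimes>.(free_calg R G) q) = lfun R S h (\<lambda>a. lfun R S h (\<lambda>b. fi (a + b)) q) p"
proof -
 let ?M = "fsupp R p" and ?N = "fsupp R q"
 let ?D = "(\<lambda>(a, b). a + b) ` (?M \<times> ?N)"
 let ?T = "\<lambda>m. {(a, b). a + b = m}"
 let ?g = "\<lambda>a b. h (p a) \<otimes>.S (h (q b) \<otimes>.S fi (a + b))"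
 have fin: "finite ?M" "finite ?N" using p q by (auto simp: free_calg_carrier)
 have c[simp]: "p m : R" "q m : R" for m using p q by (auto simp: free_calg_carrier)
 have g: "?g a b : S" for a b using fi by simp
 have inner: "h ((p \<otimes>.(free_calg R G) q) m) \<otimes>.S fi m = (\<Oplus>\<^bsub>S\<^esub>ab\<in>?T m \<inter> (?M \<times> ?N). ?g (fst ab) (snd ab))" for m
 proof -
  have "h ((p \<otimes>.(free_calg R G) q) m) \<otimes>.S fi m = (\<Oplus>\<^bsub>S\<^esub>ab\<in>?T m. (h (p (fst ab)) \<otimes>.S h (q (snd ab))) \<otimes>.S fi m)"
   using fi by (simp add: finite_splittings S.finsum_ldistr Pi_def o_def)
  also have "\<dots> = (\<Oplus>\<^bsub>S\<^esub>ab\<in>?T m \<inter> (?M \<times> ?N). ?g (fst ab) (snd ab))"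
  proof (rule S.add.finprod_mono_neutral_cong_right)
   fix ab assume "ab : ?T m - ?T m \<inter> (?M \<times> ?N)"
   hence "p (fst ab) = \<zero> \<or> q (snd ab) = \<zero>" by (auto simp: fsupp_def)
   thus "h (p (fst ab)) \<otimes>.S h (q (snd ab)) \<otimes>.S fi m = \<zero>.S" using fi by auto
  qed (use fi in \<open>auto simp: finite_splittings S.m_assoc\<close>)
  finally show ?thesis .
 qed
 have "lfun R S h fi (p \<otimes>.(free_calg R G) q) = (\<Oplus>\<^bsub>S\<^esub>m\<in>?D. \<Oplus>\<^bsub>S\<^esub>ab\<in>?T m \<inter> (?M \<times> ?N). ?g (fst ab) (snd ab))"
  unfolding inner[symmetric]
  by (rule lfun_sup[OF conv_closed[OF p q] _ conv_support[OF p q] fi]) (use fin in simp)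
 also have "\<dots> = (\<Oplus>\<^bsub>S\<^esub>ab\<in>(\<Union>m\<in>?D. ?T m \<inter> (?M \<times> ?N)). ?g (fst ab) (snd ab))"
  by (rule S.add.finprod_UN_disjoint[symmetric]) (use fin g in \<open>auto simp: pairwise_def disjnt_def\<close>)
 also have "(\<Union>m\<in>?D. ?T m \<inter> (?M \<times> ?N)) = ?M \<times> ?N" by auto
 also have "(\<Oplus>\<^bsub>S\<^esub>ab\<in>?M \<times> ?N. ?g (fst ab) (snd ab)) = (\<Oplus>\<^bsub>S\<^esub>a\<in>?M. \<Oplus>\<^bsub>S\<^esub>b\<in>?N. ?g a b)"
  by (rule finsum_times[OF fin g])
 also have "\<dots> = lfun R S h (\<lambda>a. lfun R S h (\<lambda>b. fi (a + b)) q) p"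
  unfolding lfun_def[of R S h _ p] lfun_def[of R S h _ q]
  by (rule S.finsum_cong') (use fi fin in \<open>auto simp: S.finsum_rdistr Pi_def\<close>)
 finally show ?thesis .
qed

end

context cring
begin

lemma id_hom: "ring_hom_cring R R (\<lambda>a. a)"
 using is_cring by (simp add: ring_hom_cring_def ring_hom_cring_axioms_def ring_hom_memI)

lemmas id_lfun_sup = ring_hom_cring.lfun_sup[OF id_hom]
 and id_lfun_closed = ring_hom_cring.lfun_closed[OF id_hom]
 and id_conv_closed = ring_hom_cring.conv_closed[OF id_hom]
 and id_lfun_conv = ring_hom_cring.lfun_conv[OF id_hom]

definition coef :: "'g multiset => 'g multiset => 'a" where "coef m = (\<lambda>b. if b = m then \<one> else \<zero>)"

lemma coef_closed: "coef m b : R" by (simp add: coef_def)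

lemma lfun_coef:
 assumes p: "p : free_calg R G" shows "lfun R R (\<lambda>a. a) (coef m) p = p m"
proof -
 have c: "p m : R" for m using p by (auto simp: free_calg_carrier)
 have "finite (insert m (fsupp R p))" using p by (simp add: free_calg_carrier)
 from id_lfun_sup[OF p this subset_insertI coef_closed]
 have "lfun R R (\<lambda>a. a) (coef m) p = (\<Oplus>b\<in>insert m (fsupp R p). p b \<otimes> coef m b)" .
 also have "\<dots> = (\<Oplus>b\<in>insert m (fsupp R p). if b = m then p b else \<zero>)"
  by (rule finsum_cong') (use c in \<open>auto simp: coef_def\<close>)
 also have "\<dots> = p m" 
  using add.finprod_singleton_swap[of m "insert m (fsupp R p)" p] p c by (simp add: free_calg_carrier)
 finally show ?thesis .
qed

text \<open>Associativity: a coefficient of either triple product unfolds to the same threefold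
  nested \<open>lfun\<close>, up to associativity of the sum of multisets.\<close>

lemma free_calg_cring: "cring (free_calg R (G :: 'g set))" (is "cring ?P")
proof -
 have c[simp]: "p m : R" if "p : ?P" for p m using that by (auto simp: free_calg_carrier)
 have one: "\<one>.?P : ?P"
  by (auto simp: free_calg_carrier fsupp_def intro: finite_subset[of _ "{{#}}"])
 have comm: "p \<otimes>.?P q = q \<otimes>.?P p" if "p : ?P" "q : ?P" for p q
 proof
  fix m :: "'g multiset"
  let ?T = "{(a, b). a + b = m}"
  have "?T = prod.swap ` ?T" by (auto simp: image_iff add.commute)
  hence "(p \<otimes>.?P q) m = (\<Oplus>ab\<in>prod.swap ` ?T. p (fst ab) \<otimes> q (snd ab))" by simp
  also have "\<dots> = (\<Oplus>ab\<in>?T. p (snd ab) \<otimes> q (fst ab))"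
   using finsum_reindex[of "\<lambda>ab. p (fst ab) \<otimes> q (snd ab)" prod.swap ?T] that by (auto simp: inj_on_def)
  also have "\<dots> = (q \<otimes>.?P p) m" using that by (auto simp: m_comm intro!: finsum_cong')
  finally show "(p \<otimes>.?P q) m = (q \<otimes>.?P p) m" .
 qed
 show ?thesis
 proof (rule cringI)
  show "abelian_group ?P"
  proof (rule abelian_groupI)
   fix p q assume pq: "p : ?P" "q : ?P"
   thus "p \<oplus>.?P q : ?P"
    using free_add(2) by simp
  next
   fix p assume p: "p : ?P"
   hence "(\<lambda>m. \<ominus> p m) : ?P" by (auto simp: free_calg_carrier fsupp_def)
   thus "EX q:?P. q \<oplus>.?P p = \<zero>.?P" 
    by (rule bexI[rotated]) (use p in \<open>auto simp: l_neg\<close>)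
  qed (auto simp: free_calg_carrier fsupp_def a_ac)
  show "comm_monoid ?P"
  proof (rule comm_monoidI)
   fix p q r assume pqr: "p : ?P" "q : ?P" "r : ?P"
   let ?L = "lfun R R (\<lambda>a. a)"
   have Lc: "?L fi p : R" if "p : ?P" "!!m. fi m : R" for fi :: "'g multiset => 'a" and p
    using id_lfun_closed[OF that] .
   note cl = id_conv_closed
   show "p \<otimes>.?P q \<otimes>.?P r = p \<otimes>.?P (q \<otimes>.?P r)"
   proof
    fix m
    have "(p \<otimes>.?P q \<otimes>.?P r) m = ?L (coef m) (p \<otimes>.?P q \<otimes>.?P r)"
     by (rule lfun_coef[OF cl[OF cl[OF pqr(1,2)] pqr(3)], symmetric])
    also have "\<dots> = ?L (\<lambda>a. ?L (\<lambda>b. ?L (\<lambda>c. coef m (a + b + c)) r) q) p"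
     by (subst id_lfun_conv[OF cl[OF pqr(1,2)] pqr(3) coef_closed],
       rule id_lfun_conv[OF pqr(1,2)], rule Lc[OF pqr(3) coef_closed])
    also have "\<dots> = ?L (coef m) (p \<otimes>.?P (q \<otimes>.?P r))"
     unfolding id_lfun_conv[OF pqr(1) cl[OF pqr(2,3)] coef_closed]
     by (subst id_lfun_conv[OF pqr(2,3) coef_closed]) (simp add: add.assoc)
    also have "\<dots> = (p \<otimes>.?P (q \<otimes>.?P r)) m" by (rule lfun_coef[OF cl[OF pqr(1) cl[OF pqr(2,3)]]])
    finally show "(p \<otimes>.?P q \<otimes>.?P r) m = (p \<otimes>.?P (q \<otimes>.?P r)) m" .
   qed
  next
   fix q assume q: "q : ?P"
   show "\<one>.?P \<otimes>.?P q = q"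
   proof
    fix m
    have "(\<one>.?P \<otimes>.?P q) m = lfun R R (\<lambda>a. a) (coef m) (\<one>.?P \<otimes>.?P q)"
     by (rule lfun_coef[OF id_conv_closed[OF one q], symmetric])
    also have "\<dots> = lfun R R (\<lambda>a. a) (\<lambda>a. lfun R R (\<lambda>a. a) (\<lambda>b. coef m (a + b)) q) \<one>.?P"
     by (rule id_lfun_conv[OF one q coef_closed])
    also have "\<dots> = (\<Oplus>a\<in>{{#}}. \<one>.?P a \<otimes> lfun R R (\<lambda>a. a) (\<lambda>b. coef m (a + b)) q)"
     by (rule id_lfun_sup[OF one]) (auto simp: fsupp_def intro!: id_lfun_closed[OF q] coef_closed split: if_splits)
    also have "\<dots> = q m" using q lfun_coef[OF q, of m] by simp
    finally show "(\<one>.?P \<otimes>.?P q) m = q m" .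
   qed
  qed (use one comm id_conv_closed in auto)
  fix p q r assume pqr: "p : ?P" "q : ?P" "r : ?P"
  thus "(p \<oplus>.?P q) \<otimes>.?P r = p \<otimes>.?P r \<oplus>.?P q \<otimes>.?P r"
   by (auto simp: fun_eq_iff l_distr Pi_def)
 qed
qed

end


definition monomial :: "('b, 'n) ring_scheme => ('g => 'b) => 'g multiset => 'b" where
 "monomial S f m = (\<Otimes>\<^bsub>S\<^esub>u\<in>set_mset m. f u [^].S count m u)"

context ring_hom_cring
begin

lemma lfun_single:
 assumes "r : R" "set_mset m \<subseteq> G" "!!m. fi m : S"
 shows "(\<lambda>m'. if m' = m then r else \<zero>) : free_calg R G"
  "lfun R S h fi (\<lambda>m'. if m' = m then r else \<zero>) = h r \<otimes>.S fi m"
proof -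
 have s: "fsupp R (\<lambda>m'. if m' = m then r else \<zero>) \<subseteq> {m}" by (auto simp: fsupp_def)
 show c: "(\<lambda>m'. if m' = m then r else \<zero>) : free_calg R G"
  using assms s finite_subset[OF s] unfolding free_calg_carrier by (auto split: if_splits)
 show "lfun R S h fi (\<lambda>m'. if m' = m then r else \<zero>) = h r \<otimes>.S fi m"
  unfolding lfun_sup[OF c finite.insertI[OF finite.emptyI] s assms(3)] using assms by simp
qed

lemma monomial_closed: "(!!u. f u : S) ==> monomial S f m : S"
 unfolding monomial_def by (rule S.finprod_closed) auto

lemma monomial_add:
 assumes f: "!!u. f u : S"
 shows "monomial S f (a + b) = monomial S f a \<otimes>.S monomial S f b"
proof -
 have e: "(\<Otimes>\<^bsub>S\<^esub>u\<in>set_mset (a + b). f u [^].S count m u) = monomial S f m" if "m = a \<or> m = b" for m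
  unfolding monomial_def
  by (rule S.finprod_mono_neutral_cong_right) (use that f in \<open>auto simp: not_in_iff\<close>)
 have "monomial S f (a + b) = (\<Otimes>\<^bsub>S\<^esub>u\<in>set_mset (a + b). f u [^].S count a u \<otimes>.S f u [^].S count b u)"
  unfolding monomial_def using f by (intro S.finprod_cong') (auto simp: S.nat_pow_mult)
 also have "\<dots> = monomial S f a \<otimes>.S monomial S f b"
  unfolding e[symmetric, OF disjI1[OF refl]] e[symmetric, OF disjI2[OF refl]] using f by (intro S.finprod_multf) auto
 finally show ?thesis .
qed

lemma eval_hom:
 assumes f: "!!u. f u : S"
 shows "lfun R S h (monomial S f) : ring_hom (free_calg R G) S"
proof (rule ring_hom_memI)
 have mc: "monomial S f m : S" for m using monomial_closed f by blast
 fix p q assume p: "p : free_calg R G" and q: "q : free_calg R G"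
 show "lfun R S h (monomial S f) p : S" by (rule lfun_closed[OF p mc])
 show "lfun R S h (monomial S f) (p \<oplus>.(free_calg R G) q) = lfun R S h (monomial S f) p \<oplus>.S lfun R S h (monomial S f) q"
  using lfun_add[OF p q mc] by simp
 have c: "p m : R" "q m : R" for m using p q by (auto simp: free_calg_carrier)
 have fin: "finite (fsupp R p)" "finite (fsupp R q)" using p q by (auto simp: free_calg_carrier)
 have 1: "lfun R S h (\<lambda>b. monomial S f (a + b)) q = monomial S f a \<otimes>.S lfun R S h (monomial S f) q" for a
  unfolding lfun_def monomial_add[where f = f, OF f]
  using c mc fin by (subst S.finsum_rdistr) (auto simp: Pi_def S.m_lcomm intro!: S.finsum_cong')
 have lq: "lfun R S h (monomial S f) q : S" by (rule lfun_closed[OF q mc])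
 show "lfun R S h (monomial S f) (p \<otimes>.(free_calg R G) q) = lfun R S h (monomial S f) p \<otimes>.S lfun R S h (monomial S f) q"
  unfolding lfun_conv[OF p q mc] 1 unfolding lfun_def[of R S h _ p]
  using c mc fin lq by (subst S.finsum_ldistr) (auto simp: Pi_def S.m_assoc intro!: S.finsum_cong')
next
 show "lfun R S h (monomial S f) \<one>.(free_calg R G) = \<one>.S"
  using lfun_single(2)[of \<one> "{#}" UNIV "monomial S f"] monomial_closed[where f = f] f by (simp add: monomial_def)
qed

lemma eval_const_var:
 assumes f: "!!u. f u : S" and r: "r : R"
 shows "lfun R S h (monomial S f) (free_const R r) = h r" "lfun R S h (monomial S f) (free_var R u) = f u"
 using lfun_single(2)[of r "{#}" UNIV "monomial S f"] lfun_single(2)[of \<one> "{#u#}" UNIV "monomial S f"]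
  monomial_closed[where f = f] r f by (simp_all add: free_const_def free_var_def monomial_def)

end

context cring
begin

lemmas single_closed = ring_hom_cring.lfun_single(1)[OF id_hom _ _ coef_closed]
 and single_lfun = ring_hom_cring.lfun_single(2)[OF id_hom]

lemma const_closed: "r : R ==> free_const R r : free_calg R G"
 using single_closed[of r "{#}" G] by (simp add: free_const_def)

lemma var_closed: "u : G ==> free_var R u : free_calg R G"
 using single_closed[of \<one> "{#u#}" G] by (simp add: free_var_def)

lemma single_mult:
 assumes "r : R" "s : R" "set_mset a \<subseteq> G" "set_mset b \<subseteq> G"
 shows "(\<lambda>m. if m = a then r else \<zero>) \<otimes>.(free_calg R G) (\<lambda>m. if m = b then s else \<zero>) = (\<lambda>m. if m = a + b then r \<otimes> s else \<zero>)"
  (is "?p \<otimes>.?P ?q = _")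
proof
 fix m
 note p = single_closed[OF assms(1,3)] and q = single_closed[OF assms(2,4)]
 have "(?p \<otimes>.?P ?q) m = lfun R R (\<lambda>a. a) (coef m) (?p \<otimes>.?P ?q)" by (rule lfun_coef[OF id_conv_closed[OF p q], symmetric])
 also have "\<dots> = r \<otimes> (s \<otimes> coef m (a + b))"
  unfolding id_lfun_conv[OF p q coef_closed] single_lfun[OF assms(2,4) coef_closed]
  by (rule single_lfun[OF assms(1,3)]) (use assms in \<open>simp add: coef_closed\<close>)
 finally show "(?p \<otimes>.?P ?q) m = (if m = a + b then r \<otimes> s else \<zero>)" using assms by (simp add: coef_def)
qed

lemma const_hom: "free_const R : ring_hom R (free_calg R G)"
proof (rule ring_hom_memI)
 fix r s assume "r : R" "s : R"
 thus "free_const R (r \<otimes> s) = free_const R r \<otimes>.(free_calg R G) free_const R s"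
  using single_mult[of r s "{#}" G "{#}"] by (simp add: free_const_def)
 show "free_const R (r \<oplus> s) = free_const R r \<oplus>.(free_calg R G) free_const R s" by (auto simp: free_const_def)
next
 show "free_const R \<one> = \<one>.(free_calg R G)" by (simp add: free_const_def)
qed (rule const_closed)

text \<open>Single terms arise by multiplying with one variable after another, and a polynomial by
  adding its terms over the support.\<close>

lemma free_induct:
 assumes p: "p : free_calg R G"
  and const: "!!r. r : R ==> Q (free_const R r)" and var: "!!u. u : G ==> Q (free_var R u)"
  and add: "!!p q. p : free_calg R G ==> q : free_calg R G ==> Q p ==> Q q ==> Q (p \<oplus>.(free_calg R G) q)"
  and mult: "!!p q. p : free_calg R G ==> q : free_calg R G ==> Q p ==> Q q ==> Q (p \<otimes>.(free_calg R G) q)"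
 shows "Q p"
proof -
 have single: "Q (\<lambda>m'. if m' = m then r else \<zero>)" if "r : R" "set_mset m \<subseteq> G" for m r
  using that(2)
 proof (induction m)
  case empty thus ?case using const[OF that(1)] by (simp add: free_const_def)
 next
  case (add u m)
  have "Q (free_var R u \<otimes>.(free_calg R G) (\<lambda>m'. if m' = m then r else \<zero>))"
   using add that by (intro mult var var_closed single_closed) auto
  moreover have "free_var R u \<otimes>.(free_calg R G) (\<lambda>m'. if m' = m then r else \<zero>) = (\<lambda>m'. if m' = add_mset u m then r else \<zero>)"
   unfolding free_var_def using single_mult[of \<one> r "{#u#}" G m] add that
   by (simp add: l_one[OF that(1)] cong: if_cong del: free_calg_simps)
  ultimately show ?case by simp
 qed
 have "finite (fsupp R p)" using p by (simp add: free_calg_carrier)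
 have "finite F ==> p : free_calg R G ==> fsupp R p \<subseteq> F ==> Q p" for F p
 proof (induction F arbitrary: p rule: finite_induct)
  case empty
  hence "p = free_const R \<zero>" by (auto simp: fsupp_def free_const_def)
  thus ?case using const by simp
 next
  case (insert m F)
  let ?q = "p(m := \<zero>)"
  have sq: "fsupp R ?q \<subseteq> F" using insert.prems(2) by (auto simp: fsupp_def)
  have q: "?q : free_calg R G"
   using insert.prems(1) finite_subset[OF sq insert.hyps(1)] unfolding free_calg_carrier by (auto simp: fsupp_def)
  have pm: "p m : R" using insert.prems(1) by (simp add: free_calg_carrier)
  show ?case
  proof (cases "m : fsupp R p")
   case True
   hence mG: "set_mset m \<subseteq> G" using insert.prems(1) by (simp add: free_calg_carrier)
   have "Q (?q \<oplus>.(free_calg R G) (\<lambda>m'. if m' = m then p m else \<zero>))"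
    using add[OF q single_closed[OF pm mG] insert.IH[OF q sq] single[OF pm mG]] .
   moreover have "?q \<oplus>.(free_calg R G) (\<lambda>m'. if m' = m then p m else \<zero>) = p"
    using insert.prems(1) by (auto simp: fun_eq_iff free_calg_carrier)
   ultimately show ?thesis by simp
  next
   case False
   thus ?thesis using insert.IH[OF insert.prems(1)] insert.prems(2) by blast
  qed
 qed
 from this[OF \<open>finite (fsupp R p)\<close> p] show ?thesis by blast
qed

end

section \<open>The universal property of the symmetric algebra\<close>

locale sym_module = cring R for R :: "('a, 'm) ring_scheme" (structure) and M :: "('a, 'g) module" +
 assumes M_add: "u : M ==> v : M ==> u \<oplus>.M v : M"
  and M_smult: "r : R ==> u : M ==> r \<odot>.M u : M"
begin

abbreviation "P \<equiv> free_calg R (carrier M)"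
abbreviation "I \<equiv> sym_ideal R M"

sublocale P: cring P by (rule free_calg_cring)

definition sym_rels where
 "sym_rels = {free_var R (u \<oplus>.M v) \<ominus>.P (free_var R u \<oplus>.P free_var R v)
     | u v. u : M \<and> v : M} \<union>
   {free_var R (r \<odot>.M u) \<ominus>.P (free_const R r \<otimes>.P free_var R u)
     | r u. r : R \<and> u : M}"

lemma rels_carr: "sym_rels \<subseteq> P"
 unfolding sym_rels_def by (auto intro!: P.minus_closed P.a_closed P.m_closed var_closed const_closed M_add M_smult simp del: free_calg_simps)

lemma I_eq: "I = Idl .P sym_rels" by (simp add: sym_ideal_def sym_rels_def Let_def)

sublocale I: ideal I P unfolding I_eq by (rule P.genideal_ideal[OF rels_carr])

lemma sym_alg_eq: "sym_alg R M = P Quot I" by (simp add: sym_alg_def)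

sublocale Sym: cring "sym_alg R M"
 unfolding sym_alg_eq by (rule I.quotient_is_cring[OF P.is_cring])

lemma coset_hom: "(+>.P) I : ring_hom P (sym_alg R M)"
 unfolding sym_alg_eq by (rule I.rcos_ring_hom)

lemma const_sym_hom: "sym_const R M : ring_hom R (sym_alg R M)"
proof -
 have "sym_const R M = (+>.P) I \<circ> free_const R" by (simp add: sym_const_def fun_eq_iff)
 thus ?thesis using ring_hom_trans[OF const_hom coset_hom] by simp
qed

lemma sym_in_closed: "u : M ==> sym_in R M u : sym_alg R M"
 using ring_hom_closed[OF coset_hom var_closed] by (simp add: sym_in_def)

lemma coset_eqI: "p : P ==> q : P ==> p \<ominus>.P q : I ==> I +>.P p = I +>.P q"
 using P.quotient_eq_iff_same_a_r_cos[OF I.ideal_axioms] by blast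

lemma rel_I: "p : sym_rels ==> p : I"
 using P.genideal_self[OF rels_carr] unfolding I_eq by blast

lemma sym_in_add:
 assumes "u : M" "v : M"
 shows "sym_in R M (u \<oplus>.M v) = sym_in R M u \<oplus>.(sym_alg R M) sym_in R M v"
proof -
 have "I +>.P free_var R (u \<oplus>.M v) = I +>.P (free_var R u \<oplus>.P free_var R v)"
  by (rule coset_eqI[OF _ _ rel_I]) (use assms in \<open>auto simp: sym_rels_def intro!: P.a_closed var_closed M_add simp del: free_calg_simps\<close>)
 thus ?thesis unfolding sym_in_def using ring_hom_add[OF coset_hom var_closed var_closed] assms by simp
qed

lemma sym_in_smult:
 assumes "r : R" "u : M"
 shows "sym_in R M (r \<odot>.M u) = sym_const R M r \<otimes>.(sym_alg R M) sym_in R M u"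
proof -
 have "I +>.P free_var R (r \<odot>.M u) = I +>.P (free_const R r \<otimes>.P free_var R u)"
  by (rule coset_eqI[OF _ _ rel_I])
   (use assms in \<open>auto simp: sym_rels_def intro!: P.m_closed const_closed var_closed M_smult simp del: free_calg_simps\<close>)
 thus ?thesis unfolding sym_in_def sym_const_def using ring_hom_mult[OF coset_hom const_closed var_closed] assms by simp
qed

lemma symE:
 assumes "c : sym_alg R M" obtains p where "p : P" "c = I +>.P p"
 using assms unfolding sym_alg_eq by (auto simp: FactRing_def A_RCOSETS_def')

lemma sym_induct:
 assumes c: "c : sym_alg R M"
  and const: "!!r. r : R ==> Q (sym_const R M r)" and var: "!!u. u : M ==> Q (sym_in R M u)"
  and add: "!!b c. b : sym_alg R M ==> c : sym_alg R M ==> Q b ==> Q c ==> Q (b \<oplus>.(sym_alg R M) c)"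
  and mult: "!!b c. b : sym_alg R M ==> c : sym_alg R M ==> Q b ==> Q c ==> Q (b \<otimes>.(sym_alg R M) c)"
 shows "Q c"
proof -
 obtain p where p: "p : P" "c = I +>.P p" using c by (rule symE)
 have "Q (I +>.P p)" using p(1)
 proof (rule free_induct)
  fix p q assume *: "p : P" "q : P" "Q (I +>.P p)" "Q (I +>.P q)"
  note cl = ring_hom_closed[OF coset_hom *(1)] ring_hom_closed[OF coset_hom *(2)]
  show "Q (I +>.P (p \<oplus>.P q))" unfolding ring_hom_add[OF coset_hom *(1,2)] by (rule add[OF cl *(3,4)])
  show "Q (I +>.P (p \<otimes>.P q))" unfolding ring_hom_mult[OF coset_hom *(1,2)] by (rule mult[OF cl *(3,4)])
 qed (use const var in \<open>auto simp: sym_const_def sym_in_def\<close>)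
 thus ?thesis using p(2) by simp
qed

lemma hom_eqI:
 assumes c: "c : sym_alg R M"
  and F: "F : ring_hom (sym_alg R M) S" and F': "F' : ring_hom (sym_alg R M) S"
  and "!!r. r : R ==> F (sym_const R M r) = F' (sym_const R M r)"
  and "!!u. u : M ==> F (sym_in R M u) = F' (sym_in R M u)"
 shows "F c = F' c"
 by (rule sym_induct[OF c])
  (use assms in \<open>auto simp: ring_hom_add[OF F] ring_hom_add[OF F'] ring_hom_mult[OF F] ring_hom_mult[OF F']\<close>)

text \<open>Evaluation of polynomials at \<open>f\<close> kills the relations, so it is constant on
  cosets. Therefore the description in \<open>sym_lift\<close>, which speaks of all representatives
  at once, singles out exactly one value.\<close>

lemma sym_lift:
 assumes S: "cring S" and h: "h : ring_hom R S" and f: "!!u. u : M ==> f u : S"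
  and f_add: "!!u v. u : M ==> v : M ==> f (u \<oplus>.M v) = f u \<oplus>.S f v"
  and f_smult: "!!r u. r : R ==> u : M ==> f (r \<odot>.M u) = h r \<otimes>.S f u"
 shows "sym_lift R S h f : ring_hom (sym_alg R M) S"
  "!!r. r : R ==> sym_lift R S h f (sym_const R M r) = h r"
  "!!u. u : M ==> sym_lift R S h f (sym_in R M u) = f u"
proof -
 interpret h: ring_hom_cring R S h using S h is_cring by (simp add: ring_hom_cring_def ring_hom_cring_axioms_def)
 \<comment> \<open>The evaluation lemmas want a value for every variable, also for those outside the
   module; 0 is the default.\<close>
 define f' where "f' u = (if u : M then f u else \<zero>.S)" for u
 have f': "f' u : S" for u using f by (simp add: f'_def)
 let ?e = "lfun R S h (monomial S f')"
 note eh = h.eval_hom[where f = f', OF f', of "carrier M"]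
 have ev: "(\<Oplus>\<^bsub>S\<^esub>m\<in>{m. p m ~= \<zero>}. h (p m) \<otimes>.S (\<Otimes>\<^bsub>S\<^esub>u\<in>set_mset m. f u [^].S count m u)) = ?e p" if p: "p : P" for p
 proof -
  have "(\<Otimes>\<^bsub>S\<^esub>u\<in>set_mset m. f u [^].S count m u) = monomial S f' m" if "m : fsupp R p" for m
   unfolding monomial_def
  proof (rule h.S.finprod_cong')
   show "f u [^].S count m u = f' u [^].S count m u" if "u \<in># m" for u
    using that \<open>m : fsupp R p\<close> p by (auto simp: f'_def free_calg_carrier)
  qed (use f' in auto)
  thus ?thesis unfolding lfun_def fsupp_def[symmetric] using p
   by (intro h.S.finsum_cong') (auto simp: free_calg_carrier intro!: h.monomial_closed f')
 qed
 interpret e: ring_hom_ring P S ?e by (rule ring_hom_ringI2[OF P.ring_axioms h.S.ring_axioms eh])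
 have "sym_rels \<subseteq> a_kernel P S ?e"
 proof
  fix p assume "p : sym_rels"
  then consider u v where "u : M" "v : M" "p = free_var R (u \<oplus>.M v) \<ominus>.P (free_var R u \<oplus>.P free_var R v)"
   | r u where "r : R" "u : M" "p = free_var R (r \<odot>.M u) \<ominus>.P (free_const R r \<otimes>.P free_var R u)"
   unfolding sym_rels_def by blast
  hence "p : P \<and> ?e p = \<zero>.S"
  proof cases
   case 1
   note c = var_closed[OF 1(1)] var_closed[OF 1(2)] var_closed[OF M_add[OF 1(1,2)]]
   show ?thesis using 1 c M_add f_add[OF 1(1,2)] f
    by (simp add: a_minus_def h.eval_const_var[where f = f', OF f' one_closed] f'_def h.S.r_neg del: free_calg_simps)
  next
   case 2
   note c = var_closed[OF 2(2)] const_closed[OF 2(1), of "carrier M"] var_closed[OF M_smult[OF 2(1,2)]]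
   show ?thesis using 2 c M_smult f_smult[OF 2(1,2)] f
    by (simp add: a_minus_def h.eval_const_var[where f = f', OF f'] h.eval_const_var(2)[where f = f', OF f' one_closed] f'_def h.S.r_neg del: free_calg_simps)
  qed
  thus "p : a_kernel P S ?e" unfolding a_kernel_def' by blast
 qed
 hence IK: "I \<subseteq> a_kernel P S ?e" unfolding I_eq by (rule P.genideal_minimal[OF e.kernel_is_ideal])
 have lift: "sym_lift R S h f (I +>.P p) = ?e p" if p: "p : P" for p
  unfolding sym_lift_def
 proof (rule the_equality)
  have sm: "q : P \<and> ?e q = ?e p" if q: "q : I +>.P p" for q
  proof -
   from q obtain i where i: "i : I" "q = i \<oplus>.P p" unfolding a_r_coset_def' by blast
   have "i : P" "?e i = \<zero>.S" using IK i(1) unfolding a_kernel_def' by blast+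
   thus ?thesis using p e.hom_closed[OF p] unfolding i(2) by (simp del: free_calg_simps)
  qed
  thus "ALL q:I +>.P p. ?e p = (\<Oplus>\<^bsub>S\<^esub>m\<in>{m. q m ~= \<zero>}. h (q m) \<otimes>.S (\<Otimes>\<^bsub>S\<^esub>u\<in>set_mset m. f u [^].S count m u))"
   using ev by (metis (no_types, lifting))
  fix b assume b: "ALL q:I +>.P p. b = (\<Oplus>\<^bsub>S\<^esub>m\<in>{m. q m ~= \<zero>}. h (q m) \<otimes>.S (\<Otimes>\<^bsub>S\<^esub>u\<in>set_mset m. f u [^].S count m u))"
  have "p : I +>.P p" using I.a_rcos_self[OF p] .
  thus "b = ?e p" using b ev[OF p] by simp
 qed
 show "sym_lift R S h f : ring_hom (sym_alg R M) S"
 proof (rule ring_hom_memI)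
  fix b c assume bc: "b : sym_alg R M" "c : sym_alg R M"
  obtain p where p: "p : P" "b = I +>.P p" using bc(1) by (rule symE)
  obtain q where q: "q : P" "c = I +>.P q" using bc(2) by (rule symE)
  show "sym_lift R S h f b : S" unfolding p(2) lift[OF p(1)] by (rule e.hom_closed[OF p(1)])
  show "sym_lift R S h f (b \<otimes>.(sym_alg R M) c) = sym_lift R S h f b \<otimes>.S sym_lift R S h f c"
   unfolding p(2) q(2) ring_hom_mult[OF coset_hom p(1) q(1), symmetric] lift[OF P.m_closed[OF p(1) q(1)]] lift[OF p(1)] lift[OF q(1)]
   by (rule e.hom_mult[OF p(1) q(1)])
  show "sym_lift R S h f (b \<oplus>.(sym_alg R M) c) = sym_lift R S h f b \<oplus>.S sym_lift R S h f c"
   unfolding p(2) q(2) ring_hom_add[OF coset_hom p(1) q(1), symmetric] lift[OF P.a_closed[OF p(1) q(1)]] lift[OF p(1)] lift[OF q(1)]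
   by (rule e.hom_add[OF p(1) q(1)])
 next
  show "sym_lift R S h f \<one>.(sym_alg R M) = \<one>.S"
   unfolding ring_hom_one[OF coset_hom, symmetric] lift[OF P.one_closed] by (rule e.hom_one)
 qed
 show "sym_lift R S h f (sym_const R M r) = h r" if "r : R" for r
  unfolding sym_const_def lift[OF const_closed[OF that]] by (rule h.eval_const_var(1)[where f = f', OF f' that])
 show "sym_lift R S h f (sym_in R M u) = f u" if "u : M" for u
  unfolding sym_in_def lift[OF var_closed[OF that]] using h.eval_const_var(2)[where f = f', OF f' one_closed] that by (simp add: f'_def)
qed

end


section \<open>The line with multiple origins\<close>

locale origins = dom_in_field A Q et for A :: "'a ring" (structure) and Q :: "'q ring" and et +
 fixes x :: 'a and n :: nat
 assumes x: "x : A" "x ~= \<zero>" "maximalideal (PIdl x) A" and n: "n \<ge> 1"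
begin

abbreviation "X \<equiv> Spec A"
abbreviation "x0 \<equiv> PIdl x"
abbreviation "Y \<equiv> copies X x0 n"
definition "D i U = {p : pts X. copy_pt x0 i p : U}"
abbreviation "N \<equiv> {1..n}"
abbreviation "gen \<equiv> (0 :: nat, {\<zero>})"
abbreviation "O_at y \<equiv> locq Q et A (snd y)"

declare atLeastAtMost_iff[simp del]

lemma D_mem: "p : D i U \<longleftrightarrow> p : pts X \<and> copy_pt x0 i p : U" by (simp add: D_def)

lemma copy_pt_simps[simp]: "snd (copy_pt p0 i p) = p" "fst (copy_pt p0 i p) = (if p = p0 then i else 0)"
 by (simp_all add: copy_pt_def)

lemma copy_mem: "y : copy X x0 i \<longleftrightarrow> primeideal (snd y) A \<and> fst y = (if snd y = x0 then i else 0)"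
proof
 assume "primeideal (snd y) A \<and> fst y = (if snd y = x0 then i else 0)"
 hence "y = copy_pt x0 i (snd y)" "snd y : pts X" by (auto simp: prod_eq_iff topspace_zariski)
 thus "y : copy X x0 i" unfolding copy_def by (rule image_eqI)
qed (auto simp: copy_def topspace_zariski)

lemma n1: "1 : N" using n by (simp add: atLeastAtMost_iff)

lemma x0_prime: "primeideal x0 A" by (rule maximalideal_prime[OF x(3)])

lemma x0_iff: "primeideal P A ==> x : P \<longleftrightarrow> P = x0" using maximal_PIdl[OF is_cring x(1,3)] by blast

lemma zero_x0: "{\<zero>} ~= x0" using x0_iff[OF zero_prime] x(2) by blast

lemma gen_copy: "copy_pt x0 i {\<zero>} = gen" using zero_x0 by (simp add: copy_pt_def)

text \<open>The open sets of \<open>copies\<close> are given by applying \<open>topology\<close> to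
  a predicate, which can be unfolded only after the predicate is shown to define a topology.\<close>

lemma opn_Y: "opn Y U \<longleftrightarrow> U \<subseteq> (\<Union>i\<in>N. copy_pt x0 i ` pts X) \<and> (ALL i:N. opn X (D i U))"
proof -
 let ?L = "\<lambda>U. U \<subseteq> (\<Union>i\<in>N. copy_pt x0 i ` pts X) \<and> (ALL i:N. opn X (D i U))"
 have "istopology ?L" unfolding istopology_def
 proof (intro conjI allI impI ballI)
  fix U V i assume "?L U" "?L V" "i : N"
  moreover have "D i (U \<inter> V) = D i U \<inter> D i V" by (auto simp: D_mem)
  ultimately show "opn X (D i (U \<inter> V))" by auto
 next
  fix \<U> i assume "ALL U:\<U>. ?L U" "i : N"
  moreover have "D i (\<Union>\<U>) = \<Union>(D i ` \<U>)" by (auto simp: D_mem)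
  ultimately show "opn X (D i (\<Union>\<U>))" by (auto intro!: openin_Union)
 qed blast+
 thus ?thesis unfolding copies_def Let_def D_def[symmetric] by (simp add: topology_inverse')
qed

lemma sec_Y: "sec Y U = fun_ring N (\<lambda>i. sec X (D i U))
    {s : (\<Pi>\<^sub>E i\<in>N. carrier (sec X (D i U))).
     ALL i:N. ALL j:N. res X (D i U) (D i U - {x0}) (s i) = res X (D j U) (D j U - {x0}) (s j)}"
 by (simp add: copies_def Let_def D_def)

lemma res_Y: "res Y U V s = (\<lambda>i\<in>N. res X (D i U) (D i V) (s i))" by (simp add: copies_def Let_def D_def)

lemma D_diff: "D i U - {x0} = D j U - {x0}" by (rule Set.set_eqI) (simp add: copy_pt_def D_mem)

lemma opn_D: "opn Y U ==> i : N ==> opn X (D i U)" unfolding opn_Y by blast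

lemma opn_diff: "opn X V ==> opn X (V - {x0})"
proof -
 assume V: "opn X V"
 have "V - {x0} = V \<inter> bopen A x" using openin_subset[OF V] x0_iff by (auto simp: bopen_def topspace_zariski)
 thus ?thesis using V bopen_open[OF x(1)] by auto
qed

lemma gen_in: assumes "opn Y U" "U ~= {}" shows "gen : U" "i : N ==> {\<zero>} : D i U" "i : N ==> {\<zero>} : D i U - {x0}"
proof -
 obtain y where y: "y : U" using assms(2) by blast
 then obtain j p where j: "j : N" "p : pts X" "y = copy_pt x0 j p" using assms(1) unfolding opn_Y by blast
 hence "{\<zero>} : D j U" using zero_in_open[of "D j U"] opn_D[OF assms(1)] y D_mem[of p j U] by auto
 thus g: "gen : U" using gen_copy by (simp add: D_mem)
 thus "{\<zero>} : D i U" "{\<zero>} : D i U - {x0}" using gen_copy zero_prime zero_x0 by (auto simp: topspace_zariski D_mem)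
qed

text \<open>Any copy gives the same value, by \<open>valY_i\<close>; the first one exists since
  \<open>n \<ge> 1\<close>.\<close>

definition valY where "valY U s = sp.lc_val (D 1 U) (s 1)"

lemma secY_carr: "s : sec Y U \<longleftrightarrow> s : (\<Pi>\<^sub>E i\<in>N. carrier (sec X (D i U))) \<and>
     (ALL i:N. ALL j:N. res X (D i U) (D i U - {x0}) (s i) = res X (D j U) (D j U - {x0}) (s j))"
 by (simp add: sec_Y)

lemma sec_in: "s : sec Y U ==> i : N ==> s i : sec X (D i U)"
 by (auto simp: secY_carr)

lemma val_diff:
 assumes "opn X V" "s : sec X V" "{\<zero>} : V"
 shows "res X V (V - {x0}) s : (sec X (V - {x0}))" "sp.lc_val (V - {x0}) (res X V (V - {x0}) s) = sp.lc_val V s"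
 using sp.restrict_in[OF assms(1) opn_diff[OF assms(1)] Diff_subset assms(2)] assms(3) zero_x0 by auto

text \<open>The copies agree off their origins, and the generic point lies there.\<close>

lemma valY_i:
 assumes U: "opn Y U" "U ~= {}" and s: "s : sec Y U" and i: "i : N"
 shows "sp.lc_val (D i U) (s i) = valY U s"
proof -
 have e: "res X (D i U) (D i U - {x0}) (s i) = res X (D 1 U) (D 1 U - {x0}) (s 1)"
  using s i n1 unfolding secY_carr by blast
 have "sp.lc_val (D i U) (s i) = sp.lc_val (D i U - {x0}) (res X (D i U) (D i U - {x0}) (s i))"
  by (rule val_diff(2)[symmetric, OF opn_D[OF U(1) i] sec_in[OF s i] gen_in(2)[OF U i]])
 also have "\<dots> = sp.lc_val (D 1 U - {x0}) (res X (D 1 U) (D 1 U - {x0}) (s 1))"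
  unfolding e by (simp only: D_diff[of i U 1])
 also have "\<dots> = valY U s" unfolding valY_def
  by (rule val_diff(2)[OF opn_D[OF U(1) n1] sec_in[OF s n1] gen_in(2)[OF U n1]])
 finally show ?thesis .
qed

lemma secY_I:
 assumes U: "opn Y U" "U ~= {}" and s: "s : (\<Pi>\<^sub>E i\<in>N. carrier (sec X (D i U)))"
  and v: "!!i. i : N ==> sp.lc_val (D i U) (s i) = q"
 shows "s : sec Y U" "valY U s = q"
proof -
 have "res X (D i U) (D i U - {x0}) (s i) = res X (D j U) (D j U - {x0}) (s j)" if ij: "i : N" "j : N" for i j
 proof (rule sp.sec_eqI)
  have c: "s i : sec X (D i U)" "s j : sec X (D j U)" using s ij by auto
  note di = val_diff[OF opn_D[OF U(1) ij(1)] c(1) gen_in(2)[OF U ij(1)]]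
  note dj = val_diff[OF opn_D[OF U(1) ij(2)] c(2) gen_in(2)[OF U ij(2)]]
  show "opn X (D i U - {x0})" by (rule opn_diff[OF opn_D[OF U(1) ij(1)]])
  show "res X (D i U) (D i U - {x0}) (s i) : (sec X (D i U - {x0}))" by (rule di(1))
  show "res X (D j U) (D j U - {x0}) (s j) : (sec X (D i U - {x0}))" using dj(1) unfolding D_diff[of j U i] .
  show "sp.lc_val (D i U - {x0}) (res X (D i U) (D i U - {x0}) (s i)) =
    sp.lc_val (D i U - {x0}) (res X (D j U) (D j U - {x0}) (s j))"
   using di(2) dj(2) v[OF ij(1)] v[OF ij(2)] unfolding D_diff[of j U i] by simp
 qed
 thus "s : sec Y U" using s unfolding secY_carr by blast
 show "valY U s = q" unfolding valY_def by (rule v[OF n1])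
qed

lemma secX: "opn Y U ==> i : N ==> cring (sec X (D i U))" by (rule sp.sec_cring[OF opn_D])

lemma secX_val: "opn Y U ==> U ~= {} ==> i : N ==> inj_hom (sec X (D i U)) Q (sp.lc_val (D i U))"
 using sp.lc_val_hom[OF opn_D[of U i]] gen_in(2)[of U i] by blast

sublocale qY: qspace Y Q valY
proof (rule qspace.intro[OF Q.field_axioms], rule qspace_axioms.intro)
 fix U assume U: "opn Y U" "U ~= {}"
 have e: "sec Y U = fun_ring N (\<lambda>i. sec X (D i U)) {s : (\<Pi>\<^sub>E i\<in>N. carrier (sec X (D i U))).
   ALL i:N. ALL j:N. sp.lc_val (D i U) (s i) = sp.lc_val (D j U) (s j)}" (is "_ = fun_ring N _ ?C")
 proof -
  have "s : sec Y U \<longleftrightarrow> s : ?C" for s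
  proof
   assume s: "s : sec Y U"
   have "ALL i:N. ALL j:N. sp.lc_val (D i U) (s i) = sp.lc_val (D j U) (s j)"
    using valY_i[OF U s] by metis
   thus "s : ?C" using s[unfolded secY_carr, THEN conjunct1] by blast
  next
   assume C: "s : ?C"
   note s = C[unfolded mem_Collect_eq]
   show "s : sec Y U"
    by (rule secY_I(1)[OF U s[THEN conjunct1]], rule s[THEN conjunct2, rule_format, OF _ n1])
  qed
  hence "?C = carrier (sec Y U)" by blast
  thus ?thesis unfolding sec_Y fun_ring_simps(1) by simp
 qed
 note fp = fiber_product[OF Q.is_cring n1 secX[OF U(1)] secX_val[OF U]]
 show "cring (sec Y U)" unfolding e by (rule fp(1))
 show "inj_hom (sec Y U) Q (valY U)" unfolding e valY_def[abs_def] by (rule fp(2))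
next
 fix U V s assume *: "opn Y U" "opn Y V" "V \<subseteq> U" "V ~= {}" "s : sec Y U"
 hence U: "opn Y U" "U ~= {}" by auto
 have r: "res X (D i U) (D i V) (s i) : sec X (D i V)" "sp.lc_val (D i V) (res X (D i U) (D i V) (s i)) = valY U s"
  if i: "i : N" for i
 proof -
  have sub: "D i V \<subseteq> D i U" using *(3) by (auto simp: D_mem)
  note ri = sp.restrict_in[OF opn_D[OF *(1) i] opn_D[OF *(2) i] sub sec_in[OF *(5) i]]
  show "res X (D i U) (D i V) (s i) : sec X (D i V)" by (rule ri(1))
  show "sp.lc_val (D i V) (res X (D i U) (D i V) (s i)) = valY U s"
   using ri(2) gen_in(2)[OF *(2,4) i] valY_i[OF U *(5) i] by auto
 qed
 show "res Y U V s : sec Y V \<and> valY V (res Y U V s) = valY U s"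
  using secY_I[OF *(2,4), of "res Y U V s" "valY U s"] r by (auto simp: res_Y)
qed

text \<open>On each copy \<open>q\<close> defines a section, and sections with one value agree on
  the overlaps.\<close>

lemma Y_surj:
 assumes U: "opn Y U" "U ~= {}" and q: "!!y. y : U ==> q : O_at y"
 shows "EX s:sec Y U. valY U s = q"
proof -
 have r: "q : sp.reg (D i U)" if i: "i : N" for i
  using reg_locq[of "D i U" q] opn_D[OF U(1) i] q by (force simp: D_mem copy_pt_def split: if_splits)
 have "sp.sect (D i U) q : sec X (D i U)" "sp.lc_val (D i U) (sp.sect (D i U) q) = q" if i: "i : N" for i
  using sp.sect_in[OF opn_D[OF U(1) i] r[OF i]] gen_in(2)[OF U i] by auto
 thus ?thesis using secY_I[OF U, of "\<lambda>i\<in>N. sp.sect (D i U) q" q] by auto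
qed

lemma Y_pt: assumes "opn Y U" "y : U" obtains i where "i : N" "snd y : D i U" "y = copy_pt x0 i (snd y)"
proof -
 have "y : (\<Union>i\<in>N. copy_pt x0 i ` pts X)" using assms unfolding opn_Y by blast
 then obtain i p where ip: "i : N" "p : pts X" "y = copy_pt x0 i p" by (elim UN_E imageE)
 have "snd y = p" unfolding ip(3) copy_pt_def by simp
 thus thesis using that[of i] ip assms(2) by (simp add: D_mem)
qed

lemma Y_prime: "opn Y U ==> y : U ==> primeideal (snd y) A"
 by (erule Y_pt) (auto simp: topspace_zariski D_mem)

lemma Y_locq:
 assumes U: "opn Y U" "y : U" and s: "s : sec Y U" shows "valY U s : O_at y"
proof -
 have ne: "U ~= {}" using U(2) by blast
 obtain i where i: "i : N" "snd y : D i U" using U by (rule Y_pt)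
 have "sp.lc_val (D i U) (s i) : sp.reg (D i U)" by (rule sp.lc_val_reg[OF opn_D[OF U(1) i(1)] sec_in[OF s i(1)]])
 thus ?thesis using reg_locq[of "D i U"] opn_D[OF U(1) i(1)] i(2) valY_i[OF U(1) ne s i(1)] by auto
qed

lemma pts_Y: "pts Y = (\<Union>i\<in>N. copy_pt x0 i ` pts X)"
proof
 show "pts Y \<subseteq> (\<Union>i\<in>N. copy_pt x0 i ` pts X)" using openin_topspace[of "tsp Y"] unfolding opn_Y by blast
 have "D i (\<Union>i\<in>N. copy_pt x0 i ` pts X) = pts X" if "i : N" for i
  using that unfolding D_def by blast
 hence "opn Y (\<Union>i\<in>N. copy_pt x0 i ` pts X)" unfolding opn_Y by (metis openin_topspace order_refl)
 thus "(\<Union>i\<in>N. copy_pt x0 i ` pts X) \<subseteq> pts Y" by (rule openin_subset)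
qed

text \<open>Seen from another copy the set only loses the closed point \<open>x0\<close>, so it
  remains open there.\<close>

lemma copy_opn: "i : N ==> opn Y {y : copy X x0 i. a ~: snd y}" if a: "a : A"
proof -
 assume i: "i : N"
 have "opn X (D j {y : copy X x0 i. a ~: snd y})" if j: "j : N" for j
 proof (cases "j = i")
  case True
  hence "D j {y : copy X x0 i. a ~: snd y} = bopen A a"
   by (intro Set.set_eqI) (simp add: D_mem copy_mem bopen_def topspace_zariski)
  thus ?thesis using bopen_open[OF a] by simp
 next
  case False
  hence "D j {y : copy X x0 i. a ~: snd y} = bopen A a - {x0}"
   by (intro Set.set_eqI) (auto simp add: D_mem copy_mem bopen_def topspace_zariski simp del: set_eq_iff)
  thus ?thesis using opn_diff bopen_open[OF a] by simp
 qed
 thus ?thesis unfolding opn_Y using i by (auto simp: copy_def)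
qed

lemma opn_copy: "i : N ==> opn Y (copy X x0 i)"
proof -
 assume i: "i : N"
 have "copy X x0 i = {y : copy X x0 i. \<one> ~: snd y}"
  using primeidealD(1) copy_mem by blast
 thus ?thesis using copy_opn[OF one_closed i] by simp
qed

lemma gen_copy_in: "gen : copy X x0 i"
 using gen_copy[of i] zero_prime unfolding copy_def by (force simp: topspace_zariski)

text \<open>A point with dense closure lies in every open set around \<open>gen\<close>. Thus its
  prime contains no nonzero element and it belongs to the first copy, which leaves only
  \<open>gen\<close>.\<close>

lemma generic_Y: "generic_point Y = gen"
 unfolding generic_point_def
proof (rule the_equality)
 have g: "gen : pts Y" using opn_copy[OF n1] gen_copy_in openin_subset by blast
 have "y : tsp Y closure_of {gen}" if "y : pts Y" for y unfolding in_closure_of using that gen_in(1) by blast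
 thus "gen : pts Y \<and> tsp Y closure_of {gen} = pts Y"
  using g closure_of_subset_topspace[of "tsp Y"] by blast
 fix y assume y: "y : pts Y \<and> tsp Y closure_of {y} = pts Y"
 hence "gen : tsp Y closure_of {y}" using g by simp
 hence in_all: "y : U" if asm: "opn Y U" "gen : U" for U using asm unfolding in_closure_of by blast
 have p: "primeideal (snd y) A" using Y_prime[OF openin_topspace] y by blast
 have "a ~: snd y" if "a : A" "a ~= \<zero>" for a
  using in_all[OF copy_opn[OF that(1) n1]] gen_copy_in that(2) by auto
 hence "snd y = {\<zero>}" using primeidealD(2,3)[OF p] by blast
 moreover have "y : copy X x0 1" by (rule in_all[OF opn_copy[OF n1] gen_copy_in])
 ultimately show "y = gen" using zero_x0 by (cases y) (auto simp: copy_mem)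
qed

end


text \<open>\<open>w i\<close> is the coordinate of the torsor over the i-th copy, written with a
  trivialization of the sheaf at the generic point, and \<open>T i\<close> is the coordinate that
  belongs to the local generator \<open>x^(d i)\<close>. Transcendence of \<open>T i\<close> will
  make the symmetric algebras embed into \<open>Q\<close>.\<close>

locale gluing = origins A Q et x n for A :: "'a ring" (structure) and Q :: "'q ring" and et x n +
 fixes d :: "nat => nat" and w :: "nat => 'q"
 assumes w: "i : N ==> w i : Q"
  and w_diff: "i : N ==> j : N ==> EX a:A. EX m::nat. w i \<ominus>.Q w j = et a \<otimes>.Q inv .Q (et x [^].Q m)"
  and transcendental: "i : N ==> set as \<subseteq> A ==>
   horner Q (et x [^].Q d i \<otimes>.Q w i) (map et as) = \<zero>.Q ==> set as \<subseteq> {\<zero>}"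
begin

abbreviation "ze \<equiv> et x"
abbreviation "T i \<equiv> ze [^].Q d i \<otimes>.Q w i"
abbreviation "K \<equiv> stalk Y gen"
abbreviation "io \<equiv> qY.sval"
abbreviation "Lb mu \<equiv> div_sheaf X x0 (spec_section A x) n mu"
definition "xi = rat_fun Y (pts Y) (pull (copies_map n) (pts X) (spec_section A x))"
abbreviation "M V \<equiv> msec (Lb (\<lambda>i. - int (d i))) V"

lemma ze[simp]: "ze : Q" "ze ~= \<zero>.Q" "ze [^].Q (m::nat) : Q" "ze [^].Q (m::nat) ~= \<zero>.Q"
 using al_hom(2) al_zero(2) x by auto

lemma T[simp]: "i : N ==> T i : Q" using w by simp

lemma gen_pts: "gen : pts Y" using openin_subset[OF opn_copy[OF n1]] gen_copy_in by blast

lemmas io_inj = qY.stalk_hom[OF gen_pts]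
lemmas ioh = inj_homD[OF io_inj]

sublocale K: cring K by (rule qY.stalk_cring[OF gen_pts])

lemma pts_prime: "y : pts Y ==> primeideal (snd y) A" by (rule Y_prime[OF openin_topspace])

lemma D_pts: "i : N ==> D i (pts Y) = pts X" unfolding D_def pts_Y by blast

lemma pts_ne: "pts Y ~= {}" using gen_pts by blast

lemma copies_section:
 assumes a: "a : A"
 shows "pull (copies_map n) (pts X) (spec_section A a) : sec Y (pts Y)"
  "valY (pts Y) (pull (copies_map n) (pts X) (spec_section A a)) = et a"
 using secY_I[OF openin_topspace pts_ne, of "\<lambda>i\<in>N. spec_section A a" "et a"] spec_section_in[OF a]
 by (auto simp: copies_map_def D_pts simp del: Spec_simps)

lemma io_rat:
 assumes U: "opn Y U" "U ~= {}" and s: "s : sec Y U"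
 shows "rat_fun Y U s : K" "io (rat_fun Y U s) = valY U s"
 using qY.germ_in_stalk[OF U(1) gen_in(1)[OF U] s] qY.sval_germ[OF U(1) gen_in(1)[OF U] s]
 by (simp_all add: rat_fun_def generic_Y)

lemma xi: "xi : K" "io xi = ze"
 using io_rat[OF openin_topspace pts_ne] copies_section[OF x(1)] unfolding xi_def by auto

lemma locq_frac: "primeideal P A ==> a : A ==> f : A ==> f ~: P ==> et a \<otimes>.Q inv .Q et f : locq Q et A P"
 unfolding locq_def by blast

lemma K_ex:
 assumes y: "y : pts Y" and q: "q : O_at y" shows "EX k:K. io k = q"
proof -
 obtain a f where f: "a : A" "f : A" "f ~: snd y" "q = et a \<otimes>.Q inv .Q et f"
  using q unfolding locq_def by blast
 have "f ~= \<zero>" using f(3) primeidealD(3)[OF pts_prime[OF y]] by blast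
 hence V: "opn Y {y : copy X x0 1. f ~: snd y}" "{y : copy X x0 1. f ~: snd y} ~= {}"
  using copy_opn[OF f(2) n1] gen_copy_in[of 1] by auto
 obtain s where "s : (sec Y {y : copy X x0 1. f ~: snd y})" "valY {y : copy X x0 1. f ~: snd y} s = q"
  using Y_surj[OF V, of q] locq_frac[OF Y_prime[OF V(1)] f(1,2)] f(4) by blast
 thus ?thesis using io_rat[OF V] by blast
qed

lemma pow_et: "ze [^].Q (m::nat) = et (x [^] m)"
proof (induction m)
 case 0 show ?case using al_hom(5) by simp
next
 case (Suc m) thus ?case using al_hom(3)[of "x [^] m" x] x(1) by simp
qed

lemma pow_notin: "primeideal P A ==> x ~: P ==> x [^] (m::nat) ~: P" using primeidealD(6)[of P A x m] x(1) by blast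

lemma x_inv_locq:
 assumes P: "primeideal P A" "x ~: P" and a: "a : A" shows "et a \<otimes>.Q inv .Q (ze [^].Q (m::nat)) : locq Q et A P"
 unfolding pow_et by (rule locq_frac[OF P(1) a _ pow_notin[OF P]]) (use x(1) in simp)

lemma x_pow_locq: "primeideal P A ==> ze [^].Q (m::nat) : locq Q et A P"
 unfolding pow_et using al_in_locq x(1) by simp

lemma x_inv_locq1: "primeideal P A ==> x ~: P ==> inv .Q (ze [^].Q (m::nat)) : locq Q et A P"
 using x_inv_locq[of P \<one> m] al_hom(5) by simp

text \<open>Negative powers in \<open>K\<close> are inverses of units of a ring. The powers of
  \<open>xi\<close> are units because the inverse of the value is again the value of an element of
  \<open>K\<close>.\<close>

lemma K_pow:
 "xi [^].K (int m) : K" "io (xi [^].K (int m)) = ze [^].Q m"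
 "xi [^].K (- int m) : K" "io (xi [^].K (- int m)) = inv .Q (ze [^].Q m)"
proof -
 show c: "xi [^].K (int m) : K" unfolding int_pow_int using xi by simp
 show e: "io (xi [^].K (int m)) = ze [^].Q m" for m unfolding int_pow_int
 proof (induction m)
  case 0 show ?case using ioh(5) by simp
 next
  case (Suc m) thus ?case using ioh(3)[of "xi [^].K m" xi] xi by simp
 qed
 obtain k where k: "k : K" "io k = inv .Q (ze [^].Q m)"
  using K_ex[OF gen_pts, of "inv .Q (ze [^].Q m)"] x_inv_locq1[OF zero_prime, of m] x(2) by auto
 have "inv .Q (ze [^].Q m) : io ` carrier K" unfolding k(2)[symmetric] by (rule imageI[OF k(1)])
 hence u: "xi [^].K (int m) : Units K" using Q.unit_iff_inj[OF io_inj K.is_cring c] e by simp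
 have i: "xi [^].K (- int m) = inv .K (xi [^].K (int m))"
  by (cases "m = 0") (simp_all add: int_pow_def2)
 show "xi [^].K (- int m) : K" unfolding i using u by simp
 have "ze [^].Q m \<otimes>.Q io (inv .K (xi [^].K (int m))) = \<one>.Q"
  using ioh(3)[OF c, of "inv .K (xi [^].K (int m))"] K.Units_r_inv[OF u] ioh(5) e u by simp
 also have "\<one>.Q = ze [^].Q m \<otimes>.Q inv .Q (ze [^].Q m)" using Q.inv_nz[of "ze [^].Q m"] by simp
 finally show "io (xi [^].K (- int m)) = inv .Q (ze [^].Q m)"
  unfolding i by (rule Q.l_cancel[OF ze(3,4) ioh(2)[OF K.Units_inv_closed[OF u]] Q.inv_cl[OF ze(3,4)], THEN iffD1])
qed

lemma Lb_simps:
 "zero (msec (Lb mu) U) = \<zero>.K" "add (msec (Lb mu) U) = add K"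
 "U ~= {} ==> smult (msec (Lb mu) U) = (\<lambda>r f. rat_fun Y U r \<otimes>.K f)"
 "V ~= {} ==> mres (Lb mu) U V f = f"
 "U ~= {} ==> carrier (msec (Lb mu) U) = {f : K. ALL i:N. ALL y:U \<inter> copy X x0 i.
        EX V s. opn Y V \<and> y : V \<and> V \<subseteq> U \<inter> copy X x0 i \<and> s : sec Y V \<and>
         f = rat_fun Y V s \<otimes>.K (xi [^].K (- mu i))}"
 by (simp_all add: div_sheaf_def xi_def Let_def function_field_def generic_Y fun_eq_iff del: Spec_simps)

text \<open>\<open>z j\<close> stands for the value of the local generator
  \<open>xi^(- mu j)\<close>, so one argument serves multiplicities of both signs: those of the
  cocycle and those of the dual sheaf.\<close>

lemma msec_iff:
 assumes U: "opn Y U" "U ~= {}"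
  and z: "!!j. j : N ==> xi [^].K (- mu j) : K" "!!j. j : N ==> io (xi [^].K (- mu j)) = z j" "!!j. j : N ==> z j ~= \<zero>.Q"
 shows "f : (msec (Lb mu) U) \<longleftrightarrow>
  f : K \<and> (ALL j:N. ALL y:U \<inter> copy X x0 j. io f \<otimes>.Q inv .Q z j : O_at y)"
 unfolding Lb_simps(5)[OF U(2)] mem_Collect_eq
proof (intro conj_cong refl ball_cong)
 fix j y assume f: "f : K" and j: "j : N" and y: "y : U \<inter> copy X x0 j"
 have zc: "z j : Q" "z j ~= \<zero>.Q" using ioh(2)[OF z(1)[OF j]] z(2,3)[OF j] by auto
 show "(EX V s. opn Y V \<and> y : V \<and> V \<subseteq> U \<inter> copy X x0 j \<and> s : sec Y V \<and> f = rat_fun Y V s \<otimes>.K (xi [^].K (- mu j)))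
  \<longleftrightarrow> io f \<otimes>.Q inv .Q z j : O_at y" (is "?L \<longleftrightarrow> ?R")
 proof
  assume ?L
  then obtain V s where V: "opn Y V" "y : V" "s : sec Y V" "f = rat_fun Y V s \<otimes>.K (xi [^].K (- mu j))" by blast
  have ne: "V ~= {}" using V(2) by blast
  note r = io_rat[OF V(1) ne V(3)]
  have "io f = valY V s \<otimes>.Q z j" unfolding V(4) ioh(3)[OF r(1) z(1)[OF j]] r(2) z(2)[OF j] ..
  moreover have v: "valY V s : Q" using qY.val_carr[OF V(1,2,3)] .
  ultimately have "io f \<otimes>.Q inv .Q z j = valY V s" using zc Q.inv_nz[of "z j"] by (simp add: Q.m_assoc)
  thus ?R using Y_locq[OF V(1-3)] by simp
 next
  assume R: ?R
  have fq: "io f : Q" using ioh(2)[OF f] .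
  have "primeideal (snd y) A" using y copy_mem by blast
  then obtain a g where g: "a : A" "g : A" "g ~: snd y" "io f \<otimes>.Q inv .Q z j = et a \<otimes>.Q inv .Q et g"
   using R unfolding locq_def by blast
  let ?V = "U \<inter> {y : copy X x0 j. g ~: snd y}"
  have V: "opn Y ?V" "y : ?V" "?V ~= {}" using openin_Int[OF U(1) copy_opn[OF g(2) j]] y g(3) by auto
  obtain s where s: "s : sec Y ?V" "valY ?V s = io f \<otimes>.Q inv .Q z j"
   using Y_surj[OF V(1,3), of "io f \<otimes>.Q inv .Q z j"] locq_frac[OF Y_prime[OF V(1)] g(1,2)] g(4) by auto
  note r = io_rat[OF V(1,3) s(1)]
  have "io (rat_fun Y ?V s \<otimes>.K (xi [^].K (- mu j))) = io f"
   unfolding ioh(3)[OF r(1) z(1)[OF j]] r(2) z(2)[OF j] s(2) using zc fq Q.inv_nz[of "z j"] by (simp add: Q.m_assoc)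
  hence "f = rat_fun Y ?V s \<otimes>.K (xi [^].K (- mu j))"
   using ioh(6)[of "rat_fun Y ?V s \<otimes>.K (xi [^].K (- mu j))" f] f r(1) z(1)[OF j] by simp
  thus ?L using V s(1) by blast
 qed
qed

lemma M_iff:
 assumes "opn Y U" "U ~= {}"
 shows "f : M U \<longleftrightarrow>
  f : K \<and> (ALL j:N. ALL y:U \<inter> copy X x0 j. io f \<otimes>.Q inv .Q (ze [^].Q d j) : O_at y)"
 by (rule msec_iff[OF assms]) (use K_pow in simp_all)

text \<open>At a point that lies in two different copies \<open>x\<close> is invertible, so the
  condition for \<open>j\<close> follows from the one for \<open>i\<close>.\<close>

lemma M_cover:
 assumes i: "i : N" and U: "opn Y U" "U ~= {}" "U \<subseteq> copy X x0 i"
 shows "f : M U \<longleftrightarrow>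
  f : K \<and> (ALL y:U. io f \<otimes>.Q inv .Q (ze [^].Q d i) : O_at y)"
proof -
 have "io f \<otimes>.Q inv .Q (ze [^].Q d j) : O_at y"
  if f: "f : K" and j: "j : N" and y: "y : U \<inter> copy X x0 j" and a: "io f \<otimes>.Q inv .Q (ze [^].Q d i) : O_at y" for j y
 proof (cases "j = i")
  case False
  have P: "primeideal (snd y) A" using y copy_mem by blast
  have "y : copy X x0 i" "y : copy X x0 j" using y U(3) by auto
  hence "snd y ~= x0" using False unfolding copy_mem by auto
  hence xy: "x ~: snd y" using x0_iff[OF P] by simp
  have fq: "io f : Q" using ioh(2)[OF f] .
  have "io f \<otimes>.Q inv .Q (ze [^].Q d j) = (io f \<otimes>.Q inv .Q (ze [^].Q d i)) \<otimes>.Q (ze [^].Q d i \<otimes>.Q inv .Q (ze [^].Q d j))"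
   using fq by (simp add: Q.m_assoc)
  thus ?thesis using locq_ring(1)[OF P a locq_ring(1)[OF P x_pow_locq[OF P] x_inv_locq1[OF P xy]]] by simp
 qed (use a in simp)
 thus ?thesis unfolding M_iff[OF U(1,2)] using i U(3) by blast
qed

lemma M_sym_module: assumes V: "opn Y V" "V ~= {}" shows "sym_module (sec Y V) (M V)"
proof (rule sym_module.intro[OF qY.sec_cring[OF V]], rule sym_module_axioms.intro)
 fix u assume u: "u : M V"
 hence uK: "u : K" and uO: "!!j y. j : N ==> y : V \<inter> copy X x0 j ==> io u \<otimes>.Q inv .Q (ze [^].Q d j) : O_at y"
  unfolding M_iff[OF V] by auto
 {
  fix v assume v: "v : M V"
  hence vK: "v : K" and vO: "!!j y. j : N ==> y : V \<inter> copy X x0 j ==> io v \<otimes>.Q inv .Q (ze [^].Q d j) : O_at y"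
   unfolding M_iff[OF V] by auto
  have "io (u \<oplus>.K v) \<otimes>.Q inv .Q (ze [^].Q d j) : O_at y" if "j : N" "y : V \<inter> copy X x0 j" for j y
   using locq_ring(2)[OF Y_prime[OF V(1)] uO[OF that] vO[OF that]] that uK vK ioh(2)
   by (simp add: ioh(4) Q.l_distr)
  thus "u \<oplus>.(M V) v : M V" unfolding M_iff[OF V] Lb_simps using uK vK by simp
 }
 fix r assume r: "r : sec Y V"
 note rr = io_rat[OF V r]
 have vr: "valY V r : Q" using qY.val_carr[OF V(1) gen_in(1)[OF V] r] .
 have "io (rat_fun Y V r \<otimes>.K u) \<otimes>.Q inv .Q (ze [^].Q d j) : O_at y" if "j : N" "y : V \<inter> copy X x0 j" for j y
  using locq_ring(1)[OF Y_prime[OF V(1)] Y_locq[OF V(1) _ r] uO[OF that]] that uK vr ioh(2)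
  by (simp add: ioh(3) rr Q.m_assoc)
 thus "r \<odot>.(M V) u : M V" unfolding M_iff[OF V] Lb_simps(3)[OF V(2)] using uK rr(1) by simp
qed

text \<open>The cocycle has to be an element of the stalk \<open>K\<close> at the generic point; it
  is found there through its value in \<open>Q\<close>.\<close>

definition g where "g i j = inv_into (carrier K) io (w i \<ominus>.Q w j)"

text \<open>Distinct copies meet only where \<open>x\<close> is invertible, so the denominators of
  the difference are harmless there; for \<open>i = j\<close> the difference is 0.\<close>

lemma w_diff_locq:
 assumes ij: "i : N" "j : N" and y: "y : copy X x0 i \<inter> copy X x0 j" shows "w i \<ominus>.Q w j : O_at y"
proof -
 have P: "primeideal (snd y) A" using y copy_mem by blast
 obtain a m where a: "a : A" "w i \<ominus>.Q w j = et a \<otimes>.Q inv .Q (ze [^].Q (m::nat))" using w_diff[OF ij] by blast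
 show ?thesis
 proof (cases "i = j")
  case True
  hence "w i \<ominus>.Q w j = et \<zero>" using w[OF ij(1)] al_zero(1) by (simp add: Q.minus_eq Q.r_neg)
  thus ?thesis using al_in_locq[OF P zero_closed] by simp
 next
  case False
  hence "snd y ~= x0" using y unfolding Int_iff copy_mem by auto
  hence "x ~: snd y" using x0_iff[OF P] by simp
  thus ?thesis unfolding a(2) by (rule x_inv_locq[OF P _ a(1)])
 qed
qed

lemma g: assumes "i : N" "j : N" shows "g i j : K" "io (g i j) = w i \<ominus>.Q w j"
proof -
 from K_ex[OF gen_pts w_diff_locq[OF assms IntI[OF gen_copy_in gen_copy_in]]]
 obtain k where k: "k : K" "io k = w i \<ominus>.Q w j" by (rule bexE)
 have "w i \<ominus>.Q w j : io ` carrier K" unfolding k(2)[symmetric] by (rule imageI[OF k(1)])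
 thus "g i j : K" "io (g i j) = w i \<ominus>.Q w j" unfolding g_def by (rule inv_into_into, rule f_inv_into_f)
qed

text \<open>The cocycle identity telescopes. Membership in the sheaf asks for regularity after
  multiplication by \<open>x^(d l)\<close>, and the differences are regular on the overlaps to begin
  with.\<close>

lemma g_cocycle: "cocycle N (copy X x0) (Lb (\<lambda>i. int (d i))) g"
 unfolding cocycle_def
proof (intro conjI ballI)
 fix i j assume ij: "i : N" "j : N"
 let ?U = "copy X x0 i \<inter> copy X x0 j"
 have U: "opn Y ?U" "?U ~= {}" using opn_copy ij gen_copy_in by blast+
 have pos: "io (g i j) \<otimes>.Q inv .Q (inv .Q (ze [^].Q d l)) : O_at y" if "l : N" "y : ?U \<inter> copy X x0 l" for l y
  unfolding g(2)[OF ij] Q.inv_inv'[OF ze(3,4)]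
  by (rule locq_ring(1)[OF Y_prime[OF U(1)] w_diff_locq[OF ij] x_pow_locq[OF Y_prime[OF U(1)]]]) (use that in auto)
 show "g i j : (msec (Lb (\<lambda>i. int (d i))) ?U)"
  by (rule msec_iff[OF U, where z = "\<lambda>l. inv .Q (ze [^].Q d l)", THEN iffD2])
   (use K_pow pos g(1)[OF ij] Q.inv_nz[OF ze(3,4)] in auto)
 fix l assume l: "l : N"
 have W: "?U \<inter> copy X x0 l ~= {}" using gen_copy_in by blast
 have "io (g i j \<oplus>.K g j l) = io (g i l)"
  using g[OF ij] g[OF ij(2) l] g[OF ij(1) l] w[OF ij(1)] w[OF ij(2)] w[OF l]
  by (simp add: ioh(4) Q.minus_eq Q.a_assoc Q.r_neg1)
 hence "g i j \<oplus>.K g j l = g i l"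
  using ioh(6)[of "g i j \<oplus>.K g j l" "g i l"] g(1)[OF ij] g(1)[OF ij(2) l] g(1)[OF ij(1) l] by simp
 thus "mres (Lb (\<lambda>i. int (d i))) ?U (?U \<inter> copy X x0 l) (g i j)
   \<oplus>.(msec (Lb (\<lambda>i. int (d i))) (?U \<inter> copy X x0 l))
   mres (Lb (\<lambda>i. int (d i))) (copy X x0 j \<inter> copy X x0 l) (?U \<inter> copy X x0 l) (g j l) =
   mres (Lb (\<lambda>i. int (d i))) (copy X x0 i \<inter> copy X x0 l) (?U \<inter> copy X x0 l) (g i l)"
  using W by (simp add: Lb_simps)
qed

end


lemma (in qspace) res_hom:
 assumes U: "opn X U" "U ~= {}" and V: "opn X V" "V ~= {}" "V \<subseteq> U" shows "res X U V : ring_hom (sec X U) (sec X V)"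
proof (rule ring_hom_memI)
 note r = res_val[OF U(1) V(1,3,2)] and vU = inj_homD[OF val_inj[OF U]] and vV = inj_homD[OF val_inj[OF V(1,2)]]
 interpret U: cring "sec X U" by (rule sec_cring[OF U])
 interpret V: cring "sec X V" by (rule sec_cring[OF V(1,2)])
 fix s t assume st: "s : sec X U" "t : sec X U"
 show "res X U V s : sec X V" using r st by blast
 show "res X U V (s \<otimes>.(sec X U) t) = res X U V s \<otimes>.(sec X V) res X U V t"
  by (rule vV(6)[THEN iffD1]) (use r st in \<open>simp_all add: vV(3) vU(3)\<close>)
 show "res X U V (s \<oplus>.(sec X U) t) = res X U V s \<oplus>.(sec X V) res X U V t"
  by (rule vV(6)[THEN iffD1]) (use r st in \<open>simp_all add: vV(4) vU(4)\<close>)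
next
 interpret U: cring "sec X U" by (rule sec_cring[OF U])
 interpret V: cring "sec X V" by (rule sec_cring[OF V(1,2)])
 note r = res_val[OF U(1) V(1,3,2)] and vU = inj_homD[OF val_inj[OF U]] and vV = inj_homD[OF val_inj[OF V(1,2)]]
 show "res X U V \<one>.(sec X U) = \<one>.(sec X V)" by (rule vV(6)[THEN iffD1]) (use r in \<open>simp_all add: vV(5) vU(5)\<close>)
qed

lemma poly_ring_horner:
 assumes "ring Q" "z : Q" "et ` A \<subseteq> Q" "w : poly_ring Q et A z"
 shows "EX as. set as \<subseteq> A \<and> w = horner Q z (map et as)"
 using assms(4)
proof induction
 interpret ring Q by fact
 case (base a)
 thus ?case using assms(2,3) by (intro exI[of _ "[a]"]) auto
next
 case (step a w)
 then obtain as where as: "set as \<subseteq> A" "w = horner Q z (map et as)" by blast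
 show ?case by (rule exI[of _ "a # as"]) (use as step.hyps(1) in simp)
qed

lemma (in poly_gen) horner_poly_ring: "set as \<subseteq> A ==> horner Q z (map et as) : Az"
proof (induction as)
 case Nil thus ?case using poly_ring.base[OF A.zero_closed, of et Q z] et0 by simp
next
 case (Cons a as) thus ?case by (simp add: poly_ring.step)
qed

lemma (in ring) horner_zero: "z : R ==> set rs \<subseteq> {\<zero>} ==> horner R z rs = \<zero>"
 by (induction rs) auto

lemma (in cring) horner_mult:
 "z : R ==> u : R ==> set rs \<subseteq> R ==> horner R z (map (\<lambda>r. u \<otimes> r) rs) = u \<otimes> horner R z rs"
 by (induction rs) (auto simp: r_distr m_lcomm)

lemma (in dom_in_field) common_denominator:
 assumes P: "primeideal P R" and rs: "set rs \<subseteq> locq Q al R P"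
 shows "EX f:carrier R - P. EX as. set as \<subseteq> R \<and> map (\<lambda>r. al f \<otimes>.Q r) rs = map al as"
 using rs
proof (induction rs)
 case Nil thus ?case using primeidealD(1)[OF P] by (intro bexI[of _ \<one>]) auto
next
 case (Cons r rs)
 then obtain f as where f: "f : R" "f ~: P" "set as \<subseteq> R" "map (\<lambda>r. al f \<otimes>.Q r) rs = map al as" by auto
 obtain a e where e: "a : R" "e : R" "e ~: P" "r = al a \<otimes>.Q inv .Q al e" using Cons.prems unfolding locq_def by auto
 have rsc: "set rs \<subseteq> Q" using Cons.prems locq_ring(4)[OF P] by auto
 have e0: "al e ~= \<zero>.Q" "al e : Q" using al_nz[OF P] e al_hom(2) by auto
 have ac: "al a : Q" "inv .Q al e : Q" "al f : Q" using e(1) f(1) al_hom(2) Q.inv_cl[OF e0(2,1)] by auto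
 have er: "al e \<otimes>.Q r = al a" unfolding e(4) Q.m_lcomm[OF e0(2) ac(1,2)] using Q.inv_nz[OF e0(2,1)] ac by simp
 have rc: "r : Q" unfolding e(4) using ac by simp
 have "al (e \<otimes> f) \<otimes>.Q r = al f \<otimes>.Q (al e \<otimes>.Q r)"
  using e(2) f(1) rc al_hom(2) by (simp add: al_hom(3) Q.m_ac)
 hence "al (e \<otimes> f) \<otimes>.Q r = al (f \<otimes> a)" unfolding er using e(1) f(1) by (simp add: al_hom(3))
 moreover have "map (\<lambda>r. al (e \<otimes> f) \<otimes>.Q r) rs = map al (map (\<lambda>b. e \<otimes> b) as)"
 proof -
  have "map (\<lambda>r. al (e \<otimes> f) \<otimes>.Q r) rs = map (\<lambda>b. al e \<otimes>.Q b) (map (\<lambda>r. al f \<otimes>.Q r) rs)"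
   using rsc f(1) e(2) al_hom(2) by (auto simp: al_hom(3) Q.m_assoc)
  also have "\<dots> = map al (map (\<lambda>b. e \<otimes> b) as)" unfolding f(4) using f(3) e(2) by (auto simp: al_hom(3))
  finally show ?thesis .
 qed
 ultimately have "map (\<lambda>r. al (e \<otimes> f) \<otimes>.Q r) (r # rs) = map al ((f \<otimes> a) # map (\<lambda>b. e \<otimes> b) as)" unfolding list.map by simp
 moreover have "e \<otimes> f : carrier R - P" using primeidealD(4)[OF P e(2) f(1)] e(2,3) f(1,2) by simp
 moreover have "set ((f \<otimes> a) # map (\<lambda>b. e \<otimes> b) as) \<subseteq> R" using e(1,2) f(1,3) by auto
 ultimately show ?case by blast
qed

section \<open>Symmetric algebras of the sheaf inside the field\<close>

context gluing
begin

abbreviation "L \<equiv> Lb (\<lambda>i. - int (d i))"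
abbreviation "cs V \<equiv> sym_const (sec Y V) (M V)"
abbreviation "vs V \<equiv> sym_in (sec Y V) (M V)"
text \<open>Evaluates the symmetric algebra at the coordinate \<open>w i\<close>: a section
  \<open>u\<close> of the sheaf becomes \<open>u w i\<close>. Algebras over different charts and
  open sets are thereby put into one field.\<close>

definition "E i V = sym_lift (sec Y V) Q (valY V) (\<lambda>u. io u \<otimes>.Q w i)"

lemma M_K: "opn Y V ==> V ~= {} ==> u : M V ==> u : K"
 unfolding M_iff by blast

lemma E:
 assumes i: "i : N" and V: "opn Y V" "V ~= {}"
 shows "E i V : ring_hom (SymO Y L V) Q"
  "!!r. r : sec Y V ==> E i V (cs V r) = valY V r"
  "!!u. u : M V ==> E i V (vs V u) = io u \<otimes>.Q w i"
proof -
 note h = inj_homD[OF qY.val_inj[OF V]] and wi = w[OF i] and uK = M_K[OF V]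
 have 1: "io u \<otimes>.Q w i : Q" if "u : M V" for u using ioh(2)[OF uK[OF that]] wi by simp
 have 2: "io (u \<oplus>.(M V) v) \<otimes>.Q w i = io u \<otimes>.Q w i \<oplus>.Q io v \<otimes>.Q w i"
  if "u : M V" "v : M V" for u v
  unfolding Lb_simps ioh(4)[OF uK[OF that(1)] uK[OF that(2)]]
  by (rule Q.l_distr[OF ioh(2)[OF uK[OF that(1)]] ioh(2)[OF uK[OF that(2)]] wi])
 have 3: "io (r \<odot>.(M V) u) \<otimes>.Q w i = valY V r \<otimes>.Q (io u \<otimes>.Q w i)"
  if r: "r : sec Y V" and u: "u : M V" for r u
  unfolding Lb_simps(3)[OF V(2)] ioh(3)[OF io_rat(1)[OF V r] uK[OF u]] io_rat(2)[OF V r]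
  by (rule Q.m_assoc[OF h(2)[OF r] ioh(2)[OF uK[OF u]] wi])
 note l = sym_module.sym_lift[OF M_sym_module[OF V] Q.is_cring h(1), of "\<lambda>u. io u \<otimes>.Q w i", OF 1 2 3]
 show "E i V : ring_hom (SymO Y L V) Q" unfolding E_def by (rule l(1))
 show "E i V (cs V r) = valY V r" if "r : sec Y V" for r unfolding E_def by (rule l(2)) (assumption | rule that)+
 show "E i V (vs V u) = io u \<otimes>.Q w i" if "u : M V" for u unfolding E_def by (rule l(3)) (assumption | rule that)+
qed

lemma Sym_cring: "opn Y V ==> V ~= {} ==> cring (SymO Y L V)"
proof -
 assume "opn Y V" "V ~= {}"
 then interpret S: sym_module "sec Y V" "M V" by (rule M_sym_module)
 show ?thesis by (rule S.Sym.is_cring)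
qed

lemma M_gen:
 assumes i: "i : N" and V: "opn Y V" "V ~= {}" "V \<subseteq> copy X x0 i"
 shows "xi [^].K int (d i) : M V"
  "!!u. u : M V ==> EX r:sec Y V. u = r \<odot>.(M V) (xi [^].K int (d i))"
proof -
 have "\<one>.Q : O_at y" if "y : V" for y using al_in_locq[OF Y_prime[OF V(1) that] one_closed] al_hom(5) by simp
 thus "xi [^].K int (d i) : M V" unfolding M_cover[OF i V] using K_pow Q.inv_nz[OF ze(3,4)] by simp
 fix u assume u: "u : M V"
 note u' = u[unfolded M_cover[OF i V]]
 obtain r where r: "r : sec Y V" "valY V r = io u \<otimes>.Q inv .Q (ze [^].Q d i)"
  using Y_surj[OF V(1,2)] u' by blast
 note rr = io_rat[OF V(1,2) r(1)]
 have "io (rat_fun Y V r \<otimes>.K (xi [^].K int (d i))) = io u"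
  unfolding ioh(3)[OF rr(1) K_pow(1)] rr(2) K_pow(2) r(2) using ioh(2) u' Q.inv_nz[OF ze(3,4)] by (simp add: Q.m_assoc)
 hence "rat_fun Y V r \<otimes>.K (xi [^].K int (d i)) = u"
  using ioh(6)[OF K.m_closed[OF rr(1) K_pow(1)]] u' by blast
 thus "EX r:sec Y V. u = r \<odot>.(M V) (xi [^].K int (d i))"
  unfolding Lb_simps(3)[OF V(2)] using r(1) by blast
qed

text \<open>The sheaf is free of rank one on the copy, so its symmetric algebra consists of
  polynomials in the generator.\<close>

lemma Sym_horner:
 assumes i: "i : N" and V: "opn Y V" "V ~= {}" "V \<subseteq> copy X x0 i" and c: "c : SymO Y L V"
 shows "EX rs. set rs \<subseteq> sec Y V \<and> c = horner (SymO Y L V) (vs V (xi [^].K int (d i))) (map (cs V) rs)"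
proof -
 interpret S: sym_module "sec Y V" "M V" by (rule M_sym_module[OF V(1,2)])
 note g = M_gen[OF i V]
 interpret p: poly_gen "sec Y V" "SymO Y L V" "cs V" "vs V (xi [^].K int (d i))"
  by (intro poly_gen.intro S.is_cring S.Sym.is_cring poly_gen_axioms.intro S.const_sym_hom S.sym_in_closed[OF g(1)])
 have "c : p.Az"
 proof (rule S.sym_induct[OF c])
  fix u assume u: "u : M V"
  obtain r where r: "r : sec Y V" "u = r \<odot>.(M V) (xi [^].K int (d i))" using g(2)[OF u] by (rule bexE)
  show "vs V u : p.Az" unfolding r(2) S.sym_in_smult[OF r(1) g(1)] by (rule p.Az_const_mult[OF p.Az_gen r(1)])
 qed (rule poly_ring.base p.Az_add p.Az_mult, assumption+)+
 thus ?thesis using ring_hom_closed[OF S.const_sym_hom]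
  by (intro poly_ring_horner[OF S.Sym.ring_axioms S.sym_in_closed[OF g(1)]]) auto
qed

lemma E_horner:
 assumes i: "i : N" and V: "opn Y V" "V ~= {}" "V \<subseteq> copy X x0 i" and rs: "set rs \<subseteq> sec Y V"
 shows "horner (SymO Y L V) (vs V (xi [^].K int (d i))) (map (cs V) rs) : SymO Y L V"
  "E i V (horner (SymO Y L V) (vs V (xi [^].K int (d i))) (map (cs V) rs)) = horner Q (T i) (map (valY V) rs)"
proof -
 interpret S: sym_module "sec Y V" "M V" by (rule M_sym_module[OF V(1,2)])
 note g = M_gen(1)[OF i V] and e = E[OF i V(1,2)]
 have c: "set (map (cs V) rs) \<subseteq> SymO Y L V" using rs ring_hom_closed[OF S.const_sym_hom] by auto
 show "horner (SymO Y L V) (vs V (xi [^].K int (d i))) (map (cs V) rs) : SymO Y L V"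
  by (rule S.Sym.horner_closed[OF S.sym_in_closed[OF g] c])
 have m: "map (E i V) (map (cs V) rs) = map (valY V) rs" using rs e(2) by auto
 show "E i V (horner (SymO Y L V) (vs V (xi [^].K int (d i))) (map (cs V) rs)) = horner Q (T i) (map (valY V) rs)"
  unfolding horner_hom[OF S.Sym.ring_axioms Q.ring_axioms e(1) S.sym_in_closed[OF g] c] e(3)[OF g] K_pow(2) m ..
qed

text \<open>A common denominator reduces coefficients from the fraction field to coefficients in
  \<open>A\<close>.\<close>

lemma transcendental_K:
 assumes i: "i : N" and rs: "set rs \<subseteq> locq Q et A {\<zero>}" and 0: "horner Q (T i) rs = \<zero>.Q"
 shows "set rs \<subseteq> {\<zero>.Q}"
proof -
 from common_denominator[OF zero_prime rs]
 obtain f as where f': "f : carrier A - {\<zero>}" and f34: "set as \<subseteq> A" "map (\<lambda>r. et f \<otimes>.Q r) rs = map et as"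
  by (elim bexE exE conjE)
 note f = f'[unfolded Diff_iff singleton_iff, THEN conjunct1] f'[unfolded Diff_iff singleton_iff, THEN conjunct2] f34
 have rsc: "set rs \<subseteq> Q" using rs locq_ring(4)[OF zero_prime] by blast
 have f0: "et f ~= \<zero>.Q" "et f : Q" using f al_hom(2) al_zero(2) by auto
 have "horner Q (T i) (map et as) = \<zero>.Q"
  unfolding f(4)[symmetric] Q.horner_mult[OF T[OF i] f0(2) rsc] 0 using f0 by simp
 hence "set as \<subseteq> {\<zero>}" by (rule transcendental[OF i f(3)])
 hence "set (map (\<lambda>r. et f \<otimes>.Q r) rs) \<subseteq> {\<zero>.Q}" unfolding f(4) using al_zero(1) by auto
 thus ?thesis using rsc f0 Q.integral_iff by auto
qed

text \<open>An element is a polynomial in the generator, and \<open>E\<close> evaluates it at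
  \<open>T i\<close>, which satisfies no relation.\<close>

lemma E_inj:
 assumes i: "i : N" and V: "opn Y V" "V ~= {}" "V \<subseteq> copy X x0 i" shows "inj_hom (SymO Y L V) Q (E i V)"
proof -
 interpret S: sym_module "sec Y V" "M V" by (rule M_sym_module[OF V(1,2)])
 interpret h: ring_hom_ring "SymO Y L V" Q "E i V" by (rule ring_hom_ringI2[OF S.Sym.ring_axioms Q.ring_axioms E(1)[OF i V(1,2)]])
 have "c = \<zero>.(SymO Y L V)" if c: "c : SymO Y L V" "E i V c = \<zero>.Q" for c
 proof -
  obtain rs where rs: "set rs \<subseteq> sec Y V" "c = horner (SymO Y L V) (vs V (xi [^].K int (d i))) (map (cs V) rs)"
   using Sym_horner[OF i V c(1)] by blast
  have "horner Q (T i) (map (valY V) rs) = \<zero>.Q" using c(2) unfolding rs(2) E_horner(2)[OF i V rs(1)] .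
  moreover have "set (map (valY V) rs) \<subseteq> locq Q et A {\<zero>}" using Y_locq[OF V(1) gen_in(1)[OF V(1,2)]] rs(1) by auto
  ultimately have "set (map (valY V) rs) \<subseteq> {\<zero>.Q}" by (intro transcendental_K[OF i])
  hence "set rs \<subseteq> {\<zero>.(sec Y V)}"
   using inj_hom_zero(2)[OF qY.val_inj[OF V(1,2)] S.ring_axioms Q.ring_axioms] rs(1) by auto
  hence "set (map (cs V) rs) \<subseteq> {\<zero>.(SymO Y L V)}"
   using ring_hom_zero[OF S.const_sym_hom S.ring_axioms S.Sym.ring_axioms] by auto
  thus ?thesis unfolding rs(2) by (intro S.Sym.horner_zero[OF S.sym_in_closed[OF M_gen(1)[OF i V]]])
 qed
 hence "a_kernel (SymO Y L V) Q (E i V) = {\<zero>.(SymO Y L V)}" unfolding a_kernel_def' using h.hom_zero S.Sym.zero_closed by blast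
 thus ?thesis unfolding inj_hom_def using E(1)[OF i V(1,2)] h.trivial_ker_imp_inj by blast
qed

lemma SymO_res:
 assumes i: "i : N" and V: "opn Y V" "V ~= {}" and V': "opn Y V'" "V' ~= {}" "V' \<subseteq> V" and c: "c : SymO Y L V"
 shows "SymO_res Y L V V' c : SymO Y L V'" "E i V' (SymO_res Y L V V' c) = E i V c"
proof -
 interpret S: sym_module "sec Y V" "M V" by (rule M_sym_module[OF V])
 interpret S': sym_module "sec Y V'" "M V'" by (rule M_sym_module[OF V'(1,2)])
 have sub: "u : M V'" if "u : M V" for u using that V'(3) unfolding M_iff[OF V] M_iff[OF V'(1,2)] by blast
 have rv: "res Y V V' r : sec Y V'" "valY V' (res Y V V' r) = valY V r" if "r : sec Y V" for r
  using qY.res_val[OF V(1) V'(1,3,2) that] by auto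
 have rat: "rat_fun Y V' (res Y V V' r) = rat_fun Y V r" if "r : sec Y V" for r
  using qY.germ_eq[OF V'(1) gen_in(1)[OF V'(1,2)] rv(1)[OF that] V(1) gen_in(1)[OF V] that] rv(2)[OF that]
  by (simp add: rat_fun_def generic_Y)
 let ?r = "\<lambda>r. cs V' (res Y V V' r)" and ?v = "\<lambda>u. vs V' (mres L V V' u)"
 have rh: "?r : ring_hom (sec Y V) (SymO Y L V')"
  using ring_hom_trans[OF qY.res_hom[OF V V'] S'.const_sym_hom] by (simp add: o_def)
 have 1: "?v u : SymO Y L V'" if "u : M V" for u
  unfolding Lb_simps(4)[OF V'(2)] by (rule S'.sym_in_closed[OF sub[OF that]])
 have 2: "?v (u \<oplus>.(M V) u') = ?v u \<oplus>.(SymO Y L V') ?v u'" if "u : M V" "u' : M V" for u u'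
  using S'.sym_in_add[OF sub[OF that(1)] sub[OF that(2)]] unfolding Lb_simps(4)[OF V'(2)] Lb_simps(2) .
 have 3: "?v (r \<odot>.(M V) u) = ?r r \<otimes>.(SymO Y L V') ?v u" if "r : sec Y V" "u : M V" for r u
  using S'.sym_in_smult[OF rv(1)[OF that(1)] sub[OF that(2)]]
  unfolding Lb_simps(4)[OF V'(2)] Lb_simps(3)[OF V(2)] Lb_simps(3)[OF V'(2)] rat[OF that(1)] .
 note l = S.sym_lift[OF S'.Sym.is_cring rh, of ?v, OF 1 2 3]
 have h: "SymO_res Y L V V' : ring_hom (SymO Y L V) (SymO Y L V')" unfolding SymO_res_def by (rule l(1))
 show "SymO_res Y L V V' c : SymO Y L V'" by (rule ring_hom_closed[OF h c])
 note e = E[OF i V] and e' = E[OF i V'(1,2)]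
 have "(E i V' \<circ> SymO_res Y L V V') c = E i V c"
 proof (rule S.hom_eqI[OF c ring_hom_trans[OF h e'(1)] e(1)])
  fix r assume r: "r : sec Y V"
  have "SymO_res Y L V V' (cs V r) = ?r r" unfolding SymO_res_def by (rule l(2)) (assumption | rule r)+
  thus "(E i V' \<circ> SymO_res Y L V V') (cs V r) = E i V (cs V r)" using e(2)[OF r] e'(2)[OF rv(1)[OF r]] rv(2)[OF r] by simp
 next
  fix u assume u: "u : M V"
  have "SymO_res Y L V V' (vs V u) = ?v u" unfolding SymO_res_def by (rule l(3)) (assumption | rule u)+
  thus "(E i V' \<circ> SymO_res Y L V V') (vs V u) = E i V (vs V u)" unfolding Lb_simps(4)[OF V'(2)] using e(3)[OF u] e'(3)[OF sub[OF u]] by simp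
 qed
 thus "E i V' (SymO_res Y L V V' c) = E i V c" by simp
qed

text \<open>\<open>u\<close> is a multiple of \<open>x^(d i)\<close>, in particular regular, and
  \<open>w i - w j\<close> is regular on the overlap; so the product is the value of a
  function.\<close>

lemma dual:
 assumes ij: "i : N" "j : N" and W: "opn Y W" "W ~= {}" "W \<subseteq> copy X x0 i \<inter> copy X x0 j" and u: "u : M W"
 shows "dual_section Y (g i j) W u : sec Y W" "valY W (dual_section Y (g i j) W u) = (w i \<ominus>.Q w j) \<otimes>.Q io u"
proof -
 have Wi: "W \<subseteq> copy X x0 i" using W(3) by blast
 have uK: "u : K" and uO: "io u \<otimes>.Q inv .Q (ze [^].Q d i) : O_at y" if "y : W" for y
  using u that unfolding M_cover[OF ij(1) W(1,2) Wi] by auto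
 note uK = M_K[OF W(1,2) u]
 note gg = g[OF ij]
 have "(w i \<ominus>.Q w j) \<otimes>.Q io u : O_at y" if y: "y : W" for y
 proof -
  have P: "primeideal (snd y) A" by (rule Y_prime[OF W(1) y])
  have "io u = (io u \<otimes>.Q inv .Q (ze [^].Q d i)) \<otimes>.Q ze [^].Q d i" using ioh(2)[OF uK] Q.inv_nz[OF ze(3,4)] by (simp add: Q.m_assoc)
  hence "io u : O_at y" using locq_ring(1)[OF P uO[OF y] x_pow_locq[OF P]] by metis
  thus ?thesis using locq_ring(1)[OF P w_diff_locq[OF ij]] y W(3) by blast
 qed
 then obtain s where s: "s : sec Y W" "valY W s = (w i \<ominus>.Q w j) \<otimes>.Q io u" using Y_surj[OF W(1,2)] by blast
 have fu: "io (g i j \<otimes>.K u) = (w i \<ominus>.Q w j) \<otimes>.Q io u" unfolding ioh(3)[OF gg(1) uK] gg(2) ..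
 have iff: "rat_fun Y W s' = g i j \<otimes>.K u \<longleftrightarrow> valY W s' = valY W s" if s': "s' : sec Y W" for s'
  using ioh(6)[OF io_rat(1)[OF W(1,2) s'] K.m_closed[OF gg(1) uK]] io_rat(2)[OF W(1,2) s'] fu s(2) by simp
 have "dual_section Y (g i j) W u = s" unfolding dual_section_def function_field_def generic_Y
 proof (rule the_equality)
  show "s : sec Y W \<and> rat_fun Y W s = g i j \<otimes>.K u" using s(1) iff[OF s(1)] by simp
  show "s' = s" if "s' : sec Y W \<and> rat_fun Y W s' = g i j \<otimes>.K u" for s'
   using that iff[of s'] inj_homD(6)[OF qY.val_inj[OF W(1,2)], of s' s] s(1) by simp
 qed
 thus "dual_section Y (g i j) W u : sec Y W" "valY W (dual_section Y (g i j) W u) = (w i \<ominus>.Q w j) \<otimes>.Q io u"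
  using s by simp_all
qed

text \<open>Since \<open>(w i - w j) u + u w j = u w i\<close>, the transition from chart
  \<open>i\<close> to chart \<open>j\<close> becomes invisible once both algebras are evaluated in
  \<open>Q\<close>.\<close>

lemma SymO_shift:
 assumes ij: "i : N" "j : N" and W: "opn Y W" "W ~= {}" "W \<subseteq> copy X x0 i \<inter> copy X x0 j" and c: "c : SymO Y L W"
 shows "SymO_shift Y L (dual_section Y (g i j)) W c : SymO Y L W"
  "E j W (SymO_shift Y L (dual_section Y (g i j)) W c) = E i W c"
proof -
 interpret S: sym_module "sec Y W" "M W" by (rule M_sym_module[OF W(1,2)])
 let ?D = "dual_section Y (g i j) W"
 let ?v = "\<lambda>u. cs W (?D u) \<oplus>.(SymO Y L W) vs W u"
 note D = dual[OF ij W] and vh = inj_homD[OF qY.val_inj[OF W(1,2)]] and uK = M_K[OF W(1,2)] and G = g[OF ij]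
 have wc: "w i \<ominus>.Q w j : Q" using w[OF ij(1)] w[OF ij(2)] by simp
 note ch = S.const_sym_hom
 have cc: "cs W (?D u) : SymO Y L W" if "u : M W" for u by (rule ring_hom_closed[OF ch D(1)[OF that]])
 have Dadd: "?D (u \<oplus>.(M W) u') = ?D u \<oplus>.(sec Y W) ?D u'" if u: "u : M W" and u': "u' : M W" for u u'
 proof (rule vh(6)[THEN iffD1, OF D(1)[OF S.M_add[OF u u']] S.a_closed[OF D(1)[OF u] D(1)[OF u']]])
  show "valY W (?D (u \<oplus>.(M W) u')) = valY W (?D u \<oplus>.(sec Y W) ?D u')"
   unfolding vh(4)[OF D(1)[OF u] D(1)[OF u']] D(2)[OF u] D(2)[OF u'] D(2)[OF S.M_add[OF u u']]
   unfolding Lb_simps ioh(4)[OF uK[OF u] uK[OF u']] by (rule Q.r_distr[OF ioh(2)[OF uK[OF u]] ioh(2)[OF uK[OF u']] wc])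
 qed
 have Dsm: "?D (r \<odot>.(M W) u) = r \<otimes>.(sec Y W) ?D u" if r: "r : sec Y W" and u: "u : M W" for r u
 proof (rule vh(6)[THEN iffD1, OF D(1)[OF S.M_smult[OF r u]] S.m_closed[OF r D(1)[OF u]]])
  show "valY W (?D (r \<odot>.(M W) u)) = valY W (r \<otimes>.(sec Y W) ?D u)"
   unfolding vh(3)[OF r D(1)[OF u]] D(2)[OF u] D(2)[OF S.M_smult[OF r u]]
   unfolding Lb_simps(3)[OF W(2)] ioh(3)[OF io_rat(1)[OF W(1,2) r] uK[OF u]] io_rat(2)[OF W(1,2) r]
   by (rule Q.m_lcomm[OF wc vh(2)[OF r] ioh(2)[OF uK[OF u]]])
 qed
 have 1: "?v u : SymO Y L W" if "u : M W" for u using cc[OF that] S.sym_in_closed[OF that] by simp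
 have 2: "?v (u \<oplus>.(M W) u') = ?v u \<oplus>.(SymO Y L W) ?v u'" if u: "u : M W" and u': "u' : M W" for u u'
  unfolding Dadd[OF u u'] ring_hom_add[OF ch D(1)[OF u] D(1)[OF u']] S.sym_in_add[OF u u']
  using cc[OF u] cc[OF u'] S.sym_in_closed[OF u] S.sym_in_closed[OF u'] by (simp add: S.Sym.a_ac)
 have 3: "?v (r \<odot>.(M W) u) = cs W r \<otimes>.(SymO Y L W) ?v u" if r: "r : sec Y W" and u: "u : M W" for r u
  unfolding Dsm[OF r u] ring_hom_mult[OF ch r D(1)[OF u]] S.sym_in_smult[OF r u]
  using cc[OF u] S.sym_in_closed[OF u] ring_hom_closed[OF ch r] by (simp add: S.Sym.r_distr)
 note l = S.sym_lift[OF S.Sym.is_cring ch, of ?v, OF 1 2 3]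
 have h: "SymO_shift Y L (dual_section Y (g i j)) W : ring_hom (SymO Y L W) (SymO Y L W)" unfolding SymO_shift_def by (rule l(1))
 show "SymO_shift Y L (dual_section Y (g i j)) W c : SymO Y L W" by (rule ring_hom_closed[OF h c])
 note e = E[OF ij(1) W(1,2)] and e' = E[OF ij(2) W(1,2)]
 have "(E j W \<circ> SymO_shift Y L (dual_section Y (g i j)) W) c = E i W c"
 proof (rule S.hom_eqI[OF c ring_hom_trans[OF h e'(1)] e(1)])
  fix r assume r: "r : sec Y W"
  have "SymO_shift Y L (dual_section Y (g i j)) W (cs W r) = cs W r" unfolding SymO_shift_def by (rule l(2)) (assumption | rule r)+
  thus "(E j W \<circ> SymO_shift Y L (dual_section Y (g i j)) W) (cs W r) = E i W (cs W r)" using e(2)[OF r] e'(2)[OF r] by simp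
 next
  fix u assume u: "u : M W"
  have s: "SymO_shift Y L (dual_section Y (g i j)) W (vs W u) = ?v u" unfolding SymO_shift_def by (rule l(3)) (assumption | rule u)+
  have "E j W (?v u) = (w i \<ominus>.Q w j) \<otimes>.Q io u \<oplus>.Q io u \<otimes>.Q w j"
   using ring_hom_add[OF e'(1) cc[OF u] S.sym_in_closed[OF u]] e'(2)[OF D(1)[OF u]] D(2)[OF u] e'(3)[OF u] by simp
  also have "\<dots> = io u \<otimes>.Q w i"
   using w[OF ij(1)] w[OF ij(2)] ioh(2)[OF uK[OF u]] Q.r_distr[of "w i \<ominus>.Q w j" "w j" "io u"]
   by (simp add: Q.m_comm[of _ "io u"] Q.minus_eq Q.a_assoc Q.l_neg)
  finally show "(E j W \<circ> SymO_shift Y L (dual_section Y (g i j)) W) (vs W u) = E i W (vs W u)" using s e(3)[OF u] by simp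
 qed
 thus "E j W (SymO_shift Y L (dual_section Y (g i j)) W c) = E i W c" by simp
qed

end


section \<open>The glued algebra\<close>

context gluing
begin

abbreviation "AA \<equiv> glued_alg Y N (copy X x0) L (\<lambda>i j. dual_section Y (g i j))"
abbreviation "si \<equiv> glued_alg_map Y N (copy X x0) L"
declare One_nat_def[simp del]

definition "valA V a = E 1 (V \<inter> copy X x0 1) (a 1)"

lemma tsp_A: "tsp AA = tsp Y" by (simp add: glued_alg_def)

lemma V_copy:
 assumes V: "opn Y V" "V ~= {}" and i: "i : N"
 shows "opn Y (V \<inter> copy X x0 i)" "V \<inter> copy X x0 i ~= {}" "V \<inter> copy X x0 i \<subseteq> copy X x0 i"
 using openin_Int[OF V(1) opn_copy[OF i]] gen_in(1)[OF V] gen_copy_in by auto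

text \<open>By \<open>SymO_shift\<close> and injectivity of \<open>E\<close> over the overlaps, the
  gluing condition just says that all components have the same value.\<close>

lemma sec_A:
 assumes V: "opn Y V" "V ~= {}"
 shows "sec AA V = fun_ring N (\<lambda>i. SymO Y L (V \<inter> copy X x0 i))
  {a : (\<Pi>\<^sub>E i\<in>N. carrier (SymO Y L (V \<inter> copy X x0 i))).
   ALL i:N. ALL j:N. E i (V \<inter> copy X x0 i) (a i) = E j (V \<inter> copy X x0 j) (a j)}"
proof -
 have "(let W = V \<inter> copy X x0 i \<inter> copy X x0 j in SymO_shift Y L (dual_section Y (g i j)) W (SymO_res Y L (V \<inter> copy X x0 i) W (a i))
       = SymO_res Y L (V \<inter> copy X x0 j) W (a j)) \<longleftrightarrow> E i (V \<inter> copy X x0 i) (a i) = E j (V \<inter> copy X x0 j) (a j)"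
  if a: "a : (\<Pi>\<^sub>E i\<in>N. carrier (SymO Y L (V \<inter> copy X x0 i)))" and ij: "i : N" "j : N" for a i j
 proof -
  let ?W = "V \<inter> copy X x0 i \<inter> copy X x0 j"
  have W: "opn Y ?W" "?W ~= {}" "?W \<subseteq> copy X x0 i \<inter> copy X x0 j"
   using V_copy[OF V_copy(1,2)[OF V ij(1)] ij(2)] by auto
  have sub: "?W \<subseteq> V \<inter> copy X x0 i" "?W \<subseteq> V \<inter> copy X x0 j" "?W \<subseteq> copy X x0 j" by auto
  have ai: "a i : (SymO Y L (V \<inter> copy X x0 i))" and aj: "a j : (SymO Y L (V \<inter> copy X x0 j))"
   using PiE_mem[OF a] ij by auto
  note ri = SymO_res[OF ij(1) V_copy(1,2)[OF V ij(1)] W(1,2) sub(1) ai] and rj = SymO_res[OF ij(2) V_copy(1,2)[OF V ij(2)] W(1,2) sub(2) aj]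
  note sh = SymO_shift[OF ij W ri(1)]
  have "SymO_shift Y L (dual_section Y (g i j)) ?W (SymO_res Y L (V \<inter> copy X x0 i) ?W (a i)) = SymO_res Y L (V \<inter> copy X x0 j) ?W (a j)
   \<longleftrightarrow> E j ?W (SymO_shift Y L (dual_section Y (g i j)) ?W (SymO_res Y L (V \<inter> copy X x0 i) ?W (a i))) = E j ?W (SymO_res Y L (V \<inter> copy X x0 j) ?W (a j))"
   by (rule inj_homD(6)[OF E_inj[OF ij(2) W(1,2) sub(3)] sh(1) rj(1), symmetric])
  thus ?thesis unfolding Let_def sh(2) ri(2) rj(2) .
 qed
 hence "{a : (\<Pi>\<^sub>E i\<in>N. carrier (SymO Y L (V \<inter> copy X x0 i))). ALL i:N. ALL j:N. let W = V \<inter> copy X x0 i \<inter> copy X x0 j in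
   SymO_shift Y L (dual_section Y (g i j)) W (SymO_res Y L (V \<inter> copy X x0 i) W (a i)) = SymO_res Y L (V \<inter> copy X x0 j) W (a j)}
  = {a : (\<Pi>\<^sub>E i\<in>N. carrier (SymO Y L (V \<inter> copy X x0 i))). ALL i:N. ALL j:N. E i (V \<inter> copy X x0 i) (a i) = E j (V \<inter> copy X x0 j) (a j)}"
  by (intro Collect_cong conj_cong refl ball_cong)
 thus ?thesis unfolding glued_alg_def ringed.simps by (rule arg_cong)
qed

lemma A_i:
 assumes V: "opn Y V" "V ~= {}" and a: "a : sec AA V" and i: "i : N"
 shows "a i : (SymO Y L (V \<inter> copy X x0 i))" "E i (V \<inter> copy X x0 i) (a i) = valA V a"
proof -
 note a' = a[unfolded sec_A[OF V] fun_ring_simps(1) mem_Collect_eq]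
 show "a i : (SymO Y L (V \<inter> copy X x0 i))" by (rule PiE_mem[OF a'[THEN conjunct1] i])
 show "E i (V \<inter> copy X x0 i) (a i) = valA V a" unfolding valA_def
  by (rule a'[THEN conjunct2, rule_format, OF i n1])
qed

lemma A_II:
 assumes V: "opn Y V" "V ~= {}" and a: "a : (\<Pi>\<^sub>E i\<in>N. carrier (SymO Y L (V \<inter> copy X x0 i)))"
  and q: "!!i. i : N ==> E i (V \<inter> copy X x0 i) (a i) = q"
 shows "a : sec AA V" "valA V a = q"
 using a q n1 unfolding sec_A[OF V] fun_ring_simps(1) mem_Collect_eq valA_def by metis+

lemma A_I:
 assumes V: "opn Y V" "V ~= {}" and q: "!!i. i : N ==> EX c:(SymO Y L (V \<inter> copy X x0 i)). E i (V \<inter> copy X x0 i) c = q"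
 shows "EX a:sec AA V. valA V a = q"
proof -
 obtain c where c: "!!i. i : N ==> c i : (SymO Y L (V \<inter> copy X x0 i)) \<and> E i (V \<inter> copy X x0 i) (c i) = q" using q by metis
 have "(\<lambda>i\<in>N. c i) : (\<Pi>\<^sub>E i\<in>N. carrier (SymO Y L (V \<inter> copy X x0 i)))" using c by (simp add: PiE_iff)
 from A_II[OF V this, of q] show ?thesis using c by auto
qed

sublocale qA: qspace AA Q valA
proof (rule qspace.intro[OF Q.field_axioms], rule qspace_axioms.intro)
 fix V assume "opn AA V" and ne: "V ~= {}"
 hence V: "opn Y V" "V ~= {}" unfolding tsp_A .
 note fp = fiber_product[OF Q.is_cring n1 Sym_cring[OF V_copy(1,2)[OF V]] E_inj[OF _ V_copy[OF V]]]
 show "cring (sec AA V)" unfolding sec_A[OF V] by (rule fp(1)) assumption+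
 show "inj_hom (sec AA V) Q (valA V)" unfolding sec_A[OF V] valA_def[abs_def] by (rule fp(2)) assumption+
next
 fix V W a assume "opn AA V" "opn AA W" and WV: "W \<subseteq> V" "W ~= {}" and a: "a : sec AA V"
 hence V: "opn Y V" "V ~= {}" and W: "opn Y W" "W ~= {}" unfolding tsp_A by blast+
 have r: "res AA V W a = (\<lambda>i\<in>N. SymO_res Y L (V \<inter> copy X x0 i) (W \<inter> copy X x0 i) (a i))" by (simp add: glued_alg_def)
 have i: "SymO_res Y L (V \<inter> copy X x0 i) (W \<inter> copy X x0 i) (a i) : (SymO Y L (W \<inter> copy X x0 i))"
  "E i (W \<inter> copy X x0 i) (SymO_res Y L (V \<inter> copy X x0 i) (W \<inter> copy X x0 i) (a i)) = valA V a" if i: "i : N" for i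
  using SymO_res[OF i V_copy(1,2)[OF V i] V_copy(1,2)[OF W i] _ A_i(1)[OF V a i]] A_i(2)[OF V a i] WV(1) by auto
 have "res AA V W a : (\<Pi>\<^sub>E i\<in>N. carrier (SymO Y L (W \<inter> copy X x0 i)))" unfolding r using i(1) by (simp add: PiE_iff)
 from A_II[OF W this, of "valA V a"] show "res AA V W a : sec AA W \<and> valA W (res AA V W a) = valA V a"
  using i(2) by (simp add: r)
qed

lemma si:
 assumes V: "opn Y V" "V ~= {}" and s: "s : sec Y V"
 shows "si V s : sec AA V" "valA V (si V s) = valY V s"
proof -
 have e: "si V s = (\<lambda>i\<in>N. cs (V \<inter> copy X x0 i) (res Y V (V \<inter> copy X x0 i) s))" by (simp add: glued_alg_map_def)
 have i: "cs (V \<inter> copy X x0 i) (res Y V (V \<inter> copy X x0 i) s) : (SymO Y L (V \<inter> copy X x0 i))"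
  "E i (V \<inter> copy X x0 i) (cs (V \<inter> copy X x0 i) (res Y V (V \<inter> copy X x0 i) s)) = valY V s" if i: "i : N" for i
 proof -
  note Vi = V_copy[OF V i]
  note r = qY.res_val[OF V(1) Vi(1) Int_lower1 Vi(2) s]
  interpret S: sym_module "sec Y (V \<inter> copy X x0 i)" "M (V \<inter> copy X x0 i)" by (rule M_sym_module[OF Vi(1,2)])
  show "cs (V \<inter> copy X x0 i) (res Y V (V \<inter> copy X x0 i) s) : (SymO Y L (V \<inter> copy X x0 i))"
   by (rule ring_hom_closed[OF S.const_sym_hom r[THEN conjunct1]])
  show "E i (V \<inter> copy X x0 i) (cs (V \<inter> copy X x0 i) (res Y V (V \<inter> copy X x0 i) s)) = valY V s"
   unfolding E(2)[OF i Vi(1,2) r[THEN conjunct1]] by (rule r[THEN conjunct2])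
 qed
 have "si V s : (\<Pi>\<^sub>E i\<in>N. carrier (SymO Y L (V \<inter> copy X x0 i)))" unfolding e using i(1) by (simp add: PiE_iff)
 from A_II[OF V this, of "valY V s"] show "si V s : sec AA V" "valA V (si V s) = valY V s" using i(2) by (simp_all add: e)
qed

lemma pg: "i : N ==> poly_gen A Q et (T i)"
 using T al_hom(1) by (intro poly_gen.intro poly_gen_axioms.intro is_cring Q.is_cring) auto

text \<open>The coefficients with respect to the generator are regular at \<open>y\<close>; a common
  denominator outside the prime of \<open>y\<close> moves them into \<open>A\<close>.\<close>

lemma A_poly_ring:
 assumes V: "opn Y V" "y : V" and y: "y : copy X x0 i" and i: "i : N" and a: "a : sec AA V"
 shows "EX f:carrier A - snd y. et f \<otimes>.Q valA V a : poly_ring Q et (carrier A) (T i)"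
proof -
 have ne: "V ~= {}" using V(2) by blast
 note Vi = V_copy[OF V(1) ne i] and ai = A_i[OF V(1) ne a i]
 from Sym_horner[OF i Vi ai(1)] obtain rs where rs: "set rs \<subseteq> (sec Y (V \<inter> copy X x0 i))"
  "a i = horner (SymO Y L (V \<inter> copy X x0 i)) (vs (V \<inter> copy X x0 i) (xi [^].K int (d i))) (map (cs (V \<inter> copy X x0 i)) rs)"
  by (elim exE conjE)
 have v: "valA V a = horner Q (T i) (map (valY (V \<inter> copy X x0 i)) rs)" using ai(2) unfolding rs(2) E_horner(2)[OF i Vi rs(1)] by simp
 have P: "primeideal (snd y) A" by (rule Y_prime[OF V])
 have l: "set (map (valY (V \<inter> copy X x0 i)) rs) \<subseteq> O_at y" using Y_locq[OF Vi(1), of y] V(2) y rs(1) by auto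
 from common_denominator[OF P l] obtain f as where f: "f : carrier A - snd y" "set as \<subseteq> A"
  "map (\<lambda>r. et f \<otimes>.Q r) (map (valY (V \<inter> copy X x0 i)) rs) = map et as" by (elim bexE exE conjE)
 have lc: "set (map (valY (V \<inter> copy X x0 i)) rs) \<subseteq> Q" using l locq_ring(4)[OF P] by blast
 have "et f \<otimes>.Q valA V a = horner Q (T i) (map et as)"
  unfolding v f(3)[symmetric] by (rule Q.horner_mult[OF T[OF i] _ lc, symmetric]) (use f(1) al_hom(2) in simp)
 thus ?thesis using poly_gen.horner_poly_ring[OF pg[OF i] f(2)] f(1) by metis
qed

text \<open>On the overlap \<open>T j\<close> is a polynomial of degree at most 1 in
  \<open>T i\<close> with regular coefficients, so the i-th evaluation reaches all of
  \<open>A[T j]\<close>.\<close>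

lemma E_surj:
 assumes ij: "i : N" "j : N" and V: "opn Y V" "V ~= {}" "V \<subseteq> copy X x0 i \<inter> copy X x0 j"
  and q: "q : poly_ring Q et (carrier A) (T j)"
 shows "EX c:SymO Y L V. E i V c = q"
proof -
 have Vi: "V \<subseteq> copy X x0 i" using V(3) by blast
 interpret S: sym_module "sec Y V" "M V" by (rule M_sym_module[OF V(1,2)])
 note e = E[OF ij(1) V(1,2)] and gM = M_gen(1)[OF ij(1) V(1,2) Vi]
 have cM: "valY V s : E i V ` carrier (SymO Y L V)" if s: "s : sec Y V" for s
  using imageI[OF ring_hom_closed[OF S.const_sym_hom s], of "E i V"] unfolding e(2)[OF s] .
 have add: "u \<oplus>.Q v : E i V ` carrier (SymO Y L V)" if asm: "u : E i V ` carrier (SymO Y L V)" "v : E i V ` carrier (SymO Y L V)" for u v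
 proof -
  obtain b where b: "u = E i V b" "b : SymO Y L V" using asm(1) by (rule imageE)
  obtain c where c: "v = E i V c" "c : SymO Y L V" using asm(2) by (rule imageE)
  show ?thesis unfolding b(1) c(1) ring_hom_add[OF e(1) b(2) c(2), symmetric] by (rule imageI[OF S.Sym.a_closed[OF b(2) c(2)]])
 qed
 have mult: "u \<otimes>.Q v : E i V ` carrier (SymO Y L V)" if asm: "u : E i V ` carrier (SymO Y L V)" "v : E i V ` carrier (SymO Y L V)" for u v
 proof -
  obtain b where b: "u = E i V b" "b : SymO Y L V" using asm(1) by (rule imageE)
  obtain c where c: "v = E i V c" "c : SymO Y L V" using asm(2) by (rule imageE)
  show ?thesis unfolding b(1) c(1) ring_hom_mult[OF e(1) b(2) c(2), symmetric] by (rule imageI[OF S.Sym.m_closed[OF b(2) c(2)]])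
 qed
 have sM: "r : E i V ` carrier (SymO Y L V)" if r: "!!y. y : V ==> r : O_at y" for r
 proof -
  obtain s where s: "s : sec Y V" "valY V s = r" using Y_surj[OF V(1,2) r] by (rule bexE)
  show ?thesis using cM[OF s(1)] unfolding s(2) .
 qed
 have Ti: "T i : E i V ` carrier (SymO Y L V)"
  using imageI[OF S.sym_in_closed[OF gM], of "E i V"] unfolding e(3)[OF gM] K_pow(2) .
 \<comment> \<open>Either \<open>i = j\<close> and the quotient is 1, or \<open>x\<close> is
   invertible on the overlap.\<close>
 have 1: "ze [^].Q d j \<otimes>.Q inv .Q (ze [^].Q d i) : O_at y" if y: "y : V" for y
 proof (cases "i = j")
  case True
  thus ?thesis using al_in_locq[OF Y_prime[OF V(1) y] one_closed] al_hom(5) Q.inv_nz[OF ze(3,4)] by simp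
 next
  case False
  have P: "primeideal (snd y) A" by (rule Y_prime[OF V(1) y])
  have "y : copy X x0 i" "y : copy X x0 j" using y V(3) by auto
  hence "snd y ~= x0" using False unfolding copy_mem by auto
  hence "x ~: snd y" using x0_iff[OF P] by simp
  thus ?thesis using locq_ring(1)[OF P x_pow_locq[OF P] x_inv_locq1[OF P]] by simp
 qed
 have 2: "ze [^].Q d j \<otimes>.Q (w j \<ominus>.Q w i) : O_at y" if y: "y : V" for y
  using locq_ring(1)[OF Y_prime[OF V(1) y] x_pow_locq[OF Y_prime[OF V(1) y]] w_diff_locq[OF ij(2,1)]] y V(3) by blast
 have wc: "w i : Q" "w j : Q" using w ij by auto
 have "w j = w i \<oplus>.Q (w j \<ominus>.Q w i)" using wc by (simp add: Q.minus_eq Q.a_lcomm[of "w i"] Q.r_neg)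
 hence "T j = ze [^].Q d j \<otimes>.Q (w i \<oplus>.Q (w j \<ominus>.Q w i))" by (rule arg_cong)
 also have "\<dots> = (ze [^].Q d j \<otimes>.Q inv .Q (ze [^].Q d i)) \<otimes>.Q T i \<oplus>.Q ze [^].Q d j \<otimes>.Q (w j \<ominus>.Q w i)"
  using wc by (simp add: Q.r_distr Q.m_assoc)
 finally have Tj: "T j = (ze [^].Q d j \<otimes>.Q inv .Q (ze [^].Q d i)) \<otimes>.Q T i \<oplus>.Q ze [^].Q d j \<otimes>.Q (w j \<ominus>.Q w i)" .
 have "q : E i V ` carrier (SymO Y L V)"
 proof (rule poly_ring_minimal[OF q _ _ add mult])
  show "et a : E i V ` carrier (SymO Y L V)" if a: "a : A" for a
   by (rule sM) (rule al_in_locq[OF Y_prime[OF V(1)] a])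
  show "T j : E i V ` carrier (SymO Y L V)" unfolding Tj by (rule add[OF mult[OF sM[OF 1] Ti] sM[OF 2]])
 qed
 then obtain c where c: "q = E i V c" "c : SymO Y L V" by (rule imageE)
 show ?thesis by (rule bexI[where x = c], rule c(1)[symmetric], rule c(2))
qed

lemma A_copy:
 assumes i: "i : N" and q: "q : poly_ring Q et (carrier A) (T i)"
 shows "EX a:sec AA (copy X x0 i). valA (copy X x0 i) a = q"
proof (rule A_I)
 show o: "opn Y (copy X x0 i)" "copy X x0 i ~= {}" using opn_copy[OF i] gen_copy_in by blast+
 show "EX c:(SymO Y L (copy X x0 i \<inter> copy X x0 j)). E j (copy X x0 i \<inter> copy X x0 j) c = q" if j: "j : N" for j
  by (rule E_surj[OF j i V_copy(1,2)[OF o j] _ q]) blast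
qed

text \<open>Meant for the elements of \<open>B\<close>, which are polynomials in all the coordinates
  \<open>T i\<close> at once.\<close>

lemma A_pts:
 assumes q: "!!i. i : N ==> q : poly_ring Q et (carrier A) (T i)"
 shows "EX a:sec AA (pts Y). valA (pts Y) a = q"
proof (rule A_I[OF openin_topspace pts_ne])
 show "EX c:(SymO Y L (pts Y \<inter> copy X x0 j)). E j (pts Y \<inter> copy X x0 j) c = q" if j: "j : N" for j
  by (rule E_surj[OF j j V_copy(1,2)[OF openin_topspace pts_ne j] _ q[OF j]]) blast
qed

end


section \<open>Relative spectra\<close>

context dom_in_field
begin

definition lu :: "'a set => 'q => bool" where "lu P q \<longleftrightarrow> q ~= \<zero>.Q \<and> inv .Q q : locq Q al R P"

lemma lu_frac: "primeideal P R ==> a : R ==> f : carrier R - P ==> lu P (al a \<otimes>.Q inv .Q al f) \<longleftrightarrow> a ~: P"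
 unfolding lu_def by (rule locq_unit)

lemma lu_al: "primeideal P R ==> a : R ==> lu P (al a) \<longleftrightarrow> a ~: P"
 using lu_frac[of P a \<one>] primeidealD(1)[of P R] al_hom(2,5) by simp

lemma locqE:
 assumes "q : locq Q al R P" obtains a f where "a : R" "f : carrier R - P" "q = al a \<otimes>.Q inv .Q al f"
 using assms unfolding locq_def by blast

lemma
 assumes P: "primeideal P R" and q: "q : locq Q al R P" and r: "r : locq Q al R P"
 shows lu_mult: "lu P (q \<otimes>.Q r) \<longleftrightarrow> lu P q \<and> lu P r"
  and lu_add: "~ lu P q ==> ~ lu P r ==> ~ lu P (q \<oplus>.Q r)"
proof -
 obtain a f where a: "a : R" "f : carrier R - P" "q = al a \<otimes>.Q inv .Q al f" using q by (rule locqE)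
 obtain b g where b: "b : R" "g : carrier R - P" "r = al b \<otimes>.Q inv .Q al g" using r by (rule locqE)
 have fg: "f \<otimes> g : carrier R - P" using a(2) b(2) primeidealD(4)[OF P, of f g] by simp
 have c[simp]: "f : R" "g : R" "al a : Q" "al b : Q" "al f : Q" "al g : Q"
  "al f ~= \<zero>.Q" "al g ~= \<zero>.Q" using a b al_hom(2) al_nz[OF P] by auto
 have m: "q \<otimes>.Q r = al (a \<otimes> b) \<otimes>.Q inv .Q al (f \<otimes> g)"
  unfolding a(3) b(3) using a(1) b(1) by (simp add: al_hom(3) Q.inv_mult Q.m_ac)
 show "lu P (q \<otimes>.Q r) \<longleftrightarrow> lu P q \<and> lu P r"
  unfolding m lu_frac[OF P m_closed[OF a(1) b(1)] fg] unfolding a(3) b(3) lu_frac[OF P a(1,2)] lu_frac[OF P b(1,2)]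
  using primeidealD(4)[OF P a(1) b(1)] by simp
 have s: "q \<oplus>.Q r = al (g \<otimes> a \<oplus> f \<otimes> b) \<otimes>.Q inv .Q al (f \<otimes> g)"
  unfolding a(3) b(3) using a(1) b(1) by (simp add: al_hom(3,4) Q.inv_mult Q.m_ac Q.l_distr Q.r_distr)
 show "~ lu P (q \<oplus>.Q r)" if asm: "~ lu P q" "~ lu P r"
 proof -
  have "a : P" "b : P" using asm unfolding a(3) b(3) lu_frac[OF P a(1,2)] lu_frac[OF P b(1,2)] by auto
  hence "g \<otimes> a \<oplus> f \<otimes> b : P"
   by (intro primeidealD(5)[OF P] primeidealD(4)[OF P c(2) a(1), THEN iffD2] primeidealD(4)[OF P c(1) b(1), THEN iffD2] disjI2)
  moreover have "g \<otimes> a \<oplus> f \<otimes> b : R" using a(1) b(1) by simp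
  ultimately show ?thesis unfolding s using lu_frac[OF P _ fg] by blast
 qed
qed

text \<open>This set is the contraction of the maximal ideal of the local ring at
  \<open>P\<close>.\<close>

lemma lu_prime:
 assumes P: "primeideal P R" and D: "cring D" and f: "inj_hom D Q f" "!!c. c : D ==> f c : locq Q al R P"
 shows "primeideal {c : D. ~ lu P (f c)} D"
proof -
 interpret D: cring D by fact
 note fh = inj_homD[OF f(1)]
 have f0: "~ lu P (f \<zero>.D)" using inj_hom_zero(1)[OF f(1) D.ring_axioms Q.ring_axioms] by (simp add: lu_def)
 have f1: "lu P (f \<one>.D)" using lu_al[OF P one_closed] primeidealD(1)[OF P] al_hom(5) fh(5) by simp
 have m: "lu P (f (c \<otimes>.D c')) \<longleftrightarrow> lu P (f c) \<and> lu P (f c')" if "c : D" "c' : D" for c c'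
  unfolding fh(3)[OF that] by (rule lu_mult[OF P f(2)[OF that(1)] f(2)[OF that(2)]])
 show ?thesis
 proof (rule primeidealI[OF _ D])
  show "ideal {c : D. ~ lu P (f c)} D"
  proof (rule idealI[OF D.ring_axioms])
   show "subgroup {c : D. ~ lu P (f c)} (add_monoid D)"
   proof (rule D.add.subgroupI)
    fix c assume c: "c : {c : D. ~ lu P (f c)}"
    have "\<ominus>.D c = (\<ominus>.D \<one>.D) \<otimes>.D c" using c by (simp add: D.l_minus)
    thus "\<ominus>.D c : {c : D. ~ lu P (f c)}" using c m[of "\<ominus>.D \<one>.D" c] by simp
   next
    fix c c' assume "c : {c : D. ~ lu P (f c)}" "c' : {c : D. ~ lu P (f c)}"
    thus "c \<oplus>.D c' : {c : D. ~ lu P (f c)}" using lu_add[OF P f(2) f(2)] by (simp add: fh(4))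
   qed (use f0 in auto)
  qed (simp_all add: m)
  show "carrier D ~= {c : D. ~ lu P (f c)}" using f1 D.one_closed by blast
 qed (use m in auto)
qed

end

text \<open>Conditions under which \<open>S\<close> is the relative spectrum of \<open>AA\<close>.
  By \<open>regular\<close> the local ring at \<open>p\<close> contains the stalk of
  \<open>AA\<close> at the image, so \<open>p\<close> defines a prime of that stalk.
  \<open>center\<close> determines the image of \<open>p\<close> from the local ring at
  \<open>p\<close>. By \<open>global\<close> and \<open>local\<close>, elements of the stalks are
  fractions from \<open>B\<close> whose denominators avoid the given prime.\<close>

locale rspec_model = smodel B Q al S F G + qY: qspace Y Q valY + qA: qspace AA Q valA
 for B :: "('b, 'm) ring_scheme" and Q :: "'q ring" and al and S :: "('p, 's) ringed" and F G
  and Y :: "('y, 't) ringed" and valY and AA :: "('y, 'u) ringed" and valA +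
 fixes ro :: "('p, 's, 'y, 't) mor" and si :: "'y set => 't => 'u"
 assumes tsp_A: "tsp AA = tsp Y" and ro_mor: "is_mor S Y ro"
  and ro_val: "opn Y U ==> pre S ro U ~= {} ==> s : sec Y U ==> vS (pre S ro U) (pull ro U s) = valY U s"
  and si: "opn Y U ==> U ~= {} ==> s : sec Y U ==> si U s : sec AA U \<and> valA U (si U s) = valY U s"
  and regular: "p : pts S ==> opn Y U ==> pt ro p : U ==> a : sec AA U ==> valA U a : locq Q al B (pr p)"
  and center: "y : pts Y ==> p : pts S ==>
   (!!U a. opn Y U ==> y : U ==> a : sec AA U ==> valA U a : locq Q al B (pr p)) ==>
   (!!U s. opn Y U ==> y : U ==> s : sec Y U ==> germ Y y U s ~: Units (stalk Y y) ==> ~ lu (pr p) (valY U s)) ==> pt ro p = y"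
  and global: "b : B ==> EX a:sec AA (pts Y). valA (pts Y) a = al b"
  and local: "y : pts Y ==> primeideal \<PP> (stalk AA y) ==>
   (!!U s. opn Y U ==> y : U ==> s : sec Y U ==> germ AA y U (si U s) : \<PP> \<longleftrightarrow> germ Y y U s ~: Units (stalk Y y)) ==>
   c : stalk AA y ==> EX s:B. EX b:B. EX e:carrier (stalk AA y) - \<PP>. qA.sval e = al s \<and> al s \<otimes>.Q qA.sval c = al b"
begin

abbreviation "St y \<equiv> stalk AA y"
abbreviation "W \<equiv> rspec Y AA si"
definition "\<Phi> p = (pt ro p, {c : St (pt ro p). ~ lu (pr p) (qA.sval c)})"

lemma pts_A: "y : pts Y ==> y : pts AA" by (simp add: tsp_A)

lemmas roD = is_morD[OF ro_mor]

lemma St_inj: "y : pts Y ==> inj_hom (St y) Q qA.sval" using qA.stalk_hom pts_A by blast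

lemma St_cring: "y : pts Y ==> cring (St y)" using qA.stalk_cring pts_A by blast

lemma St_regular: "p : pts S ==> c : St (pt ro p) ==> qA.sval c : locq Q al B (pr p)"
proof -
 assume p: "p : pts S" and "c : St (pt ro p)"
 then obtain U a where U: "opn AA U" "pt ro p : U" "a : sec AA U" "c = germ AA (pt ro p) U a" by (elim qA.stalkE)
 thus ?thesis using regular[OF p _ U(2,3)] qA.sval_germ[OF U(1-3)] by (simp add: tsp_A)
qed

text \<open>By \<open>global\<close> an element of \<open>B\<close> is the value of a global section
  of the algebra; this is its germ at \<open>y\<close>.\<close>

definition bgerm where "bgerm y b = germ AA y (pts Y) (SOME a. a : sec AA (pts Y) \<and> valA (pts Y) a = al b)"

lemma bgerm: assumes "y : pts Y" "b : B" shows "bgerm y b : St y" "qA.sval (bgerm y b) = al b"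
proof -
 have o: "opn AA (pts Y)" by (simp add: tsp_A)
 have "EX a. a : sec AA (pts Y) \<and> valA (pts Y) a = al b" using global[OF assms(2)] by blast
 note a = someI_ex[OF this]
 show "bgerm y b : St y" "qA.sval (bgerm y b) = al b"
  using qA.germ_in_stalk[OF o assms(1)] qA.sval_germ[OF o assms(1)] a unfolding bgerm_def by auto
qed

lemma si_germ:
 assumes "opn Y U" "y : U" "s : sec Y U"
 shows "germ AA y U (si U s) : St y" "qA.sval (germ AA y U (si U s)) = valY U s"
proof -
 have o: "opn AA U" and ne: "U ~= {}" using assms(1,2) by (auto simp: tsp_A)
 note s = si[OF assms(1) ne assms(3)]
 show "germ AA y U (si U s) : St y" "qA.sval (germ AA y U (si U s)) = valY U s"
  using qA.germ_in_stalk[OF o assms(2)] qA.sval_germ[OF o assms(2)] s by auto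
qed

text \<open>A unit stays a unit at \<open>p\<close> because the pullback of its local inverse has
  the inverse value; the converse is locality of the morphism.\<close>

lemma ro_unit:
 assumes p: "p : pts S" and U: "opn Y U" "pt ro p : U" and s: "s : sec Y U"
 shows "germ Y (pt ro p) U s : Units (stalk Y (pt ro p)) \<longleftrightarrow> lu (pr p) (valY U s)"
proof -
 have pre: "opn S (pre S ro V)" "p : pre S ro V" "pre S ro V ~= {}" if "opn Y V" "pt ro p : V" for V
  using roD(7)[OF that(1)] p that(2) by (auto simp: pre_def)
 note r = roD(3)[OF U(1) s] and pU = pre[OF U]
 have e: "lu (pr p) (valY U s) \<longleftrightarrow> germ S p (pre S ro U) (pull ro U s) : Units (stalk S p)"
  unfolding Q.unit_iff_inj[OF qS.stalk_hom[OF p] qS.stalk_cring[OF p] qS.germ_in_stalk[OF pU(1,2) r]]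
   qS.sval_germ[OF pU(1,2) r] ro_val[OF U(1) pU(3) s] stalk_image[OF p] lu_def ..
 show ?thesis
 proof
  assume "germ Y (pt ro p) U s : Units (stalk Y (pt ro p))"
  then obtain V t where V: "valY U s ~= \<zero>.Q" "opn Y V" "pt ro p : V" "t : sec Y V" "valY V t = inv .Q valY U s"
   unfolding qY.stalk_unit_iff[OF U s] by blast
  have "valY V t : locq Q al B (pr p)"
   using vS_locq[OF pre(1)[OF V(2,3)] roD(3)[OF V(2,4)] pre(2)[OF V(2,3)]] ro_val[OF V(2) pre(3)[OF V(2,3)] V(4)] by simp
  thus "lu (pr p) (valY U s)" unfolding lu_def using V(1,5) by simp
 next
  assume "lu (pr p) (valY U s)"
  thus "germ Y (pt ro p) U s : Units (stalk Y (pt ro p))" using roD(5)[OF p U s] e by blast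
 qed
qed

definition over :: "'y => ('y set \<times> 'u) set set => bool" where
 "over y \<PP> \<longleftrightarrow> y : pts Y \<and> primeideal \<PP> (St y) \<and> (ALL V s. opn Y V \<and> y : V \<and> s : sec Y V -->
    (germ AA y V (si V s) : \<PP> \<longleftrightarrow> germ Y y V s ~: Units (stalk Y y)))"

lemma basic_eq: "opn Y U ==> rspec_basic Y AA si U f = {(y, \<PP>). over y \<PP> \<and> y : U \<and> germ AA y U f ~: \<PP>}"
 using openin_subset[of "tsp Y" U] unfolding rspec_basic_def over_def by blast

lemma over_\<Phi>: assumes p: "p : pts S" shows "over (fst (\<Phi> p)) (snd (\<Phi> p))"
 unfolding over_def \<Phi>_def fst_conv snd_conv
proof (intro conjI allI impI)
 show y: "pt ro p : pts Y" by (rule roD(6)[OF p])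
 show "primeideal {c : St (pt ro p). ~ lu (pr p) (qA.sval c)} (St (pt ro p))"
  by (rule lu_prime[OF pr_prime[OF p] St_cring[OF y] St_inj[OF y] St_regular[OF p]])
 fix V s assume "opn Y V \<and> pt ro p : V \<and> s : sec Y V"
 hence V: "opn Y V" "pt ro p : V" and s: "s : sec Y V" by auto
 show "germ AA (pt ro p) V (si V s) : {c : St (pt ro p). ~ lu (pr p) (qA.sval c)} \<longleftrightarrow>
   germ Y (pt ro p) V s ~: Units (stalk Y (pt ro p))"
  unfolding ro_unit[OF p V s] using si_germ[OF V s] by simp
qed

text \<open>The elements of \<open>B\<close> with germ in \<open>\<PP>\<close> form the prime of
  some point \<open>p\<close>. By \<open>local\<close> each germ of \<open>AA\<close> is a fraction
  \<open>b / s\<close> with \<open>s\<close> outside that prime, so it is regular at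
  \<open>p\<close> and vanishes there exactly when it lies in \<open>\<PP>\<close>. Then
  \<open>center\<close> identifies the image of \<open>p\<close> with \<open>y\<close>.\<close>

lemma \<Phi>_surj: assumes o: "over y \<PP>" shows "EX p:pts S. \<Phi> p = (y, \<PP>)"
proof -
 have y: "y : pts Y" and P: "primeideal \<PP> (St y)" and ov: "!!V s. opn Y V ==> y : V ==> s : sec Y V ==>
    germ AA y V (si V s) : \<PP> \<longleftrightarrow> germ Y y V s ~: Units (stalk Y y)" using o unfolding over_def by blast+
 interpret Sy: cring "St y" by (rule St_cring[OF y])
 note si = inj_homD[OF St_inj[OF y]] and bg = bgerm[OF y]
 have "bgerm y : ring_hom B (St y)"
 proof (rule ring_hom_memI)
  fix a b assume ab: "a : B" "b : B"
  show "bgerm y a : St y" by (rule bg(1)[OF ab(1)])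
  show "bgerm y (a \<otimes>.B b) = bgerm y a \<otimes>.(St y) bgerm y b"
   by (rule si(6)[THEN iffD1]) (use ab bg in \<open>simp_all add: si(3) al_hom(3)\<close>)
  show "bgerm y (a \<oplus>.B b) = bgerm y a \<oplus>.(St y) bgerm y b"
   by (rule si(6)[THEN iffD1]) (use ab bg in \<open>simp_all add: si(4) al_hom(4)\<close>)
 next
  show "bgerm y \<one>.B = \<one>.(St y)"
   by (rule si(6)[THEN iffD1]) (use bg in \<open>simp_all add: si(5) al_hom(5)\<close>)
 qed
 from pr_surj[OF prime_preimage[OF is_cring Sy.is_cring this P]]
 obtain p where p: "p : pts S" "pr p = {b : B. bgerm y b : \<PP>}" by blast
 have loc: "EX s:carrier B - pr p. EX b:B. qA.sval c = al b \<otimes>.Q inv .Q al s \<and> (b : pr p \<longleftrightarrow> c : \<PP>)" if c: "c : St y" for c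
 proof -
  obtain s b e where s: "s : B" "b : B" "e : carrier (St y) - \<PP>" "qA.sval e = al s" "al s \<otimes>.Q qA.sval c = al b"
   using local[OF y P ov c] by blast
  have e: "e : St y" "e ~: \<PP>" using s(3) by auto
  have "bgerm y s = e" using si(6)[OF bg(1)[OF s(1)] e(1)] bg(2)[OF s(1)] s(4) by simp
  hence sp: "s ~: pr p" using p(2) e(2) by simp
  have s0: "al s : Q" "al s ~= \<zero>.Q" using al_hom(2)[OF s(1)] al_nz[OF pr_prime[OF p(1)], of s] s(1) sp by auto
  have v: "qA.sval c = al b \<otimes>.Q inv .Q al s"
   unfolding s(5)[symmetric] using s0 si(2)[OF c] by (simp add: Q.m_comm[of "al s \<otimes>.Q qA.sval c"])
  have "qA.sval (bgerm y b) = qA.sval (e \<otimes>.(St y) c)" unfolding bg(2)[OF s(2)] si(3)[OF e(1) c] s(4) s(5) ..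
  hence "bgerm y b = e \<otimes>.(St y) c" using si(6)[OF bg(1)[OF s(2)] Sy.m_closed[OF e(1) c]] by simp
  hence "b : pr p \<longleftrightarrow> c : \<PP>" using p(2) s(2) primeidealD(4)[OF P e(1) c] e(2) by simp
  thus ?thesis using s(1,2) sp v by blast
 qed
 have reg: "qA.sval c : locq Q al B (pr p)" and unit: "lu (pr p) (qA.sval c) \<longleftrightarrow> c ~: \<PP>" if c: "c : St y" for c
 proof -
  obtain s b where s: "s : carrier B - pr p" "b : B" "qA.sval c = al b \<otimes>.Q inv .Q al s" "b : pr p \<longleftrightarrow> c : \<PP>" using loc[OF c] by blast
  show "qA.sval c : locq Q al B (pr p)" unfolding locq_def using s(1-3) by blast
  show "lu (pr p) (qA.sval c) \<longleftrightarrow> c ~: \<PP>" unfolding s(3) lu_frac[OF pr_prime[OF p(1)] s(2,1)] s(4) ..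
 qed
 have "pt ro p = y"
 proof (rule center[OF y p(1)])
  fix U a assume U: "opn Y U" "y : U" "a : sec AA U"
  have o: "opn AA U" using U(1) by (simp add: tsp_A)
  show "valA U a : locq Q al B (pr p)" using reg[OF qA.germ_in_stalk[OF o U(2,3)]] unfolding qA.sval_germ[OF o U(2,3)] .
 next
  fix U s assume U: "opn Y U" "y : U" "s : sec Y U" and n: "germ Y y U s ~: Units (stalk Y y)"
  show "~ lu (pr p) (valY U s)" using unit[OF si_germ(1)[OF U]] ov[OF U] n unfolding si_germ(2)[OF U] by simp
 qed
 moreover have "{c : St y. ~ lu (pr p) (qA.sval c)} = \<PP>"
  by (rule Set.set_eqI) (use unit primeidealD(2)[OF P] in auto)
 ultimately have "\<Phi> p = (y, \<PP>)" unfolding \<Phi>_def by simp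
 thus ?thesis using p(1) by blast
qed

lemma \<Phi>_b: "p : pts S ==> b : B ==> bgerm (pt ro p) b : snd (\<Phi> p) \<longleftrightarrow> b : pr p"
 using bgerm[OF roD(6)] lu_al[OF pr_prime] by (simp add: \<Phi>_def)

lemma \<Phi>_inj: "inj_on \<Phi> (pts S)"
proof (rule inj_onI)
 fix p p' assume p: "p : pts S" "p' : pts S" "\<Phi> p = \<Phi> p'"
 hence "pt ro p = pt ro p'" unfolding \<Phi>_def by simp
 hence "b : pr p \<longleftrightarrow> b : pr p'" if "b : B" for b using \<Phi>_b[OF p(1) that] \<Phi>_b[OF p(2) that] p(3) by simp
 hence "pr p = pr p'" using primeidealD(2)[OF pr_prime[OF p(1)]] primeidealD(2)[OF pr_prime[OF p(2)]] by blast
 thus "p = p'" by (rule pr_inj[OF p(1,2)])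
qed

lemma tsp_W: "tsp W = rspec_top Y AA si" by (simp add: rspec_def Let_def)

lemma basic_opn: "opn Y U ==> f : sec AA U ==> opn W (rspec_basic Y AA si U f)"
 unfolding tsp_W rspec_top_def by (rule topology_generated_by_Basis) blast

lemma A_one: assumes "opn Y U" "y : U"
 shows "\<one>.(sec AA U) : sec AA U" "germ AA y U \<one>.(sec AA U) = \<one>.(St y)"
proof -
 have U: "opn AA U" "U ~= {}" "y : pts Y" using assms openin_subset[OF assms(1)] by (auto simp: tsp_A)
 interpret U: cring "sec AA U" by (rule qA.sec_cring[OF U(1,2)])
 interpret Sy: cring "St y" by (rule St_cring[OF U(3)])
 show 1: "\<one>.(sec AA U) : sec AA U" by simp
 have "qA.sval (germ AA y U \<one>.(sec AA U)) = qA.sval \<one>.(St y)"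
  unfolding qA.sval_germ[OF U(1) assms(2) 1] inj_homD(5)[OF qA.val_inj[OF U(1,2)]] inj_homD(5)[OF St_inj[OF U(3)]] ..
 thus "germ AA y U \<one>.(sec AA U) = \<one>.(St y)"
  using inj_homD(6)[OF St_inj[OF U(3)] qA.germ_in_stalk[OF U(1) assms(2) 1] Sy.one_closed] by simp
qed

lemma pts_W: "pts W = {(y, \<PP>). over y \<PP>}"
proof -
 have "pts W = \<Union>{rspec_basic Y AA si U f | U f. opn Y U \<and> f : sec AA U}"
  unfolding tsp_W rspec_top_def by (rule topology_generated_by_topspace)
 moreover have "(y, \<PP>) : rspec_basic Y AA si (pts Y) \<one>.(sec AA (pts Y)) \<and> \<one>.(sec AA (pts Y)) : sec AA (pts Y)"
  if o: "over y \<PP>" for y \<PP>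
 proof -
  have y: "y : pts Y" "primeideal \<PP> (St y)" using o unfolding over_def by blast+
  show ?thesis unfolding basic_eq[OF openin_topspace] using A_one[OF openin_topspace y(1)] primeidealD(1)[OF y(2)] o y(1) by simp
 qed
 moreover have "z : {(y, \<PP>). over y \<PP>}" if "z : rspec_basic Y AA si U f" "opn Y U" for z U f
  using that(1) unfolding basic_eq[OF that(2)] by blast
 ultimately show ?thesis by blast
qed

lemma \<Phi>_image: "\<Phi> ` pts S = pts W"
proof
 show "\<Phi> ` pts S \<subseteq> pts W" unfolding pts_W
  by (rule image_subsetI) (use over_\<Phi> in \<open>simp add: case_prod_beta\<close>)
 show "pts W \<subseteq> \<Phi> ` pts S"
 proof
  fix z assume "z : pts W"
  then obtain y \<PP> where z: "z = (y, \<PP>)" "over y \<PP>" unfolding pts_W by blast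
  from \<Phi>_surj[OF z(2)] obtain p where "p : pts S" "\<Phi> p = z" unfolding z(1) by (rule bexE)
  thus "z : \<Phi> ` pts S" by (metis imageI)
 qed
qed

text \<open>Continuity: near \<open>p\<close> the function \<open>f\<close> has a value
  \<open>a / e\<close>, and where \<open>e\<close> does not vanish, \<open>f\<close> vanishes
  exactly with \<open>a\<close>. Openness: \<open>S\<close> has a base of sets given by elements
  \<open>b\<close> of \<open>B\<close>, and each \<open>b\<close> is a global section of the
  algebra, so its set is basic in the relative spectrum.\<close>

lemma \<Phi>_homeo: "homeomorphic_map (tsp S) (tsp W) \<Phi>"
proof (rule bijective_open_imp_homeomorphic_map[OF _ _ \<Phi>_image \<Phi>_inj])
 have "opn S (\<Phi> -` rspec_basic Y AA si U f \<inter> pts S)" if U: "opn Y U" and f: "f : sec AA U" for U f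
 proof (subst openin_subopen, intro ballI)
  fix p assume "p : \<Phi> -` rspec_basic Y AA si U f \<inter> pts S"
  hence p: "p : pts S" and pU: "pt ro p : U" and pf: "germ AA (pt ro p) U f ~: snd (\<Phi> p)"
   unfolding basic_eq[OF U] by (auto simp: \<Phi>_def)
  have o: "opn AA U" using U by (simp add: tsp_A)
  have gf: "germ AA y U f : St y" "qA.sval (germ AA y U f) = valA U f" if "y : U" for y
   using qA.germ_in_stalk[OF o that f] qA.sval_germ[OF o that f] by auto
  have m: "germ AA (pt ro p') U f : snd (\<Phi> p') \<longleftrightarrow> ~ lu (pr p') (valA U f)" if "pt ro p' : U" for p'
   unfolding \<Phi>_def using gf[OF that] by simp
  obtain a e where a: "a : B" "e : carrier B - pr p" "valA U f = al a \<otimes>.Q inv .Q al e"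
   using regular[OF p U pU f] by (rule locqE)
  have ap: "a ~: pr p" using pf m[OF pU] lu_frac[OF pr_prime[OF p] a(1,2)] a(3) by simp
  let ?V = "pre S ro U \<inter> {p : pts S. a ~: pr p} \<inter> {p : pts S. e ~: pr p}"
  have "opn S ?V" using roD(7)[OF U] opn_bopen a(1,2) by blast
  moreover have "p : ?V" using p pU ap a(2) by (auto simp: pre_def)
  moreover have "?V \<subseteq> \<Phi> -` rspec_basic Y AA si U f \<inter> pts S"
  proof
   fix p' assume "p' : ?V"
   hence p': "p' : pts S" "pt ro p' : U" "a ~: pr p'" "e : carrier B - pr p'" using a(2) by (auto simp: pre_def)
   have "germ AA (pt ro p') U f ~: snd (\<Phi> p')" using m[OF p'(2)] lu_frac[OF pr_prime[OF p'(1)] a(1) p'(4)] p'(3) a(3) by simp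
   thus "p' : \<Phi> -` rspec_basic Y AA si U f \<inter> pts S"
    unfolding basic_eq[OF U] using over_\<Phi>[OF p'(1)] p'(1,2) by (auto simp: \<Phi>_def)
  qed
  ultimately show "EX T. opn S T \<and> p : T \<and> T \<subseteq> \<Phi> -` rspec_basic Y AA si U f \<inter> pts S" by blast
 qed
 thus "continuous_map (tsp S) (tsp W) \<Phi>"
  unfolding tsp_W rspec_top_def
  by (intro continuous_on_generated_topo) (use \<Phi>_image[unfolded tsp_W rspec_top_def topology_generated_by_topspace] in auto)
 show "open_map (tsp S) (tsp W) \<Phi>" unfolding open_map_def
 proof (intro allI impI)
  fix U assume U: "opn S U"
  show "opn W (\<Phi> ` U)"
  proof (subst openin_subopen, intro ballI)
   fix z assume "z : \<Phi> ` U"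
   then obtain p where p: "z = \<Phi> p" "p : U" by (rule imageE)
   have pS: "p : pts S" using S_opnD[OF U p(2)] .
   obtain b where b: "b : B" "b ~: pr p" "{p' : pts S. b ~: pr p'} \<subseteq> U" using S_basis[OF U p(2)] by blast
   obtain a where a: "a : sec AA (pts Y)" "valA (pts Y) a = al b" using global[OF b(1)] by blast
   have o: "opn AA (pts Y)" by (simp add: tsp_A)
   have m: "germ AA (pt ro p') (pts Y) a : snd (\<Phi> p') \<longleftrightarrow> b : pr p'" if p': "p' : pts S" for p'
    using qA.germ_in_stalk[OF o roD(6)[OF p'] a(1)] qA.sval_germ[OF o roD(6)[OF p'] a(1)] lu_al[OF pr_prime[OF p'] b(1)] a(2)
    by (simp add: \<Phi>_def)
   have "\<Phi> p : rspec_basic Y AA si (pts Y) a"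
    unfolding basic_eq[OF openin_topspace] using over_\<Phi>[OF pS] roD(6)[OF pS] m[OF pS] b(2) by (auto simp: \<Phi>_def)
   moreover have "rspec_basic Y AA si (pts Y) a \<subseteq> \<Phi> ` U"
   proof
    fix z assume z: "z : rspec_basic Y AA si (pts Y) a"
    hence "z : pts W" unfolding pts_W basic_eq[OF openin_topspace] by auto
    then obtain p' where p': "z = \<Phi> p'" "p' : pts S" unfolding \<Phi>_image[symmetric] by (rule imageE)
    have "b ~: pr p'" using z m[OF p'(2)] unfolding p'(1) basic_eq[OF openin_topspace] by (auto simp: \<Phi>_def)
    thus "z : \<Phi> ` U" using b(3) p' by blast
   qed
   ultimately show "EX T. opn W T \<and> z : T \<and> T \<subseteq> \<Phi> ` U" using basic_opn[OF openin_topspace a(1)] p(1) by blast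
  qed
 qed
qed

end


section \<open>The relative spectrum as a space inside the field\<close>

context rspec_model
begin

lemma St_dom: assumes "y : pts Y" shows "dom_in_field (St y) Q qA.sval"
 using domain_of_inj[OF St_inj[OF assms] St_cring[OF assms] Q.domain_axioms] St_inj[OF assms]
 by (simp add: dom_in_field_def dom_in_field_axioms_def Q.field_axioms)

abbreviation "Lw w \<equiv> localization (St (fst w)) (carrier (St (fst w)) - snd w)"

lemma over_D: "w : pts W ==> over (fst w) (snd w)" "w : pts W ==> fst w : pts Y" "w : pts W ==> primeideal (snd w) (St (fst w))"
 unfolding pts_W over_def by auto

definition "gpt = \<Phi> (THE p. p : pts S \<and> pr p = {\<zero>.B})"

lemma gpt: "gpt : pts W" "!!U. opn W U ==> U ~= {} ==> gpt : U"
proof -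
 obtain p where p: "p : pts S" "pr p = {\<zero>.B}" using pr_surj[OF zero_prime] by blast
 have g: "gpt = \<Phi> p" unfolding gpt_def
  by (rule arg_cong[where f = \<Phi>], rule the_equality) (use p pr_inj in auto)
 show "gpt : pts W" unfolding g \<Phi>_image[symmetric] by (rule imageI[OF p(1)])
 fix U assume U: "opn W U" "U ~= {}"
 have o: "opn S {p : pts S. \<Phi> p : U}"
  using homeomorphic_imp_continuous_map[OF \<Phi>_homeo] U(1) unfolding continuous_map_def by blast
 obtain z where "z : U" using U(2) by blast
 hence "z : \<Phi> ` pts S" unfolding \<Phi>_image using openin_subset[OF U(1)] by blast
 then obtain p' where p': "z = \<Phi> p'" "p' : pts S" by (rule imageE)
 hence "p' : {p : pts S. \<Phi> p : U}" using \<open>z : U\<close> by simp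
 from S_basis[OF o this] obtain b where b: "b : B" "b ~: pr p'" "{p' : pts S. b ~: pr p'} \<subseteq> {p : pts S. \<Phi> p : U}" by blast
 have "b ~: pr p" using b(2) primeidealD(3)[OF pr_prime[OF p'(2)]] unfolding p(2) by blast
 thus "gpt : U" unfolding g using b(3) p(1) by blast
qed

text \<open>An instance of \<open>loc_space\<close> whose index is an open set with a numerator and
  a denominator over it. Two germs at a point are brought to a common open set by
  restriction.\<close>

lemma W_lc: "lc_space W Lw (\<lambda>w. lval Q qA.sval) Q gpt"
proof -
 let ?D = "{(U, a, f). opn Y U \<and> a : sec AA U \<and> f : sec AA U}"
 have oA: "opn AA U \<longleftrightarrow> opn Y U" for U by (simp add: tsp_A)
 note gs = qA.germ_in_stalk[unfolded oA] and sg = qA.sval_germ[unfolded oA]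
 show ?thesis
 proof (rule loc_space[where \<Delta> = ?D and def = "\<lambda>(U, a, f) w. fst w : U" and num = "\<lambda>(U, a, f) w. germ AA (fst w) U a"
   and den = "\<lambda>(U, a, f) w. germ AA (fst w) U f" and vn = "\<lambda>(U, a, f). valA U a" and vd = "\<lambda>(U, a, f). valA U f"])
  show "field Q" by (rule Q.field_axioms)
  show "gpt : pts W" "!!U. opn W U ==> U ~= {} ==> gpt : U" using gpt by blast+
  show "!!w. w : pts W ==> dom_in_field (St (fst w)) Q qA.sval" using St_dom over_D(2) by blast
  show "!!w. w : pts W ==> primeideal (snd w) (St (fst w))" by (rule over_D(3))
  show "!!U V s. res W U V s = restrict s V" by (simp add: rspec_def Let_def)
  fix de assume d: "de : ?D"
  obtain U a f where df: "de = (U, a, f)" by (cases de) auto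
  have da: "opn Y U" "a : sec AA U" "f : sec AA U" using d df by auto
  have "{w : pts W. fst w : U \<and> germ AA (fst w) U f ~: snd w} = rspec_basic Y AA si U f"
   unfolding basic_eq[OF da(1)] pts_W by auto
  thus "opn W {w : pts W. (case de of (U, a, f) => \<lambda>w. fst w : U) w \<and> (case de of (U, a, f) => \<lambda>w. germ AA (fst w) U f) w ~: snd w}"
   using basic_opn[OF da(1,3)] unfolding df by simp
  fix w assume w: "w : pts W" "(case de of (U, a, f) => \<lambda>w. fst w : U) w"
  have wU: "fst w : U" using w(2) df by simp
  show "(case de of (U, a, f) => \<lambda>w. germ AA (fst w) U a) w : St (fst w) \<and>
    qA.sval ((case de of (U, a, f) => \<lambda>w. germ AA (fst w) U a) w) = (case de of (U, a, f) => valA U a)"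
   unfolding df prod.case using gs[OF da(1) wU da(2)] sg[OF da(1) wU da(2)] by simp
  show "(case de of (U, a, f) => \<lambda>w. germ AA (fst w) U f) w : St (fst w) \<and>
    qA.sval ((case de of (U, a, f) => \<lambda>w. germ AA (fst w) U f) w) = (case de of (U, a, f) => valA U f)"
   unfolding df prod.case using gs[OF da(1) wU da(3)] sg[OF da(1) wU da(3)] by simp
 next
  fix w a f assume w: "w : pts W" and a: "a : St (fst w)" and f: "f : St (fst w)"
  obtain U s where U: "opn Y U" "fst w : U" "s : sec AA U" "a = germ AA (fst w) U s" using a unfolding oA[symmetric] by (rule qA.stalkE)
  obtain V t where V: "opn Y V" "fst w : V" "t : sec AA V" "f = germ AA (fst w) V t" using f unfolding oA[symmetric] by (rule qA.stalkE)
  have UV: "opn Y (U \<inter> V)" "fst w : U \<inter> V" using U V by auto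
  note rU = qA.resv[unfolded oA, OF U(1) UV(1) Int_lower1 UV(2) U(3)] and rV = qA.resv[unfolded oA, OF V(1) UV(1) Int_lower2 UV(2) V(3)]
  have "germ AA (fst w) (U \<inter> V) (res AA U (U \<inter> V) s) = a" "germ AA (fst w) (U \<inter> V) (res AA V (U \<inter> V) t) = f"
   unfolding U(4) V(4) using qA.germ_eq[unfolded oA, OF UV rU(1) U(1-3)] qA.germ_eq[unfolded oA, OF UV rV(1) V(1-3)] rU(2) rV(2) by auto
  thus "EX de:?D. (case de of (U, a, f) => \<lambda>w. fst w : U) w \<and>
    (case de of (U, a, f) => \<lambda>w. germ AA (fst w) U a) w = a \<and> (case de of (U, a, f) => \<lambda>w. germ AA (fst w) U f) w = f"
   using UV rU(1) rV(1) by (intro bexI[of _ "(U \<inter> V, res AA U (U \<inter> V) s, res AA V (U \<inter> V) t)"]) auto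
 next
  fix U assume "opn W U"
  show "sec W U = fun_ring U Lw {s : (\<Pi>\<^sub>E w\<in>U. carrier (Lw w)). ALL w:U. EX V. EX de:?D. opn W V \<and> w : V \<and> V \<subseteq> U \<and>
    (ALL w:V. (case de of (U, a, f) => \<lambda>w. fst w : U) w \<and> (case de of (U, a, f) => \<lambda>w. germ AA (fst w) U f) w ~: snd w \<and>
     s w = fraction (St (fst w)) (carrier (St (fst w)) - snd w) ((case de of (U, a, f) => \<lambda>w. germ AA (fst w) U a) w)
      ((case de of (U, a, f) => \<lambda>w. germ AA (fst w) U f) w))}"
  proof -
   have bex: "(EX de:?D. R de) \<longleftrightarrow> (EX U a f. opn Y U \<and> a : sec AA U \<and> f : sec AA U \<and> R (U, a, f))" for R by auto
   show ?thesis unfolding bex prod.case unfolding rspec_def Let_def ringed.simps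
    by (rule arg_cong[where f = "fun_ring U Lw"], intro Collect_cong conj_cong refl ball_cong) (auto simp: case_prod_beta)
  qed
 qed
qed

sublocale Wl: lc_space W Lw "\<lambda>w. lval Q qA.sval" Q gpt by (rule W_lc)

text \<open>A denominator outside the prime is by definition of \<open>\<Phi>\<close> a unit at
  \<open>p\<close>, which with regularity gives one inclusion. For the other, elements of
  \<open>B\<close> are replaced by the germs of the global sections with the same values.\<close>

lemma \<Phi>_stalk:
 assumes p: "p : pts S"
 shows "lval Q qA.sval ` carrier (Lw (\<Phi> p)) = lval Q al ` carrier (localization B (carrier B - pr p))"
proof -
 have w: "\<Phi> p : pts W" using \<Phi>_image p by blast
 have f[simp]: "fst (\<Phi> p) = pt ro p" by (simp add: \<Phi>_def)
 note y = over_D(2)[OF w, unfolded f] and P = over_D(3)[OF w, unfolded f] and pp = pr_prime[OF p]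
 have sn: "c : snd (\<Phi> p) \<longleftrightarrow> c : St (pt ro p) \<and> ~ lu (pr p) (qA.sval c)" for c by (simp add: \<Phi>_def)
 have "locq Q qA.sval (St (pt ro p)) (snd (\<Phi> p)) = locq Q al B (pr p)"
 proof (intro equalityI subsetI)
  fix q assume "q : locq Q qA.sval (St (pt ro p)) (snd (\<Phi> p))"
  then obtain a f where a: "a : St (pt ro p)" "f : carrier (St (pt ro p)) - snd (\<Phi> p)" "q = qA.sval a \<otimes>.Q inv .Q qA.sval f"
   unfolding locq_def by blast
  have "lu (pr p) (qA.sval f)" using a(2) sn by blast
  thus "q : locq Q al B (pr p)" unfolding a(3) lu_def using locq_ring(1)[OF pp St_regular[OF p a(1)]] by blast
 next
  fix q assume "q : locq Q al B (pr p)"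
  then obtain b s where b: "b : B" "s : carrier B - pr p" "q = al b \<otimes>.Q inv .Q al s" by (rule locqE)
  have s: "s : B" "s ~: pr p" using b(2) by auto
  note bg = bgerm[OF y b(1)] and sg = bgerm[OF y s(1)]
  have "bgerm (pt ro p) s ~: snd (\<Phi> p)" using \<Phi>_b[OF p s(1)] s(2) by simp
  thus "q : locq Q qA.sval (St (pt ro p)) (snd (\<Phi> p))" unfolding locq_def b(3) bg(2)[symmetric] sg(2)[symmetric] using bg(1) sg(1) by blast
 qed
 thus ?thesis unfolding locq_image[OF pp] f dom_in_field.locq_image[OF St_dom[OF y] P] .
qed

text \<open>The isomorphism is \<open>F\<close> followed by a map of spectra that is
  \<open>\<Phi>\<close> on points. It is compatible with the maps to \<open>Y\<close> because both
  pullbacks of a function keep its value.\<close>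

lemma iso_rspec: "iso_over Y S ro W (rspec_map Y AA si)"
proof -
 define fi where "fi = (\<lambda>P. \<Phi> (pt G P))"
 define I where "I = \<lparr>pt = fi, pull = lc_pull (Spec B) (\<lambda>P. localization B (carrier B - P)) (\<lambda>P. lval Q al) (\<lambda>w. lval Q qA.sval) fi\<rparr>"
 have prG: "P : pts (Spec B) ==> pt G P : pts S \<and> pr (pt G P) = P" for P
  using is_morD(6)[OF FD(2)] GD(3) unfolding pr_def by blast
 have G: "homeomorphic_map (tsp (Spec B)) (tsp S) (pt G)"
  using inv_pair_homeo[OF inv_pair_sym[OF FG]] homeomorphic_maps_map by blast
 have h: "homeomorphic_map (tsp (Spec B)) (tsp W) fi"
  using homeomorphic_map_compose[OF G \<Phi>_homeo] by (simp add: fi_def o_def)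
 have img: "lval Q qA.sval ` carrier (Lw (fi P)) = lval Q al ` carrier (localization B (carrier B - P))" if "P : pts (Spec B)" for P
  using \<Phi>_stalk[of "pt G P"] prG[OF that] by (simp add: fi_def)
 have I: "is_iso (Spec B) W I" unfolding I_def by (rule lc_iso[OF Spec_lc W_lc h img])
 then obtain I' where I': "inv_pair (Spec B) W I I'" unfolding inv_pair_iso by blast
 interpret lp: lc_pair "Spec B" "\<lambda>P. localization B (carrier B - P)" "\<lambda>P. lval Q al" Q "{\<zero>.B}" W Lw "\<lambda>w. lval Q qA.sval" gpt fi
  using Spec_lc W_lc homeomorphic_imp_continuous_map[OF h] img by (simp add: lc_pair_def lc_pair_axioms_def)
 have lpF: "lp.F = I" unfolding lp.F_def I_def ..
 have iso: "is_iso S W (mor_comp (Spec B) I F)" unfolding inv_pair_iso using inv_pair_comp[OF FG I'] by blast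
 let ?q = "rspec_map Y AA si"
 have ptI: "fi (pt F p) = \<Phi> p" if "p : pts S" for p using FD(3)[OF that] by (simp add: fi_def)
 have "mor_eq S Y (mor_comp W ?q (mor_comp (Spec B) I F)) ro" unfolding mor_eq_def
 proof (intro conjI ballI allI impI)
  fix p assume "p : pts S"
  thus "pt (mor_comp W ?q (mor_comp (Spec B) I F)) p = pt ro p" using ptI by (simp add: rspec_map_def I_def \<Phi>_def)
 next
  fix U s assume U: "opn Y U" and s: "s : sec Y U"
  let ?W = "pre W ?q U"
  have We: "?W = {w : pts W. fst w : U}" by (simp add: pre_def rspec_map_def)
  have Wo: "opn W ?W"
  proof (cases "U = {}")
   case False
   have one: "germ AA y U \<one>.(sec AA U) ~: \<PP>" if asm: "over y \<PP>" "y : U" for y \<PP>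
    unfolding A_one(2)[OF U asm(2)] by (rule primeidealD(1)) (use asm(1) in \<open>simp add: over_def\<close>)
   have "?W = rspec_basic Y AA si U \<one>.(sec AA U)" unfolding We basic_eq[OF U] pts_W using one by auto
   moreover obtain y where "y : U" using False by blast
   ultimately show ?thesis using basic_opn[OF U A_one(1)[OF U]] by simp
  next
   case True
   thus ?thesis unfolding We by simp
  qed
  let ?t = "pull ?q U s"
  have t: "?t w = fraction (St (fst w)) (carrier (St (fst w)) - snd w) (germ AA (fst w) U (si U s)) \<one>.(St (fst w))" if "w : ?W" for w
   using that unfolding We tsp_W by (simp add: rspec_map_def case_prod_beta)
  have tv: "?t w : Lw w \<and> lval Q qA.sval (?t w) = valY U s" if w: "w : ?W" for w
  proof -
   have w': "w : pts W" "fst w : U" using w unfolding We by auto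
   note sg = si_germ[OF U w'(2) s] and P = over_D(3)[OF w'(1)] and D = St_dom[OF over_D(2)[OF w'(1)]]
   interpret Sy: cring "St (fst w)" by (rule St_cring[OF over_D(2)[OF w'(1)]])
   have o: "\<one>.(St (fst w)) : carrier (St (fst w)) - snd w" using primeidealD(1)[OF P] by simp
   have v: "valY U s : Q" by (rule qY.val_carr[OF U w'(2) s])
   show ?thesis unfolding t[OF w] dom_in_field.lval_frac[OF D P sg(1) o] sg(2)
    inj_homD(5)[OF St_inj[OF over_D(2)[OF w'(1)]]]
    using loc_in_field.frac_in_loc[OF dom_in_field.lf[OF D P] sg(1) o] v by simp
  qed
  have te: "?t : extensional ?W" unfolding We tsp_W by (simp add: rspec_map_def)
  have tc: "?t : sec W ?W" unfolding Wl.sec_carr[OF Wo] using tv te by (auto simp: PiE_iff)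
  let ?V = "pre (Spec B) I ?W"
  have Vo: "opn (Spec B) ?V" using lp.pre_opn[OF Wo] unfolding lpF .
  have SV: "pre S F ?V = pre S ro U"
  proof (rule Set.set_eqI)
   fix p
   have "\<Phi> p : pts W" "fst (\<Phi> p) = pt ro p" "pt F p : pts (Spec B)" if "p : pts S"
    using that \<Phi>_image is_morD(6)[OF FD(1)] by (auto simp: \<Phi>_def)
   thus "p : pre S F ?V \<longleftrightarrow> p : pre S ro U" using ptI[of p] unfolding pre_def by (auto simp: I_def rspec_map_def)
  qed
  have pe: "pull (mor_comp W ?q (mor_comp (Spec B) I F)) U s = pull F ?V (pull I ?W ?t)" by simp
  have rc: "pull I ?W ?t : sec (Spec B) ?V" using lp.pull_in(1)[OF Wo tc] unfolding lpF .
  have lc: "pull F ?V (pull I ?W ?t) : sec S (pre S ro U)" using is_morD(3)[OF FD(1) Vo rc] unfolding SV .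
  note So = roD(7)[OF U] and rhos = roD(3)[OF U s]
  show "pull (mor_comp W ?q (mor_comp (Spec B) I F)) U s = pull ro U s" unfolding pe
  \<comment> \<open>Over the empty set there are no values; there the sheaf axiom for the empty
    covering makes sections unique.\<close>
  proof (cases "pre S ro U = {}")
   case True
   have "s = t" if "s : (sec S {})" "t : (sec S {})" for s t
    using S_ringed[unfolded ringed_space_def, THEN conjunct2, THEN conjunct2, THEN conjunct2, THEN conjunct2, THEN conjunct1,
      rule_format, of "{}" s t] that by simp
   thus "pull F ?V (pull I ?W ?t) = pull ro U s" using lc rhos unfolding True by blast
  next
   case False
   have Vne: "?V ~= {}" using False SV by (auto simp: pre_def)
   obtain w where w: "w : ?W" using Vne unfolding pre_def by blast
   have "sp.lc_val ?V (pull I ?W ?t) = valY U s"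
    using lp.pull_in(2)[OF Wo tc] Vne Wl.sec_val[OF Wo tc w] tv[OF w] unfolding lpF by simp
   moreover have "pre (Spec B) G (pre S F ?V) = ?V" "pull G (pre S F ?V) (pull F ?V (pull I ?W ?t)) = pull I ?W ?t"
    using GD(5)[OF Vo] GD(4)[OF Vo rc] by auto
   ultimately have "vS (pre S ro U) (pull F ?V (pull I ?W ?t)) = valY U s" unfolding vS_def SV by simp
   thus "pull F ?V (pull I ?W ?t) = pull ro U s"
    using inj_homD(6)[OF vS_inj[OF So False] lc rhos] ro_val[OF U False s] by simp
  qed
 qed
 thus ?thesis unfolding iso_over_def using iso by blast
qed

end


section \<open>The surface as a relative spectrum\<close>

context dfmodel_inj
begin

text \<open>Collects what the gluing needs to know of one component, in terms of elements of
  \<open>Q\<close>. The denominators \<open>s\<close> and the separating function \<open>e\<close>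
  come in the form \<open>1 + x w'\<close> with \<open>w'\<close> in \<open>A[z]\<close>, which
  keeps them from vanishing where \<open>x\<close> vanishes and \<open>w'\<close> is
  regular.\<close>

lemma component_generator:
 assumes oC: "opn Fib C" and oC': "opn Fib (Z - C)"
  and iso: "iso_over (Spec A) (restr Fib C) (mor_comp Fib (mor_comp S pj (fiber_incl S (Spec A) pj x0)) (incl Fib C))
    (Spec (UP ka)) (affine_line_map A ka (\<lambda>a. x0 +>.A a))"
  and t: "t : B" and \<Psi>: "inj_hom (UP A) Q \<Psi>" "!!a. a : A ==> \<Psi> (monom (UP A) a 0) = al (h a)"
  and t\<Psi>: "al t = \<Psi> (monom (UP A) \<one>.A 1) \<otimes>.Q al (h x) [^].Q (M::nat)"
  and t_gen: "!!b. b : B ==> EX m::nat. al (h x) [^].Q m \<otimes>.Q al b : poly_ring Q (\<lambda>a. al (h a)) (carrier A) (al t)"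
 defines "T \<equiv> poly_ring Q (\<lambda>a. al (h a)) (carrier A)"
 shows "EX m a z. a : A \<and> z : Q \<and> al t = al (h a) \<oplus>.Q al (h x) [^].Q (m::nat) \<otimes>.Q z \<and>
  (ALL b:B. al b : T z) \<and>
  (ALL w:T z. EX s:B. EX b:B. al s \<otimes>.Q w = al b \<and> (ALL p:C. s ~: pr p) \<and> (EX w':T z. al s = \<one>.Q \<oplus>.Q al (h x) \<otimes>.Q w')) \<and>
  (EX e:B. (ALL p:Z - C. e : pr p) \<and> (EX w':T z. al e = \<one>.Q \<oplus>.Q al (h x) \<otimes>.Q w')) \<and>
  (ALL w:T z. EX k::nat. EX b:B. al (h x) [^].Q k \<otimes>.Q w = al b) \<and>
  (ALL as. set as \<subseteq> A --> horner Q z (map (\<lambda>a. al (h a)) as) = \<zero>.Q --> set as \<subseteq> {\<zero>.A})"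
proof -
 from component_data[OF oC oC' iso] obtain q e where q0: "q : ring_hom B (UP ka)" "q ` carrier B = carrier (UP ka)"
  "ALL a:A. q (h a) = monom (UP ka) (x0 +>.A a) 0" "e : B" "q e = \<one>.(UP ka)"
  and ker0: "ALL b:B. q b = \<zero>.(UP ka) --> (EX c:B. e \<otimes>.B b = h x \<otimes>.B c)"
  and npr0: "ALL s:B. q s = \<one>.(UP ka) --> (ALL p:C. s ~: pr p)" and epr: "ALL p:Z - C. e : pr p"
  by (elim exE conjE)
 note q = q0(1,2) bspec[OF q0(3)] q0(4,5) and ker = mp[OF bspec[OF ker0]] and npr = mp[OF bspec[OF npr0]]
 interpret c: component B Q al A h x q e t
  by (rule component.intro[OF dom_in_field_axioms A.domain_axioms component_axioms.intro]) (fact h_hom h_inj x q(1,2) q0(3)[THEN bspec] q0(4,5) ker t t_gen)+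
 from c.ex_generator obtain m a z where g: "a : A" "z : c.Bq" "al t = al (h a) \<oplus>.Q al (h x) [^].Q (m::nat) \<otimes>.Q z" "deg ka (c.qt z) \<ge> 1"
  by (elim exE conjE)
 interpret g: generator B Q al A h x q e t a m z
  by (rule generator.intro[OF c.component_axioms generator_axioms.intro[OF g]])
 have sb: "EX s:B. EX b:B. al s \<otimes>.Q w = al b \<and> (ALL p:C. s ~: pr p) \<and> (EX w':T z. al s = \<one>.Q \<oplus>.Q al (h x) \<otimes>.Q w')" if w: "w : T z" for w
 proof -
  from g.T_B[OF w[unfolded T_def]] obtain s b where s: "s : B" "b : B" "q s = \<one>.(UP ka)" "al s \<otimes>.Q w = al b" by (elim bexE conjE)
  show ?thesis
   by (rule bexI[where x = s], rule bexI[where x = b], rule conjI[OF s(4) conjI[OF npr[OF s(1,3)] g.unit_T[OF s(1,3), folded T_def]]]) (rule s)+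
 qed
 have ee: "EX e:B. (ALL p:Z - C. e : pr p) \<and> (EX w':T z. al e = \<one>.Q \<oplus>.Q al (h x) \<otimes>.Q w')"
  by (rule bexI[where x = e], rule conjI[OF epr g.unit_T[OF q0(4,5), folded T_def]], rule q0)
 show ?thesis
  by (rule exI[of _ m], rule exI[of _ a], rule exI[of _ z], intro conjI g(1,3) g.t1c ballI allI impI)
   (assumption | rule sb ee g.B_T[folded T_def] g.T_pow_B[folded T_def] g.transcendental[OF \<Psi> t\<Psi>])+
qed

end

text \<open>\<open>T_B\<close> and \<open>T_pow\<close> bring an element of \<open>A[T i]\<close>
  into \<open>B\<close> in two ways: by a factor invertible along \<open>C i\<close>, or by a power
  of \<open>x\<close>, which is harmless off the special fiber. \<open>idem\<close> separates
  \<open>C i\<close> from the other components.\<close>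

locale df_gluing = dfmodel_inj B Q al S F G A pj x + gl: gluing A Q "\<lambda>a. al (h a)" x n d w
 for B :: "('b, 'm) ring_scheme" and Q :: "'q ring" and al and S :: "('p, 's) ringed" and F G and A :: "'a ring" and pj x n d w +
 fixes ro :: "('p, 's, nat \<times> 'a set, nat => 'a set => ('a \<times> 'a) set) mor" and C :: "nat => 'p set"
 assumes ro_mor: "is_mor S gl.Y ro" and ro_pj: "mor_eq S (Spec A) (mor_comp gl.Y (copies_map n) ro) pj"
  and C: "i : gl.N ==> pre S ro {(i, x0)} = C i" and C_cover: "Z \<subseteq> (\<Union>i\<in>gl.N. C i)"
  and B_T: "i : gl.N ==> b : B ==> al b : poly_ring Q (\<lambda>a. al (h a)) (carrier A) (gl.T i)"
  and T_B: "i : gl.N ==> w' : poly_ring Q (\<lambda>a. al (h a)) (carrier A) (gl.T i) ==>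
   EX s:B. EX b:B. al s \<otimes>.Q w' = al b \<and> (ALL p:C i. s ~: pr p) \<and>
    (EX v:poly_ring Q (\<lambda>a. al (h a)) (carrier A) (gl.T i). al s = \<one>.Q \<oplus>.Q al (h x) \<otimes>.Q v)"
  and idem: "i : gl.N ==> EX e:B. (ALL p:Z - C i. e : pr p) \<and>
    (EX v:poly_ring Q (\<lambda>a. al (h a)) (carrier A) (gl.T i). al e = \<one>.Q \<oplus>.Q al (h x) \<otimes>.Q v)"
  and T_pow: "i : gl.N ==> w' : poly_ring Q (\<lambda>a. al (h a)) (carrier A) (gl.T i) ==>
   EX k::nat. EX b:B. al (h x) [^].Q k \<otimes>.Q w' = al b"
begin

abbreviation "Tr i \<equiv> poly_ring Q (\<lambda>a. al (h a)) (carrier A) (gl.T i)"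

lemmas roD = is_morD[OF ro_mor]

lemma hc: "a : A ==> h a : B" by (rule h_val(1))

lemma snd_ro: "p : pts S ==> snd (pt ro p) = pt pj p"
 using mor_eqD(1)[OF ro_pj] by (simp add: copies_map_def)

lemma snd_ro_iff: "p : pts S ==> a : A ==> a : snd (pt ro p) \<longleftrightarrow> h a : pr p"
 using snd_ro[of p] pt_pj[of p] by simp

abbreviation "gsecA a \<equiv> pull (copies_map n) (pts (Spec A)) (spec_section A a)"

text \<open>Global functions from \<open>A\<close> keep their value because \<open>ro\<close> lies
  over \<open>pj\<close>. Any other function satisfies an equation \<open>f s = a\<close> with such
  functions, and the pullback respects it.\<close>

lemma ro_val:
 assumes U: "opn gl.Y U" and ne: "pre S ro U ~= {}" and s: "s : sec gl.Y U"
 shows "vS (pre S ro U) (pull ro U s) = gl.valY U s"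
proof -
 have Une: "U ~= {}" using ne by (auto simp: pre_def)
 note So = roD(7)[OF U]
 have prY: "pre S ro (pts gl.Y) = pts S" using roD(6) by (auto simp: pre_def)
 have cm: "pre gl.Y (copies_map n) (pts (Spec A)) = pts gl.Y"
  using gl.pts_prime by (auto simp: pre_def copies_map_def A.topspace_zariski)
 note oY = openin_topspace[of "tsp gl.Y"] and Uo = openin_subset[OF U]
 have g: "EX r:sec gl.Y U. gl.valY U r = al (h a) \<and> vS (pre S ro U) (pull ro U r) = al (h a)" if a: "a : A" for a
 proof -
  note ga = gl.copies_section[OF a]
  have e: "pull ro (pts gl.Y) (gsecA a) = pull pj (pts (Spec A)) (spec_section A a)"
   using mor_eqD(2)[OF ro_pj openin_topspace fa.spec_section_in(1)[OF a]] unfolding mor_comp_simps(2) cm .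
  have "pull ro U (res gl.Y (pts gl.Y) U (gsecA a)) = res S (pts S) (pre S ro U) (pull pj (pts (Spec A)) (spec_section A a))"
   using roD(4)[OF oY U Uo ga(1)] unfolding prY e by (rule sym)
  hence "vS (pre S ro U) (pull ro U (res gl.Y (pts gl.Y) U (gsecA a))) = al (h a)"
   using res_vS(2)[OF openin_topspace So openin_subset[OF So] ne pull_spec_section[OF a]] h_val(2)[OF a] by simp
  thus ?thesis using gl.qY.res_val[OF oY U Uo Une ga(1)] ga(2) by (intro bexI conjI) auto
 qed
 obtain a f where af: "a : A" "f : carrier A - {\<zero>.A}" "gl.valY U s = al (h a) \<otimes>.Q inv .Q al (h f)"
  using gl.Y_locq[OF U gl.gen_in(1)[OF U Une] s] unfolding snd_conv by (rule ax.locqE)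
 have f: "f : A" "al (h f) ~= \<zero>.Q" "al (h f) : Q" "al (h a) : Q"
  using af(1,2) ax.al_zero(2) ax.al_hom(2) by auto
 from g[OF af(1)] obtain r where r: "r : sec gl.Y U" "gl.valY U r = al (h a)" "vS (pre S ro U) (pull ro U r) = al (h a)"
  by (elim bexE conjE)
 from g[OF f(1)] obtain r' where r': "r' : sec gl.Y U" "gl.valY U r' = al (h f)" "vS (pre S ro U) (pull ro U r') = al (h f)"
  by (elim bexE conjE)
 note yh = inj_homD[OF gl.qY.val_inj[OF U Une]] and vh = inj_homD[OF vS_inj[OF So ne]]
 have e: "al (h f) \<otimes>.Q (al (h a) \<otimes>.Q inv .Q al (h f)) = al (h a)" using f by (simp add: Q.m_lcomm Q.inv_nz)
 interpret U: cring "sec gl.Y U" by (rule gl.qY.sec_cring[OF U Une])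
 have eq: "r' \<otimes>.(sec gl.Y U) s = r"
  by (rule yh(6)[THEN iffD1, OF U.m_closed[OF r'(1) s] r(1)]) (use yh(3)[OF r'(1) s] r(2) r'(2) af(3) e in simp)
 have "al (h f) \<otimes>.Q vS (pre S ro U) (pull ro U s) = al (h a)"
  using ring_hom_mult[OF roD(2)[OF U] r'(1) s] vh(3)[OF roD(3)[OF U r'(1)] roD(3)[OF U s]] r(3) r'(3) unfolding eq by simp
 hence "al (h f) \<otimes>.Q vS (pre S ro U) (pull ro U s) = al (h f) \<otimes>.Q (al (h a) \<otimes>.Q inv .Q al (h f))" unfolding e .
 thus ?thesis unfolding af(3) using Q.l_cancel[OF f(3,2) vh(2)[OF roD(3)[OF U s]]] f by simp
qed

text \<open>A point on the special fiber lies on some \<open>C i\<close> and so over the i-th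
  origin. A point off the fiber lies over all copies, and the first one is taken.\<close>

lemma ro_copy:
 assumes p: "p : pts S" obtains i where "i : gl.N" "pt ro p : copy (Spec A) x0 i" "h x : pr p --> p : C i"
proof (cases "h x : pr p")
 case True
 hence "p : Z" using Z_iff p by blast
 then obtain i where i: "i : gl.N" "p : C i" using C_cover by blast
 hence "pt ro p = (i, x0)" using C[OF i(1)] by (auto simp: pre_def)
 thus thesis using that[of i] i x0_prime by (simp add: gl.copy_mem)
next
 case False
 have y: "pt ro p : pts gl.Y" by (rule roD(6)[OF p])
 have "x ~: snd (pt ro p)" using False snd_ro_iff[OF p x(1)] by simp
 hence "snd (pt ro p) ~= x0" using gl.x0_iff[OF x0_prime] by auto
 moreover obtain j where "pt ro p = copy_pt x0 j (snd (pt ro p))" using openin_topspace y by (rule gl.Y_pt)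
 hence "fst (pt ro p) = (if snd (pt ro p) = x0 then j else 0)" by (metis gl.copy_pt_simps(2))
 ultimately show thesis using that[OF gl.n1] False gl.pts_prime[OF y] by (simp add: gl.copy_mem)
qed

text \<open>After multiplication by a denominator \<open>f\<close> from \<open>A\<close> the value
  is a polynomial in \<open>T i\<close>. On the fiber \<open>T_B\<close>, elsewhere
  \<open>T_pow\<close>, gives a further factor that does not vanish at \<open>p\<close> and brings
  it into \<open>B\<close>.\<close>

lemma ro_regular:
 assumes p: "p : pts S" and U: "opn gl.Y U" "pt ro p : U" and a: "a : sec gl.AA U"
 shows "gl.valA U a : locq Q al B (pr p)"
proof -
 obtain i where i: "i : gl.N" "pt ro p : copy (Spec A) x0 i" "h x : pr p --> p : C i" using p by (rule ro_copy)
 have P: "primeideal (pr p) B" by (rule pr_prime[OF p])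
 obtain f where f': "f : carrier A - snd (pt ro p)" "al (h f) \<otimes>.Q gl.valA U a : Tr i" using gl.A_poly_ring[OF U i(2,1) a] by (rule bexE)
 hence f: "f : A" "h f ~: pr p" using snd_ro_iff[OF p] by auto
 let ?w = "al (h f) \<otimes>.Q gl.valA U a"
 have "EX s:B. s ~: pr p \<and> (EX b:B. al s \<otimes>.Q ?w = al b)"
 proof (cases "h x : pr p")
  case True
  from T_B[OF i(1) f'(2)] obtain s b where "s : B" "b : B" "al s \<otimes>.Q ?w = al b" "ALL p:C i. s ~: pr p" by (elim bexE conjE)
  thus ?thesis using mp[OF i(3) True] by blast
 next
  case False
  from T_pow[OF i(1) f'(2)] obtain k b where k: "b : B" "al (h x) [^].Q (k::nat) \<otimes>.Q ?w = al b" by (elim exE bexE)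
  have "h (x [^].A k) ~: pr p" using snd_ro_iff[OF p] gl.pow_notin[OF gl.pts_prime[OF roD(6)[OF p]], of k] x(1) False by simp
  thus ?thesis using k(1) unfolding k(2)[symmetric] gl.pow_et using hc[of "x [^].A k"] x(1) k(2) unfolding gl.pow_et by auto
 qed
 then obtain s b where s: "s : B" "s ~: pr p" "b : B" "al s \<otimes>.Q ?w = al b" by (elim bexE conjE)
 have sf: "s \<otimes>.B h f : carrier B - pr p" using primeidealD(4)[OF P s(1) hc[OF f(1)]] s(1,2) f hc by simp
 have v: "gl.valA U a : Q" using gl.qA.val_carr[of U "pt ro p" a] U a unfolding gl.tsp_A by blast
 note c = al_hom(2)[OF s(1)] al_hom(2)[OF hc[OF f(1)]]
 have sf0: "al (s \<otimes>.B h f) : Q" "al (s \<otimes>.B h f) ~= \<zero>.Q" using al_hom(2) al_nz[OF P sf] sf by auto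
 have "al (s \<otimes>.B h f) \<otimes>.Q gl.valA U a = al b"
  unfolding s(4)[symmetric] al_hom(3)[OF s(1) hc[OF f(1)]] by (rule Q.m_assoc[OF c v])
 hence "gl.valA U a = al b \<otimes>.Q inv .Q al (s \<otimes>.B h f)"
  using sf0 v by (metis Q.m_comm Q.inv_l2 Q.inv_cl Q.m_closed)
 thus ?thesis unfolding locq_def using s(3) sf by blast
qed

lemma unit_germ_Y:
 assumes y: "y : pts gl.Y" and a: "a : A"
 shows "germ gl.Y y (pts gl.Y) (gsecA a) : Units (stalk gl.Y y) \<longleftrightarrow> a ~: snd y"
proof -
 note ga = gl.copies_section[OF a] and P = gl.pts_prime[OF y]
 note u = gl.qY.stalk_unit_iff[OF openin_topspace y ga(1), unfolded ga(2)]
 show ?thesis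
 proof
  assume "germ gl.Y y (pts gl.Y) (gsecA a) : Units (stalk gl.Y y)"
  then obtain V t where V: "al (h a) ~= \<zero>.Q" "opn gl.Y V" "y : V" "t : sec gl.Y V" "gl.valY V t = inv .Q al (h a)" unfolding u by blast
  have "ax.lu (snd y) (al (h a))" unfolding ax.lu_def using gl.Y_locq[OF V(2-4)] V(1,5) by simp
  thus "a ~: snd y" using ax.lu_al[OF P a] by simp
 next
  assume an: "a ~: snd y"
  have a0: "al (h a) ~= \<zero>.Q" using ax.al_nz[OF P] a an by blast
  obtain i where i: "i : gl.N" "y = copy_pt x0 i (snd y)" using openin_topspace y by (rule gl.Y_pt)
  have yi: "y : copy (Spec A) x0 i" unfolding gl.copy_mem using P gl.copy_pt_simps(2)[of x0 i "snd y"] i(2) by simp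
  let ?V = "{y : copy (Spec A) x0 i. a ~: snd y}"
  have yV: "y : ?V" using yi an by blast
  have V: "opn gl.Y ?V" "?V ~= {}" using gl.copy_opn[OF a i(1)] yV by blast+
  have "inv .Q al (h a) : gl.O_at y'" if asm: "y' : ?V" for y'
   using gl.locq_frac[OF gl.Y_prime[OF V(1) asm] A.one_closed a] asm ax.al_hom(2,5) a a0 by simp
  from gl.Y_surj[OF V this] obtain t where "t : sec gl.Y ?V" "gl.valY ?V t = inv .Q al (h a)" by (rule bexE)
  thus "germ gl.Y y (pts gl.Y) (gsecA a) : Units (stalk gl.Y y)" unfolding u using a0 V(1) yi an by blast
 qed
qed

text \<open>The primes agree because a function from \<open>A\<close> vanishes at \<open>y\<close>
  exactly when it vanishes at \<open>p\<close>. Which origin is meant is decided by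
  \<open>idem\<close>: on a component other than \<open>C i\<close> the function \<open>e\<close>
  vanishes, although \<open>e = 1 + x v\<close> with \<open>v\<close> regular at \<open>p\<close>
  and \<open>x\<close> vanishing there.\<close>

lemma ro_center:
 assumes y: "y : pts gl.Y" and p: "p : pts S"
  and reg: "!!U a. opn gl.Y U ==> y : U ==> a : sec gl.AA U ==> gl.valA U a : locq Q al B (pr p)"
  and nu: "!!U s. opn gl.Y U ==> y : U ==> s : sec gl.Y U ==> germ gl.Y y U s ~: Units (stalk gl.Y y) ==> ~ lu (pr p) (gl.valY U s)"
 shows "pt ro p = y"
proof -
 have P: "primeideal (pr p) B" and Py: "primeideal (snd y) A" using pr_prime[OF p] gl.pts_prime[OF y] .
 have iff: "a : snd y \<longleftrightarrow> h a : pr p" if a: "a : A" for a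
 proof
  note ga = gl.copies_section[OF a]
  assume "a : snd y"
  hence "~ lu (pr p) (al (h a))" using nu[OF openin_topspace y ga(1)] unit_germ_Y[OF y a] ga(2) by simp
  thus "h a : pr p" using lu_al[OF P hc[OF a]] by simp
 next
  note ga = gl.copies_section[OF a]
  assume hp: "h a : pr p"
  show "a : snd y"
  proof (rule ccontr)
   assume "a ~: snd y"
   then obtain V t where V: "al (h a) ~= \<zero>.Q" "opn gl.Y V" "y : V" "t : sec gl.Y V" "gl.valY V t = inv .Q al (h a)"
    using unit_germ_Y[OF y a] gl.qY.stalk_unit_iff[OF openin_topspace y ga(1), unfolded ga(2)] by blast
   have ne: "V ~= {}" using V(3) by blast
   have "inv .Q al (h a) : locq Q al B (pr p)" using reg[OF V(2,3) gl.si(1)[OF V(2) ne V(4)]] gl.si(2)[OF V(2) ne V(4)] V(5) by simp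
   hence "lu (pr p) (al (h a))" unfolding lu_def using V(1) by simp
   thus False using lu_al[OF P hc[OF a]] hp by simp
  qed
 qed
 have "snd (pt ro p) = snd y" using iff snd_ro_iff[OF p] primeidealD(2)[OF Py] primeidealD(2)[OF gl.pts_prime[OF roD(6)[OF p]]] by blast
 moreover have "fst (pt ro p) = fst y"
 proof -
  obtain i where i: "i : gl.N" "y = copy_pt x0 i (snd y)" using openin_topspace y by (rule gl.Y_pt)
  have yi: "y : copy (Spec A) x0 i" unfolding gl.copy_mem using Py gl.copy_pt_simps(2)[of x0 i "snd y"] i(2) by simp
  obtain j where j: "j : gl.N" "pt ro p : copy (Spec A) x0 j" "h x : pr p --> p : C j" using p by (rule ro_copy)
  show ?thesis
  proof (cases "snd y = x0")
   case False
   thus ?thesis using yi j(2) \<open>snd (pt ro p) = snd y\<close> by (simp add: gl.copy_mem)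
  next
   case True
   hence xp: "h x : pr p" using iff[OF x(1)] gl.x0_iff[OF x0_prime] by simp
   have "p : C i"
   proof (rule ccontr)
    assume "p ~: C i"
    hence pZ: "p : Z - C i" using Z_iff p xp by blast
    from idem[OF i(1)] obtain e v where e: "e : B" "ALL p:Z - C i. e : pr p" "v : Tr i" "al e = \<one>.Q \<oplus>.Q al (h x) \<otimes>.Q v" by (elim bexE conjE)
    \<comment> \<open>\<open>v\<close> is a section of the algebra over the i-th copy, so the
      assumption on the local ring at \<open>p\<close> makes it regular there.\<close>
    from gl.A_copy[OF i(1) e(3)] obtain a where a: "a : sec gl.AA (copy (Spec A) x0 i)" "gl.valA (copy (Spec A) x0 i) a = v" by (rule bexE)
    have v: "v : locq Q al B (pr p)" using reg[OF gl.opn_copy[OF i(1)] yi a(1)] unfolding a(2) .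
    note hx = al_in_locq[OF P hxc] and vc = locq_ring(4)[OF P v]
    have xv: "al (h x) \<otimes>.Q v : locq Q al B (pr p)" by (rule locq_ring(1)[OF P hx v])
    have "~ lu (pr p) (al (h x) \<otimes>.Q v)" using lu_mult[OF P hx v] lu_al[OF P hxc] xp by simp
    moreover have "\<ominus>.Q (al (h x) \<otimes>.Q v) = al (\<ominus>.B \<one>.B) \<otimes>.Q (al (h x) \<otimes>.Q v)"
     using inj_hom_minus[OF al_inj ring_axioms Q.ring_axioms one_closed] al_hom(5) alhx(2) vc by (simp add: Q.l_minus)
    ultimately have "~ lu (pr p) (\<ominus>.Q (al (h x) \<otimes>.Q v))" using lu_mult[OF P al_in_locq[OF P] xv] by simp
    moreover have "~ lu (pr p) (al e)" using lu_al[OF P e(1)] e(2) pZ by simp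
    ultimately have "~ lu (pr p) (al e \<oplus>.Q \<ominus>.Q (al (h x) \<otimes>.Q v))"
     using lu_add[OF P al_in_locq[OF P e(1)] locq_ring(3)[OF P xv]] by blast
    moreover have "al e \<oplus>.Q \<ominus>.Q (al (h x) \<otimes>.Q v) = al \<one>.B"
     unfolding e(4) using alhx(2) vc al_hom(5) by (simp add: Q.a_assoc Q.r_neg)
    ultimately show False using lu_al[OF P one_closed] primeidealD(1)[OF P] by simp
   qed
   hence "fst (pt ro p) = i" unfolding C[OF i(1), symmetric] by (simp add: pre_def)
   thus ?thesis using yi True by (simp add: gl.copy_mem)
  qed
 qed
 ultimately show ?thesis by (simp add: prod_eq_iff)
qed

text \<open>The factors are those of \<open>ro_regular\<close>, but now they must be values of germs
  outside the given prime. Over an origin \<open>1 + x v\<close> is outside since \<open>x\<close>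
  is inside; at the other points the powers of \<open>x\<close> are outside.\<close>

lemma ro_local:
 assumes y: "y : pts gl.Y" and P: "primeideal P (stalk gl.AA y)"
  and over: "!!U s. opn gl.Y U ==> y : U ==> s : sec gl.Y U ==> germ gl.AA y U (gl.si U s) : P \<longleftrightarrow> germ gl.Y y U s ~: Units (stalk gl.Y y)"
  and c: "c : stalk gl.AA y"
 shows "EX s:B. EX b:B. EX e:carrier (stalk gl.AA y) - P. gl.qA.sval e = al s \<and> al s \<otimes>.Q gl.qA.sval c = al b"
proof -
 have oA: "opn gl.AA U \<longleftrightarrow> opn gl.Y U" for U by (simp add: gl.tsp_A)
 have yA: "y : pts gl.AA" using y by (simp add: gl.tsp_A)
 interpret St: cring "stalk gl.AA y" by (rule gl.qA.stalk_cring[OF yA])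
 note sh = inj_homD[OF gl.qA.stalk_hom[OF yA]] and gs = gl.qA.germ_in_stalk[unfolded oA] and sg = gl.qA.sval_germ[unfolded oA]
 note Py = gl.pts_prime[OF y] and oY = openin_topspace[of "tsp gl.Y"]
 obtain i where i: "i : gl.N" "y = copy_pt x0 i (snd y)" using openin_topspace y by (rule gl.Y_pt)
 have yi: "y : copy (Spec A) x0 i" unfolding gl.copy_mem using Py gl.copy_pt_simps(2)[of x0 i "snd y"] i(2) by simp
 have e: "EX e:stalk gl.AA y. gl.qA.sval e = al (h a) \<and> (a ~: snd y --> e ~: P)" if a: "a : A" for a
 proof -
  note ga = gl.copies_section[OF a] and u = unit_germ_Y[OF y a]
  note s = gl.si[OF oY gl.pts_ne ga(1)]
  show ?thesis using gs[OF oY y s(1)] sg[OF oY y s(1)] s(2) ga(2) over[OF oY y ga(1)] u by (intro bexI[OF _ gs[OF oY y s(1)]]) simp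
 qed
 obtain U a where U: "opn gl.AA U" "y : U" "a : sec gl.AA U" "c = germ gl.AA y U a" using c by (rule gl.qA.stalkE)
 obtain f where f': "f : carrier A - snd y" "al (h f) \<otimes>.Q gl.valA U a : Tr i" using gl.A_poly_ring[OF U(1)[unfolded oA] U(2) yi i(1) U(3)] by (rule bexE)
 hence f: "f : A" "f ~: snd y" by auto
 have cv: "gl.qA.sval c = gl.valA U a" unfolding U(4) by (rule sg[OF U(1)[unfolded oA] U(2,3)])
 let ?w = "al (h f) \<otimes>.Q gl.qA.sval c"
 have w: "?w : Tr i" unfolding cv by (rule f'(2))
 have "EX s:B. EX b:B. EX e:stalk gl.AA y. e ~: P \<and> gl.qA.sval e = al s \<and> al s \<otimes>.Q ?w = al b"
 proof (cases "x : snd y")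
  case True
  from T_B[OF i(1) w] obtain s b v where s: "s : B" "b : B" "al s \<otimes>.Q ?w = al b"
   and v: "v : Tr i" "al s = \<one>.Q \<oplus>.Q al (h x) \<otimes>.Q v" by (elim bexE conjE)
  from gl.A_copy[OF i(1) v(1)] obtain a' where a': "a' : sec gl.AA (copy (Spec A) x0 i)" "gl.valA (copy (Spec A) x0 i) a' = v" by (rule bexE)
  note ga' = gs[OF gl.opn_copy[OF i(1)] yi a'(1)] and va' = sg[OF gl.opn_copy[OF i(1)] yi a'(1), unfolded a'(2)]
  note gx = gl.copies_section[OF x(1)]
  define ex where "ex = germ gl.AA y (pts gl.Y) (gl.si (pts gl.Y) (gsecA x))"
  note sx = gl.si[OF oY gl.pts_ne gx(1)]
  have ex: "ex : stalk gl.AA y" "gl.qA.sval ex = al (h x)" "ex : P"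
   unfolding ex_def using gs[OF oY y sx(1)] sg[OF oY y sx(1)] sx(2) gx(2) over[OF oY y gx(1)] unit_germ_Y[OF y x(1)] True by simp_all
  let ?p = "ex \<otimes>.(stalk gl.AA y) germ gl.AA y (copy (Spec A) x0 i) a'"
  let ?e = "\<one>.(stalk gl.AA y) \<oplus>.(stalk gl.AA y) ?p"
  interpret P: primeideal P "stalk gl.AA y" by (rule P)
  have pP: "?p : P" by (rule P.I_r_closed[OF ex(3) ga'])
  have pc: "?p : stalk gl.AA y" using ex(1) ga' by simp
  have ec: "?e : stalk gl.AA y" using pc by simp
  have "?e ~: P"
  proof
   assume "?e : P"
   hence "?e \<oplus>.(stalk gl.AA y) \<ominus>.(stalk gl.AA y) ?p : P" using P.a_inv_closed[OF pP] by (rule P.a_closed)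
   hence "\<one>.(stalk gl.AA y) : P" using pc by (simp add: St.a_assoc St.r_neg)
   thus False using primeidealD(1)[OF P] by simp
  qed
  moreover have "gl.qA.sval ?e = al s" unfolding sh(4)[OF St.one_closed pc] sh(5) sh(3)[OF ex(1) ga'] ex(2) va' by (rule v(2)[symmetric])
  ultimately show ?thesis using s ec by blast
 next
  case False
  from T_pow[OF i(1) w] obtain k b where k: "b : B" "al (h x) [^].Q (k::nat) \<otimes>.Q ?w = al b" by (elim exE bexE)
  have xk: "x [^].A k : A" using x(1) by simp
  from e[OF xk] obtain e where e: "e : stalk gl.AA y" "gl.qA.sval e = al (h (x [^].A k))" "e ~: P"
   using gl.pow_notin[OF Py False, of k] by blast
  show ?thesis
   by (rule bexI[where x = "h (x [^].A k)"], rule bexI[where x = b], rule bexI[where x = e]) (use e k hc[OF xk] in \<open>simp_all only: gl.pow_et simp_thms\<close>)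
 qed
 then obtain s b e' where s: "s : B" "b : B" "e' : stalk gl.AA y" "e' ~: P" "gl.qA.sval e' = al s" "al s \<otimes>.Q ?w = al b"
  by (elim bexE conjE)
 from e[OF f(1)] obtain ef where ef: "ef : stalk gl.AA y" "gl.qA.sval ef = al (h f)" "ef ~: P" using f(2) by blast
 let ?e = "e' \<otimes>.(stalk gl.AA y) ef"
 have e1: "?e : carrier (stalk gl.AA y) - P" using primeidealD(4)[OF P s(3) ef(1)] s(3,4) ef(1,3) by simp
 have m: "al (s \<otimes>.B h f) = al s \<otimes>.Q al (h f)" by (rule al_hom(3)[OF s(1) hc[OF f(1)]])
 have e2: "gl.qA.sval ?e = al (s \<otimes>.B h f)" unfolding sh(3)[OF s(3) ef(1)] s(5) ef(2) m ..
 have e3: "al (s \<otimes>.B h f) \<otimes>.Q gl.qA.sval c = al b"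
  unfolding m s(6)[symmetric] by (rule Q.m_assoc[OF al_hom(2)[OF s(1)] al_hom(2)[OF hc[OF f(1)]] sh(2)[OF c]])
 show ?thesis
  by (rule bexI[where x = "s \<otimes>.B h f"], rule bexI[where x = b], rule bexI[where x = ?e], rule conjI[OF e2 e3]) (rule e1 s(2) m_closed[OF s(1) hc[OF f(1)]])+
qed

lemma iso_glued: "iso_over gl.Y S ro (rspec gl.Y gl.AA gl.si) (rspec_map gl.Y gl.AA gl.si)"
proof -
 interpret r: rspec_model B Q al S F G gl.Y gl.valY gl.AA gl.valA ro gl.si
 proof (rule rspec_model.intro[OF smodel_axioms gl.qY.qspace_axioms gl.qA.qspace_axioms rspec_model_axioms.intro], goal_cases)
  case (4 U s)
  thus ?case using gl.si by blast
 next
  case (5 p U a)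
  thus ?case by (rule ro_regular)
 next
  case (6 y p)
  show ?case by (rule ro_center) (fact 6)+
 next
  case (7 b)
  show ?case using gl.A_pts[OF B_T] 7 by blast
 next
  case (8 y P c)
  show ?case by (rule ro_local) (fact 8)+
 qed (fact gl.tsp_A ro_mor ro_val)+
 show ?thesis by (rule r.iso_rspec)
qed

end


section \<open>Components of the fiber, the base ring and polynomial subrings\<close>

lemma connected_components_of_clopen_partition:
 assumes o: "!!D. D : \<C> ==> openin X D" and c: "!!D. D : \<C> ==> connectedin X D"
  and dis: "disjoint \<C>" and un: "\<Union>\<C> = topspace X" and C: "C : connected_components_of X"
 shows "C : \<C>" "openin X C" "openin X (topspace X - C)"
proof -
 have Cc: "connectedin X C" by (rule connectedin_connected_components_of[OF C])
 have oc: "openin X (topspace X - D)" if D: "D : \<C>" for D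
 proof -
  have "topspace X - D = \<Union>(\<C> - {D})" using dis D unfolding un[symmetric] by (auto simp: disjoint_def)
  thus ?thesis using openin_Union[of "\<C> - {D}" X] o by auto
 qed
 obtain y where y: "y : C" using nonempty_connected_components_of[OF C] by blast
 then obtain D where D: "D : \<C>" "y : D" using un connected_components_of_subset[OF C] by blast
 have "C \<subseteq> D"
 proof (rule ccontr)
  assume "~ C \<subseteq> D"
  hence "(topspace X - D) \<inter> C ~= {}" "D \<inter> C ~= {}" "C \<subseteq> D \<union> (topspace X - D)" "D \<inter> (topspace X - D) \<inter> C = {}"
   using y D(2) connected_components_of_subset[OF C] by auto
  thus False using Cc[unfolded connectedin] o[OF D(1)] oc[OF D(1)] by blast
 qed
 moreover have "D \<subseteq> C" by (rule connected_components_of_maximal[OF C c[OF D(1)]]) (use y D(2) in \<open>auto simp: disjnt_iff\<close>)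
 ultimately have "C = D" by blast
 thus "C : \<C>" "openin X C" "openin X (topspace X - C)" using D(1) o oc by auto
qed

text \<open>Any two nonempty open sets share the zero ideal.\<close>

lemma (in dom_in_field) connected_Spec: "connected_space (zariski R)"
 unfolding connected_space_def
proof (intro notI, elim exE conjE)
 fix U V assume "openin (zariski R) U" "openin (zariski R) V" "U \<inter> V = {}" "U ~= {}" "V ~= {}"
 thus False using zero_in_open by blast
qed

text \<open>For a discrete valuation ring, \<open>x = 0\<close> would make the zero ideal maximal
  and \<open>A\<close> a field. For polynomials, division by the variable leaves a constant
  remainder; an ideal strictly above \<open>(x)\<close> thus contains a nonzero constant, which is
  invertible.\<close>

lemma base_pair_domain:
 assumes k: "field k" and bp: "base_pair k A x"
 shows "domain A" "x : A" "x ~= \<zero>.A" "maximalideal (PIdl .A x) A"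
proof -
 interpret A: cring A using bp by (simp add: base_pair_def)
 show xA: "x : A" using bp by (simp add: base_pair_def)
 have "domain A \<and> x ~= \<zero>.A \<and> maximalideal (PIdl .A x) A"
 proof (cases "discrete_valuation_ring A \<and> maximalideal (PIdl .A x) A")
  case True
  hence "domain A" "~ field A" by (auto simp: discrete_valuation_ring_def principal_domain_def)
  moreover have "PIdl .A \<zero>.A = {\<zero>.A}" using A.zero_closed unfolding cgenideal_def by (auto intro: exI[of _ "\<zero>.A"])
  ultimately show ?thesis using True A.zeromaximalideal_fieldI by metis
 next
  case False
  then obtain h where h: "h : ring_iso (UP k) A" "h (monom (UP k) \<one>.k 1) = x" using bp by (auto simp: base_pair_def)
  interpret k: field k by (rule k)
  interpret U: UP_domain k "UP k" by unfold_locales simp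
  let ?X = "monom (UP k) \<one>.k 1"
  have Xc: "?X : UP k" by simp
  have degX: "deg k ?X = 1" by simp
  have X0: "?X ~= \<zero>.(UP k)" using degX by (metis U.deg_zero zero_neq_one)
  have hh: "h : ring_hom (UP k) A" and hb: "bij_betw h (carrier (UP k)) (carrier A)" using h(1) by (auto simp: ring_iso_def)
  have hi: "inj_hom (UP k) A h" using hh hb by (auto simp: inj_hom_def bij_betw_def)
  note hD = inj_homD[OF hi] and h0 = inj_hom_zero[OF hi U.UP_ring A.ring_axioms]
  have surj: "EX p:UP k. b = h p" if asm: "b : A" for b
   using asm bij_betw_imp_surj_on[OF hb] by (blast elim: imageE)
  have hiso: "inv_into (carrier (UP k)) h : ring_iso A (UP k)" by (rule ring_iso_set_sym[OF U.UP_ring h(1)])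
  hence dom: "domain A" by (intro domain_of_inj[OF _ A.is_cring U.domain_axioms, where f = "inv_into (carrier (UP k)) h"])
   (auto simp: ring_iso_def inj_hom_def bij_betw_def)
  have x0: "x ~= \<zero>.A" using hD(6)[OF Xc U.UP_zero_closed] X0 h(2) h0 by auto
  have "maximalideal (PIdl .A x) A"
  proof (rule maximalidealI[OF A.cgenideal_ideal[OF xA]])
   show "carrier A ~= PIdl .A x"
   proof
    assume "carrier A = PIdl .A x"
    hence "\<one>.A : PIdl .A x" using A.one_closed by simp
    then obtain y where y: "y : A" "\<one>.A = y \<otimes>.A x" by (auto simp: cgenideal_def)
    from surj[OF y(1)] obtain q where q: "q : UP k" "y = h q" by (rule bexE)
    have "h (q \<otimes>.(UP k) ?X) = h \<one>.(UP k)" unfolding hD(3)[OF q(1) Xc] hD(5) h(2) y(2) q(2) ..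
    hence e: "q \<otimes>.(UP k) ?X = \<one>.(UP k)" using hD(6)[OF U.UP_mult_closed[OF q(1) Xc] U.UP_one_closed] by simp
    show False
    proof (cases "q = \<zero>.(UP k)")
     case True thus False using e by simp
    next
     case qn: False
     have "deg k (q \<otimes>.(UP k) ?X) = deg k q + 1" using U.deg_mult[OF qn X0 q(1) Xc] degX by simp
     thus False unfolding e by simp
    qed
   qed
  next
   fix J assume J: "ideal J A" "PIdl .A x \<subseteq> J" "J \<subseteq> A"
   interpret J: ideal J A by (rule J(1))
   show "J = PIdl .A x \<or> J = carrier A"
   proof (cases "J \<subseteq> PIdl .A x")
    case True thus ?thesis using J(2) by blast
   next
    case False
    then obtain f where f: "f : J" "f ~: PIdl .A x" by blast
    from surj[OF J.Icarr[OF f(1)]] obtain p where p: "p : UP k" "f = h p" by (rule bexE)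
    have kn: "carrier k ~= {\<zero>.k}" using k.one_closed k.one_not_zero by (metis singletonD)
    from U.remainder_theorem_exist[OF p(1) k.zero_closed kn] obtain q r where qr: "q : UP k" "r : UP k"
     "p = (?X \<ominus>.(UP k) monom (UP k) \<zero>.k 0) \<otimes>.(UP k) q \<oplus>.(UP k) r" "deg k r = 0"
     by (elim exE conjE)
    define c where "c = coeff (UP k) r 0"
    have c: "c : k" "r = monom (UP k) c 0" unfolding c_def using qr(2) U.deg_zero_impl_monom[OF qr(2,4)] by auto
    have hf: "f = x \<otimes>.A h q \<oplus>.A h r"
     unfolding p(2) qr(3) using hD(3)[OF Xc qr(1)] hD(4)[OF U.UP_mult_closed[OF Xc qr(1)] qr(2)] h(2) by (simp add: U.P.minus_eq)
    have xq: "x \<otimes>.A h q : PIdl .A x" using A.m_comm[OF xA hD(2)[OF qr(1)]] hD(2)[OF qr(1)] unfolding cgenideal_def by auto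
    have c0: "c ~= \<zero>.k"
    proof
     assume "c = \<zero>.k"
     hence "h r = \<zero>.A" using c(2) h0 by simp
     hence "f = x \<otimes>.A h q" using hf xA hD(2)[OF qr(1)] by simp
     thus False using xq f(2) by simp
    qed
    have rJ: "h r : J"
    proof -
     have cc: "x \<otimes>.A h q : A" "h r : A" using xA hD(2)[OF qr(1)] hD(2)[OF qr(2)] by auto
     have e: "h r = f \<oplus>.A \<ominus>.A (x \<otimes>.A h q)" unfolding hf A.a_comm[OF cc]
      using cc by (simp add: A.a_assoc A.r_neg)
     show ?thesis unfolding e by (rule J.a_closed[OF f(1) J.a_inv_closed[OF subsetD[OF J(2) xq]]])
    qed
    have ci: "inv .k c : k" "inv .k c \<otimes>.k c = \<one>.k" using c0 c(1) k.field_Units by auto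
    have "monom (UP k) (inv .k c) 0 \<otimes>.(UP k) r = \<one>.(UP k)"
     unfolding c(2) using U.monom_mult[OF ci(1) c(1), of 0 0] ci(2) by (simp add: U.monom_one)
    hence "h (monom (UP k) (inv .k c) 0) \<otimes>.A h r = \<one>.A" using hD(3)[OF U.monom_closed[OF ci(1)] qr(2)] hD(5) by metis
    hence "\<one>.A : J" using J.I_l_closed[OF rJ hD(2)[OF U.monom_closed[OF ci(1), of 0]]] by simp
    thus ?thesis using J.one_imp_carrier by blast
   qed
  qed
  thus ?thesis using dom x0 by blast
 qed
 thus "domain A" "x ~= \<zero>.A" "maximalideal (PIdl .A x) A" by auto
qed

text \<open>Each step of the Horner scheme uses one factor \<open>z\<close>, which costs a factor
  \<open>x^M\<close>.\<close>

lemma (in poly_gen) poly_ring_scale: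
 assumes w: "w : Az" and x: "x : A"
 shows "EX m::nat. et x [^].Q m \<otimes>.Q w : poly_ring Q et (carrier A) (z \<otimes>.Q et x [^].Q (M::nat))"
 using w
proof induction
 case (base a)
 show ?case by (intro exI[of _ 0]) (use poly_ring.base[OF base] base in simp)
next
 case (step a v)
 obtain m :: nat where m: "et x [^].Q m \<otimes>.Q v : poly_ring Q et (carrier A) (z \<otimes>.Q et x [^].Q M)" using step.IH by (rule exE)
 have p: "et x [^].Q k = et (x [^].A k)" for k :: nat
  by (induction k) (use x in \<open>simp_all add: ring_hom_one[OF et] ring_hom_mult[OF et]\<close>)
 have c: "v : Q" "et a : Q" "et x : Q" using Az_carr[OF step(2)] step(1) x by auto
 have "et x [^].Q (m + M) \<otimes>.Q (et a \<oplus>.Q z \<otimes>.Q v) =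
  et (x [^].A (m + M) \<otimes>.A a) \<oplus>.Q (z \<otimes>.Q et x [^].Q M) \<otimes>.Q (et x [^].Q m \<otimes>.Q v)"
  unfolding ring_hom_mult[OF et A.nat_pow_closed[OF x] step(1)] p[symmetric] Q.nat_pow_mult[OF c(3), symmetric]
  using c z by (simp add: Q.r_distr Q.m_ac)
 moreover have "x [^].A (m + M) \<otimes>.A a : A" using x step(1) by simp
 ultimately show ?case using poly_ring.step[OF _ m] by metis
qed

text \<open>Polynomials of the library are sums of monomials; this turns the image of
  \<open>\<Psi>\<close> into a \<open>poly_ring\<close>.\<close>

lemma (in UP_cring) poly_ring_hom:
 assumes Q: "cring Q" and h: "h : ring_hom P Q" and p: "p : P"
 shows "h p : poly_ring Q (\<lambda>a. h (monom P a 0)) (carrier R) (h (monom P \<one> 1))"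
proof -
 have c: "(\<lambda>a. h (monom P a 0)) : ring_hom R Q"
  by (rule ring_hom_memI) (use ring_hom_closed[OF h] ring_hom_mult[OF h] ring_hom_add[OF h] ring_hom_one[OF h] monom_mult[of _ _ 0 0] in
   \<open>simp_all add: monom_one\<close>)
 interpret Q: cring Q by (rule Q)
 interpret g: poly_gen R Q "\<lambda>a. h (monom P a 0)" "h (monom P \<one> 1)"
  using c R_cring ring_hom_closed[OF h] by unfold_locales simp_all
 have mon: "h (monom P a i) : g.Az" if a: "a : R" for a i
 proof (induction i)
  case 0 show ?case by (rule poly_ring.base[OF a])
 next
  case (Suc i)
  have "monom P a (Suc i) = monom P \<one> 1 \<otimes>.P monom P a i" using monom_mult[of \<one> a 1 i] a by simp
  hence "h (monom P a (Suc i)) = h (monom P \<one> 1) \<otimes>.Q h (monom P a i)" using ring_hom_mult[OF h] a by simp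
  thus ?case using g.Az_z_mult[OF Suc] by simp
 qed
 have "h (\<Oplus>\<^bsub>P\<^esub>i\<in>{..n}. monom P (coeff P p i) i) : g.Az" for n
 proof (induction n)
  case 0 show ?case using mon[of "coeff P p 0" 0] p by simp
 next
  case (Suc n)
  have "h (\<Oplus>\<^bsub>P\<^esub>i\<in>{..Suc n}. monom P (coeff P p i) i) = h (monom P (coeff P p (Suc n)) (Suc n)) \<oplus>.Q h (\<Oplus>\<^bsub>P\<^esub>i\<in>{..n}. monom P (coeff P p i) i)"
   using p by (simp add: ring_hom_add[OF h])
  thus ?case using g.Az_add[OF mon[of "coeff P p (Suc n)" "Suc n"] Suc] p by simp
 qed
 from this[of "deg R p"] show ?thesis unfolding up_repr[OF p] .
qed

text \<open>The computation of the cocycle: with \<open>u\<close> the inverse of \<open>x^M\<close>,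
  the coordinate \<open>t\<close> cancels from the difference.\<close>

lemma (in cring) diff_scale:
 assumes "u : R" "t : R" "a : R" "b : R"
 shows "u \<otimes> (t \<ominus> a) \<ominus> u \<otimes> (t \<ominus> b) = (b \<ominus> a) \<otimes> u"
proof -
 have "u \<otimes> (t \<ominus> a) \<ominus> u \<otimes> (t \<ominus> b) = u \<otimes> ((t \<ominus> a) \<ominus> (t \<ominus> b))" using assms by (simp add: minus_eq r_distr r_minus)
 also have "(t \<ominus> a) \<ominus> (t \<ominus> b) = b \<ominus> a" 
  using assms by (simp add: minus_eq minus_add a_assoc a_lcomm[of t "\<ominus> a"] r_neg2 r_neg1 a_comm[of "\<ominus> a" b])
 finally show ?thesis using assms by (simp add: m_comm)
qed

section \<open>Assembling the torsor\<close>

context dfmodel_inj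
begin

text \<open>The variable of the trivial line need not be a function on \<open>S\<close>; a power of
  \<open>x\<close> makes it one, and this is \<open>t\<close>. Polynomials in the variable become
  polynomials in \<open>t\<close> after multiplication by a further power of
  \<open>x\<close>.\<close>

lemma ex_coordinate:
 defines "Xs \<equiv> pts (Spec A) - {x0}" and "L \<equiv> Spec (UP A)" and "l \<equiv> affine_line_map A A (\<lambda>a. a)"
 assumes iso: "iso_over (restr (Spec A) Xs) (restr S (pre S pj Xs)) pj (restr L (pre L l Xs)) l"
 shows "EX \<Psi> t M. inj_hom (UP A) Q \<Psi> \<and> (ALL a:A. \<Psi> (monom (UP A) a 0) = al (h a)) \<and> t : B \<and>
  al t = \<Psi> (monom (UP A) \<one>.A 1) \<otimes>.Q al (h x) [^].Q (M::nat) \<and>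
  (ALL b:B. EX m::nat. al (h x) [^].Q m \<otimes>.Q al b : poly_ring Q (\<lambda>a. al (h a)) (carrier A) (al t))"
proof -
 interpret UA: UP_domain A "UP A" by unfold_locales simp
 have Xc: "monom (UP A) \<one>.A 1 : UP A" by simp
 have pw: "al (h x [^].B m) = al (h x) [^].Q m" for m :: nat
  by (induction m) (use al_hom(3,5) hxc in simp_all)
 from generic_trivial[OF x iso[unfolded Xs_def L_def l_def]] obtain \<Psi> where \<Psi>: "inj_hom (UP A) Q \<Psi>"
  "ALL a:A. \<Psi> (monom (UP A) a 0) = al (h a)"
  and to: "ALL b:B. EX p:UP A. EX m::nat. al b \<otimes>.Q al (h x [^].B m) = \<Psi> p"
  and "from": "ALL p:UP A. EX b:B. EX m::nat. \<Psi> p \<otimes>.Q al (h x [^].B m) = al b"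
  by (elim exE conjE)
 from bspec[OF "from" Xc] obtain t M where t: "t : B" "\<Psi> (monom (UP A) \<one>.A 1) \<otimes>.Q al (h x [^].B (M::nat)) = al t"
  by (elim bexE exE)
 let ?z = "\<Psi> (monom (UP A) \<one>.A 1)"
 have z: "?z : Q" by (rule inj_homD(2)[OF \<Psi>(1) Xc])
 interpret g: poly_gen A Q "\<lambda>a. al (h a)" ?z
  by (rule poly_gen.intro[OF A.is_cring Q.is_cring poly_gen_axioms.intro[OF inj_homD(1)[OF ahinj] z]])
 have "EX m::nat. al (h x) [^].Q m \<otimes>.Q al b : poly_ring Q (\<lambda>a. al (h a)) (carrier A) (al t)" if b: "b : B" for b
 proof -
  from bspec[OF to b] obtain p m where p: "p : UP A" "al b \<otimes>.Q al (h x [^].B (m::nat)) = \<Psi> p" by (elim bexE exE)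
  have sub: "poly_ring Q (\<lambda>a. \<Psi> (monom (UP A) a 0)) (carrier A) ?z \<subseteq> g.Az"
  proof
   fix v assume "v : poly_ring Q (\<lambda>a. \<Psi> (monom (UP A) a 0)) (carrier A) ?z"
   thus "v : g.Az"
    by (rule poly_ring_minimal) (use bspec[OF \<Psi>(2)] g.Az_gen g.Az_add g.Az_mult poly_ring.base[of _ "carrier A" "\<lambda>a. al (h a)" Q ?z] in auto)
  qed
  have "\<Psi> p : g.Az" using UA.poly_ring_hom[OF Q.is_cring inj_homD(1)[OF \<Psi>(1)] p(1)] sub by blast
  from g.poly_ring_scale[OF this x(1), of M] obtain m' :: nat where
   m': "al (h x) [^].Q m' \<otimes>.Q \<Psi> p : poly_ring Q (\<lambda>a. al (h a)) (carrier A) (al t)"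
   unfolding t(2)[unfolded pw] by (rule exE)
  have "al (h x) [^].Q m' \<otimes>.Q \<Psi> p = al (h x) [^].Q (m' + m) \<otimes>.Q al b"
   unfolding p(2)[unfolded pw, symmetric] Q.nat_pow_mult[OF alhx(2), symmetric] using alhx(2) al_hom(2)[OF b] by (simp add: Q.m_ac)
  thus ?thesis using m' by (intro exI[of _ "m' + m"]) simp
 qed
 thus ?thesis using \<Psi> t unfolding pw by - (rule exI[of _ \<Psi>], rule exI[of _ t], rule exI[of _ M], auto)
qed

lemma ex_torsor:
 defines "Xs \<equiv> pts (Spec A) - {x0}" and "L \<equiv> Spec (UP A)" and "l \<equiv> affine_line_map A A (\<lambda>a. a)"
 assumes iso: "iso_over (restr (Spec A) Xs) (restr S (pre S pj Xs)) pj (restr L (pre L l Xs)) l"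
  and n: "n \<ge> 1" and oC: "!!i. i : {1..n} ==> opn Fib (C i)" and oC': "!!i. i : {1..n} ==> opn Fib (Z - C i)"
  and isoC: "!!i. i : {1..n} ==> iso_over (Spec A) (restr Fib (C i)) (mor_comp Fib (mor_comp S pj (fiber_incl S (Spec A) pj x0)) (incl Fib (C i)))
    (Spec (UP ka)) (affine_line_map A ka (\<lambda>a. x0 +>.A a))"
  and cov: "Z \<subseteq> (\<Union>i\<in>{1..n}. C i)" and ro: "is_mor S (copies (Spec A) x0 n) ro"
  and ropj: "mor_eq S (Spec A) (mor_comp (copies (Spec A) x0 n) (copies_map n) ro) pj"
  and C: "!!i. i : {1..n} ==> pre S ro {(i, x0)} = C i"
 defines "Y \<equiv> copies (Spec A) x0 n" and "\<L> \<equiv> div_sheaf (Spec A) x0 (spec_section A x) n"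
 shows "EX (mu :: nat => int) g. (ALL i:{1..n}. mu i \<ge> 0) \<and> (EX i:{1..n}. mu i = 0) \<and>
  cocycle {1..n} (copy (Spec A) x0) (\<L> mu) g \<and>
  iso_over Y S ro (Wtorsor Y {1..n} (copy (Spec A) x0) (\<L> (\<lambda>i. - mu i)) (\<lambda>i j. dual_section Y (g i j)))
   (Wtorsor_map Y {1..n} (copy (Spec A) x0) (\<L> (\<lambda>i. - mu i)) (\<lambda>i j. dual_section Y (g i j)))"
proof -
 let ?et = "\<lambda>a. al (h a)"
 let ?T = "poly_ring Q ?et (carrier A)"
 from ex_coordinate[OF iso[unfolded Xs_def L_def l_def]] obtain \<Psi> t M0 where \<Psi>: "inj_hom (UP A) Q \<Psi>"
  "ALL a:A. \<Psi> (monom (UP A) a 0) = al (h a)" and t: "t : B"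
  "al t = \<Psi> (monom (UP A) \<one>.A 1) \<otimes>.Q al (h x) [^].Q (M0::nat)"
  and t_gen: "ALL b:B. EX m::nat. al (h x) [^].Q m \<otimes>.Q al b : poly_ring Q (\<lambda>a. al (h a)) (carrier A) (al t)"
  by (elim exE conjE)
 define P where "P i m a z \<longleftrightarrow> a : A \<and> z : Q \<and> al t = ?et a \<oplus>.Q ?et x [^].Q (m::nat) \<otimes>.Q z \<and>
  (ALL b:B. al b : ?T z) \<and>
  (ALL w:?T z. EX s:B. EX b:B. al s \<otimes>.Q w = al b \<and> (ALL p:C i. s ~: pr p) \<and> (EX w':?T z. al s = \<one>.Q \<oplus>.Q ?et x \<otimes>.Q w')) \<and>
  (EX e:B. (ALL p:Z - C i. e : pr p) \<and> (EX w':?T z. al e = \<one>.Q \<oplus>.Q ?et x \<otimes>.Q w')) \<and>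
  (ALL w:?T z. EX k::nat. EX b:B. ?et x [^].Q k \<otimes>.Q w = al b) \<and>
  (ALL as. set as \<subseteq> A --> horner Q z (map ?et as) = \<zero>.Q --> set as \<subseteq> {\<zero>.A})" for i m a z
 have ex: "EX m a z. P i m a z" if i: "i : {1..n}" for i
  unfolding P_def
  by (rule component_generator[OF oC[OF i] oC'[OF i] isoC[OF i] t(1) \<Psi>(1) bspec[OF \<Psi>(2)] t(2) bspec[OF t_gen]])
 have "ALL i:{1..n}. EX v. P i (fst v) (fst (snd v)) (snd (snd v))"
 proof
  fix i assume "i : {1..n}"
  from ex[OF this] obtain m a z where "P i m a z" by (elim exE)
  thus "EX v. P i (fst v) (fst (snd v)) (snd (snd v))" by (intro exI[of _ "(m, a, z)"]) (simp only: fst_conv snd_conv)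
 qed
 from bchoice[OF this] obtain v where v: "ALL i:{1..n}. P i (fst (v i)) (fst (snd (v i))) (snd (snd (v i)))" by (rule exE)
 define m where "m i = fst (v i)" for i
 define a where "a i = fst (snd (v i))" for i
 define z where "z i = snd (snd (v i))" for i
 have P: "P i (m i) (a i) (z i)" if i: "i : {1..n}" for i using bspec[OF v i] by (simp only: m_def a_def z_def)
 note PD = P[unfolded P_def]
 \<comment> \<open>The largest exponent makes all multiplicities \<open>d i\<close> nonnegative and
   one of them zero.\<close>
 define M where "M = Max (m ` {1..n})"
 define d where "d i = M - m i" for i
 define tau where "tau = inv .Q (?et x [^].Q M)"
 define w where "w i = tau \<otimes>.Q (al t \<ominus>.Q ?et (a i))" for i
 have mM: "m i \<le> M" if i: "i : {1..n}" for i unfolding M_def using i by simp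
 have "M : m ` {1..n}" unfolding M_def using n by (intro Max_in) auto
 then obtain i0 where i0: "i0 : {1..n}" "M = m i0" by (rule imageE)
 have etx: "?et x : Q" "?et x ~= \<zero>.Q" using alhx by simp_all
 have xp: "?et x [^].Q k : Q" "?et x [^].Q k ~= \<zero>.Q" for k :: nat
  using etx by (induction k) (auto simp: Q.integral_iff)
 have tau: "tau : Q" "tau \<otimes>.Q ?et x [^].Q M = \<one>.Q" unfolding tau_def using xp[of M] by (auto simp: Q.inv_cl Q.inv_l)
 have at: "al t : Q" by (rule al_hom(2)[OF t(1)])
 have aA: "a i : A" and zQ: "z i : Q" and te: "al t = ?et (a i) \<oplus>.Q ?et x [^].Q m i \<otimes>.Q z i" if i: "i : {1..n}" for i
  using PD[OF i] by blast+
 have eta: "?et (a i) : Q" if i: "i : {1..n}" for i by (rule al_hom(2)[OF h_val(1)[OF aA[OF i]]])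
 have Tz: "?et x [^].Q d i \<otimes>.Q w i = z i" if i: "i : {1..n}" for i
 proof -
  have "al t \<ominus>.Q ?et (a i) = ?et x [^].Q m i \<otimes>.Q z i" unfolding te[OF i] using eta[OF i] xp(1) zQ[OF i] by (simp add: Q.minus_eq Q.a_ac Q.r_neg1 Q.r_neg2)
  hence "?et x [^].Q d i \<otimes>.Q w i = (tau \<otimes>.Q (?et x [^].Q d i \<otimes>.Q ?et x [^].Q m i)) \<otimes>.Q z i"
   unfolding w_def using tau(1) xp(1) zQ[OF i] by (simp add: Q.m_ac)
  \<comment> \<open>\<open>d i\<close> is a difference of natural numbers, so
    \<open>m i \<le> M\<close> is needed to recombine the exponents.\<close>
  also have "?et x [^].Q d i \<otimes>.Q ?et x [^].Q m i = ?et x [^].Q M" unfolding Q.nat_pow_mult[OF etx(1)] d_def using mM[OF i] by simp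
  finally show ?thesis unfolding tau(2) using zQ[OF i] by simp
 qed
 have gl: "gluing A Q (\<lambda>a. al (h a)) x n d w"
 proof (rule gluing.intro[OF origins.intro[OF ax.dom_in_field_axioms origins_axioms.intro[OF x(1,3,2) n]] gluing_axioms.intro])
  fix i j assume i: "i : {1..n}" and j: "j : {1..n}"
  have "w i \<ominus>.Q w j = (?et (a j) \<ominus>.Q ?et (a i)) \<otimes>.Q tau" unfolding w_def by (rule Q.diff_scale[OF tau(1) at eta[OF i] eta[OF j]])
  also have "?et (a j) \<ominus>.Q ?et (a i) = ?et (a j \<ominus>.A a i)"
   using inj_hom_minus[OF ahinj A.ring_axioms Q.ring_axioms aA[OF i]] inj_homD(4)[OF ahinj aA[OF j] A.a_inv_closed[OF aA[OF i]]]
   unfolding A.minus_eq Q.minus_eq by simp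
  finally show "EX b:A. EX k::nat. w i \<ominus>.Q w j = ?et b \<otimes>.Q inv .Q (?et x [^].Q k)"
   unfolding tau_def using A.minus_closed[OF aA[OF j] aA[OF i]] by blast
 next
  fix i assume i: "i : {1..n}"
  show "w i : Q" unfolding w_def using tau(1) at eta[OF i] by simp
  fix as show "set as \<subseteq> A ==> horner Q (?et x [^].Q d i \<otimes>.Q w i) (map ?et as) = \<zero>.Q ==> set as \<subseteq> {\<zero>.A}"
   unfolding Tz[OF i] using PD[OF i] by blast
 qed
 have "df_gluing_axioms B Q al S F G A pj x n d w ro C"
 proof (rule df_gluing_axioms.intro[OF ro ropj C cov], assumption)
  fix i assume i: "i : {1..n}"
  note D = PD[OF i, THEN conjunct2, THEN conjunct2, THEN conjunct2]
  show "al b : ?T (?et x [^].Q d i \<otimes>.Q w i)" if "b : B" for b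
   unfolding Tz[OF i] by (rule bspec[OF D[THEN conjunct1] that])
  show "EX s:B. EX b:B. al s \<otimes>.Q u = al b \<and> (ALL p:C i. s ~: pr p) \<and> (EX v:?T (?et x [^].Q d i \<otimes>.Q w i). al s = \<one>.Q \<oplus>.Q ?et x \<otimes>.Q v)"
   if "u : ?T (?et x [^].Q d i \<otimes>.Q w i)" for u
   using that unfolding Tz[OF i] by (rule bspec[OF D[THEN conjunct2, THEN conjunct1]])
  show "EX e:B. (ALL p:Z - C i. e : pr p) \<and> (EX v:?T (?et x [^].Q d i \<otimes>.Q w i). al e = \<one>.Q \<oplus>.Q ?et x \<otimes>.Q v)"
   unfolding Tz[OF i] by (rule D[THEN conjunct2, THEN conjunct2, THEN conjunct1])
  show "EX k::nat. EX b:B. ?et x [^].Q k \<otimes>.Q u = al b" if "u : ?T (?et x [^].Q d i \<otimes>.Q w i)" for u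
   using that unfolding Tz[OF i] by (rule bspec[OF D[THEN conjunct2, THEN conjunct2, THEN conjunct2, THEN conjunct1]])
 qed
 then interpret g: df_gluing B Q al S F G A pj x n d w ro C
  by (rule df_gluing.intro[OF dfmodel_inj_axioms gl])
 show ?thesis unfolding Y_def \<L>_def
  by (rule exI[of _ "\<lambda>i. int (d i)"], rule exI[of _ g.gl.g], intro conjI g.gl.g_cocycle g.iso_glued bexI[OF _ i0(1)]) (simp_all add: d_def i0(2))
qed

end


theorem proposition2p6:
  fixes k :: "'k ring" and A :: "'a ring" and x :: 'a
    and S :: "('p, 's) ringed"
    and \<pi> :: "('p, 's, 'a set, 'a set \<Rightarrow> ('a \<times> 'a) set) mor"
    and n :: nat and C :: "nat \<Rightarrow> 'p set"
    and \<rho> :: "('p, 's, nat \<times> 'a set, nat \<Rightarrow> 'a set \<Rightarrow> ('a \<times> 'a) set) mor"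
  defines "X \<equiv> Spec A" and "x0 \<equiv> PIdl\<^bsub>A\<^esub> x"
  defines "Xn \<equiv> copies X x0 n"
  defines "\<L> \<equiv> div_sheaf X x0 (spec_section A x) n"
  assumes "field k" and "\<forall>m::nat. m > 0 \<longrightarrow> [m] \<cdot>\<^bsub>k\<^esub> \<one>\<^bsub>k\<^esub> \<noteq> \<zero>\<^bsub>k\<^esub>"
    and "base_pair k A x"
    and "danielewski_fieseler A x S \<pi>"
    and "bij_betw C {1..n} (connected_components_of (tsp (fiber S X \<pi> x0)))"
    and "is_mor S Xn \<rho>"
    and "mor_eq S X (mor_comp Xn (copies_map n) \<rho>) \<pi>"
    and "\<forall>i\<in>{1..n}. pre S \<rho> {(i, x0)} = C i"
  shows "\<exists>(\<mu> :: nat \<Rightarrow> int) g.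
    (\<forall>i\<in>{1..n}. \<mu> i \<ge> 0) \<and> (\<exists>i\<in>{1..n}. \<mu> i = 0) \<and>
    cocycle {1..n} (copy X x0) (\<L> \<mu>) g \<and>
    iso_over Xn S \<rho>
      (Wtorsor Xn {1..n} (copy X x0) (\<L> (\<lambda>i. - \<mu> i)) (\<lambda>i j. dual_section Xn (g i j)))
      (Wtorsor_map Xn {1..n} (copy X x0) (\<L> (\<lambda>i. - \<mu> i)) (\<lambda>i j. dual_section Xn (g i j)))"
proof -
 note k = assms(5) and bp = assms(7) and df = assms(8)[unfolded danielewski_fieseler_def Let_def]
 note b = base_pair_domain[OF k bp]
 interpret A: domain A by (rule b(1))
 from df obtain \<C> where S: "integral_scheme S" and \<pi>: "is_mor S (Spec A) \<pi>" and aff: "affine_mor S (Spec A) \<pi>"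
  and gen: "iso_over (restr (Spec A) (pts (Spec A) - {PIdl .A x})) (restr S (pre S \<pi> (pts (Spec A) - {PIdl .A x}))) \<pi>
   (restr (Spec (UP A)) (pre (Spec (UP A)) (affine_line_map A A (\<lambda>a. a)) (pts (Spec A) - {PIdl .A x}))) (affine_line_map A A (\<lambda>a. a))"
  and ne: "pts (fiber S (Spec A) \<pi> (PIdl .A x)) ~= {}"
  and \<C>: "ALL C:\<C>. opn (fiber S (Spec A) \<pi> (PIdl .A x)) C" "disjoint \<C>" "\<Union>\<C> = pts (fiber S (Spec A) \<pi> (PIdl .A x))"
  and iso\<C>: "ALL C:\<C>. iso_over (Spec A) (restr (fiber S (Spec A) \<pi> (PIdl .A x)) C)
   (mor_comp (fiber S (Spec A) \<pi> (PIdl .A x)) (mor_comp S \<pi> (fiber_incl S (Spec A) \<pi> (PIdl .A x))) (incl (fiber S (Spec A) \<pi> (PIdl .A x)) C))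
   (Spec (UP (A Quot PIdl .A x))) (affine_line_map A (A Quot PIdl .A x) (\<lambda>a. PIdl .A x +>.A a))"
  by (elim conjE exE)
 have whole: "restr Y (pts Y) = Y" for Y :: "('x, 'y) ringed" by (simp add: restr_def)
 have pX: "pre S \<pi> (pts (Spec A)) = pts S" using is_morD(6)[OF \<pi>] by (auto simp: pre_def)
 have aX: "affine_scheme (restr (Spec A) (pts (Spec A)))" unfolding whole by (rule affine_Spec[OF b(1)])
 \<comment> \<open>The base is affine as a whole, so affineness of the morphism makes
   \<open>S\<close> affine.\<close>
 have affS: "affine_scheme S"
  using aff[unfolded affine_mor_def, THEN spec, THEN mp, OF conjI[OF openin_topspace aX]] unfolding pX whole .
 from affS obtain R :: "'s ring" and F where R: "cring R" "is_iso S (Spec R) F" unfolding affine_scheme_def by (elim conjE exE)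
 have Sr: "ringed_space S" using affS by (simp add: affine_scheme_def locally_ringed_space_def)
 have "domain (sec S (pts S))" using S[unfolded integral_scheme_def] openin_topspace by blast
 hence Rd: "domain R" by (rule domain_of_iso_Spec[OF R])
 obtain G where FG: "inv_pair S (Spec R) F G" using R(2) unfolding inv_pair_iso by (rule exE)
 let ?Q = "localization R (carrier R - {\<zero>.R})" and ?\<alpha> = "\<lambda>a. fraction R (carrier R - {\<zero>.R}) a \<one>.R"
 interpret d: dfmodel R ?Q ?\<alpha> S F G A \<pi>
  by (rule dfmodel.intro[OF smodel.intro[OF domain.frac_dom_in_field[OF Rd] smodel_axioms.intro[OF FG Sr]] dfmodel_axioms.intro[OF b(1) \<pi>]])
 \<comment> \<open>Constants are distinguished as polynomials, and \<open>\<Psi>\<close> is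
   injective on polynomials.\<close>
 have inj: "inj_on d.h (carrier A)"
 proof (rule inj_onI)
  fix a a' assume a: "a : A" "a' : A" "d.h a = d.h a'"
  interpret UA: UP_domain A "UP A" by unfold_locales simp
  from d.generic_trivial[OF b(2,4,3) gen] obtain \<Psi> where \<Psi>: "inj_hom (UP A) ?Q \<Psi>" "ALL a:A. \<Psi> (monom (UP A) a 0) = ?\<alpha> (d.h a)"
   by (elim exE conjE)
  have "\<Psi> (monom (UP A) a 0) = \<Psi> (monom (UP A) a' 0)" using \<Psi>(2) a by simp
  hence "monom (UP A) a 0 = monom (UP A) a' 0" using inj_homD(6)[OF \<Psi>(1)] a by simp
  thus "a = a'" using UA.monom_inj[of 0] a by (simp add: inj_on_def)
 qed
 interpret i: dfmodel_inj R ?Q ?\<alpha> S F G A \<pi> x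
  by (rule dfmodel_inj.intro[OF d.dfmodel_axioms dfmodel_inj_axioms.intro[OF inj b(2,4,3)]])
 \<comment> \<open>Each given piece is homeomorphic to the spectrum of a polynomial ring over a
   field, which is a domain. Hence the pieces are connected, and every component of the fiber
   enumerated by \<open>C\<close> is one of them.\<close>
 have conn: "connectedin (tsp i.Fib) D" if D: "D : \<C>" for D
 proof -
  interpret x0: maximalideal "PIdl .A x" A by (rule b(4))
  interpret \<kappa>: field "A Quot PIdl .A x" by (rule x0.quotient_is_field[OF A.is_cring])
  interpret U: UP_domain "A Quot PIdl .A x" "UP (A Quot PIdl .A x)" by unfold_locales simp
  from bspec[OF iso\<C> D] obtain \<psi> where "is_iso (restr i.Fib D) (Spec (UP (A Quot PIdl .A x))) \<psi>" unfolding iso_over_def by (elim exE conjE)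
  then obtain \<omega> where "inv_pair (restr i.Fib D) (Spec (UP (A Quot PIdl .A x))) \<psi> \<omega>" unfolding inv_pair_iso by (rule exE)
  from inv_pair_homeo[OF this] have "subtopology (tsp i.Fib) D homeomorphic_space zariski (UP (A Quot PIdl .A x))"
   by (auto simp: homeomorphic_space_def)
  hence "connected_space (subtopology (tsp i.Fib) D)"
   using dom_in_field.connected_Spec[OF domain.frac_dom_in_field[OF U.domain_axioms]] homeomorphic_connected_space by blast
  thus ?thesis using openin_subset[OF bspec[OF \<C>(1) D]] by (simp add: connectedin_def)
 qed
 have bij: "bij_betw C {1..n} (connected_components_of (tsp i.Fib))" using assms(9) unfolding assms(1,2) .
 have comp: "C j : \<C>" "opn i.Fib (C j)" "opn i.Fib (pts i.Fib - C j)" if j: "j : {1..n}" for j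
  using connected_components_of_clopen_partition[OF bspec[OF \<C>(1)] conn \<C>(2,3) bij_betwE[OF bij, rule_format, OF j]] by blast+
 have un: "(\<Union>j\<in>{1..n}. C j) = i.Z"
  using Union_connected_components_of[of "tsp i.Fib"] unfolding bij_betw_imp_surj_on[OF bij, symmetric] i.Fib_pts .
 \<comment> \<open>With no component the fiber would be empty.\<close>
 have n: "n \<ge> 1"
 proof (rule ccontr)
  assume "~ n \<ge> 1"
  hence "i.Z = {}" unfolding un[symmetric] by simp
  thus False using ne unfolding i.Fib_pts by simp
 qed
 show ?thesis unfolding assms(1-4)
  by (rule i.ex_torsor[OF gen n comp(2) comp(3)[unfolded i.Fib_pts] bspec[OF iso\<C> comp(1)] equalityD1[OF un[symmetric]]
   assms(10,11)[unfolded assms(1-3)] bspec[OF assms(12)[unfolded assms(1,2)]]])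
qed

end
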